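(* Let $\Omega$ be an open subset of $\mathbb R^N$, $N\ge1$, and let $a_{kl}=a_{lk}:\Omega\to\mathbb R$, $1\le k,l\le N$, be bounded measurable functions with $\sum_{k,l=1}^Na_{kl}(x)\xi_k\xi_l\ge\nu|\xi|^2$ for all $\xi\in\mathbb R^N$, with $\nu>0$ independent of $x\in\Omega$. Let $L=-\mathrm{div}(A(x)\nabla\cdot)$ with Dirichlet boundary conditions on $\Omega$. Then for every $q\in[2,\infty)$ there exists a constant $C>0$ such that for all $f\in L^q(\Omega)\cap L^2(\Omega)$ $$C\,\|f\|_{L^q(\Omega)}\le\Big\|\Big(\int_0^\infty|\nabla e^{-tL}f|^2dt\Big)^{1/2}\Big\|_{L^q(\Omega)}$$ and $$C\,\|f\|_{L^q(\Omega)}\le\|e^{-L}f\|_{L^q(\Omega)}+\Big\|\Big(\int_0^1|\nabla e^{-tL}f|^2dt\Big)^{1/2}\Big\|_{L^q(\Omega)}.$$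
   Context: $A(x)=(a_{kl}(x))_{1\le k,l\le N}$. $L$ is the self-adjoint operator on $L^2(\Omega)$ associated with the symmetric form $\mathfrak a(u,v)=\sum_{k,l=1}^N\int_\Omega a_{kl}\,\partial_ku\,\partial_lv\,dx$ with domain $W^{1,2}_0(\Omega)$; $e^{-tL}$ extends to a contraction semigroup on every $L^q(\Omega)$. No regularity of $\Omega$ or of the coefficients is assumed. *)

theory Defs
  imports "HOL-Analysis.Analysis"
begin

text \<open>
  Functions on \<open>\<Omega>\<close> are real-valued and represented by total functions on \<open>real ^ 'n\<close>; only
  their values on \<open>\<Omega>\<close> matter, and elements of \<open>L\<^sup>q(\<Omega>)\<close> and \<open>W\<^sup>1\<^sup>,\<^sup>2(\<Omega>)\<close> are representatives of
  their classes modulo almost-everywhere equality.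
\<close>

section \<open>Lebesgue spaces\<close>

text \<open>Real powers on \<open>[0, \<infinity>]\<close>, only meant for exponents \<open>p > 0\<close>.\<close>

definition epowr :: "ennreal \<Rightarrow> real \<Rightarrow> ennreal" where
  "epowr a p = (if a = top then top else ennreal (enn2real a powr p))"

definition Lnorm_enn :: "(real ^ 'n) set \<Rightarrow> real \<Rightarrow> (real ^ 'n \<Rightarrow> ennreal) \<Rightarrow> ennreal" where
  "Lnorm_enn \<Omega> q h = epowr (\<integral>\<^sup>+ x. epowr (h x) q \<partial>lebesgue_on \<Omega>) (1 / q)"

definition Lnorm :: "(real ^ 'n) set \<Rightarrow> real \<Rightarrow> (real ^ 'n \<Rightarrow> real) \<Rightarrow> ennreal" where
  "Lnorm \<Omega> q f = Lnorm_enn \<Omega> q (\<lambda>x. ennreal \<bar>f x\<bar>)"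

definition Lspace :: "(real ^ 'n) set \<Rightarrow> real \<Rightarrow> (real ^ 'n \<Rightarrow> real) set" where
  "Lspace \<Omega> q = {f \<in> borel_measurable (lebesgue_on \<Omega>). Lnorm \<Omega> q f < top}"

section \<open>Test functions and Sobolev spaces\<close>

definition partial :: "'n \<Rightarrow> (real ^ 'n \<Rightarrow> real) \<Rightarrow> real ^ 'n \<Rightarrow> real" where
  "partial i f x = frechet_derivative f (at x) (axis i 1)"

primrec Ck :: "nat \<Rightarrow> (real ^ 'n \<Rightarrow> real) \<Rightarrow> bool" where
  "Ck 0 f \<longleftrightarrow> continuous_on UNIV f"
| "Ck (Suc k) f \<longleftrightarrow> (\<forall>x. f differentiable (at x)) \<and> (\<forall>i. Ck k (partial i f))"

definition test_function :: "(real ^ 'n) set \<Rightarrow> (real ^ 'n \<Rightarrow> real) \<Rightarrow> bool" where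
  "test_function \<Omega> \<phi> \<longleftrightarrow>
     (\<forall>k. Ck k \<phi>) \<and> (\<exists>K. compact K \<and> K \<subseteq> \<Omega> \<and> (\<forall>x. x \<notin> K \<longrightarrow> \<phi> x = 0))"

text \<open>\<open>u \<in> W\<^sup>1\<^sup>,\<^sup>2(\<Omega>)\<close> with distributional gradient \<open>G\<close>.\<close>

definition has_weak_gradient ::
  "(real ^ 'n) set \<Rightarrow> (real ^ 'n \<Rightarrow> real) \<Rightarrow> (real ^ 'n \<Rightarrow> real ^ 'n) \<Rightarrow> bool" where
  "has_weak_gradient \<Omega> u G \<longleftrightarrow>
     u \<in> Lspace \<Omega> 2 \<and> (\<forall>i. (\<lambda>x. G x $ i) \<in> Lspace \<Omega> 2) \<and>
     (\<forall>\<phi> i. test_function \<Omega> \<phi> \<longrightarrow>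
        (LINT x|lebesgue_on \<Omega>. u x * partial i \<phi> x) = - (LINT x|lebesgue_on \<Omega>. G x $ i * \<phi> x))"

definition weak_gradient ::
  "(real ^ 'n) set \<Rightarrow> (real ^ 'n \<Rightarrow> real) \<Rightarrow> real ^ 'n \<Rightarrow> real ^ 'n" where
  "weak_gradient \<Omega> u = (SOME G. has_weak_gradient \<Omega> u G)"

text \<open>The closure of the test functions in \<open>W\<^sup>1\<^sup>,\<^sup>2(\<Omega>)\<close>.\<close>

definition W12_0 :: "(real ^ 'n) set \<Rightarrow> (real ^ 'n \<Rightarrow> real) set" where
  "W12_0 \<Omega> = {u. \<exists>G. has_weak_gradient \<Omega> u G \<and>
     (\<exists>\<phi>. (\<forall>m::nat. test_function \<Omega> (\<phi> m)) \<and>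
        (\<lambda>m. Lnorm \<Omega> 2 (\<lambda>x. \<phi> m x - u x)) \<longlonglongrightarrow> 0 \<and>
        (\<forall>i. (\<lambda>m. Lnorm \<Omega> 2 (\<lambda>x. partial i (\<phi> m) x - G x $ i)) \<longlonglongrightarrow> 0))}"

section \<open>The Dirichlet operator and its semigroup\<close>

definition dirichlet_form ::
  "(real ^ 'n) set \<Rightarrow> (real ^ 'n \<Rightarrow> real ^ 'n ^ 'n) \<Rightarrow>
     (real ^ 'n \<Rightarrow> real) \<Rightarrow> (real ^ 'n \<Rightarrow> real) \<Rightarrow> real" where
  "dirichlet_form \<Omega> A u v =
     (\<Sum>k\<in>UNIV. \<Sum>l\<in>UNIV. LINT x|lebesgue_on \<Omega>.
        A x $ k $ l * weak_gradient \<Omega> u x $ k * weak_gradient \<Omega> v x $ l)"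

text \<open>The graph of the operator \<open>L\<close> on \<open>L\<^sup>2(\<Omega>)\<close> associated with the form: \<open>u \<in> D(L)\<close> and \<open>L u = g\<close>.\<close>

definition div_operator ::
  "(real ^ 'n) set \<Rightarrow> (real ^ 'n \<Rightarrow> real ^ 'n ^ 'n) \<Rightarrow>
     (real ^ 'n \<Rightarrow> real) \<Rightarrow> (real ^ 'n \<Rightarrow> real) \<Rightarrow> bool" where
  "div_operator \<Omega> A u g \<longleftrightarrow> u \<in> W12_0 \<Omega> \<and> g \<in> Lspace \<Omega> 2 \<and>
     (\<forall>v\<in>W12_0 \<Omega>. dirichlet_form \<Omega> A u v = (LINT x|lebesgue_on \<Omega>. g x * v x))"

definition C0_semigroup ::
  "(real ^ 'n) set \<Rightarrow> (real \<Rightarrow> (real ^ 'n \<Rightarrow> real) \<Rightarrow> real ^ 'n \<Rightarrow> real) \<Rightarrow> bool" where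
  "C0_semigroup \<Omega> T \<longleftrightarrow>
     (\<forall>t\<ge>0. \<forall>f\<in>Lspace \<Omega> 2. T t f \<in> Lspace \<Omega> 2) \<and>
     (\<forall>t\<ge>0. \<forall>f\<in>Lspace \<Omega> 2. \<forall>g\<in>Lspace \<Omega> 2. \<forall>c.
        AE x in lebesgue_on \<Omega>. T t (\<lambda>y. c * f y + g y) x = c * T t f x + T t g x) \<and>
     (\<forall>t\<ge>0. \<exists>M::real. \<forall>f\<in>Lspace \<Omega> 2. Lnorm \<Omega> 2 (T t f) \<le> ennreal M * Lnorm \<Omega> 2 f) \<and>
     (\<forall>f\<in>Lspace \<Omega> 2. AE x in lebesgue_on \<Omega>. T 0 f x = f x) \<and>
     (\<forall>s\<ge>0. \<forall>t\<ge>0. \<forall>f\<in>Lspace \<Omega> 2. AE x in lebesgue_on \<Omega>. T (s + t) f x = T s (T t f) x) \<and>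
     (\<forall>f\<in>Lspace \<Omega> 2. ((\<lambda>t. Lnorm \<Omega> 2 (\<lambda>x. T t f x - f x)) \<longlongrightarrow> 0) (at_right 0))"

definition generator ::
  "(real ^ 'n) set \<Rightarrow> (real \<Rightarrow> (real ^ 'n \<Rightarrow> real) \<Rightarrow> real ^ 'n \<Rightarrow> real) \<Rightarrow>
     (real ^ 'n \<Rightarrow> real) \<Rightarrow> (real ^ 'n \<Rightarrow> real) \<Rightarrow> bool" where
  "generator \<Omega> T u g \<longleftrightarrow> u \<in> Lspace \<Omega> 2 \<and> g \<in> Lspace \<Omega> 2 \<and>
     ((\<lambda>t. Lnorm \<Omega> 2 (\<lambda>x. (T t u x - u x) / t - g x)) \<longlongrightarrow> 0) (at_right 0)"

text \<open>
  \<open>heat \<Omega> A t f\<close> is \<open>e\<^sup>-\<^sup>t\<^sup>L f\<close>, where \<open>e\<^sup>-\<^sup>t\<^sup>L\<close> is the strongly continuous semigroup on \<open>L\<^sup>2(\<Omega>)\<close>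
  generated by \<open>-L\<close>. A generator determines its semigroup, so the choice only affects null sets.
\<close>

definition heat ::
  "(real ^ 'n) set \<Rightarrow> (real ^ 'n \<Rightarrow> real ^ 'n ^ 'n) \<Rightarrow>
     real \<Rightarrow> (real ^ 'n \<Rightarrow> real) \<Rightarrow> real ^ 'n \<Rightarrow> real" where
  "heat \<Omega> A = (SOME T. C0_semigroup \<Omega> T \<and>
     (\<forall>u g. generator \<Omega> T u g \<longleftrightarrow> div_operator \<Omega> A u (\<lambda>x. - g x)))"

section \<open>Square functions\<close>

text \<open>
  For each \<open>t\<close> separately, \<open>\<nabla>e\<^sup>-\<^sup>t\<^sup>L f\<close> is only defined up to a null set depending on \<open>t\<close>, so
  integrating in \<open>t\<close> at fixed \<open>x\<close> requires a version that is jointly measurable in \<open>(t, x)\<close>. By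
  Fubini, two such versions give the same square function almost everywhere.
\<close>

definition heat_gradient ::
  "(real ^ 'n) set \<Rightarrow> (real ^ 'n \<Rightarrow> real ^ 'n ^ 'n) \<Rightarrow>
     (real ^ 'n \<Rightarrow> real) \<Rightarrow> real \<times> (real ^ 'n) \<Rightarrow> real ^ 'n" where
  "heat_gradient \<Omega> A f = (SOME G. G \<in> borel_measurable (lebesgue_on ({0<..} \<times> \<Omega>)) \<and>
     (\<forall>t>0. has_weak_gradient \<Omega> (heat \<Omega> A t f) (\<lambda>x. G (t, x))))"

text \<open>\<open>(\<integral>\<^sub>I |\<nabla>e\<^sup>-\<^sup>t\<^sup>L f (x)|\<^sup>2 dt)\<^sup>1\<^sup>/\<^sup>2\<close>, a value in \<open>[0, \<infinity>]\<close>, for an interval \<open>I \<subseteq> (0, \<infinity>)\<close>.\<close>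

definition square_function ::
  "(real ^ 'n) set \<Rightarrow> (real ^ 'n \<Rightarrow> real ^ 'n ^ 'n) \<Rightarrow> real set \<Rightarrow>
     (real ^ 'n \<Rightarrow> real) \<Rightarrow> real ^ 'n \<Rightarrow> ennreal" where
  "square_function \<Omega> A I f x =
     epowr (\<integral>\<^sup>+ t. ennreal ((norm (heat_gradient \<Omega> A f (t, x)))\<^sup>2) \<partial>lebesgue_on I) (1 / 2)"

end

theory Submission
  imports Defs "HOL-Computational_Algebra.Polynomial"
begin

text \<open>
  Let \<open>u(t) = e\<^sup>-\<^sup>t\<^sup>L f\<close>. Formally
  \<open>- d/dt \<integral> |u|\<^sup>q = q (q - 1) \<integral> |u|\<^sup>q\<^sup>-\<^sup>2 A\<nabla>u \<cdot> \<nabla>u\<close>, so with the maximal function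
  \<open>f\<^sup>* = sup\<^sub>t |u(t)|\<close> and the square function \<open>S\<close> one gets
  \<open>\<parallel>f\<parallel>\<^sup>q \<le> C \<integral> (f\<^sup>*)\<^sup>q\<^sup>-\<^sup>2 S\<^sup>2\<close>, up to \<open>\<parallel>u(1)\<parallel>\<^sup>q\<close> if \<open>t\<close> stops at \<open>1\<close>. By Young's inequality
  this is at most \<open>\<epsilon> \<parallel>f\<^sup>*\<parallel>\<^sup>q + C \<parallel>S\<parallel>\<^sup>q\<close>, and the first term is absorbed thanks to the maximal
  inequality \<open>\<parallel>f\<^sup>*\<parallel> \<le> C \<parallel>f\<parallel>\<close>. For \<open>q = 2\<close> the latter is Stein's maximal theorem for symmetric
  positivity preserving contractions; \<open>q > 2\<close> reduces to it because \<open>|u(t)|\<^sup>q\<^sup>/\<^sup>2 \<le> e\<^sup>-\<^sup>t\<^sup>L |f|\<^sup>q\<^sup>/\<^sup>2\<close>.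
  Truncating \<open>|u|\<^sup>q\<^sup>-\<^sup>2\<close> keeps the entropies quadratic, so that \<open>L\<^sup>2\<close> theory justifies the computation.
\<close>

section \<open>Functional calculus of a positive contraction\<close>

text \<open>The statement speaks about choices: \<open>heat\<close> is some semigroup generated by
  -L, and \<open>heat_gradient\<close> some jointly measurable gradient. Nothing is known of them
  before existence is shown, and nothing useful before uniqueness. Both come from the bounded
  operator J = (1 + L)^(-1), which satisfies 0 \<le> J \<le> 1: continuous functions of J are limits
  of polynomials, and Bernstein coefficients take the place of the spectral theorem. The maximal
  function freezes the weight |u(t)|^(q-2) at a value independent of t, so that Tonelli leaves the
  time integral on |\<nabla>u|^2 alone. The absorption is legitimate because the L^q norm of f is
  finite, while the operator theory rests on f being in L^2. The maximal inequality is proved for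
  the powers of one operator with a constant independent of that operator, hence passes to time
  steps 2^(-m). On (0, \<infinity>) the final entropy has to vanish. An arbitrary open set need not
  have a spectral gap; that e^(-tL) f tends to 0 rests on 0 being the only element of W_0^(1,2) with
  zero gradient.\<close>

lemma lim_inverse_Suc: "(\<lambda>n. 1 / real (Suc n)) \<longlonglongrightarrow> 0"
  by (rule LIMSEQ_Suc[OF lim_const_over_n])

text \<open>Minimise \<open>E v = Q v v - 2 l v\<close> over \<open>V\<close>: by the parallelogram
  identity and coercivity a minimising sequence is Cauchy, and the first variation at the minimiser
  is the equation. With \<open>Q = inner\<close> the same lemma serves as orthogonal projection onto
  a closed subspace.\<close>

lemma symmetric_lax_milgram:
  fixes Q :: "'a::{real_inner,banach} \<Rightarrow> 'a \<Rightarrow> real"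
  assumes "closed V" and V: "subspace V" and "bounded_bilinear Q" and sym: "\<And>x y. Q x y = Q y x"
    and c: "c > 0" and coer: "\<And>v. v \<in> V \<Longrightarrow> Q v v \<ge> c * (norm v)\<^sup>2" and "bounded_linear l"
  obtains w where "w \<in> V" "\<And>v. v \<in> V \<Longrightarrow> Q w v = l v"
proof -
  interpret Q: bounded_bilinear Q by fact
  interpret l: bounded_linear l by fact
  define E where "E v = Q v v - 2 * l v" for v
  define m where "m = Inf (E ` V)"
  obtain K where K: "K > 0" "\<And>v. \<bar>l v\<bar> \<le> norm v * K" using l.pos_bounded by auto
  have low: "E v \<ge> - (K\<^sup>2 / c)" if "v \<in> V" for v
  proof -
    have "l v \<le> norm v * K" using K(2)[of v] by linarith
    then have "E v \<ge> c * (norm v)\<^sup>2 - 2 * (norm v * K)"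
      unfolding E_def using coer[OF that] by linarith
    moreover have "c * (norm v)\<^sup>2 - 2 * (norm v * K) + K\<^sup>2 / c = (c * norm v - K)\<^sup>2 / c"
      using c by (simp add: field_simps power2_eq_square)
    moreover have "(c * norm v - K)\<^sup>2 / c \<ge> 0" using c by simp
    ultimately show ?thesis by linarith
  qed
  have bdd: "bdd_below (E ` V)" using low by (auto intro!: bdd_belowI)
  have ne: "V \<noteq> {}" using subspace_0[OF V] by blast
  have mle: "m \<le> E v" if "v \<in> V" for v
    unfolding m_def using bdd that by (intro cInf_lower) auto
  have est: "c / 2 * (norm (v - w))\<^sup>2 \<le> E v + E w - 2 * m" if "v \<in> V" "w \<in> V" for v w
  proof -
    have "E v + E w - 2 * E ((1/2) *\<^sub>R (v + w)) = 1/2 * Q (v - w) (v - w)"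
      unfolding E_def
      by (simp add: Q.add_left Q.add_right Q.diff_left Q.diff_right Q.scaleR_left Q.scaleR_right
          l.add l.scaleR sym[of w v] algebra_simps)
    moreover have "m \<le> E ((1/2) *\<^sub>R (v + w))"
      using that V by (intro mle subspace_scale subspace_add)
    moreover have "c * (norm (v - w))\<^sup>2 \<le> Q (v - w) (v - w)"
      using that V by (intro coer subspace_diff)
    ultimately show ?thesis by linarith
  qed
  have "\<exists>v\<in>V. E v < m + 1 / real (Suc n)" for n
    using cInf_lessD[of "E ` V" "m + 1 / real (Suc n)"] ne by (auto simp: m_def)
  then obtain X where X: "\<And>n. X n \<in> V" "\<And>n. E (X n) < m + 1 / real (Suc n)" by metis
  have "Cauchy X"
  proof (rule metric_CauchyI)
    fix e :: real assume "e > 0"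
    obtain N where N: "1 / real (Suc N) < c * e\<^sup>2 / 4"
      by (rule nat_approx_posE[of "c * e\<^sup>2 / 4"]) (use \<open>e > 0\<close> c in auto)
    have "dist (X i) (X j) < e" if "i \<ge> N" "j \<ge> N" for i j
    proof -
      have "1 / real (Suc i) \<le> 1 / real (Suc N)" "1 / real (Suc j) \<le> 1 / real (Suc N)"
        using that by (auto simp: field_simps)
      then have "c / 2 * (norm (X i - X j))\<^sup>2 < c / 2 * e\<^sup>2"
        using est[OF X(1) X(1), of i j] X(2)[of i] X(2)[of j] N by linarith
      then have "(norm (X i - X j))\<^sup>2 < e\<^sup>2" using c by simp
      then show ?thesis using \<open>e > 0\<close> by (simp add: dist_norm power2_less_imp_less)
    qed
    then show "\<exists>N. \<forall>i\<ge>N. \<forall>j\<ge>N. dist (X i) (X j) < e" by blast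
  qed
  then obtain w where w: "X \<longlonglongrightarrow> w" using Cauchy_convergent_iff convergent_def by blast
  have wV: "w \<in> V" using \<open>closed V\<close> X(1) w closed_sequentially by blast
  have lim: "(\<lambda>n. E (X n)) \<longlonglongrightarrow> E w"
    unfolding E_def by (intro tendsto_intros Q.tendsto l.tendsto w)
  have "(\<lambda>n. m + 1 / real (Suc n)) \<longlonglongrightarrow> m + 0"
    by (intro tendsto_intros lim_inverse_Suc)
  then have Ew: "E w \<le> m"
    using LIMSEQ_le[OF lim, of "\<lambda>n. m + 1 / real (Suc n)" m] X(2) less_imp_le by auto
  show ?thesis
  proof (rule that[OF wV])
    fix v assume v: "v \<in> V"
    define d where "d = Q w v - l v"
    define q where "q = Q v v"
    have q: "q \<ge> 0" using coer[OF v] c unfolding q_def by (smt (verit) mult_nonneg_nonneg zero_le_power2)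
    have "0 \<le> 2 * t * d + t\<^sup>2 * q" for t
    proof -
      have "E (w + t *\<^sub>R v) = E w + 2 * t * d + t\<^sup>2 * q"
        unfolding E_def d_def q_def
        by (simp add: Q.add_left Q.add_right Q.scaleR_left Q.scaleR_right l.add l.scaleR sym[of v w]
            algebra_simps power2_eq_square)
      moreover have "m \<le> E (w + t *\<^sub>R v)" using wV v V by (intro mle subspace_add subspace_scale)
      ultimately show ?thesis using Ew by linarith
    qed
    \<comment> \<open>The minimiser in \<open>t\<close> would be \<open>- d / q\<close>;
      \<open>q + 1\<close> replaces \<open>q\<close> because \<open>Q v v\<close> may be 0. Clearing
      denominators still leaves a negative multiple of \<open>d\<^sup>2\<close>.\<close>
    from this[of "- d / (q + 1)"] have "0 \<le> (2 * (- d / (q + 1)) * d + (- d / (q + 1))\<^sup>2 * q) * (q + 1)\<^sup>2"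
      by simp
    also have "\<dots> = - (d\<^sup>2 * (q + 2))"
    proof -
      define p where "p = q + 1"
      have "(2 * (- d / p) * d + (- d / p)\<^sup>2 * (p - 1)) * p\<^sup>2 = - (d\<^sup>2 * (p + 1))"
        using q by (simp add: p_def[symmetric] field_simps power2_eq_square) (simp add: p_def algebra_simps)
      then show ?thesis by (simp add: p_def add.commute)
    qed
    finally have "d\<^sup>2 * (q + 2) \<le> 0" by simp
    then have "d = 0" using q by (simp add: mult_le_0_iff)
    then show "Q w v = l v" by (simp add: d_def)
  qed
qed

section \<open>Polynomials of an operator, and positive polynomials in the Bernstein basis\<close>

definition poly_op :: "('a \<Rightarrow> 'a) \<Rightarrow> real poly \<Rightarrow> 'a \<Rightarrow> 'a::real_vector" where
  "poly_op J p f = (\<Sum>i\<le>degree p. coeff p i *\<^sub>R (J ^^ i) f)"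

lemma poly_op_bound: "degree p \<le> n \<Longrightarrow> poly_op J p f = (\<Sum>i\<le>n. coeff p i *\<^sub>R (J ^^ i) f)"
  unfolding poly_op_def by (rule sum.mono_neutral_left) (auto simp: coeff_eq_0)

lemma poly_op_0 [simp]: "poly_op J 0 f = 0" by (simp add: poly_op_def)

text \<open>Both quantities are products of \<open>j\<close> factors of modulus at most 1, so their
  difference is at most the sum of the differences of the factors. The assumption
  \<open>2 * j < n\<close> keeps \<open>(k - i) / (n - i)\<close> above -1 even when
  \<open>k < i\<close>.\<close>

lemma binomial_ratio_approx:
  fixes j n k :: nat
  assumes "k \<le> n" "2 * j < n"
  shows "\<bar>real (k choose j) / real (n choose j) - (real k / real n) ^ j\<bar> \<le> real j * (real j / (real n - real j))"
proof -
  have e: "real (m choose j) = (\<Prod>i<j. real m - real i) / fact j" for m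
    by (simp add: binomial_gbinomial gbinomial_prod_rev atLeast0LessThan)
  have "real (k choose j) / real (n choose j) = (\<Prod>i<j. (real k - real i) / (real n - real i))"
    by (simp add: e prod_dividef)
  moreover have "(real k / real n) ^ j = (\<Prod>i<j. real k / real n)" by simp
  moreover have "norm ((\<Prod>i<j. (real k - real i) / (real n - real i)) - (\<Prod>i<j. real k / real n))
      \<le> (\<Sum>i<j. norm ((real k - real i) / (real n - real i) - real k / real n))"
    using assms by (intro norm_prod_diff) (auto simp: abs_le_iff field_simps)
  moreover have "(\<Sum>i<j. norm ((real k - real i) / (real n - real i) - real k / real n)) \<le> (\<Sum>i<j. real j / (real n - real j))"
  proof (rule sum_mono)
    fix i assume i: "i \<in> {..<j}"
    have "(real k - real i) / (real n - real i) - real k / real n = - (real i / (real n - real i) * ((real n - real k) / real n))"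
      using i assms by (simp add: field_simps)
    then have "norm ((real k - real i) / (real n - real i) - real k / real n) = real i / (real n - real i) * ((real n - real k) / real n)"
      using i assms by (simp add: abs_mult)
    also have "\<dots> \<le> real i / (real n - real i) * 1"
      using i assms by (intro mult_left_mono) (auto simp: field_simps)
    also have "\<dots> \<le> real j / (real n - real j)"
      using i assms by (auto intro!: frac_le)
    finally show "norm ((real k - real i) / (real n - real i) - real k / real n) \<le> real j / (real n - real j)" .
  qed
  ultimately show ?thesis by simp
qed

text \<open>The identity \<open>(n choose k) * (k choose j) = (n choose j) * ((n - j) choose (k -
  j))\<close> splits off the factor \<open>x ^ j\<close>; what remains is the partition of unity by
  Bernstein polynomials of degree \<open>n - j\<close>.\<close>

lemma power_Bernstein:
  assumes "j \<le> n"
  shows "x ^ j = (\<Sum>k\<le>n. real (k choose j) / real (n choose j) * Bernstein n k x)"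
proof -
  have "(\<Sum>k\<le>n. real (k choose j) / real (n choose j) * Bernstein n k x)
      = (\<Sum>k\<in>{j..n}. real (k choose j) / real (n choose j) * Bernstein n k x)"
    by (rule sum.mono_neutral_right) (auto simp: binomial_eq_0)
  also have "\<dots> = (\<Sum>k\<in>{j..n}. real ((n - j) choose (k - j)) * x ^ k * (1 - x) ^ (n - k))"
  proof (rule sum.cong)
    fix k assume k: "k \<in> {j..n}"
    then have "(n choose k) * (k choose j) = (n choose j) * ((n - j) choose (k - j))"
      by (intro choose_mult) auto
    then have "real (n choose k) * real (k choose j) = real (n choose j) * real ((n - j) choose (k - j))"
      by (metis of_nat_mult)
    moreover have "real (n choose j) \<noteq> 0" using assms by simp
    ultimately have "real (k choose j) / real (n choose j) * real (n choose k) = real ((n - j) choose (k - j))"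
      by (simp add: field_simps)
    then show "real (k choose j) / real (n choose j) * Bernstein n k x
      = real ((n - j) choose (k - j)) * x ^ k * (1 - x) ^ (n - k)"
      by (simp add: Bernstein_def flip: mult.assoc)
  qed simp
  also have "\<dots> = (\<Sum>i\<in>{..n-j}. real ((n - j) choose i) * x ^ (i + j) * (1 - x) ^ (n - j - i))"
    using assms by (intro sum.reindex_bij_witness[of _ "\<lambda>i. i + j" "\<lambda>k. k - j"]) auto
  also have "\<dots> = x ^ j * (\<Sum>i\<le>n-j. Bernstein (n - j) i x)"
    by (simp add: Bernstein_def sum_distrib_left power_add mult_ac)
  finally show ?thesis by simp
qed

definition bern_poly :: "nat \<Rightarrow> nat \<Rightarrow> real poly" where
  "bern_poly n k = smult (real (n choose k)) ([:0,1:] ^ k * [:1,-1:] ^ (n - k))"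

lemma poly_bern_poly: "poly (bern_poly n k) x = Bernstein n k x"
  by (simp add: bern_poly_def Bernstein_def poly_power)

text \<open>As the degree \<open>n\<close> of the basis grows, the \<open>k\<close>-th Bernstein
  coefficient of \<open>p\<close> approaches the sample \<open>p (k / n)\<close> uniformly in
  \<open>k\<close>, and the samples stay above the positive minimum \<open>m\<close> of
  \<open>p\<close>. This gives an algebraic certificate of positivity into which an operator can be
  substituted.\<close>

lemma positive_poly_Bernstein:
  fixes p :: "real poly"
  assumes "\<And>s. 0 \<le> s \<Longrightarrow> s \<le> 1 \<Longrightarrow> poly p s > 0"
  obtains n c where "p = (\<Sum>k\<le>n. smult (c k) (bern_poly n k))" "\<And>k. k \<le> n \<Longrightarrow> c k \<ge> 0"
proof -
  define d where "d = degree p"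
  define B where "B = (\<Sum>j\<le>d. \<bar>coeff p j\<bar>)"
  have "continuous_on {0..1} (poly p)" by (simp add: continuous_on_poly)
  then obtain s0 where s0: "s0 \<in> {0..1}" "\<And>s. s \<in> {0..1} \<Longrightarrow> poly p s0 \<le> poly p s"
    using continuous_attains_inf[of "{0..1::real}" "poly p"] by auto
  define m where "m = poly p s0"
  have m: "m > 0" "\<And>s. 0 \<le> s \<Longrightarrow> s \<le> 1 \<Longrightarrow> m \<le> poly p s" using s0 assms by (auto simp: m_def)
  have B0: "B \<ge> 0" by (simp add: B_def sum_nonneg)
  \<comment> \<open>Chosen so that the distance of a coefficient from its sample, which is at most
    \<open>B * d\<^sup>2 / (n - d)\<close>, stays below \<open>m\<close>.\<close>
  obtain N where N: "real N > B * (real d * real d) / m" using reals_Archimedean2 by blast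
  define n where "n = N + 2 * d + 1"
  have nd: "2 * d < n" "real n - real d > B * (real d * real d) / m" "real n - real d > 0" using N by (auto simp: n_def)
  then have "B * (real d * real d) < m * (real n - real d)" using m(1) by (simp add: field_simps)
  then have Bm: "B * (real d * (real d / (real n - real d))) < m" using nd(3) by (simp add: field_simps)
  define c where "c k = (\<Sum>j\<le>d. coeff p j * (real (k choose j) / real (n choose j)))" for k
  have eq: "p = (\<Sum>k\<le>n. smult (c k) (bern_poly n k))"
  proof (rule poly_eq_poly_eq_iff[THEN iffD1], rule ext)
    fix x
    have "poly p x = (\<Sum>j\<le>d. coeff p j * x ^ j)" by (simp add: poly_altdef d_def)
    also have "\<dots> = (\<Sum>j\<le>d. coeff p j * (\<Sum>k\<le>n. real (k choose j) / real (n choose j) * Bernstein n k x))"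
      using nd by (intro sum.cong refl) (simp add: power_Bernstein[of _ n x, symmetric] del: times_divide_eq_left)
    also have "\<dots> = (\<Sum>k\<le>n. c k * Bernstein n k x)"
      unfolding c_def sum_distrib_left sum_distrib_right by (subst sum.swap) (simp add: mult_ac)
    finally show "poly p x = poly (\<Sum>k\<le>n. smult (c k) (bern_poly n k)) x"
      by (simp add: poly_sum poly_bern_poly)
  qed
  have "c k \<ge> 0" if k: "k \<le> n" for k
  proof -
    have "\<bar>c k - poly p (real k / real n)\<bar> = \<bar>\<Sum>j\<le>d. coeff p j * (real (k choose j) / real (n choose j) - (real k / real n) ^ j)\<bar>"
      by (simp add: c_def poly_altdef d_def sum_subtractf right_diff_distrib)
    also have "\<dots> \<le> (\<Sum>j\<le>d. \<bar>coeff p j\<bar> * (real d * (real d / (real n - real d))))"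
    proof (rule order_trans[OF sum_abs], rule sum_mono)
      fix j assume j: "j \<in> {..d}"
      have "\<bar>real (k choose j) / real (n choose j) - (real k / real n) ^ j\<bar> \<le> real j * (real j / (real n - real j))"
        using j nd k by (intro binomial_ratio_approx) auto
      also have "\<dots> \<le> real d * (real d / (real n - real d))"
        using j nd by (intro mult_mono frac_le) auto
      finally show "\<bar>coeff p j * (real (k choose j) / real (n choose j) - (real k / real n) ^ j)\<bar>
        \<le> \<bar>coeff p j\<bar> * (real d * (real d / (real n - real d)))"
        unfolding abs_mult by (intro mult_left_mono) auto
    qed
    also have "\<dots> = B * (real d * (real d / (real n - real d)))" unfolding B_def by (rule sum_distrib_right[symmetric])
    also have "\<dots> < m" by (rule Bm)
    finally show ?thesis using m(2)[of "real k / real n"] k nd by (auto simp: divide_le_eq)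
  qed
  with eq show ?thesis by (rule that)
qed

lemma poly_dense_Icc:
  fixes h :: "real \<Rightarrow> real"
  assumes "continuous_on {0..1} h" "e > 0"
  shows "\<exists>p :: real poly. \<forall>s\<in>{0..1}. \<bar>poly p s - h s\<bar> \<le> e"
proof -
  from Bernstein_Weierstrass[OF assms] obtain N where
    N: "\<And>n x. N \<le> n \<and> x \<in> {0..1} \<longrightarrow> \<bar>h x - (\<Sum>k\<le>n. h(k/n) * Bernstein n k x)\<bar> < e" by metis
  show ?thesis
  proof (intro exI ballI)
    fix s :: real assume "s \<in> {0..1}"
    then show "\<bar>poly (\<Sum>k\<le>N. smult (h (k/N)) (bern_poly N k)) s - h s\<bar> \<le> e"
      using N[of N s] by (simp add: poly_sum poly_bern_poly abs_minus_commute)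
  qed
qed

lemma continuous_on_Icc_abs_bounded:
  fixes h :: "real \<Rightarrow> real"
  assumes "continuous_on {a..b} h"
  shows "\<exists>M. \<forall>s. s \<in> {a..b} \<longrightarrow> \<bar>h s\<bar> \<le> M"
proof -
  have "bounded (h ` {a..b})" by (intro compact_imp_bounded compact_continuous_image assms compact_Icc)
  then obtain M where "\<forall>x\<in>h ` {a..b}. norm x \<le> M" unfolding bounded_iff by blast
  then have "\<forall>s. s \<in> {a..b} \<longrightarrow> \<bar>h s\<bar> \<le> M" by simp
  then show ?thesis by blast
qed

section \<open>Polynomials and continuous functions of an operator with
  \<open>J\<^sup>2 \<le> J\<close>, that is 0 \<le> J \<le> 1\<close>

locale positive_contraction =
  fixes J :: "'a::{real_inner,banach} \<Rightarrow> 'a"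
  assumes J_bounded_linear: "bounded_linear J"
    and J_sym: "inner (J x) y = inner x (J y)"
    and J_le: "(norm (J x))\<^sup>2 \<le> inner (J x) x"
begin

sublocale J: bounded_linear J by (rule J_bounded_linear)

abbreviation "pop \<equiv> poly_op J"

lemma norm_J_le: "norm (J x) \<le> norm x"
proof -
  have "norm (J x) * norm (J x) \<le> norm (J x) * norm x"
    using J_le[of x] norm_cauchy_schwarz[of "J x" x] by (simp add: power2_eq_square)
  then show ?thesis by (cases "norm (J x) = 0") (auto simp: mult_le_cancel_left)
qed

lemma funpow_linear: "linear (J ^^ i)"
proof (induction i)
  case 0
  then show ?case by (simp add: linear_id[unfolded id_def] id_def)
next
  case (Suc i)
  have "J ^^ Suc i = J \<circ> J ^^ i" by simp
  then show ?case using linear_compose[OF Suc J.linear] by metis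
qed

lemma pop_linear: "linear (pop p)"
proof -
  have "linear (\<lambda>f. \<Sum>i\<le>degree p. coeff p i *\<^sub>R (J ^^ i) f)"
    by (intro linear_compose_sum ballI linear_compose_scale_right funpow_linear)
  then show ?thesis unfolding poly_op_def .
qed

lemma pop_pCons: "pop (pCons a p) f = a *\<^sub>R f + J (pop p f)"
proof -
  have "degree (pCons a p) \<le> Suc (degree p)" by (rule degree_pCons_le)
  then have "pop (pCons a p) f = (\<Sum>i\<le>Suc (degree p). coeff (pCons a p) i *\<^sub>R (J ^^ i) f)"
    by (rule poly_op_bound)
  also have "\<dots> = a *\<^sub>R f + (\<Sum>i\<le>degree p. coeff p i *\<^sub>R (J ^^ (Suc i)) f)"
    by (subst sum.atMost_Suc_shift) simp
  also have "\<dots> = a *\<^sub>R f + J (pop p f)"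
    by (simp add: poly_op_def J.sum J.scaleR)
  finally show ?thesis .
qed

lemma pop_add: "pop (p + q) f = pop p f + pop q f"
proof (induction p q rule: poly_induct2)
  case 0 then show ?case by simp
next
  case (pCons a p b q) then show ?case by (simp add: pop_pCons J.add algebra_simps)
qed

lemma pop_smult: "pop (smult a p) f = a *\<^sub>R pop p f"
  by (induction p) (simp_all add: pop_pCons J.scaleR algebra_simps)

lemma pop_diff: "pop (p - q) f = pop p f - pop q f"
  using pop_add[of "p - q" q f] by simp

lemma pop_sum: "pop (sum F S) f = (\<Sum>k\<in>S. pop (F k) f)"
  by (induction S rule: infinite_finite_induct) (auto simp: pop_add)

lemma pop_mult: "pop (p * q) f = pop p (pop q f)"
  by (induction p) (simp_all add: pop_pCons pop_add pop_smult)

lemma pop_J: "pop p (J f) = J (pop p f)"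
  by (induction p) (simp_all add: pop_pCons J.add J.scaleR J.zero)

lemma pop_const: "pop [:a:] f = a *\<^sub>R f" and pop_X: "pop [:0, 1:] f = J f" and pop_1X: "pop [:1, -1:] f = f - J f"
  by (simp_all add: pop_pCons J.zero J.neg)

lemma pop_sym: "inner (pop p f) g = inner f (pop p g)"
proof (induction p arbitrary: f g)
  case 0 then show ?case by simp
next
  case (pCons a p)
  have "inner (J (pop p f)) g = inner f (J (pop p g))"
    by (simp add: J_sym pCons.IH pop_J)
  then show ?case by (simp add: pop_pCons inner_add_left inner_add_right)
qed

lemma pop_square_weight:
  assumes "\<And>g. inner (pop w g) g \<ge> 0"
  shows "inner (pop (r * r * w) f) f \<ge> 0"
proof -
  have "inner (pop (r * r * w) f) f = inner (pop r (pop w (pop r f))) f"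
    by (metis mult.assoc mult.commute pop_mult)
  then show ?thesis using assms[of "pop r f"] by (simp add: pop_sym)
qed

text \<open>The three weights J, 1 - J and J(1 - J); the last one is exactly \<open>J_le\<close>. Up
  to squares, every product of powers of J and 1 - J is one of these or the identity.\<close>

lemma pop_weight_nonneg:
  "inner (J f) f \<ge> 0" "inner (f - J f) f \<ge> 0" "inner (J f - J (J f)) f \<ge> 0"
proof -
  show "inner (J f) f \<ge> 0" using J_le[of f] by (meson order_trans zero_le_power2)
  have "inner (J f) f \<le> norm (J f) * norm f" by (rule norm_cauchy_schwarz)
  also have "\<dots> \<le> norm f * norm f" by (intro mult_right_mono norm_J_le) auto
  finally show "inner (f - J f) f \<ge> 0" by (simp add: inner_diff_left dot_square_norm power2_eq_square)
  show "inner (J f - J (J f)) f \<ge> 0"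
    using J_le[of f] by (simp add: inner_diff_left J_sym[of "J f"] dot_square_norm)
qed

text \<open>Taking out the even parts of both exponents writes the product as
  \<open>r * r * w\<close> with \<open>w\<close> among 1, X, 1 - X and X(1 - X). The square is moved
  symmetrically to both sides of the inner product.\<close>

lemma pop_bern_nonneg: "inner (pop ([:0,1:] ^ i * [:1,-1:] ^ j) f) f \<ge> 0"
proof -
  let ?X = "[:0,1::real:]" and ?Y = "[:1,-1::real:]"
  define r where "r = ?X ^ (i div 2) * ?Y ^ (j div 2)"
  define w where "w = (if even i then 1 else ?X) * (if even j then 1 else ?Y)"
  have pw: "a ^ k = a ^ (k div 2) * a ^ (k div 2) * (if even k then 1 else a)" for a :: "real poly" and k
  proof (cases "even k")
    case True
    then have "k = k div 2 + k div 2" by presburger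
    then have "a ^ k = a ^ (k div 2) * a ^ (k div 2)" by (metis power_add)
    then show ?thesis using True by simp
  next
    case False
    then have "k = Suc (k div 2 + k div 2)" by presburger
    then have "a ^ k = a * (a ^ (k div 2) * a ^ (k div 2))" by (metis power_Suc power_add)
    then show ?thesis using False by (simp add: mult_ac)
  qed
  have "?X ^ i * ?Y ^ j = r * r * w"
    unfolding r_def w_def by (subst pw[of ?X i], subst pw[of ?Y j]) (simp only: mult_ac)
  moreover have "inner (pop w g) g \<ge> 0" for g
  proof -
    have "pop 1 g = g" by (simp add: pop_const one_pCons)
    moreover have "pop (?X * ?Y) g = J g - J (J g)" by (simp only: pop_mult pop_X pop_1X J.diff)
    ultimately show ?thesis
      using pop_weight_nonneg[of g] by (simp add: w_def pop_X pop_1X del: mult_pCons_left mult_pCons_right)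
  qed
  ultimately show ?thesis using pop_square_weight by metis
qed

text \<open>Expand \<open>p\<close> in Bernstein polynomials with nonnegative coefficients; each
  summand is nonnegative at J by \<open>pop_bern_nonneg\<close>.\<close>

lemma pop_positive:
  assumes "\<And>s. 0 \<le> s \<Longrightarrow> s \<le> 1 \<Longrightarrow> poly p s > 0"
  shows "inner (pop p f) f \<ge> 0"
proof -
  obtain n c where p: "p = (\<Sum>k\<le>n. smult (c k) (bern_poly n k))" and c: "\<And>k. k \<le> n \<Longrightarrow> c k \<ge> 0"
    using positive_poly_Bernstein[OF assms] by metis
  have "inner (pop p f) f = (\<Sum>k\<le>n. c k * real (n choose k) * inner (pop ([:0,1:] ^ k * [:1,-1:] ^ (n - k)) f) f)"
    unfolding p by (simp only: pop_sum pop_smult bern_poly_def inner_sum_left inner_scaleR_left mult.assoc)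
  also have "\<dots> \<ge> 0" by (intro sum_nonneg mult_nonneg_nonneg c pop_bern_nonneg) auto
  finally show ?thesis .
qed

text \<open>The bound says that \<open>M\<^sup>2 - p\<^sup>2\<close> is nonnegative at J. The
  Bernstein certificate wants strict positivity, hence the slack \<open>e\<close>, which is sent to
  0 at the end.\<close>

lemma norm_pop_le:
  assumes "\<And>s. s \<in> {0..1} \<Longrightarrow> \<bar>poly p s\<bar> \<le> M"
  shows "norm (pop p f) \<le> M * norm f"
proof -
  have M: "M \<ge> 0" using assms[of 0] by auto
  have bd: "(norm (pop p f))\<^sup>2 \<le> (M\<^sup>2 + e) * (norm f)\<^sup>2" if "e > 0" for e
  proof -
    have "0 \<le> inner (pop ([:M\<^sup>2 + e:] - p * p) f) f"
    proof (rule pop_positive)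
      fix s :: real assume "0 \<le> s" "s \<le> 1"
      then have "\<bar>poly p s\<bar>\<^sup>2 \<le> M\<^sup>2" using assms[of s] by (intro power_mono) auto
      then show "0 < poly ([:M\<^sup>2 + e:] - p * p) s" using that by (simp add: power2_eq_square)
    qed
    also have "\<dots> = (M\<^sup>2 + e) * (norm f)\<^sup>2 - (norm (pop p f))\<^sup>2"
      by (simp only: pop_diff pop_const pop_mult inner_diff_left inner_scaleR_left pop_sym[of p "pop p f"])
         (simp add: dot_square_norm)
    finally show ?thesis by simp
  qed
  have "(norm (pop p f))\<^sup>2 \<le> M\<^sup>2 * (norm f)\<^sup>2"
  proof (rule tendsto_lowerbound)
    show "((\<lambda>e. (M\<^sup>2 + e) * (norm f)\<^sup>2) \<longlongrightarrow> M\<^sup>2 * (norm f)\<^sup>2) (at_right 0)" by (auto intro!: tendsto_eq_intros)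
    show "\<forall>\<^sub>F e in at_right 0. (norm (pop p f))\<^sup>2 \<le> (M\<^sup>2 + e) * (norm f)\<^sup>2"
      using bd by (auto simp: eventually_at_filter)
  qed simp
  then have "(norm (pop p f))\<^sup>2 \<le> (M * norm f)\<^sup>2" by (simp add: power_mult_distrib)
  then show ?thesis by (rule power2_le_imp_le) (use M in auto)
qed

definition fc :: "(real \<Rightarrow> real) \<Rightarrow> 'a \<Rightarrow> 'a" where
  "fc h f = lim (\<lambda>n. pop (SOME p. \<forall>s\<in>{0..1}. \<bar>poly p s - h s\<bar> \<le> 1 / real (Suc n)) f)"

text \<open>By \<open>norm_pop_le\<close> a uniform error on [0, 1] is an error in operator norm. So
  the polynomials picked in \<open>fc\<close> form a Cauchy sequence, and the limit does not depend
  on which ones were picked. The algebraic rules below are inherited from polynomials through this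
  estimate.\<close>

lemma fc_approx:
  assumes h: "continuous_on {0..1} h" and p: "\<And>s. s \<in> {0..1} \<Longrightarrow> \<bar>poly p s - h s\<bar> \<le> e"
  shows "norm (fc h f - pop p f) \<le> e * norm f"
proof -
  define P where "P n = (SOME p. \<forall>s\<in>{0..1}. \<bar>poly p s - h s\<bar> \<le> 1 / real (Suc n))" for n
  have P: "\<bar>poly (P n) s - h s\<bar> \<le> 1 / real (Suc n)" if "s \<in> {0..1}" for n s
    using someI_ex[OF poly_dense_Icc[OF h, of "1 / real (Suc n)"]] that unfolding P_def by simp
  have dist: "norm (pop (P n) f - pop q f) \<le> (1 / real (Suc n) + d) * norm f"
    if "\<And>s. s \<in> {0..1} \<Longrightarrow> \<bar>poly q s - h s\<bar> \<le> d" for n q d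
  proof -
    have "norm (pop (P n - q) f) \<le> (1 / real (Suc n) + d) * norm f"
    proof (rule norm_pop_le)
      fix s :: real assume "s \<in> {0..1}"
      then show "\<bar>poly (P n - q) s\<bar> \<le> 1 / real (Suc n) + d" using P[of s n] that[of s] by simp
    qed
    then show ?thesis by (simp add: pop_diff)
  qed
  have "Cauchy (\<lambda>n. pop (P n) f)"
  proof (rule metric_CauchyI)
    fix e :: real assume "e > 0"
    define a where "a = e / (2 * (norm f + 1))"
    obtain N where N: "1 / real (Suc N) < a"
      by (rule nat_approx_posE[of a]) (use \<open>e > 0\<close> in \<open>auto simp: a_def intro!: divide_pos_pos add_nonneg_pos\<close>)
    have "dist (pop (P i) f) (pop (P j) f) < e" if "i \<ge> N" "j \<ge> N" for i j
    proof -
      have "1 / real (Suc i) \<le> 1 / real (Suc N)" "1 / real (Suc j) \<le> 1 / real (Suc N)"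
        using that by (simp_all add: frac_le)
      moreover have "a + a = e / (norm f + 1)"
        unfolding a_def by (metis field_sum_of_halves divide_divide_eq_left')
      ultimately have le: "1 / real (Suc i) + 1 / real (Suc j) \<le> e / (norm f + 1)" using N by linarith
      have "norm (pop (P i) f - pop (P j) f) \<le> (1 / real (Suc i) + 1 / real (Suc j)) * norm f"
        using dist[of "P j" "1 / real (Suc j)" i] P by blast
      also have "\<dots> \<le> e / (norm f + 1) * norm f" by (intro mult_right_mono le) auto
      also have "\<dots> < e" using \<open>e > 0\<close> by (simp add: pos_divide_less_eq add_nonneg_pos)
      finally show ?thesis by (simp add: dist_norm)
    qed
    then show "\<exists>N. \<forall>i\<ge>N. \<forall>j\<ge>N. dist (pop (P i) f) (pop (P j) f) < e" by blast
  qed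
  then have lim: "(\<lambda>n. pop (P n) f) \<longlonglongrightarrow> fc h f"
    unfolding fc_def P_def[symmetric] by (simp add: Cauchy_convergent_iff convergent_LIMSEQ_iff)
  have "(\<lambda>n. (1 / real (Suc n) + e) * norm f) \<longlonglongrightarrow> (0 + e) * norm f"
    by (intro tendsto_intros lim_inverse_Suc)
  moreover have "(\<lambda>n. norm (pop (P n) f - pop p f)) \<longlonglongrightarrow> norm (fc h f - pop p f)"
    by (intro tendsto_intros lim)
  ultimately have "norm (fc h f - pop p f) \<le> (0 + e) * norm f"
    using dist[of p e, OF p] LIMSEQ_le[of "\<lambda>n. norm (pop (P n) f - pop p f)" _ "\<lambda>n. (1 / real (Suc n) + e) * norm f" "(0 + e) * norm f"] by blast
  then show ?thesis by simp
qed

lemma fc_LIMSEQ: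
  assumes h: "continuous_on {0..1} h" and "\<And>n s. s \<in> {0..1} \<Longrightarrow> \<bar>poly (R n) s - h s\<bar> \<le> e n" and e: "e \<longlonglongrightarrow> 0"
  shows "(\<lambda>n. pop (R n) f) \<longlonglongrightarrow> fc h f"
proof -
  have "(\<lambda>n. e n * norm f) \<longlonglongrightarrow> 0" using tendsto_mult_left_zero[OF e] .
  moreover have "norm (pop (R n) f - fc h f) \<le> e n * norm f" for n
    using fc_approx[OF h assms(2), of f n] by (simp only: norm_minus_commute)
  then have "\<forall>\<^sub>F n in sequentially. norm (pop (R n) f - fc h f) \<le> e n * norm f" by simp
  ultimately have "(\<lambda>n. pop (R n) f - fc h f) \<longlonglongrightarrow> 0" by (rule Lim_null_comparison[rotated])
  then show ?thesis by (simp add: LIM_zero_iff)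
qed

lemma fc_sequence:
  assumes h: "continuous_on {0..1} h"
  shows "\<exists>P. (\<forall>n s. s \<in> {0..1} \<longrightarrow> \<bar>poly (P n) s - h s\<bar> \<le> 1 / real (Suc n)) \<and> (\<forall>f. (\<lambda>n. pop (P n) f) \<longlonglongrightarrow> fc h f)"
proof -
  have "\<exists>p. \<forall>s\<in>{0..1}. \<bar>poly p s - h s\<bar> \<le> 1 / real (Suc n)" for n
    using poly_dense_Icc[OF h, of "1 / real (Suc n)"] by simp
  then obtain P where P: "\<And>n s. s \<in> {0..1} \<Longrightarrow> \<bar>poly (P n) s - h s\<bar> \<le> 1 / real (Suc n)" by metis
  show ?thesis
    using P fc_LIMSEQ[OF h P lim_inverse_Suc] by blast
qed

lemma fc_poly: "(\<And>s. s \<in> {0..1} \<Longrightarrow> h s = poly p s) \<Longrightarrow> fc h f = pop p f"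
proof -
  assume h: "\<And>s. s \<in> {0..1} \<Longrightarrow> h s = poly p s"
  have "continuous_on {0..1} (poly p)" by (intro continuous_on_poly continuous_on_id)
  moreover have "continuous_on {0..1} h = continuous_on {0..1} (poly p)" by (rule continuous_on_cong) (auto simp: h)
  ultimately have "continuous_on {0..1} h" by simp
  from fc_approx[OF this, of p 0] show ?thesis using h by simp
qed

lemma fc_linear_comb:
  assumes h: "continuous_on {0..1} h" and k: "continuous_on {0..1} k"
  shows "fc (\<lambda>s. a * h s + b * k s) f = a *\<^sub>R fc h f + b *\<^sub>R fc k f"
proof -
  obtain P where P: "\<And>n s. s \<in> {0..1} \<Longrightarrow> \<bar>poly (P n) s - h s\<bar> \<le> 1 / real (Suc n)" "\<And>f. (\<lambda>n. pop (P n) f) \<longlonglongrightarrow> fc h f"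
    using fc_sequence[OF h] by blast
  obtain Q where Q: "\<And>n s. s \<in> {0..1} \<Longrightarrow> \<bar>poly (Q n) s - k s\<bar> \<le> 1 / real (Suc n)" "\<And>f. (\<lambda>n. pop (Q n) f) \<longlonglongrightarrow> fc k f"
    using fc_sequence[OF k] by blast
  have "(\<lambda>n. pop (smult a (P n) + smult b (Q n)) f) \<longlonglongrightarrow> fc (\<lambda>s. a * h s + b * k s) f"
  proof (rule fc_LIMSEQ)
    show "continuous_on {0..1} (\<lambda>s. a * h s + b * k s)" by (intro continuous_intros h k)
    fix n and s :: real assume s: "s \<in> {0..1}"
    have "\<bar>poly (smult a (P n) + smult b (Q n)) s - (a * h s + b * k s)\<bar> = \<bar>a * (poly (P n) s - h s) + b * (poly (Q n) s - k s)\<bar>"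
      by (simp add: algebra_simps)
    also have "\<dots> \<le> \<bar>a\<bar> * (1 / real (Suc n)) + \<bar>b\<bar> * (1 / real (Suc n))"
      by (intro order_trans[OF abs_triangle_ineq] add_mono, unfold abs_mult; intro mult_left_mono P Q s abs_ge_zero)
    finally show "\<bar>poly (smult a (P n) + smult b (Q n)) s - (a * h s + b * k s)\<bar> \<le> (\<bar>a\<bar> + \<bar>b\<bar>) * (1 / real (Suc n))"
      by (simp only: distrib_right)
  next
    show "(\<lambda>n. (\<bar>a\<bar> + \<bar>b\<bar>) * (1 / real (Suc n))) \<longlonglongrightarrow> 0"
      by (intro tendsto_mult_right_zero lim_inverse_Suc)
  qed
  moreover have "(\<lambda>n. pop (smult a (P n) + smult b (Q n)) f) \<longlonglongrightarrow> a *\<^sub>R fc h f + b *\<^sub>R fc k f"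
    unfolding pop_add pop_smult by (intro tendsto_intros P Q)
  ultimately show ?thesis by (rule LIMSEQ_unique)
qed

lemma fc_linear:
  assumes h: "continuous_on {0..1} h" shows "linear (fc h)"
proof -
  obtain P where P: "\<And>f. (\<lambda>n. pop (P n) f) \<longlonglongrightarrow> fc h f" using fc_sequence[OF h] by blast
  show ?thesis
  proof (rule linearI)
    fix x y and r :: real
    have "(\<lambda>n. pop (P n) (x + y)) \<longlonglongrightarrow> fc h x + fc h y"
      unfolding linear_add[OF pop_linear] by (intro tendsto_intros P)
    then show "fc h (x + y) = fc h x + fc h y" using P LIMSEQ_unique by blast
    have "(\<lambda>n. pop (P n) (r *\<^sub>R x)) \<longlonglongrightarrow> r *\<^sub>R fc h x"
      unfolding linear_cmul[OF pop_linear] by (intro tendsto_intros P)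
    then show "fc h (r *\<^sub>R x) = r *\<^sub>R fc h x" using P LIMSEQ_unique by blast
  qed
qed

lemma fc_sym:
  assumes h: "continuous_on {0..1} h" shows "inner (fc h f) g = inner f (fc h g)"
proof -
  obtain P where P: "\<And>f. (\<lambda>n. pop (P n) f) \<longlonglongrightarrow> fc h f" using fc_sequence[OF h] by blast
  have "(\<lambda>n. inner (pop (P n) f) g) \<longlonglongrightarrow> inner (fc h f) g" by (intro tendsto_intros P)
  moreover have "(\<lambda>n. inner (pop (P n) f) g) \<longlonglongrightarrow> inner f (fc h g)" unfolding pop_sym by (intro tendsto_intros P)
  ultimately show ?thesis by (rule LIMSEQ_unique)
qed

lemma norm_fc_le:
  assumes h: "continuous_on {0..1} h" and M: "\<And>s. s \<in> {0..1} \<Longrightarrow> \<bar>h s\<bar> \<le> M"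
  shows "norm (fc h f) \<le> M * norm f"
proof -
  obtain P where P: "\<And>n s. s \<in> {0..1} \<Longrightarrow> \<bar>poly (P n) s - h s\<bar> \<le> 1 / real (Suc n)" "\<And>f. (\<lambda>n. pop (P n) f) \<longlonglongrightarrow> fc h f"
    using fc_sequence[OF h] by blast
  have "norm (pop (P n) f) \<le> (1 / real (Suc n) + M) * norm f" for n
  proof (rule norm_pop_le)
    fix s :: real assume "s \<in> {0..1}"
    then show "\<bar>poly (P n) s\<bar> \<le> 1 / real (Suc n) + M" using P(1)[of s n] M[of s] by linarith
  qed
  moreover have "(\<lambda>n. (1 / real (Suc n) + M) * norm f) \<longlonglongrightarrow> (0 + M) * norm f"
    by (intro tendsto_intros lim_inverse_Suc)
  moreover have "(\<lambda>n. norm (pop (P n) f)) \<longlonglongrightarrow> norm (fc h f)" by (intro tendsto_intros P)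
  ultimately have "norm (fc h f) \<le> (0 + M) * norm f"
    using LIMSEQ_le[of "\<lambda>n. norm (pop (P n) f)" "norm (fc h f)" "\<lambda>n. (1 / real (Suc n) + M) * norm f" "(0 + M) * norm f"] by blast
  then show ?thesis by simp
qed

lemma fc_bounded_linear:
  assumes h: "continuous_on {0..1} h" shows "bounded_linear (fc h)"
proof -
  obtain M where M: "\<And>s. s \<in> {0..1} \<Longrightarrow> \<bar>h s\<bar> \<le> M"
    using continuous_on_Icc_abs_bounded[OF h] by blast
  show ?thesis
  proof (rule bounded_linear_intro)
    show "norm (fc h x) \<le> norm x * M" for x using norm_fc_le[OF h M, of x] by (simp add: mult.commute)
  qed (simp_all add: linear_add[OF fc_linear[OF h]] linear_cmul[OF fc_linear[OF h]])
qed

lemma fc_mult: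
  assumes h: "continuous_on {0..1} h" and k: "continuous_on {0..1} k"
  shows "fc (\<lambda>s. h s * k s) f = fc h (fc k f)"
proof -
  obtain P where P: "\<And>n s. s \<in> {0..1} \<Longrightarrow> \<bar>poly (P n) s - h s\<bar> \<le> 1 / real (Suc n)" "\<And>f. (\<lambda>n. pop (P n) f) \<longlonglongrightarrow> fc h f"
    using fc_sequence[OF h] by blast
  obtain Q where Q: "\<And>n s. s \<in> {0..1} \<Longrightarrow> \<bar>poly (Q n) s - k s\<bar> \<le> 1 / real (Suc n)" "\<And>f. (\<lambda>n. pop (Q n) f) \<longlonglongrightarrow> fc k f"
    using fc_sequence[OF k] by blast
  obtain M where M: "\<And>s. s \<in> {0..1} \<Longrightarrow> \<bar>h s\<bar> \<le> M"
    using continuous_on_Icc_abs_bounded[OF h] by blast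
  obtain N where N: "\<And>s. s \<in> {0..1} \<Longrightarrow> \<bar>k s\<bar> \<le> N"
    using continuous_on_Icc_abs_bounded[OF k] by blast
  have Mn: "\<bar>poly (P n) s\<bar> \<le> M + 1" if "s \<in> {0..1}" for s n
  proof -
    have "1 / real (Suc n) \<le> 1" by simp
    then show ?thesis using P(1)[OF that, of n] M[OF that] by linarith
  qed
  have lim0: "(\<lambda>n. 1 / real (Suc n)) \<longlonglongrightarrow> 0" by (rule lim_inverse_Suc)
  have "(\<lambda>n. pop (P n * Q n) f) \<longlonglongrightarrow> fc (\<lambda>s. h s * k s) f"
  proof (rule fc_LIMSEQ)
    show "continuous_on {0..1} (\<lambda>s. h s * k s)" by (intro continuous_intros h k)
    fix n and s :: real assume s: "s \<in> {0..1}"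
    have "\<bar>poly (P n * Q n) s - h s * k s\<bar> = \<bar>poly (P n) s * (poly (Q n) s - k s) + k s * (poly (P n) s - h s)\<bar>"
      by (simp add: algebra_simps)
    also have "\<dots> \<le> (M + 1) * (1 / real (Suc n)) + N * (1 / real (Suc n))"
      unfolding abs_mult
      by (intro order_trans[OF abs_triangle_ineq] add_mono, unfold abs_mult; intro mult_mono P Q s Mn N)
         (use Mn[OF s] N[OF s] in \<open>auto intro: order_trans[OF abs_ge_zero]\<close>)
    finally show "\<bar>poly (P n * Q n) s - h s * k s\<bar> \<le> (M + 1 + N) * (1 / real (Suc n))"
      by (simp only: distrib_right)
  next
    show "(\<lambda>n. (M + 1 + N) * (1 / real (Suc n))) \<longlonglongrightarrow> 0" by (intro tendsto_mult_right_zero lim0)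
  qed
  moreover have "(\<lambda>n. pop (P n * Q n) f) \<longlonglongrightarrow> fc h (fc k f)"
  proof -
    \<comment> \<open>The inner difference tends to 0 and the operators applied to it have norms at
      most \<open>M + 1\<close> for all \<open>n\<close>.\<close>
    have "(\<lambda>n. pop (P n) (pop (Q n) f - fc k f)) \<longlonglongrightarrow> 0"
    proof (rule Lim_null_comparison)
      show "\<forall>\<^sub>F n in sequentially. norm (pop (P n) (pop (Q n) f - fc k f)) \<le> (M + 1) * norm (pop (Q n) f - fc k f)"
        using Mn by (intro always_eventually allI norm_pop_le)
      show "(\<lambda>n. (M + 1) * norm (pop (Q n) f - fc k f)) \<longlonglongrightarrow> 0"
        using Q(2)[of f] by (intro tendsto_mult_right_zero tendsto_norm_zero) (simp add: LIM_zero)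
    qed
    then have "(\<lambda>n. pop (P n) (pop (Q n) f - fc k f) + pop (P n) (fc k f)) \<longlonglongrightarrow> 0 + fc h (fc k f)"
      by (intro tendsto_add P)
    then show ?thesis by (simp add: pop_mult linear_diff[OF pop_linear])
  qed
  ultimately show ?thesis by (rule LIMSEQ_unique)
qed

end

section \<open>The semigroup of a coercive form\<close>

lemma bounded_bilinear_add:
  assumes f: "bounded_bilinear f" and g: "bounded_bilinear g"
  shows "bounded_bilinear (\<lambda>x y. f x y + g x y)"
proof -
  interpret f: bounded_bilinear f by fact
  interpret g: bounded_bilinear g by fact
  obtain K where K: "\<And>x y. norm (f x y) \<le> norm x * norm y * K" using f.bounded by blast
  obtain L where L: "\<And>x y. norm (g x y) \<le> norm x * norm y * L" using g.bounded by blast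
  show ?thesis
  proof
    have "norm (f x y + g x y) \<le> norm x * norm y * (K + L)" for x y
      using norm_triangle_ineq[of "f x y" "g x y"] K[of x y] L[of x y] by (simp add: distrib_left)
    then show "\<exists>K. \<forall>a b. norm (f a b + g a b) \<le> norm a * norm b * K" by blast
  qed (simp_all add: f.add_left g.add_left f.add_right g.add_right f.scaleR_left f.scaleR_right g.scaleR_left g.scaleR_right scaleR_add_right)
qed

lemma closure_subspace:
  fixes S :: "'a::real_normed_vector set"
  assumes "subspace S" shows "subspace (closure S)"
  unfolding subspace_def
proof (intro conjI ballI allI)
  show "0 \<in> closure S" using subspace_0[OF assms] closure_subset by blast
  fix x y assume "x \<in> closure S" "y \<in> closure S"
  then obtain X Y where X: "\<And>n. X n \<in> S" "X \<longlonglongrightarrow> x" and Y: "\<And>n. Y n \<in> S" "Y \<longlonglongrightarrow> y"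
    by (auto simp: closure_sequential)
  have "(\<lambda>n. X n + Y n) \<longlonglongrightarrow> x + y" by (intro tendsto_intros X Y)
  moreover have "X n + Y n \<in> S" for n using X Y by (intro subspace_add[OF assms])
  ultimately show "x + y \<in> closure S" unfolding closure_sequential by (intro exI[of _ "\<lambda>n. X n + Y n"]) simp
next
  fix c :: real and x assume "x \<in> closure S"
  then obtain X where X: "\<And>n. X n \<in> S" "X \<longlonglongrightarrow> x" by (auto simp: closure_sequential)
  have "(\<lambda>n. c *\<^sub>R X n) \<longlonglongrightarrow> c *\<^sub>R x" by (intro tendsto_intros X)
  moreover have "c *\<^sub>R X n \<in> S" for n using X by (intro subspace_scale[OF assms])
  ultimately show "c *\<^sub>R x \<in> closure S" unfolding closure_sequential by (intro exI[of _ "\<lambda>n. c *\<^sub>R X n"]) simp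
qed

text \<open>Baire: one of the closed sets \<open>C k\<close> contains a ball. The bound is needed
  for a semigroup that is only known to be bounded at each time separately.\<close>

lemma banach_steinhaus_sequence:
  fixes F :: "nat \<Rightarrow> 'a::banach \<Rightarrow> 'b::real_normed_vector"
  assumes lin: "\<And>n. bounded_linear (F n)" and bd: "\<And>x. \<exists>B. \<forall>n. norm (F n x) \<le> B"
  shows "\<exists>M. \<forall>n x. norm (F n x) \<le> M * norm x"
proof -
  define C where "C k = {x. \<forall>n. norm (F n x) \<le> real k}" for k :: nat
  have closed: "closed (C k)" for k
  proof -
    have "C k = (\<Inter>n. {x. norm (F n x) \<le> real k})" by (auto simp: C_def)
    moreover have "closed {x. norm (F n x) \<le> real k}" for n
      by (intro closed_Collect_le continuous_intros linear_continuous_on[OF lin])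
    ultimately show ?thesis by auto
  qed
  have "\<exists>k. interior (C k) \<noteq> {}"
  proof (rule ccontr)
    assume "\<not> (\<exists>k. interior (C k) \<noteq> {})"
    then have "Met_TC.mtopology interior_of \<Union> (range C) = {}"
      by (intro Met_TC.metric_Baire_category_alt) (auto simp: closed complete_UNIV)
    moreover have "x \<in> \<Union> (range C)" for x
    proof -
      obtain B where B: "\<forall>n. norm (F n x) \<le> B" using bd by blast
      obtain k :: nat where "B \<le> real k" using real_arch_simple by blast
      then have "norm (F n x) \<le> real k" for n using B order.trans[of "norm (F n x)" B "real k"] by blast
      then have "x \<in> C k" by (simp add: C_def)
      then show ?thesis by blast
    qed
    then have "\<Union> (range C) = UNIV" by blast
    ultimately show False by simp
  qed
  then obtain k x0 where "x0 \<in> interior (C k)" by blast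
  then obtain r where r: "r > 0" "ball x0 r \<subseteq> C k" by (auto simp: mem_interior)
  \<comment> \<open>\<open>x\<close> is rescaled to a vector \<open>y\<close> of norm
    \<open>r / 2\<close>. As \<open>x0\<close> and \<open>x0 + y\<close> lie in \<open>C k\<close>,
    the image of \<open>y\<close> has norm at most \<open>2 * k\<close>.\<close>
  have "norm (F n x) \<le> (4 * real k / r) * norm x" for n x
  proof (cases "x = 0")
    case True
    then show ?thesis using linear_0[OF bounded_linear.linear[OF lin[of n]]] by simp
  next
    case False
    interpret F: bounded_linear "F n" by (rule lin)
    define y where "y = (r / (2 * norm x)) *\<^sub>R x"
    have "norm y = r / 2" using False r by (simp add: y_def)
    then have "x0 + y \<in> C k" "x0 \<in> C k" using r by (auto simp: dist_norm)
    then have "norm (F n (x0 + y)) \<le> real k" "norm (F n x0) \<le> real k" by (auto simp: C_def)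
    moreover have "F n y = F n (x0 + y) - F n x0" by (simp add: F.add)
    ultimately have "norm (F n y) \<le> 2 * real k"
      using norm_triangle_ineq4[of "F n (x0 + y)" "F n x0"] by simp
    then have "r / (2 * norm x) * norm (F n x) \<le> 2 * real k" using r by (simp add: y_def F.scaleR)
    then show ?thesis using False r by (simp add: field_simps)
  qed
  then show ?thesis by blast
qed

lemma has_vector_derivativeI_quadratic:
  fixes f :: "real \<Rightarrow> 'a::real_normed_vector"
  assumes "e > 0" and q: "\<And>t. \<bar>t - r\<bar> < e \<Longrightarrow> norm (f t - f r - (t - r) *\<^sub>R d) \<le> C * (t - r)\<^sup>2"
  shows "(f has_vector_derivative d) (at r)"
  unfolding has_vector_derivative_def
proof (rule has_derivativeI_sandwich[OF \<open>e > 0\<close> bounded_linear_scaleR_left, where H="\<lambda>t. C * \<bar>t - r\<bar>"])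
  fix t assume t: "t \<noteq> r" "dist t r < e"
  have "norm (f t - f r - (t - r) *\<^sub>R d) / norm (t - r) \<le> C * (t - r)\<^sup>2 / norm (t - r)"
    using q[of t] t by (intro divide_right_mono) (auto simp: dist_real_def)
  also have "\<dots> = C * (\<bar>t - r\<bar> * \<bar>t - r\<bar>) / \<bar>t - r\<bar>" by (metis power2_abs power2_eq_square real_norm_def)
  also have "\<dots> = C * \<bar>t - r\<bar>" using t(1) by (simp del: abs_mult_self_eq)
  finally show "norm (f t - f r - (t - r) *\<^sub>R d) / norm (t - r) \<le> C * \<bar>t - r\<bar>" .
next
  show "((\<lambda>t. C * \<bar>t - r\<bar>) \<longlongrightarrow> 0) (at r)" by (auto intro!: tendsto_eq_intros)
qed

text \<open>Let \<open>s\<close> be the last time at which the bound \<open>\<phi> 0 + e * s\<close>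
  holds. If \<open>s\<close> were below \<open>\<tau>\<close>, the right difference quotient would
  carry the bound beyond \<open>s\<close>. Only right derivatives enter, because a generator is
  defined by a limit from the right.\<close>

lemma nonincreasing_if_right_derivative_nonpos:
  fixes \<phi> :: "real \<Rightarrow> real"
  assumes cont: "continuous_on {0..\<tau>} \<phi>" and "\<tau> \<ge> 0"
    and der: "\<And>t e. 0 \<le> t \<Longrightarrow> t < \<tau> \<Longrightarrow> e > 0 \<Longrightarrow> \<forall>\<^sub>F h in at_right 0. \<phi> (t + h) - \<phi> t \<le> e * h"
  shows "\<phi> \<tau> \<le> \<phi> 0"
proof -
  have le: "\<phi> \<tau> \<le> \<phi> 0 + e * \<tau>" if "e > 0" for e
  proof (rule ccontr)
    assume gt: "\<not> \<phi> \<tau> \<le> \<phi> 0 + e * \<tau>"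
    define S where "S = {t \<in> {0..\<tau>}. \<phi> t \<le> \<phi> 0 + e * t}"
    have "closed S" unfolding S_def
      by (intro continuous_on_closed_Collect_le continuous_intros cont)
    moreover have S0: "0 \<in> S" "bdd_above S" using \<open>\<tau> \<ge> 0\<close> by (auto simp: S_def intro!: bdd_aboveI[of _ \<tau>])
    ultimately have "Sup S \<in> S" by (intro closed_contains_Sup) auto
    define s where "s = Sup S"
    have s: "0 \<le> s" "s \<le> \<tau>" "\<phi> s \<le> \<phi> 0 + e * s" using \<open>Sup S \<in> S\<close> by (auto simp: S_def s_def)
    have "s \<noteq> \<tau>" using gt s by auto
    then have "s < \<tau>" using s by simp
    have "\<forall>\<^sub>F h in at_right 0. \<phi> (s + h) - \<phi> s \<le> e * h" by (rule der) (use s \<open>s < \<tau>\<close> \<open>e > 0\<close> in auto)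
    moreover have "\<forall>\<^sub>F h in at_right 0. h \<in> {0<..<\<tau> - s}"
      using \<open>s < \<tau>\<close> by (intro eventually_at_right_real) simp
    ultimately have "\<forall>\<^sub>F h in at_right 0. h \<in> {0<..<\<tau> - s} \<and> \<phi> (s + h) - \<phi> s \<le> e * h" by eventually_elim simp
    then obtain h where h: "h \<in> {0<..<\<tau> - s}" "\<phi> (s + h) - \<phi> s \<le> e * h"
      using eventually_happens'[of "at_right (0::real)"] trivial_limit_at_right_real by blast
    then have "s + h \<in> S" using s by (auto simp: S_def algebra_simps)
    then have "s + h \<le> s" using S0(2) unfolding s_def by (rule cSup_upper)
    then show False using h by simp
  qed
  show ?thesis
  proof (rule tendsto_lowerbound)
    show "((\<lambda>e. \<phi> 0 + e * \<tau>) \<longlongrightarrow> \<phi> 0) (at_right 0)" by (auto intro!: tendsto_eq_intros)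
    show "\<forall>\<^sub>F e in at_right 0. \<phi> \<tau> \<le> \<phi> 0 + e * \<tau>" using le by (auto simp: eventually_at_filter)
  qed simp
qed

text \<open>The usual density argument. The family \<open>D\<close> is uniformly bounded and
  compatible with differences, so convergence on \<open>S\<close> spreads to its closure.\<close>

lemma tendsto_zero_on_closure:
  fixes D :: "real \<Rightarrow> 'a::real_normed_vector \<Rightarrow> 'b::real_normed_vector"
  assumes diff: "\<And>t x y. t > 0 \<Longrightarrow> D t (x - y) = D t x - D t y"
    and bd: "\<And>t x. t > 0 \<Longrightarrow> norm (D t x) \<le> C * norm x"
    and S: "\<And>x. x \<in> S \<Longrightarrow> ((\<lambda>t. D t x) \<longlongrightarrow> 0) (at_right 0)" and x: "x \<in> closure S"
  shows "((\<lambda>t. D t x) \<longlongrightarrow> 0) (at_right 0)"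
proof (rule tendstoI)
  fix e :: real assume e: "e > 0"
  define K where "K = \<bar>C\<bar> + 1"
  have K: "K > 0" "C \<le> K" by (auto simp: K_def)
  obtain y where y: "y \<in> S" "dist y x < e / (2 * K)"
    using x e K closure_approachable by (metis divide_pos_pos mult_pos_pos zero_less_numeral)
  have "\<forall>\<^sub>F t in at_right 0. dist (D t y) 0 < e / 2" using tendstoD[OF S[OF y(1)], of "e / 2"] e by simp
  moreover have "\<forall>\<^sub>F t in at_right (0::real). t > 0" by (simp add: eventually_at_right_less)
  ultimately show "\<forall>\<^sub>F t in at_right 0. dist (D t x) 0 < e"
  proof eventually_elim
    case (elim t)
    have "norm (D t (x - y)) \<le> K * norm (x - y)"
      using bd[OF elim(2), of "x - y"] mult_right_mono[OF K(2), of "norm (x - y)"] by simp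
    moreover have "K * norm (x - y) < K * (e / (2 * K))"
      using y K by (intro mult_strict_left_mono) (auto simp: dist_norm norm_minus_commute)
    moreover have "K * (e / (2 * K)) = e / 2" using K by simp
    ultimately have "norm (D t x - D t y) < e / 2" using diff[OF elim(2), of x y] by simp
    then show ?case using elim(1) norm_triangle_ineq[of "D t x - D t y" "D t y"] by simp
  qed
qed

section \<open>Estimates for the symbols of the semigroup\<close>

lemma exp_neg_remainder:
  fixes x :: real
  shows "\<bar>exp (- x) - 1 + x\<bar> \<le> x\<^sup>2 * max 1 (exp (- x))"
proof (cases "x \<ge> 0")
  case True
  have "exp x \<ge> 1 + x + x\<^sup>2 / 2" using exp_lower_Taylor_quadratic[OF True] .
  moreover have p: "1 + x + x\<^sup>2 / 2 > 0" using True by (simp add: add_pos_nonneg)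
  ultimately have "exp (- x) \<le> 1 / (1 + x + x\<^sup>2 / 2)" by (simp add: exp_minus field_simps)
  also have "\<dots> \<le> 1 - x + x\<^sup>2"
  proof -
    have "(1 - x + x\<^sup>2) * (1 + x + x\<^sup>2 / 2) = 1 + x\<^sup>2 / 2 + x ^ 3 / 2 + x ^ 4 / 2"
      by (simp add: field_simps power2_eq_square power3_eq_cube power4_eq_xxxx)
    then have "(1 - x + x\<^sup>2) * (1 + x + x\<^sup>2 / 2) \<ge> 1" using True by simp
    then show ?thesis using p by (simp add: pos_divide_le_eq)
  qed
  finally have "exp (- x) - 1 + x \<le> x\<^sup>2" by simp
  moreover have "x\<^sup>2 * 1 \<le> x\<^sup>2 * max 1 (exp (- x))" by (intro mult_left_mono) auto
  ultimately show ?thesis using exp_ge_add_one_self[of "- x"] by linarith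
next
  case False
  define y where "y = - x"
  have y: "y > 0" using False by (simp add: y_def)
  have "1 - exp (- y) \<le> y" using exp_ge_add_one_self[of "- y"] by simp
  then have "exp y * (1 - exp (- y)) \<le> exp y * y" by (intro mult_left_mono) auto
  then have a: "exp y - 1 \<le> y * exp y" by (simp add: right_diff_distrib mult.commute flip: exp_add)
  have "exp y - 1 - y \<le> y * (exp y - 1)" using a by (simp add: algebra_simps) 
  also have "\<dots> \<le> y * (y * exp y)" using a y by (intro mult_left_mono) auto
  finally have "exp y - 1 - y \<le> y\<^sup>2 * exp y" by (simp add: power2_eq_square)
  moreover have "y\<^sup>2 * exp y \<le> y\<^sup>2 * max 1 (exp y)" by (intro mult_left_mono) auto
  ultimately show ?thesis using exp_ge_add_one_self[of y] by (simp add: y_def)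
qed

lemma exp_neg_diff_le:
  fixes x y :: real
  assumes "\<delta> \<le> x" "\<delta> \<le> y" "l \<ge> 0"
  shows "\<bar>exp (- (x * l)) - exp (- (y * l))\<bar> \<le> \<bar>x - y\<bar> * l * exp (- (\<delta> * l))"
proof -
  have *: "\<bar>exp (- (x * l)) - exp (- (y * l))\<bar> \<le> \<bar>x - y\<bar> * l * exp (- (\<delta> * l))" if "x \<le> y" "\<delta> \<le> x" for x y
  proof -
    have "1 - (y - x) * l \<le> exp (- ((y - x) * l))" using exp_ge_add_one_self[of "- ((y - x) * l)"] by simp
    then have "1 - exp (- ((y - x) * l)) \<le> (y - x) * l" by simp
    then have "exp (- (x * l)) * (1 - exp (- ((y - x) * l))) \<le> exp (- (\<delta> * l)) * ((y - x) * l)"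
      using that assms(3) by (intro mult_mono) (auto simp: mult_right_mono)
    moreover have "exp (- (x * l)) * (1 - exp (- ((y - x) * l))) = exp (- (x * l)) - exp (- (y * l))"
      by (simp add: right_diff_distrib left_diff_distrib flip: exp_add)
    moreover have "exp (- (y * l)) \<le> exp (- (x * l))" using that assms(3) by (simp add: mult_right_mono)
    ultimately show ?thesis using that by (simp add: mult_ac)
  qed
  show ?thesis
  proof (cases "x \<le> y")
    case True then show ?thesis using * assms by blast
  next
    case False then show ?thesis using *[of y x] assms by (simp add: abs_minus_commute)
  qed
qed

lemma exp_decay_bounds:
  fixes \<delta> l :: real
  assumes "\<delta> > 0" "l \<ge> 0"
  shows "l * exp (- (\<delta> * l)) \<le> 1 / \<delta>" "l\<^sup>2 * exp (- (\<delta> * l)) \<le> 2 / \<delta>\<^sup>2"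
proof -
  have e: "exp (\<delta> * l) \<ge> 1 + \<delta> * l + (\<delta> * l)\<^sup>2 / 2" using exp_lower_Taylor_quadratic[of "\<delta> * l"] assms by simp
  have s: "(\<delta> * l)\<^sup>2 \<ge> 0" "\<delta> * l \<ge> 0" using assms by auto
  have "exp (\<delta> * l) \<ge> \<delta> * l" "exp (\<delta> * l) \<ge> (\<delta> * l)\<^sup>2 / 2" using e s by linarith+
  then show "l * exp (- (\<delta> * l)) \<le> 1 / \<delta>" "l\<^sup>2 * exp (- (\<delta> * l)) \<le> 2 / \<delta>\<^sup>2"
    using assms by (simp_all add: exp_minus field_simps power_mult_distrib)
qed

lemma continuous_on_extend_zero:
  fixes g :: "real \<Rightarrow> real"
  assumes g: "continuous_on {0<..1} g" and le: "\<And>s. 0 < s \<Longrightarrow> s \<le> 1 \<Longrightarrow> \<bar>g s\<bar> \<le> C * s"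
  shows "continuous_on {0..1} (\<lambda>s. if s \<le> 0 then 0 else g s)" (is "continuous_on _ ?f")
  unfolding continuous_on_eq_continuous_within
proof
  fix x :: real assume x: "x \<in> {0..1}"
  show "continuous (at x within {0..1}) ?f"
  proof (cases "x = 0")
    case True
    have "(?f \<longlongrightarrow> 0) (at 0 within {0..1})"
    proof (rule Lim_null_comparison)
      show "\<forall>\<^sub>F s in at 0 within {0..1}. norm (?f s) \<le> C * s"
        using le by (auto simp: eventually_at_filter)
      show "((\<lambda>s. C * s) \<longlongrightarrow> 0) (at 0 within {0..1})" by (auto intro!: tendsto_eq_intros)
    qed
    then show ?thesis using True by (simp add: continuous_within)
  next
    case False
    then have x0: "x > 0" using x by simp
    have "continuous_on {0<..1} ?f" by (rule continuous_on_eq[OF g]) auto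
    then have "continuous (at x within {0<..1}) ?f" using x x0 by (simp add: continuous_on_eq_continuous_within)
    moreover have "at x within {0<..1} = at x within {0..1}"
      by (rule at_within_nhd[of x "{0<..}"]) (use x0 in auto)
    ultimately show ?thesis by simp
  qed
qed

text \<open>If \<open>s\<close> stands for J = (1 + L)^(-1), then \<open>l = 1 / s - 1\<close>
  stands for L. So this is e^(-tl), and \<open>heat_symbol1\<close> is (1 + l) e^(-tl). The point
  \<open>s = 0\<close> corresponds to \<open>l\<close> = \<infinity>, where both vanish; for
  \<open>t > 0\<close> they are continuous there.\<close>

definition heat_symbol :: "real \<Rightarrow> real \<Rightarrow> real" where
  "heat_symbol t s = (if s \<le> 0 then 0 else exp (- (t * (1 / s - 1))))"

definition heat_symbol1 :: "real \<Rightarrow> real \<Rightarrow> real" where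
  "heat_symbol1 t s = (if s \<le> 0 then 0 else exp (- (t * (1 / s - 1))) / s)"

lemma heat_symbol1_le:
  fixes t s :: real
  assumes "t > 0" "0 < s"  "s \<le> 1"
  shows "\<bar>exp (- (t * (1 / s - 1))) / s\<bar> \<le> 2 * exp t / t\<^sup>2 * s"
proof -
  have "(1/s)\<^sup>2 * exp (- (t * (1/s))) \<le> 2 / t\<^sup>2" using assms by (intro exp_decay_bounds) auto
  then have "s * exp t * ((1/s)\<^sup>2 * exp (- (t * (1/s)))) \<le> s * exp t * (2 / t\<^sup>2)" using assms by (intro mult_left_mono) auto
  moreover have "s * exp t * ((1/s)\<^sup>2 * exp (- (t * (1/s)))) = exp (- (t * (1 / s - 1))) / s"
  proof -
    have "exp (- (t * (1 / s - 1))) = exp t * exp (- (t * (1/s)))" unfolding exp_add[symmetric] by (simp add: algebra_simps)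
    then show ?thesis using assms by (simp add: power2_eq_square)
  qed
  ultimately show ?thesis using assms by (simp add: mult_ac)
qed

lemma continuous_heat_symbol1: "t > 0 \<Longrightarrow> continuous_on {0..1} (heat_symbol1 t)"
  unfolding heat_symbol1_def
  by (rule continuous_on_extend_zero[OF _ heat_symbol1_le]) (auto intro!: continuous_intros)

lemma continuous_heat_symbol:
  assumes "t > 0" shows "continuous_on {0..1} (heat_symbol t)"
proof -
  have "heat_symbol t = (\<lambda>s. s * heat_symbol1 t s)" by (auto simp: heat_symbol_def heat_symbol1_def)
  then show ?thesis using continuous_heat_symbol1[OF assms] by (auto intro!: continuous_intros)
qed

lemma heat_symbol_bounds: "0 \<le> s \<Longrightarrow> s \<le> 1 \<Longrightarrow> t \<ge> 0 \<Longrightarrow> \<bar>heat_symbol t s\<bar> \<le> 1"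
  by (auto simp: heat_symbol_def)

lemma heat_symbol_add: "heat_symbol (t + r) s = heat_symbol t s * heat_symbol r s"
  by (auto simp: heat_symbol_def distrib_right simp flip: exp_add)

text \<open>The \<open>t\<close>-derivative is of size (l + l^2) e^(-tl), bounded uniformly in
  \<open>l\<close> once \<open>t\<close> stays above \<delta>. Later this gives the Lipschitz
  continuity of the gradient in time, and from it a jointly measurable version.\<close>

lemma heat_symbol1_Lipschitz:
  assumes "0 < \<delta>" "\<delta> \<le> t" "\<delta> \<le> r" "s \<in> {0..1}"
  shows "\<bar>heat_symbol1 t s - heat_symbol1 r s\<bar> \<le> (1 / \<delta> + 2 / \<delta>\<^sup>2) * \<bar>t - r\<bar>"
proof (cases "s = 0")
  case True
  then show ?thesis using assms by (simp add: heat_symbol1_def)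
next
  case False
  then have s: "0 < s" "s \<le> 1" using assms by auto
  define l where "l = 1 / s - 1"
  have l: "l \<ge> 0" "1 / s = 1 + l" using s by (auto simp: l_def)
  have "heat_symbol1 t s - heat_symbol1 r s = (1 + l) * (exp (- (t * l)) - exp (- (r * l)))"
    using s l(2) unfolding heat_symbol1_def l_def[symmetric] by (simp add: divide_inverse right_diff_distrib mult.commute)
  then have "\<bar>heat_symbol1 t s - heat_symbol1 r s\<bar> = (1 + l) * \<bar>exp (- (t * l)) - exp (- (r * l))\<bar>"
    using l by (simp add: abs_mult)
  also have "\<dots> \<le> (1 + l) * (\<bar>t - r\<bar> * l * exp (- (\<delta> * l)))"
    using l assms by (intro mult_left_mono exp_neg_diff_le) auto
  also have "\<dots> = \<bar>t - r\<bar> * (l * exp (- (\<delta> * l)) + l\<^sup>2 * exp (- (\<delta> * l)))" by (simp add: algebra_simps power2_eq_square)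
  also have "\<dots> \<le> \<bar>t - r\<bar> * (1 / \<delta> + 2 / \<delta>\<^sup>2)"
    using assms l by (intro mult_left_mono add_mono exp_decay_bounds) auto
  finally show ?thesis by (simp add: mult.commute)
qed

text \<open>The derivative -l e^(-rl) of the symbol is written e^(-rl) - (1 + l) e^(-rl), that is
  \<open>heat_symbol r s - heat_symbol1 r s\<close>, to avoid the unbounded symbol
  \<open>l\<close>.\<close>

lemma heat_symbol_derivative:
  assumes "0 < \<delta>" "\<delta> \<le> t" "\<delta> \<le> r" "s \<in> {0..1}"
  shows "\<bar>heat_symbol t s - heat_symbol r s - (t - r) * (heat_symbol r s - heat_symbol1 r s)\<bar> \<le> 2 / \<delta>\<^sup>2 * (t - r)\<^sup>2"
proof (cases "s = 0")
  case True
  then show ?thesis using assms by (simp add: heat_symbol1_def heat_symbol_def)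
next
  case False
  then have s: "0 < s" "s \<le> 1" using assms by auto
  define l where "l = 1 / s - 1"
  have l: "l \<ge> 0" "1 / s = 1 + l" using s by (auto simp: l_def)
  define x where "x = (t - r) * l"
  have h1: "heat_symbol1 r s = (1 + l) * exp (- (r * l))"
    using s l(2) unfolding heat_symbol1_def l_def[symmetric] by (simp add: divide_inverse mult.commute)
  have tx: "exp (- (t * l)) = exp (- (r * l)) * exp (- x)" unfolding exp_add[symmetric] by (simp add: x_def algebra_simps)
  have "heat_symbol t s - heat_symbol r s - (t - r) * (heat_symbol r s - heat_symbol1 r s)
     = exp (- (r * l)) * (exp (- x) - 1 + x)"
  proof -
    have "E * X - E - (t - r) * (E - (1 + l) * E) = E * (X - 1 + (t - r) * l)" for E X :: real by (simp add: algebra_simps)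
    then show ?thesis using s unfolding h1 heat_symbol_def l_def[symmetric] x_def[symmetric] by (simp add: tx)
  qed
  then have "\<bar>heat_symbol t s - heat_symbol r s - (t - r) * (heat_symbol r s - heat_symbol1 r s)\<bar>
     = exp (- (r * l)) * \<bar>exp (- x) - 1 + x\<bar>" by (simp add: abs_mult)
  \<comment> \<open>Here \<open>x\<close> is negative when \<open>t < r\<close>, which explains the
    maximum in the remainder. Multiplied by \<open>exp (- (r * l))\<close> it becomes the larger of
    the two exponentials at \<open>r\<close> and \<open>t\<close>, both below
    \<open>exp (- (\<delta> * l))\<close>.\<close>
  also have "\<dots> \<le> exp (- (r * l)) * (x\<^sup>2 * max 1 (exp (- x)))" by (intro mult_left_mono exp_neg_remainder) auto
  also have "\<dots> = x\<^sup>2 * max (exp (- (r * l))) (exp (- (t * l)))" by (simp add: tx max_def)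
  also have "\<dots> \<le> x\<^sup>2 * exp (- (\<delta> * l))" using assms l by (intro mult_left_mono) (auto simp: mult_right_mono)
  also have "\<dots> = (t - r)\<^sup>2 * (l\<^sup>2 * exp (- (\<delta> * l)))" by (simp add: x_def power_mult_distrib)
  also have "\<dots> \<le> (t - r)\<^sup>2 * (2 / \<delta>\<^sup>2)" using assms l by (intro mult_left_mono exp_decay_bounds) auto
  finally show ?thesis by (simp add: mult.commute)
qed

text \<open>One factor \<open>s\<close> tames the unbounded \<open>l\<close>: from 1 - e^(-tl) \<le>
  tl and \<open>s * l = 1 - s\<close> the rate \<open>t\<close> results. This is strong continuity
  on the range of J.\<close>

lemma heat_symbol_strong: 
  assumes "t > 0" "s \<in> {0..1}" shows "\<bar>heat_symbol t s * s - s\<bar> \<le> t"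
proof (cases "s = 0")
  case False
  then have s: "0 < s" "s \<le> 1" using assms by auto
  define l where "l = 1 / s - 1"
  have l: "l \<ge> 0" using s by (auto simp: l_def)
  have "1 - exp (- (t * l)) \<le> t * l" using exp_ge_add_one_self[of "- (t * l)"] by linarith
  then have "s * (1 - exp (- (t * l))) \<le> s * (t * l)" using s by (intro mult_left_mono) auto
  also have "s * (t * l) = t * (1 - s)" using s by (simp add: l_def field_simps)
  also have "\<dots> \<le> t" using s assms by (simp add: mult_le_cancel_left1)
  moreover have "s * (1 - exp (- (t * l))) \<ge> 0" using s l assms by simp
  moreover have "heat_symbol t s * s - s = - (s * (1 - exp (- (t * l))))" using s by (simp add: heat_symbol_def l_def algebra_simps)
  ultimately show ?thesis by linarith
qed (use assms in \<open>simp add: heat_symbol_def\<close>)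

text \<open>\<open>s\<^sup>2 - s\<close> equals \<open>- l * s\<^sup>2\<close>, the symbol of -L
  J^2. Two factors \<open>s\<close> are needed to tame the \<open>l\<^sup>2\<close> in the
  second-order remainder.\<close>

lemma heat_symbol_generator: 
  assumes "t > 0" "s \<in> {0..1}" shows "\<bar>heat_symbol t s * s\<^sup>2 - s\<^sup>2 - t * (s\<^sup>2 - s)\<bar> \<le> t\<^sup>2"
proof (cases "s = 0")
  case False
  then have s: "0 < s" "s \<le> 1" using assms by auto
  define l where "l = 1 / s - 1"
  have l: "l \<ge> 0" "s * l = 1 - s" using s by (auto simp: l_def field_simps)
  define x where "x = t * l"
  have x: "x \<ge> 0" using l assms by (simp add: x_def)
  have "heat_symbol t s * s\<^sup>2 - s\<^sup>2 - t * (s\<^sup>2 - s) = s\<^sup>2 * (exp (- x) - 1) + t * (s * (s * l))"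
    using s unfolding l(2) by (simp add: heat_symbol_def l_def x_def algebra_simps power2_eq_square)
  also have "\<dots> = s\<^sup>2 * (exp (- x) - 1 + x)" by (simp add: x_def algebra_simps power2_eq_square)
  finally have "\<bar>heat_symbol t s * s\<^sup>2 - s\<^sup>2 - t * (s\<^sup>2 - s)\<bar> = s\<^sup>2 * \<bar>exp (- x) - 1 + x\<bar>" by (simp add: abs_mult)
  also have "\<dots> \<le> s\<^sup>2 * (x\<^sup>2 * max 1 (exp (- x)))" by (intro mult_left_mono exp_neg_remainder) auto
  also have "\<dots> = t\<^sup>2 * (s * l)\<^sup>2" using x by (simp add: max_def x_def power_mult_distrib mult_ac)
  also have "\<dots> \<le> t\<^sup>2 * 1" using s unfolding l(2) by (intro mult_left_mono) (auto simp: power_le_one)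
  finally show ?thesis by simp
qed (use assms in \<open>simp add: heat_symbol_def\<close>)

text \<open>An element of \<open>V\<close> is meant as a pair of a function and its gradient, so
  that closedness of the form is closedness of a set. Since \<open>b\<close> controls the gradient
  alone, the inner product of the first components has to be added for coercivity; this is why 1 + L
  appears below rather than L.\<close>

locale energy_form =
  fixes V :: "('h::{real_inner,banach} \<times> 'k::{real_inner,banach}) set"
    and b :: "'k \<Rightarrow> 'k \<Rightarrow> real" and \<nu> :: real
  assumes V_closed: "closed V" and V_subspace: "subspace V" and b_bilinear: "bounded_bilinear b"
    and b_sym: "b g g' = b g' g" and \<nu>_pos: "\<nu> > 0" and b_coercive: "b g g \<ge> \<nu> * (norm g)\<^sup>2"
begin

sublocale b: bounded_bilinear b by (rule b_bilinear)

definition Q :: "'h \<times> 'k \<Rightarrow> 'h \<times> 'k \<Rightarrow> real" where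
  "Q w v = inner (fst w) (fst v) + b (snd w) (snd v)"

lemma Q_bilinear: "bounded_bilinear Q"
  unfolding Q_def
  by (intro bounded_bilinear_add bounded_bilinear.comp[OF bounded_bilinear_inner]
      bounded_bilinear.comp[OF b_bilinear] bounded_linear_fst bounded_linear_snd)

sublocale Q: bounded_bilinear Q by (rule Q_bilinear)

lemma Q_sym: "Q w v = Q v w" by (simp add: Q_def inner_commute b_sym)

lemma Q_coercive: "Q w w \<ge> min 1 \<nu> * (norm w)\<^sup>2"
proof -
  have "(norm w)\<^sup>2 = (norm (fst w))\<^sup>2 + (norm (snd w))\<^sup>2" by (simp add: norm_prod_def)
  then have "min 1 \<nu> * (norm w)\<^sup>2 = min 1 \<nu> * (norm (fst w))\<^sup>2 + min 1 \<nu> * (norm (snd w))\<^sup>2"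
    by (simp add: distrib_left)
  also have "\<dots> \<le> 1 * (norm (fst w))\<^sup>2 + \<nu> * (norm (snd w))\<^sup>2" by (intro add_mono mult_right_mono) auto
  also have "\<dots> \<le> Q w w" using b_coercive[of "snd w"] by (simp add: Q_def dot_square_norm)
  finally show ?thesis .
qed

lemma Q_zero: "Q w w \<le> 0 \<Longrightarrow> w = 0"
proof -
  assume "Q w w \<le> 0"
  then have "min 1 \<nu> * (norm w)\<^sup>2 \<le> 0" using Q_coercive[of w] by linarith
  then show "w = 0" using \<nu>_pos by (simp add: mult_le_0_iff min_def split: if_splits)
qed

text \<open>The resolvent (1 + L)^(-1) f together with its gradient. Keeping the second component
  makes the gradient of the semigroup available as a bounded image of its argument.\<close>

definition R :: "'h \<Rightarrow> 'h \<times> 'k" where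
  "R f = (SOME w. w \<in> V \<and> (\<forall>v\<in>V. Q w v = inner f (fst v)))"

lemma R: "R f \<in> V" "v \<in> V \<Longrightarrow> Q (R f) v = inner f (fst v)"
proof -
  have l: "bounded_linear (\<lambda>v. inner f (fst v))"
    by (rule bounded_linear_compose[OF bounded_linear_inner_right bounded_linear_fst])
  have "\<exists>w. w \<in> V \<and> (\<forall>v\<in>V. Q w v = inner f (fst v))"
  proof (rule symmetric_lax_milgram[OF V_closed V_subspace Q_bilinear])
    show "Q x y = Q y x" for x y by (rule Q_sym)
    show "0 < min 1 \<nu>" using \<nu>_pos by simp
    show "bounded_linear (\<lambda>v::'h \<times> 'k. inner f (fst v))" by (rule l)
    show "min 1 \<nu> * (norm v)\<^sup>2 \<le> Q v v" for v by (rule Q_coercive)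
  qed blast
  from someI_ex[OF this] show "R f \<in> V" "v \<in> V \<Longrightarrow> Q (R f) v = inner f (fst v)"
    by (auto simp: R_def)
qed

lemma R_unique:
  assumes "w \<in> V" "\<And>v. v \<in> V \<Longrightarrow> Q w v = inner f (fst v)"
  shows "R f = w"
proof -
  have d: "R f - w \<in> V" by (intro subspace_diff[OF V_subspace] R assms)
  have "Q (R f - w) (R f - w) = 0" using R(2)[OF d] assms(2)[OF d] by (simp add: Q.diff_left)
  then show ?thesis using Q_zero[of "R f - w"] by simp
qed

lemma R_bounded_linear: "bounded_linear R"
proof (rule bounded_linear_intro)
  show "R (x + y) = R x + R y" for x y
    by (rule R_unique) (auto simp: R subspace_add[OF V_subspace] Q.add_left inner_add_left)
  show "R (r *\<^sub>R x) = r *\<^sub>R R x" for r x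
    by (rule R_unique) (auto simp: R subspace_scale[OF V_subspace] Q.scaleR_left)
  show "norm (R x) \<le> norm x * (1 / min 1 \<nu>)" for x
  proof -
    have "min 1 \<nu> * (norm (R x))\<^sup>2 \<le> inner x (fst (R x))" using Q_coercive[of "R x"] R(2)[OF R(1), of x x] by simp
    also have "\<dots> \<le> norm x * norm (fst (R x))" by (rule norm_cauchy_schwarz)
    also have "\<dots> \<le> norm x * norm (R x)" using norm_fst_le[of "fst (R x)" "snd (R x)"] by (intro mult_left_mono) simp_all
    finally have "norm (R x) * (min 1 \<nu> * norm (R x)) \<le> norm (R x) * norm x" by (simp add: power2_eq_square mult_ac)
    then have "min 1 \<nu> * norm (R x) \<le> norm x" by (cases "norm (R x) = 0") (auto simp: mult_le_cancel_left)
    then show ?thesis using \<nu>_pos by (simp add: field_simps)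
  qed
qed

sublocale R: bounded_linear R by (rule R_bounded_linear)

definition J :: "'h \<Rightarrow> 'h" where "J f = fst (R f)"

sublocale positive_contraction J
proof (rule positive_contraction.intro)
  show "bounded_linear J" unfolding J_def by (rule bounded_linear_compose[OF bounded_linear_fst R_bounded_linear])
  show "inner (J x) y = inner x (J y)" for x y
    using R(2)[OF R(1), of y x] R(2)[OF R(1), of x y] Q_sym[of "R x" "R y"] by (simp add: J_def inner_commute)
  show "(norm (J x))\<^sup>2 \<le> inner (J x) x" for x
  proof -
    have "inner x (J x) = Q (R x) (R x)" using R(2)[OF R(1), of x x] by (simp add: J_def)
    moreover have "b (snd (R x)) (snd (R x)) \<ge> 0"
      using b_coercive[of "snd (R x)"] \<nu>_pos by (smt (verit) mult_nonneg_nonneg zero_le_power2)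
    ultimately show ?thesis by (simp add: Q_def J_def dot_square_norm inner_commute)
  qed
qed

text \<open>The form domain need not be dense in the ambient space. This is the subspace in which L
  is densely defined; J vanishes on its orthogonal complement.\<close>

definition H0 :: "'h set" where "H0 = closure (fst ` V)"

lemma H0_subspace: "subspace H0" and H0_closed: "closed H0"
proof -
  have "subspace (fst ` V)" by (rule linear_subspace_image[OF _ V_subspace]) (simp add: bounded_linear.linear bounded_linear_fst)
  then show "subspace H0" unfolding H0_def by (rule closure_subspace)
qed (simp add: H0_def)

lemma V_H0: "v \<in> V \<Longrightarrow> fst v \<in> H0" unfolding H0_def by (intro closure_subset[THEN subsetD] imageI)

lemma J_H0: "J f \<in> H0" unfolding J_def by (intro V_H0 R)

lemma J_inj: 
  assumes "g \<in> H0" "J g = 0" shows "g = 0"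
proof -
  have "Q (R g) (R g) = 0" using R(2)[OF R(1), of g g] assms(2) by (simp add: J_def)
  then have "R g = 0" using Q_zero by simp
  then have "inner g (fst v) = 0" if "v \<in> V" for v using R(2)[OF that, of g] by (simp add: Q.zero_left)
  then have "fst ` V \<subseteq> {x. inner g x = 0}" by auto
  moreover have "closed {x. inner g x = 0}" by (intro closed_Collect_eq continuous_intros)
  ultimately have "H0 \<subseteq> {x. inner g x = 0}" unfolding H0_def by (rule closure_minimal)
  then show ?thesis using assms(1) by auto
qed

text \<open>Whatever part of \<open>f\<close> is orthogonal to the range of J is annihilated by J,
  by symmetry, and J is injective on \<open>H0\<close>.\<close>

lemma H0_closure_range_J: "H0 = closure (range J)"
proof
  define W where "W = closure (range J)"
  have Wc: "closed W" by (simp add: W_def)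
  have Ws: "subspace W" unfolding W_def
    by (intro closure_subspace linear_subspace_image[OF J.linear subspace_UNIV])
  have WH: "W \<subseteq> H0" unfolding W_def by (rule closure_minimal) (auto simp: J_H0 H0_closed)
  then show "closure (range J) \<subseteq> H0" by (simp add: W_def)
  show "H0 \<subseteq> closure (range J)"
  proof
    fix f assume f: "f \<in> H0"
    obtain w where w: "w \<in> W" "\<And>v. v \<in> W \<Longrightarrow> inner w v = inner f v"
      by (rule symmetric_lax_milgram[OF Wc Ws bounded_bilinear_inner inner_commute, of 1 "inner f"])
         (auto simp: dot_square_norm bounded_linear_inner_right)
    define g where "g = f - w"
    have g: "g \<in> H0" using f w WH H0_subspace by (auto simp: g_def intro!: subspace_diff)
    have orth: "inner g v = 0" if "v \<in> W" for v using w(2)[OF that] by (simp add: g_def inner_diff_left)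
    have "J v \<in> W" for v unfolding W_def using closure_subset[of "range J"] by blast
    then have "inner g (J v) = 0" for v using orth by blast
    then have "inner (J g) (J g) = 0" by (simp add: J_sym)
    then have "g = 0" using J_inj[OF g] by simp
    then show "f \<in> closure (range J)" using w(1) by (simp add: g_def W_def)
  qed
qed

text \<open>With \<open>J = (1 + L)\<^sup>-\<^sup>1\<close> one has \<open>T t = e\<^sup>-\<^sup>t\<^sup>L\<close> and \<open>W t = (1 + L) e\<^sup>-\<^sup>t\<^sup>L\<close>.\<close>

definition T :: "real \<Rightarrow> 'h \<Rightarrow> 'h" where "T t f = (if t \<le> 0 then f else fc (heat_symbol t) f)"

definition W :: "real \<Rightarrow> 'h \<Rightarrow> 'h" where "W t f = fc (heat_symbol1 t) f"

lemma T_0 [simp]: "T 0 f = f" by (simp add: T_def)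

lemma T_pos: "t > 0 \<Longrightarrow> T t f = fc (heat_symbol t) f" by (simp add: T_def)

lemma T_bounded_linear: "bounded_linear (T t)"
  by (cases "t \<le> 0") (auto simp: T_def[abs_def] fc_bounded_linear continuous_heat_symbol bounded_linear_ident)

lemma T_norm_le: "norm (T t f) \<le> norm f"
proof (cases "t \<le> 0")
  case False
  have "norm (fc (heat_symbol t) f) \<le> 1 * norm f"
    by (rule norm_fc_le) (use False in \<open>auto intro!: continuous_heat_symbol heat_symbol_bounds\<close>)
  then show ?thesis using False by (simp add: T_def)
qed (simp add: T_def)

lemma T_sym: "inner (T t f) g = inner f (T t g)"
  by (cases "t \<le> 0") (auto simp: T_def fc_sym continuous_heat_symbol)

lemma T_add:
  assumes "t \<ge> 0" "r \<ge> 0" shows "T (t + r) f = T t (T r f)"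
proof (cases "t = 0 \<or> r = 0")
  case False
  then have p: "t > 0" "r > 0" using assms by auto
  then have "T (t + r) f = fc (\<lambda>s. heat_symbol t s * heat_symbol r s) f" by (simp add: T_pos heat_symbol_add[abs_def])
  also have "\<dots> = T t (T r f)" using p by (simp add: T_pos fc_mult continuous_heat_symbol)
  finally show ?thesis .
qed auto

lemma fc_X: "fc (\<lambda>s. s) f = J f"
  by (subst fc_poly[where p="[:0,1:]"]) (auto simp: pop_X)

lemma J_W: "t > 0 \<Longrightarrow> J (W t f) = T t f"
proof -
  assume t: "t > 0"
  have "J (W t f) = fc (\<lambda>s. s * heat_symbol1 t s) f"
    unfolding W_def using fc_mult[OF continuous_on_id continuous_heat_symbol1[OF t]] by (simp add: fc_X)
  also have "(\<lambda>s. s * heat_symbol1 t s) = heat_symbol t" by (auto simp: heat_symbol_def heat_symbol1_def)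
  finally show ?thesis using t by (simp add: T_pos)
qed

lemma T_H0: "t > 0 \<Longrightarrow> T t f \<in> H0" using J_H0 J_W by metis

lemma T_H0': "f \<in> H0 \<Longrightarrow> T t f \<in> H0" using T_H0 by (cases "t > 0") (auto simp: T_def)

lemma T_J: "T t (J f) = J (T t f)"
proof (cases "t > 0")
  case True
  have "fc (heat_symbol t) (fc (\<lambda>s. s) f) = fc (\<lambda>s. heat_symbol t s * s) f"
    using True by (intro fc_mult[symmetric] continuous_heat_symbol continuous_on_id)
  also have "\<dots> = fc (\<lambda>s. s * heat_symbol t s) f" by (simp add: mult.commute)
  also have "\<dots> = fc (\<lambda>s. s) (fc (heat_symbol t) f)"
    using True by (intro fc_mult continuous_heat_symbol continuous_on_id)
  finally show ?thesis using True by (simp add: T_pos fc_X)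
qed (simp add: T_def)

lemma W_Lipschitz:
  assumes "0 < \<delta>" "\<delta> \<le> t" "\<delta> \<le> r"
  shows "norm (W t f - W r f) \<le> (1 / \<delta> + 2 / \<delta>\<^sup>2) * \<bar>t - r\<bar> * norm f"
proof -
  have c: "continuous_on {0..1} (heat_symbol1 t)" "continuous_on {0..1} (heat_symbol1 r)"
    using assms by (auto intro!: continuous_heat_symbol1)
  have "W t f - W r f = fc (\<lambda>s. 1 * heat_symbol1 t s + (-1) * heat_symbol1 r s) f"
    unfolding W_def fc_linear_comb[OF c] by simp
  also have "norm \<dots> \<le> ((1 / \<delta> + 2 / \<delta>\<^sup>2) * \<bar>t - r\<bar>) * norm f"
    using heat_symbol1_Lipschitz[OF assms] by (intro norm_fc_le continuous_intros c) auto
  finally show ?thesis .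
qed

text \<open>\<open>T r f - W r f\<close> is -L e^(-rL) f. The neighbourhood of radius
  \<open>r / 2\<close> keeps all times above a positive \<delta>, as the symbol estimates degenerate
  at 0.\<close>

lemma T_has_vector_derivative:
  assumes "r > 0" shows "((\<lambda>t. T t f) has_vector_derivative (T r f - W r f)) (at r)"
proof (rule has_vector_derivativeI_quadratic[where e="r/2" and C="2 / (r/2)\<^sup>2 * norm f"])
  fix t assume "\<bar>t - r\<bar> < r / 2"
  then have t: "r/2 \<le> t" "t > 0" using abs_less_iff[of "t - r" "r/2"] assms by (auto simp: field_simps)
  have c: "continuous_on {0..1} (heat_symbol t)" "continuous_on {0..1} (heat_symbol r)" "continuous_on {0..1} (heat_symbol1 r)"
    using assms t by (auto intro!: continuous_heat_symbol1 continuous_heat_symbol)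
  have c2: "continuous_on {0..1} (\<lambda>s. 1 * heat_symbol t s + (-1) * heat_symbol r s)"
    "continuous_on {0..1} (\<lambda>s. 1 * heat_symbol r s + (-1) * heat_symbol1 r s)" by (intro continuous_intros c)+
  have "T t f - T r f - (t - r) *\<^sub>R (T r f - W r f) =
     fc (\<lambda>s. 1 * (1 * heat_symbol t s + (-1) * heat_symbol r s) + (- (t - r)) * (1 * heat_symbol r s + (-1) * heat_symbol1 r s)) f"
    unfolding fc_linear_comb[OF c2] fc_linear_comb[OF c(1,2)] fc_linear_comb[OF c(2,3)] 
    using assms t by (simp add: T_pos W_def algebra_simps)
  also have "norm \<dots> \<le> (2 / (r/2)\<^sup>2 * (t - r)\<^sup>2) * norm f"
  proof (rule norm_fc_le)
    fix s :: real assume "s \<in> {0..1}"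
    from heat_symbol_derivative[of "r/2" t r s, OF _ _ _ this]
    show "\<bar>1 * (1 * heat_symbol t s + (-1) * heat_symbol r s) + (- (t - r)) * (1 * heat_symbol r s + (-1) * heat_symbol1 r s)\<bar>
      \<le> 2 / (r/2)\<^sup>2 * (t - r)\<^sup>2" using assms t by (simp add: algebra_simps)
  qed (intro continuous_intros c2)
  finally show "norm (T t f - T r f - (t - r) *\<^sub>R (T r f - W r f)) \<le> 2 / (r/2)\<^sup>2 * norm f * (t - r)\<^sup>2"
    by (simp add: mult_ac)
qed (use assms in simp)

lemma T_diff: "T t (x - y) = T t x - T t y"
  using linear_diff[OF bounded_linear.linear[OF T_bounded_linear]] .

lemma T_strong:
  assumes "f \<in> H0" shows "((\<lambda>t. T t f) \<longlongrightarrow> f) (at_right 0)"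
proof -
  have "((\<lambda>t. T t f - f) \<longlongrightarrow> 0) (at_right 0)"
  proof (rule tendsto_zero_on_closure[where S="range J" and C=2 and D="\<lambda>t x. T t x - x"])
    show "norm (T t x - x) \<le> 2 * norm x" if "t > 0" for t x
      using norm_triangle_ineq4[of "T t x" x] T_norm_le[of t x] by simp
    show "f \<in> closure (range J)" using assms by (simp add: H0_closure_range_J)
    fix x assume "x \<in> range J"
    then obtain g where g: "x = J g" by blast
    have le: "norm (T t x - x) \<le> t * norm g" if t: "t > 0" for t
    proof -
      have c: "continuous_on {0..1} (\<lambda>s. heat_symbol t s * s)" "continuous_on {0..1} (\<lambda>s::real. s)"
        by (intro continuous_intros continuous_heat_symbol t)+
      have "T t x - x = fc (\<lambda>s. 1 * (heat_symbol t s * s) + (-1) * s) g"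
        unfolding fc_linear_comb[OF c] fc_mult[OF continuous_heat_symbol[OF t] c(2)] using t by (simp add: g T_pos fc_X)
      also have "norm \<dots> \<le> t * norm g"
        using heat_symbol_strong[OF t] by (intro norm_fc_le continuous_intros c) auto
      finally show ?thesis .
    qed
    have lim: "((\<lambda>t. t * norm g) \<longlongrightarrow> 0) (at_right 0)" by (auto intro!: tendsto_eq_intros)
    have "\<forall>\<^sub>F t in at_right 0. norm (T t x - x) \<le> t * norm g" using le by (auto simp: eventually_at_filter)
    then show "((\<lambda>t. T t x - x) \<longlongrightarrow> 0) (at_right 0)" by (rule Lim_null_comparison[OF _ lim])
  qed (simp add: T_diff)
  then show ?thesis by (simp add: LIM_zero_iff)
qed

text \<open>The limit is -L J f, because L J = 1 - J. For \<open>f\<close> in the range of J the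
  symbol estimate gives a rate; the difference quotients at \<open>J f\<close> are bounded by the
  norm of \<open>f\<close>, so the limit extends to the closure.\<close>

lemma T_J_right_derivative:
  assumes f: "f \<in> H0"
  shows "((\<lambda>t. (1 / t) *\<^sub>R (T t (J f) - J f)) \<longlongrightarrow> J f - f) (at_right 0)"
  proof -
    have "((\<lambda>t. (1 / t) *\<^sub>R (T t (J f) - J f) - (J f - f)) \<longlongrightarrow> 0) (at_right 0)"
    proof (rule tendsto_zero_on_closure[where S="range J" and C=3 and D="\<lambda>t f. (1 / t) *\<^sub>R (T t (J f) - J f) - (J f - f)"])
      show "f \<in> closure (range J)" using f by (simp add: H0_closure_range_J)
      show "norm ((1 / t) *\<^sub>R (T t (J x) - J x) - (J x - x)) \<le> 3 * norm x" if t: "t > 0" for t x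
      proof -
        have c: "continuous_on {0..1} (\<lambda>s. heat_symbol t s * s)" "continuous_on {0..1} (\<lambda>s::real. s)"
          by (intro continuous_intros continuous_heat_symbol t)+
        have "T t (J x) - J x = fc (\<lambda>s. 1 * (heat_symbol t s * s) + (-1) * s) x"
          unfolding fc_linear_comb[OF c] fc_mult[OF continuous_heat_symbol[OF t] c(2)] using t by (simp add: T_pos fc_X)
        also have "norm \<dots> \<le> t * norm x"
          using heat_symbol_strong[OF t] by (intro norm_fc_le continuous_intros c) auto
        finally have le: "norm (T t (J x) - J x) \<le> t * norm x" .
        have "norm ((1 / t) *\<^sub>R v) \<le> norm x" if "norm v \<le> t * norm x" for v :: 'h using that t by (simp add: field_simps)
        from this[OF le] have "norm ((1 / t) *\<^sub>R (T t (J x) - J x)) \<le> norm x" .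
        moreover have "norm (J x - x) \<le> 2 * norm x" using norm_triangle_ineq4[of "J x" x] norm_J_le[of x] by simp
        ultimately show ?thesis using norm_triangle_ineq4[of "(1 / t) *\<^sub>R (T t (J x) - J x)" "J x - x"] by linarith
      qed
      fix x assume "x \<in> range J"
      then obtain g where g: "x = J g" by blast
      have le: "norm ((1 / t) *\<^sub>R (T t (J x) - J x) - (J x - x)) \<le> t * norm g" if t: "t > 0" for t
      proof -
        have c: "continuous_on {0..1} (\<lambda>s. heat_symbol t s * s\<^sup>2)" "continuous_on {0..1} (\<lambda>s::real. s)" "continuous_on {0..1} (\<lambda>s::real. s\<^sup>2)"
          by (intro continuous_intros continuous_heat_symbol t)+
        have c2: "continuous_on {0..1} (\<lambda>s. 1 * (heat_symbol t s * s\<^sup>2) + (-1) * s\<^sup>2)"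
          "continuous_on {0..1} (\<lambda>s::real. 1 * s\<^sup>2 + (-1) * s)" by (intro continuous_intros c)+
        have JJ: "fc power2 g = J (J g)"
          using fc_mult[OF continuous_on_id continuous_on_id] by (simp add: fc_X power2_eq_square[abs_def])
        have "T t (J x) - J x - t *\<^sub>R (J x - x)
          = fc (\<lambda>s. 1 * (1 * (heat_symbol t s * s\<^sup>2) + (-1) * s\<^sup>2) + (- t) * (1 * s\<^sup>2 + (-1) * s)) g"
          unfolding fc_linear_comb[OF c2] fc_linear_comb[OF c(1,3)] fc_linear_comb[OF c(3,2)]
            fc_mult[OF continuous_heat_symbol[OF t] c(3)]
          using t by (simp add: g T_pos fc_X JJ algebra_simps)
        also have "norm \<dots> \<le> t\<^sup>2 * norm g"
        proof (rule norm_fc_le)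
          fix s :: real assume "s \<in> {0..1}"
          from heat_symbol_generator[OF t this]
          show "\<bar>1 * (1 * (heat_symbol t s * s\<^sup>2) + (-1) * s\<^sup>2) + (- t) * (1 * s\<^sup>2 + (-1) * s)\<bar> \<le> t\<^sup>2"
            by (simp add: algebra_simps)
        qed (intro continuous_intros c2)
        finally have *: "norm (T t (J x) - J x - t *\<^sub>R (J x - x)) \<le> t\<^sup>2 * norm g" .
        have "(1 / t) *\<^sub>R (T t (J x) - J x) - (J x - x) = (1 / t) *\<^sub>R (T t (J x) - J x - t *\<^sub>R (J x - x))"
          using t by (simp add: scaleR_right_diff_distrib)
        also have "norm \<dots> = (1 / t) * norm (T t (J x) - J x - t *\<^sub>R (J x - x))" using t by simp
        also have "\<dots> \<le> (1 / t) * (t\<^sup>2 * norm g)" using t by (intro mult_left_mono *) auto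
        also have "\<dots> = t * norm g" using t by (simp add: power2_eq_square)
        finally show ?thesis .
      qed
      have lim: "((\<lambda>t. t * norm g) \<longlongrightarrow> 0) (at_right 0)" by (auto intro!: tendsto_eq_intros)
      have "\<forall>\<^sub>F t in at_right 0. norm ((1 / t) *\<^sub>R (T t (J x) - J x) - (J x - x)) \<le> t * norm g" using le by (auto simp: eventually_at_filter)
      then show "((\<lambda>t. (1 / t) *\<^sub>R (T t (J x) - J x) - (J x - x)) \<longlongrightarrow> 0) (at_right 0)" by (rule Lim_null_comparison[OF _ lim])
    qed (simp add: T_diff J.diff scaleR_right_diff_distrib)
    then show ?thesis by (simp add: LIM_zero_iff)
  qed

text \<open>With g = -L u the right-hand side is (1 + L) u = u - g, inverted. Given the limit, apply
  J, which commutes with T, and compare with \<open>T_J_right_derivative\<close> at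
  \<open>u\<close>.\<close>

lemma T_generator:
  assumes u: "u \<in> H0" and g: "g \<in> H0"
  shows "((\<lambda>t. (1 / t) *\<^sub>R (T t u - u)) \<longlongrightarrow> g) (at_right 0) \<longleftrightarrow> J (u - g) = u"
proof
  assume lim: "((\<lambda>t. (1 / t) *\<^sub>R (T t u - u)) \<longlongrightarrow> g) (at_right 0)"
  then have "((\<lambda>t. J ((1 / t) *\<^sub>R (T t u - u))) \<longlongrightarrow> J g) (at_right 0)" by (rule J.tendsto)
  then have "((\<lambda>t. (1 / t) *\<^sub>R (T t (J u) - J u)) \<longlongrightarrow> J g) (at_right 0)" by (simp add: J.scaleR J.diff T_J)
  then have "J g = J u - u" using T_J_right_derivative[OF u] tendsto_unique[OF trivial_limit_at_right_real] by blast
  then show "J (u - g) = u" by (simp add: J.diff)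
next
  assume *: "J (u - g) = u"
  have "u - g \<in> H0" using H0_subspace u g by (rule subspace_diff)
  from T_J_right_derivative[OF this] show "((\<lambda>t. (1 / t) *\<^sub>R (T t u - u)) \<longlongrightarrow> g) (at_right 0)" unfolding * by simp
qed

text \<open>J annihilates the difference between \<open>f\<close> and its projection onto
  \<open>H0\<close>.\<close>

lemma J_image_H0: "\<exists>w\<in>H0. J f = J w"
proof -
  obtain w where w: "w \<in> H0" "\<And>v. v \<in> H0 \<Longrightarrow> inner w v = inner f v"
    by (rule symmetric_lax_milgram[OF H0_closed H0_subspace bounded_bilinear_inner inner_commute, of 1 "inner f"])
       (auto simp: dot_square_norm bounded_linear_inner_right)
  have "Q (R (f - w)) (R (f - w)) = inner (f - w) (J (f - w))" using R(2)[OF R(1)] by (simp add: J_def)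
  also have "\<dots> = 0" using w(2)[OF J_H0] by (simp add: inner_diff_left)
  finally have "R (f - w) = 0" using Q_zero by simp
  then have "J (f - w) = 0" by (simp add: J_def)
  then show ?thesis using w(1) by (auto simp: J.diff)
qed

text \<open>The function \<open>c t = inner (T t f) f\<close> is nonnegative and nonincreasing,
  hence converges, and it expresses all distances between values of the orbit. So the orbit is
  Cauchy. Its limit \<open>g\<close> is invariant, which means \<open>J g = g\<close>; then the
  energy of \<open>g\<close> is 0 and \<open>ker\<close> applies.\<close>

lemma T_tendsto_zero:
  assumes ker: "\<And>u. (u, 0) \<in> V \<Longrightarrow> u = 0" and f: "f \<in> H0"
  shows "(\<lambda>n. T (real n) f) \<longlonglongrightarrow> 0"
proof -
  define c where "c t = inner (T t f) f" for t
  have cc: "inner (T t f) (T r f) = c (t + r)" if "t \<ge> 0" "r \<ge> 0" for t r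
    using that by (simp add: c_def T_add T_sym add.commute[of t r])
  have c0: "c t \<ge> 0" if "t \<ge> 0" for t
    using cc[of "t/2" "t/2"] that by (metis inner_ge_zero field_sum_of_halves divide_nonneg_nonneg zero_le_numeral)
  have cdec: "c (t + r) \<le> c t" if "t \<ge> 0" "r \<ge> 0" for t r
  proof -
    have "inner (T r (T (t/2) f)) (T (t/2) f) \<le> norm (T (t/2) f) * norm (T (t/2) f)"
      using norm_cauchy_schwarz[of "T r (T (t/2) f)" "T (t/2) f"] mult_right_mono[OF T_norm_le[of r "T (t/2) f"], of "norm (T (t/2) f)"] by simp
    also have "\<dots> = inner (T (t/2) f) (T (t/2) f)" by (simp only: power2_norm_eq_inner flip: power2_eq_square)
    also have "\<dots> = c t" using cc[of "t/2" "t/2"] that by simp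
    also have "T r (T (t/2) f) = T (r + t/2) f" using that by (simp add: T_add)
    also have "inner (T (r + t/2) f) (T (t/2) f) = c (t + r)" using cc[of "r + t/2" "t/2"] that by (simp add: add.commute)
    finally show ?thesis .
  qed
  have nd: "(norm (T t f - T r f))\<^sup>2 = c (2 * t) + c (2 * r) - 2 * c (t + r)" if "t \<ge> 0" "r \<ge> 0" for t r
    using cc[of t t] cc[of r r] cc[of t r] cc[of r t] that
    by (simp add: power2_norm_eq_inner inner_diff_left inner_diff_right add.commute)
  have "decseq (\<lambda>n. c (real n))"
    unfolding decseq_Suc_iff
  proof
    show "c (real (Suc n)) \<le> c (real n)" for n using cdec[of "real n" 1] by (simp add: add.commute)
  qed
  moreover have "0 \<le> c (real n)" for n by (simp add: c0)
  ultimately obtain L where L: "(\<lambda>n. c (real n)) \<longlonglongrightarrow> L" "\<And>n. L \<le> c (real n)"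
    by (metis decseq_convergent)
  have small: "\<exists>N. \<forall>n\<ge>N. c (real n) - L < e" if "e > 0" for e
  proof -
    from order_tendstoD(2)[OF L(1), of "L + e"] that have "\<forall>\<^sub>F n in sequentially. c (real n) < L + e" by simp
    then show ?thesis by (auto simp: eventually_sequentially algebra_simps)
  qed
  have "Cauchy (\<lambda>n. T (real n) f)"
  proof (rule metric_CauchyI)
    fix e :: real assume e: "e > 0"
    obtain N where N: "\<And>n. n \<ge> N \<Longrightarrow> c (real n) - L < e\<^sup>2 / 2" using small[of "e\<^sup>2 / 2"] e by auto
    have "dist (T (real i) f) (T (real j) f) < e" if "i \<ge> N" "j \<ge> N" for i j
    proof -
      have "(norm (T (real i) f - T (real j) f))\<^sup>2 < e\<^sup>2"
        using nd[of "real i" "real j"] N[of "2 * i"] N[of "2 * j"] L(2)[of "i + j"] that by simp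
      then show ?thesis using e by (simp add: dist_norm power2_less_imp_less)
    qed
    then show "\<exists>N. \<forall>i\<ge>N. \<forall>j\<ge>N. dist (T (real i) f) (T (real j) f) < e" by blast
  qed
  then obtain g where g: "(\<lambda>n. T (real n) f) \<longlonglongrightarrow> g" using Cauchy_convergent_iff convergent_def by blast
  have gH: "g \<in> H0" using closed_sequentially[OF H0_closed _ g] T_H0'[OF f] by simp
  have Tg: "T s g = g" if s: "s > 0" for s
  proof -
    obtain k :: nat where k: "s \<le> real k" using real_arch_simple by blast
    have "(\<lambda>n. (norm (T (s + real n) f - T (real n) f))\<^sup>2) \<longlonglongrightarrow> 0"
    proof (rule Lim_null_comparison)
      have "(norm (T (s + real n) f - T (real n) f))\<^sup>2 \<le> 2 * (c (real (2 * n)) - c (real (2 * n + 2 * k)))" for n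
      proof -
        \<comment> \<open>Convergence is known along integer times only; by monotonicity the values
          at the intermediate times lie between those at \<open>2 * n\<close> and
          \<open>2 * n + 2 * k\<close>.\<close>
        have "c (2 * real n + 2 * s + 2 * (real k - s)) \<le> c (2 * real n + 2 * s)" using s k by (intro cdec) auto
        moreover have "c (2 * real n + s + (2 * real k - s)) \<le> c (2 * real n + s)" using s k by (intro cdec) auto
        moreover have "c (2 * real n + 2 * s) \<le> c (2 * real n)" using s by (intro cdec) auto
        ultimately show ?thesis using nd[of "s + real n" "real n"] s by (simp add: algebra_simps)
      qed
      then show "\<forall>\<^sub>F n in sequentially. norm ((norm (T (s + real n) f - T (real n) f))\<^sup>2) \<le> 2 * (c (real (2 * n)) - c (real (2 * n + 2 * k)))"
        by simp
      have m: "strict_mono (\<lambda>n::nat. 2 * n)" "strict_mono (\<lambda>n::nat. 2 * n + 2 * k)" by (auto simp: strict_mono_def)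
      have "(\<lambda>n. 2 * (c (real (2 * n)) - c (real (2 * n + 2 * k)))) \<longlonglongrightarrow> 2 * (L - L)"
        using LIMSEQ_subseq_LIMSEQ[OF L(1) m(1)] LIMSEQ_subseq_LIMSEQ[OF L(1) m(2)]
        by (intro tendsto_intros) (simp_all add: o_def)
      then show "(\<lambda>n. 2 * (c (real (2 * n)) - c (real (2 * n + 2 * k)))) \<longlonglongrightarrow> 0" by simp
    qed
    moreover have "(\<lambda>n. (norm (T (s + real n) f - T (real n) f))\<^sup>2) \<longlonglongrightarrow> (norm (T s g - g))\<^sup>2"
      using bounded_linear.tendsto[OF T_bounded_linear g, of s] g s by (intro tendsto_intros) (simp_all add: T_add)
    ultimately have "(norm (T s g - g))\<^sup>2 = 0" using LIMSEQ_unique by blast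
    then show ?thesis by simp
  qed
  have "((\<lambda>t. (1 / t) *\<^sub>R (T t g - g)) \<longlongrightarrow> 0) (at_right 0)"
    by (rule tendsto_eventually) (auto simp: eventually_at_filter Tg)
  then have "J g = g" using T_generator[OF gH subspace_0[OF H0_subspace]] by simp
  then have Rg: "R g = (g, snd (R g))" by (metis J_def prod.collapse)
  have "Q (R g) (R g) = inner g g" using R(2)[OF R(1), of g g] \<open>J g = g\<close> by (simp add: J_def)
  then have "b (snd (R g)) (snd (R g)) = 0" using Rg by (metis Q_def fst_conv add_cancel_left_right)
  then have "\<nu> * (norm (snd (R g)))\<^sup>2 \<le> 0" using b_coercive[of "snd (R g)"] by simp
  then have "snd (R g) = 0" using \<nu>_pos by (simp add: mult_le_0_iff)
  then have "(g, 0) \<in> V" using R(1)[of g] Rg by metis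
  then show ?thesis using ker g by blast
qed

end

section \<open>Uniqueness of the semigroup with a given generator\<close>

lemma semigroup_locally_bounded:
  fixes S :: "real \<Rightarrow> 'a::banach \<Rightarrow> 'a"
  assumes lin: "\<And>t. t \<ge> 0 \<Longrightarrow> bounded_linear (S t)"
    and strong: "\<And>f. ((\<lambda>t. S t f) \<longlongrightarrow> S 0 f) (at_right 0)"
  shows "\<exists>\<delta>>0. \<exists>M. \<forall>t f. 0 \<le> t \<longrightarrow> t \<le> \<delta> \<longrightarrow> norm (S t f) \<le> M * norm f"
proof (rule ccontr)
  assume neg: "\<not> ?thesis"
  have "\<exists>t f. 0 \<le> t \<and> t \<le> 1 / real (Suc n) \<and> \<not> norm (S t f) \<le> real n * norm f" for n
  proof -
    have "1 / real (Suc n) > 0" by simp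
    then show ?thesis using neg by blast
  qed
  then obtain \<tau> F where tau: "\<And>n. 0 \<le> \<tau> n" "\<And>n. \<tau> n \<le> 1 / real (Suc n)" and F: "\<And>n. \<not> norm (S (\<tau> n) (F n)) \<le> real n * norm (F n)"
    by metis
  have "\<tau> \<longlonglongrightarrow> 0"
    by (rule tendsto_sandwich[OF _ _ tendsto_const lim_inverse_Suc]) (use tau in \<open>auto simp del: of_nat_Suc\<close>)
  then have conv: "(\<lambda>n. S (\<tau> n) f) \<longlonglongrightarrow> S 0 f" for f
    using strong[of f] tau(1) continuous_within_tendsto_compose'[of 0 "{0..}" "\<lambda>t. S t f" \<tau>]
    by (simp add: continuous_within at_within_Ici_at_right)
  \<comment> \<open>Each orbit converges along \<open>\<tau>\<close>, so it is bounded there;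
    Banach-Steinhaus turns this into a uniform bound, against the choice of
    \<open>F\<close>.\<close>
  have "\<exists>M. \<forall>n x. norm (S (\<tau> n) x) \<le> M * norm x"
  proof (rule banach_steinhaus_sequence)
    show "bounded_linear (S (\<tau> n))" for n using lin tau by blast
    show "\<exists>B. \<forall>n. norm (S (\<tau> n) x) \<le> B" for x
      using convergentI[OF conv[of x], THEN convergent_imp_Bseq] by (auto simp: Bseq_def)
  qed
  then obtain M where M: "\<And>n x. norm (S (\<tau> n) x) \<le> M * norm x" by blast
  obtain n :: nat where "M \<le> real n" using real_arch_simple by blast
  then have "M * norm (F n) \<le> real n * norm (F n)" by (intro mult_right_mono) auto
  then show False using M[of n "F n"] F[of n] by linarith
qed

text \<open>The operators are linear on the whole space, but the semigroup laws hold on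
  \<open>H\<close> only: in the application \<open>S 0\<close> is a projection onto
  \<open>H\<close>. The bound near 0 is what left continuity requires.\<close>

locale strongly_continuous_semigroup_on =
  fixes H :: "'a::banach set" and S :: "real \<Rightarrow> 'a \<Rightarrow> 'a" and \<delta> M :: real
  assumes S_linear: "t \<ge> 0 \<Longrightarrow> bounded_linear (S t)"
    and S_add: "s \<ge> 0 \<Longrightarrow> t \<ge> 0 \<Longrightarrow> f \<in> H \<Longrightarrow> S (s + t) f = S s (S t f)"
    and S_H: "t \<ge> 0 \<Longrightarrow> f \<in> H \<Longrightarrow> S t f \<in> H"
    and S_0: "f \<in> H \<Longrightarrow> S 0 f = f"
    and S_strong: "f \<in> H \<Longrightarrow> ((\<lambda>t. S t f) \<longlongrightarrow> f) (at_right 0)"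
    and \<delta>_pos: "\<delta> > 0"
    and S_bound: "0 \<le> t \<Longrightarrow> t \<le> \<delta> \<Longrightarrow> norm (S t f) \<le> M * norm f"
begin

lemma S_diff: "t \<ge> 0 \<Longrightarrow> S t (x - y) = S t x - S t y"
  using linear_diff[OF bounded_linear.linear[OF S_linear]] .

lemma S_right_continuous:
  assumes "t \<ge> 0" "f \<in> H" shows "((\<lambda>x. S x f) \<longlongrightarrow> S t f) (at_right t)"
proof -
  have "((\<lambda>h. S h (S t f)) \<longlongrightarrow> S t f) (at_right 0)" by (intro S_strong S_H assms)
  moreover have "\<forall>\<^sub>F h in at_right 0. S h (S t f) = S (h + t) f"
    using assms by (auto simp: eventually_at_filter S_add)
  ultimately have "((\<lambda>h. S (h + t) f) \<longlongrightarrow> S t f) (at_right 0)" by (rule Lim_transform_eventually)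
  then show ?thesis by (simp only: filterlim_at_right_to_0[of _ _ t])
qed

text \<open>Step back from \<open>t\<close> by \<open>r \<le> \<delta>\<close> to the point
  \<open>g\<close>. For \<open>x\<close> just below \<open>t\<close> the difference of the two
  values is \<open>S (x - (t - r))\<close>, an operator with the bound \<open>M\<close>, applied to
  \<open>g - S (t - x) g\<close>, which is small by continuity at 0.\<close>

lemma S_left_continuous:
  assumes t: "t > 0" and f: "f \<in> H" shows "((\<lambda>x. S x f) \<longlongrightarrow> S t f) (at_left t)"
proof -
  define r where "r = min \<delta> t"
  have r: "r > 0" "r \<le> \<delta>" "r \<le> t" using t \<delta>_pos by (auto simp: r_def)
  define g where "g = S (t - r) f"
  have g: "g \<in> H" using r f by (auto simp: g_def intro!: S_H)
  have le: "norm (S x f - S t f) \<le> M * norm (S (t - x) g - g)" if x: "x \<in> {t - r<..<t}" for x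
  proof -
    have "S x f = S (x - (t - r)) g" using S_add[of "x - (t - r)" "t - r" f] x r f by (simp add: g_def)
    moreover have "S t f = S (x - (t - r)) (S (t - x) g)"
    proof -
      have "S t f = S r g" using S_add[of r "t - r" f] r f by (simp add: g_def)
      also have "\<dots> = S (x - (t - r)) (S (t - x) g)" using S_add[of "x - (t - r)" "t - x" g] x g by simp
      finally show ?thesis .
    qed
    ultimately have "S x f - S t f = S (x - (t - r)) (g - S (t - x) g)" using x by (simp add: S_diff)
    also have "norm \<dots> \<le> M * norm (g - S (t - x) g)" using x r by (intro S_bound) auto
    finally show ?thesis by (simp add: norm_minus_commute)
  qed
  have "filterlim (\<lambda>x. t - x) (at_right 0) (at_left t)"
    unfolding filterlim_at by (auto simp: eventually_at_filter intro!: tendsto_eq_intros)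
  then have "((\<lambda>x. S (t - x) g) \<longlongrightarrow> g) (at_left t)" by (rule filterlim_compose[OF S_strong[OF g]])
  then have lim: "((\<lambda>x. M * norm (S (t - x) g - g)) \<longlongrightarrow> 0) (at_left t)"
    by (intro tendsto_mult_right_zero tendsto_norm_zero) (simp add: LIM_zero)
  have "\<forall>\<^sub>F x in at_left t. x \<in> {t - r<..<t}" using r by (intro eventually_at_left_real) simp
  then have "\<forall>\<^sub>F x in at_left t. norm (S x f - S t f) \<le> M * norm (S (t - x) g - g)"
    by eventually_elim (rule le)
  then have "((\<lambda>x. S x f - S t f) \<longlongrightarrow> 0) (at_left t)" by (rule Lim_null_comparison[OF _ lim])
  then show ?thesis by (simp add: LIM_zero_iff)
qed

lemma S_continuous:
  assumes f: "f \<in> H" shows "continuous_on {0..\<tau>} (\<lambda>t. S t f)"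
  unfolding continuous_on_eq_continuous_within continuous_within
proof
  fix t assume t: "t \<in> {0..\<tau>}"
  have "((\<lambda>x. S x f) \<longlongrightarrow> S t f) (at t within {0..})"
  proof (cases "t = 0")
    case True
    then show ?thesis using S_right_continuous[of 0 f] f by (simp add: at_within_Ici_at_right)
  next
    case False
    then have "((\<lambda>x. S x f) \<longlongrightarrow> S t f) (at t)"
      using S_left_continuous[of t f] S_right_continuous[of t f] f t by (simp add: filterlim_split_at)
    then show ?thesis by (rule tendsto_within_subset) simp
  qed
  then show "((\<lambda>x. S x f) \<longlongrightarrow> S t f) (at t within {0..\<tau>})" by (rule tendsto_within_subset) auto
qed

lemma S_right_derivative:
  assumes "t \<ge> 0" "f \<in> H" and lim: "((\<lambda>h. (1 / h) *\<^sub>R (S h f - f)) \<longlongrightarrow> g) (at_right 0)"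
  shows "((\<lambda>h. (1 / h) *\<^sub>R (S (t + h) f - S t f)) \<longlongrightarrow> S t g) (at_right 0)"
    "((\<lambda>h. (1 / h) *\<^sub>R (S h (S t f) - S t f)) \<longlongrightarrow> S t g) (at_right 0)"
proof -
  have l: "((\<lambda>h. S t ((1 / h) *\<^sub>R (S h f - f))) \<longlongrightarrow> S t g) (at_right 0)"
    using bounded_linear.tendsto[OF S_linear lim] assms by blast
  have "\<forall>\<^sub>F h in at_right 0. S t ((1 / h) *\<^sub>R (S h f - f)) = (1 / h) *\<^sub>R (S (t + h) f - S t f)"
    using assms by (auto simp: eventually_at_filter S_add S_diff linear_cmul[OF bounded_linear.linear[OF S_linear]])
  then show 1: "((\<lambda>h. (1 / h) *\<^sub>R (S (t + h) f - S t f)) \<longlongrightarrow> S t g) (at_right 0)"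
    by (rule Lim_transform_eventually[OF l])
  have "\<forall>\<^sub>F h in at_right 0. (1 / h) *\<^sub>R (S (t + h) f - S t f) = (1 / h) *\<^sub>R (S h (S t f) - S t f)"
    using assms S_add[of _ t f] by (auto simp: eventually_at_filter add.commute)
  then show "((\<lambda>h. (1 / h) *\<^sub>R (S h (S t f) - S t f)) \<longlongrightarrow> S t g) (at_right 0)"
    by (rule Lim_transform_eventually[OF 1])
qed

end

context energy_form
begin

lemma T_semigroup_on: "strongly_continuous_semigroup_on H0 T 1 1"
  by (rule strongly_continuous_semigroup_on.intro) (auto simp: T_bounded_linear T_add T_H0' T_strong T_norm_le)

text \<open>Start both semigroups at \<open>u\<close> in the domain and let \<open>y\<close> be the
  difference, with right derivative \<open>\<gamma>\<close>. The generator equations give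
  \<open>J (y - \<gamma>) = y\<close>, and \<open>J_le\<close> reads
  \<open>inner \<gamma> y \<le> 0\<close>: the squared norm of \<open>y\<close> cannot grow from its
  initial value 0. The domain is dense because it contains the range of J.\<close>

lemma semigroup_unique:
  assumes "strongly_continuous_semigroup_on H0 S \<delta> M"
    and gen: "\<And>u g. u \<in> H0 \<Longrightarrow> g \<in> H0 \<Longrightarrow> ((\<lambda>h. (1 / h) *\<^sub>R (S h u - u)) \<longlongrightarrow> g) (at_right 0) \<longleftrightarrow> J (u - g) = u"
    and \<tau>: "\<tau> \<ge> 0" and f: "f \<in> H0"
  shows "S \<tau> f = T \<tau> f"
proof -
  interpret S: strongly_continuous_semigroup_on H0 S \<delta> M by fact
  interpret T: strongly_continuous_semigroup_on H0 T 1 1 by (rule T_semigroup_on)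
  have eq: "S \<tau> u = T \<tau> u" if u: "u \<in> H0" and g: "g \<in> H0" and J: "J (u - g) = u" for u g
  proof -
    define y where "y t = S t u - T t u" for t
    define \<gamma> where "\<gamma> t = S t g - T t g" for t
    note limS = gen[OF u g, THEN iffD2, OF J]
    note limT = T_generator[OF u g, THEN iffD2, OF J]
    have der: "((\<lambda>h. (1 / h) *\<^sub>R (y (t + h) - y t)) \<longlongrightarrow> \<gamma> t) (at_right 0)" if "t \<ge> 0" for t
    proof -
      have "((\<lambda>h. (1 / h) *\<^sub>R (S (t + h) u - S t u) - (1 / h) *\<^sub>R (T (t + h) u - T t u)) \<longlongrightarrow> \<gamma> t) (at_right 0)"
        unfolding \<gamma>_def by (intro tendsto_diff S.S_right_derivative(1) T.S_right_derivative(1) that u limS limT)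
      then show ?thesis by (simp add: y_def algebra_simps)
    qed
    have inner_le: "inner (\<gamma> t) (y t) \<le> 0" if t: "t \<ge> 0" for t
    proof -
      have "J (S t u - S t g) = S t u" "J (T t u - T t g) = T t u"
        using S.S_right_derivative(2)[OF t u limS] T.S_right_derivative(2)[OF t u limT]
          gen[OF S.S_H[OF t u] S.S_H[OF t g]] T_generator[OF T.S_H[OF t u] T.S_H[OF t g]] by blast+
      moreover have "y t - \<gamma> t = (S t u - S t g) - (T t u - T t g)" by (simp add: y_def \<gamma>_def)
      ultimately have "J (y t - \<gamma> t) = y t" by (simp only: J.diff[of "S t u - S t g"] y_def)
      then have "(norm (y t))\<^sup>2 \<le> inner (y t) (y t - \<gamma> t)" using J_le[of "y t - \<gamma> t"] by simp
      then show ?thesis by (simp add: inner_diff_right dot_square_norm inner_commute)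
    qed
    define \<phi> where "\<phi> t = inner (y t) (y t)" for t
    have ycont: "continuous_on {0..\<tau>} y" unfolding y_def by (intro continuous_on_diff S.S_continuous T.S_continuous u)
    have "\<phi> \<tau> \<le> \<phi> 0"
    proof (rule nonincreasing_if_right_derivative_nonpos[OF _ \<tau>])
      show "continuous_on {0..\<tau>} \<phi>" unfolding \<phi>_def by (intro continuous_on_inner ycont)
      fix t e :: real assume t: "0 \<le> t" "t < \<tau>" and e: "e > 0"
      have yr: "((\<lambda>h. y (t + h)) \<longlongrightarrow> y t) (at_right 0)"
      proof -
        have "((\<lambda>x. y x) \<longlongrightarrow> y t) (at_right t)" unfolding y_def
          by (intro tendsto_diff S.S_right_continuous T.S_right_continuous t u)
        then show ?thesis by (simp only: filterlim_at_right_to_0[of _ _ t] add.commute)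
      qed
      have "((\<lambda>h. inner ((1 / h) *\<^sub>R (y (t + h) - y t)) (y (t + h) + y t)) \<longlongrightarrow> inner (\<gamma> t) (y t + y t)) (at_right 0)"
        by (intro tendsto_inner tendsto_add tendsto_const der yr t)
      moreover have "inner (\<gamma> t) (y t + y t) < e" using inner_le[OF t(1)] e by (simp add: inner_add_right)
      ultimately have "\<forall>\<^sub>F h in at_right 0. inner ((1 / h) *\<^sub>R (y (t + h) - y t)) (y (t + h) + y t) < e"
        by (rule order_tendstoD(2))
      moreover have "\<forall>\<^sub>F h in at_right (0::real). h > 0" by (simp add: eventually_at_right_less)
      ultimately show "\<forall>\<^sub>F h in at_right 0. \<phi> (t + h) - \<phi> t \<le> e * h"
      proof eventually_elim
        case (elim h)
        have "\<phi> (t + h) - \<phi> t = h * inner ((1 / h) *\<^sub>R (y (t + h) - y t)) (y (t + h) + y t)"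
          using elim(2) by (simp add: \<phi>_def inner_add_right inner_diff_left inner_commute algebra_simps)
        also have "\<dots> \<le> h * e" using elim by (intro mult_left_mono) auto
        finally show ?case by (simp add: mult.commute)
      qed
    qed
    moreover have "\<phi> 0 = 0" by (simp add: \<phi>_def y_def S.S_0[OF u])
    ultimately have "inner (y \<tau>) (y \<tau>) \<le> 0" by (simp add: \<phi>_def)
    then have "y \<tau> = 0" using inner_ge_zero[of "y \<tau>"] inner_eq_zero_iff[of "y \<tau>"] by linarith
    then show ?thesis by (simp add: y_def)
  qed
  have sub: "range J \<subseteq> {x. S \<tau> x = T \<tau> x}"
  proof
    fix x assume "x \<in> range J"
    then obtain w where w: "w \<in> H0" "x = J w" using J_image_H0 by auto
    \<comment> \<open>The generator value at \<open>x = J w\<close> is \<open>x - w\<close>, as this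
      makes \<open>J (x - (x - w)) = x\<close>.\<close>
    have "S \<tau> x = T \<tau> x"
      by (rule eq[of x "x - w"]) (use w in \<open>auto simp: J_H0 intro!: subspace_diff[OF H0_subspace]\<close>)
    then show "x \<in> {x. S \<tau> x = T \<tau> x}" by simp
  qed
  have "closed {x. S \<tau> x = T \<tau> x}"
    by (intro closed_Collect_eq linear_continuous_on S.S_linear T_bounded_linear \<tau>)
  then have "H0 \<subseteq> {x. S \<tau> x = T \<tau> x}" unfolding H0_closure_range_J by (rule closure_minimal[OF sub])
  then show ?thesis using f by blast
qed

end

section \<open>The Hilbert space of square integrable functions\<close>

definition sqint :: "('a::euclidean_space \<Rightarrow> real) \<Rightarrow> bool" where
  "sqint f \<longleftrightarrow> f \<in> borel_measurable lebesgue \<and> integrable lebesgue (\<lambda>x. (f x)\<^sup>2)"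

lemma sqint_measurable [measurable_dest]: "sqint f \<Longrightarrow> f \<in> borel_measurable lebesgue"
  by (simp add: sqint_def)

lemma sqint_integrable: "sqint f \<Longrightarrow> integrable lebesgue (\<lambda>x. (f x)\<^sup>2)"
  by (simp add: sqint_def)

lemma sqint_nn_integral:
  "sqint f \<longleftrightarrow> f \<in> borel_measurable lebesgue \<and> (\<integral>\<^sup>+ x. ennreal ((f x)\<^sup>2) \<partial>lebesgue) < top"
  unfolding sqint_def
proof (intro conj_cong refl)
  assume [measurable]: "f \<in> borel_measurable lebesgue"
  have "(\<lambda>x. (f x)\<^sup>2) \<in> borel_measurable lebesgue" by measurable
  then show "integrable lebesgue (\<lambda>x. (f x)\<^sup>2) = ((\<integral>\<^sup>+ x. ennreal ((f x)\<^sup>2) \<partial>lebesgue) < top)"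
    by (simp add: integrable_iff_bounded)
qed

lemma sqint_mult_integrable:
  assumes f: "sqint f" and g: "sqint g" shows "integrable lebesgue (\<lambda>x. f x * g x)"
proof (rule Bochner_Integration.integrable_bound)
  show "integrable lebesgue (\<lambda>x. (f x)\<^sup>2 + (g x)\<^sup>2)"
    using f g by (intro Bochner_Integration.integrable_add sqint_integrable)
  show "(\<lambda>x. f x * g x) \<in> borel_measurable lebesgue"
    using sqint_measurable[OF f] sqint_measurable[OF g] by (rule borel_measurable_times)
  have "\<bar>a * b\<bar> \<le> \<bar>a\<^sup>2 + b\<^sup>2\<bar>" for a b :: real
  proof -
    have "2 * (\<bar>a\<bar> * \<bar>b\<bar>) \<le> \<bar>a\<bar>\<^sup>2 + \<bar>b\<bar>\<^sup>2" using sum_squares_bound[of "\<bar>a\<bar>" "\<bar>b\<bar>"] by (simp add: mult_ac)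
    moreover have "\<bar>a\<bar> * \<bar>b\<bar> \<ge> 0" by simp
    ultimately have "\<bar>a\<bar> * \<bar>b\<bar> \<le> \<bar>a\<bar>\<^sup>2 + \<bar>b\<bar>\<^sup>2" by linarith
    then show ?thesis by (simp add: abs_mult)
  qed
  then show "AE x in lebesgue. norm (f x * g x) \<le> norm ((f x)\<^sup>2 + (g x)\<^sup>2)" by simp
qed

lemma sqint_add:
  assumes f: "sqint f" and g: "sqint g" shows "sqint (\<lambda>x. f x + g x)"
  unfolding sqint_def
proof
  show "(\<lambda>x. f x + g x) \<in> borel_measurable lebesgue"
    using sqint_measurable[OF f] sqint_measurable[OF g] by (rule borel_measurable_add)
  have "integrable lebesgue (\<lambda>x. (f x)\<^sup>2 + (g x)\<^sup>2 + 2 * (f x * g x))"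
    using f g by (intro Bochner_Integration.integrable_add sqint_integrable integrable_mult_right sqint_mult_integrable)
  then show "integrable lebesgue (\<lambda>x. (f x + g x)\<^sup>2)" by (simp add: power2_sum mult.assoc)
qed

lemma sqint_scale: "sqint f \<Longrightarrow> sqint (\<lambda>x. c * f x)"
  unfolding sqint_def by (auto simp: power_mult_distrib)

lemma sqint_minus: "sqint f \<Longrightarrow> sqint (\<lambda>x. - f x)"
  using sqint_scale[of f "-1"] by simp

lemma sqint_diff: "sqint f \<Longrightarrow> sqint g \<Longrightarrow> sqint (\<lambda>x. f x - g x)"
  using sqint_add[OF _ sqint_minus, of f g] by simp

lemma sqint_zero: "sqint (\<lambda>x. 0)" by (simp add: sqint_def)

lemma sqint_bound:
  assumes "sqint g" "f \<in> borel_measurable lebesgue" "AE x in lebesgue. \<bar>f x\<bar> \<le> C * \<bar>g x\<bar>"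
  shows "sqint f"
  unfolding sqint_def
proof
  show "integrable lebesgue (\<lambda>x. (f x)\<^sup>2)"
  proof (rule Bochner_Integration.integrable_bound)
    show "integrable lebesgue (\<lambda>x. (C * g x)\<^sup>2)" using sqint_integrable[OF sqint_scale[OF assms(1)]] .
    show "(\<lambda>x. (f x)\<^sup>2) \<in> borel_measurable lebesgue" using assms(2) by measurable
    show "AE x in lebesgue. norm ((f x)\<^sup>2) \<le> norm ((C * g x)\<^sup>2)"
    proof (rule AE_mp[OF assms(3)], rule AE_I2, rule impI)
      fix x assume "\<bar>f x\<bar> \<le> C * \<bar>g x\<bar>"
      then have "\<bar>f x\<bar>\<^sup>2 \<le> (C * \<bar>g x\<bar>)\<^sup>2" by (intro power_mono) auto
      then show "norm ((f x)\<^sup>2) \<le> norm ((C * g x)\<^sup>2)" by (simp add: power_mult_distrib)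
    qed
  qed
qed fact

\<comment> \<open>A type cannot depend on \<open>\<Omega>\<close>, so there is one Hilbert space
  over the whole space, and functions on \<open>\<Omega>\<close> are those vanishing almost
  everywhere outside. The relation is partial: \<open>cls\<close> is meaningful on square integrable
  functions only.\<close>
quotient_type (overloaded) 'a l2 = "'a::euclidean_space \<Rightarrow> real" / partial: "\<lambda>f g. sqint f \<and> sqint g \<and> (AE x in lebesgue. f x = g x)"
  morphisms rp cls
proof (rule part_equivpI)
  show "\<exists>x::'a \<Rightarrow> real. sqint x \<and> sqint x \<and> (AE xa in lebesgue. x xa = x xa)" using sqint_zero by auto
qed (auto intro!: sympI transpI elim: AE_mp)

lemma sqint_rp [simp]: "sqint (rp X)"
  and cls_rp [simp]: "cls (rp X) = X"
  using Quotient_rep_reflp[OF Quotient_l2, of X] Quotient_abs_rep[OF Quotient_l2, of X] by auto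

lemma rp_measurable [measurable]: "rp X \<in> borel_measurable lebesgue" using sqint_rp sqint_measurable by blast

lemma cls_eq_iff: "sqint f \<Longrightarrow> sqint g \<Longrightarrow> cls f = cls g \<longleftrightarrow> (AE x in lebesgue. f x = g x)"
  using Quotient_rel[OF Quotient_l2, of f g] by auto

lemma AE_rp_cls: "sqint f \<Longrightarrow> AE x in lebesgue. rp (cls f) x = f x"
  by (subst cls_eq_iff[symmetric]) auto

lemma l2_eq_iff: "X = Y \<longleftrightarrow> (AE x in lebesgue. rp X x = rp Y x)"
  using cls_eq_iff[OF sqint_rp sqint_rp, of X Y] by simp

instantiation l2 :: (euclidean_space) real_vector
begin

lift_definition zero_l2 :: "'a l2" is "\<lambda>x. 0" by (simp add: sqint_zero)
lift_definition plus_l2 :: "'a l2 \<Rightarrow> 'a l2 \<Rightarrow> 'a l2" is "\<lambda>f g x. f x + g x" by (auto simp: sqint_add)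
lift_definition minus_l2 :: "'a l2 \<Rightarrow> 'a l2 \<Rightarrow> 'a l2" is "\<lambda>f g x. f x - g x" by (auto simp: sqint_diff)
lift_definition uminus_l2 :: "'a l2 \<Rightarrow> 'a l2" is "\<lambda>f x. - f x" by (auto simp: sqint_minus)
lift_definition scaleR_l2 :: "real \<Rightarrow> 'a l2 \<Rightarrow> 'a l2" is "\<lambda>c f x. c * f x" by (auto simp: sqint_scale)

instance
  by standard (transfer; auto simp: sqint_add sqint_diff sqint_minus sqint_scale sqint_zero algebra_simps)+

end

instantiation l2 :: (euclidean_space) real_inner
begin

lift_definition inner_l2 :: "'a l2 \<Rightarrow> 'a l2 \<Rightarrow> real" is "\<lambda>f g. \<integral>x. f x * g x \<partial>lebesgue"
proof -
  fix f f' g g' :: "'a \<Rightarrow> real"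
  assume f: "sqint f \<and> sqint f' \<and> (AE x in lebesgue. f x = f' x)" and g: "sqint g \<and> sqint g' \<and> (AE x in lebesgue. g x = g' x)"
  show "(\<integral>x. f x * g x \<partial>lebesgue) = (\<integral>x. f' x * g' x \<partial>lebesgue)"
  proof (rule integral_cong_AE)
    show "(\<lambda>x. f x * g x) \<in> borel_measurable lebesgue" "(\<lambda>x. f' x * g' x) \<in> borel_measurable lebesgue"
      using f g by (auto intro!: borel_measurable_times dest: sqint_measurable)
    from f g have "AE x in lebesgue. f x = f' x" "AE x in lebesgue. g x = g' x" by auto
    then show "AE x in lebesgue. f x * g x = f' x * g' x" by eventually_elim simp
  qed
qed

definition norm_l2 :: "'a l2 \<Rightarrow> real" where "norm_l2 X = sqrt (inner X X)"
definition dist_l2 :: "'a l2 \<Rightarrow> 'a l2 \<Rightarrow> real" where "dist_l2 X Y = norm (X - Y)"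
definition sgn_l2 :: "'a l2 \<Rightarrow> 'a l2" where "sgn_l2 X = inverse (norm X) *\<^sub>R X"
definition uniformity_l2 :: "('a l2 \<times> 'a l2) filter" where
  "uniformity_l2 = (INF e\<in>{0<..}. principal {(x, y). dist x y < e})"
definition open_l2 :: "'a l2 set \<Rightarrow> bool" where
  "open_l2 U = (\<forall>x\<in>U. \<forall>\<^sub>F (x', y) in uniformity. x' = x \<longrightarrow> y \<in> U)"

instance
proof
  fix x y z :: "'a l2" and r :: real and U :: "'a l2 set"
  show "inner x y = inner y x" by transfer (simp add: mult.commute)
  show "inner (x + y) z = inner x z + inner y z"
    by transfer (auto simp: distrib_right sqint_mult_integrable)
  show "inner (r *\<^sub>R x) y = r * inner x y" by transfer (simp add: mult.assoc)
  show "0 \<le> inner x x" by transfer simp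
  show "(inner x x = 0) = (x = 0)"
  proof transfer
    fix f :: "'a \<Rightarrow> real" assume f: "sqint f \<and> sqint f \<and> (AE x in lebesgue. f x = f x)"
    then have "integrable lebesgue (\<lambda>x. f x * f x)" using sqint_mult_integrable by blast
    from integral_nonneg_eq_0_iff_AE[OF this] f
    show "((\<integral>x. f x * f x \<partial>lebesgue) = 0) = (sqint f \<and> sqint (\<lambda>x::'a. 0) \<and> (AE x in lebesgue. f x = 0))"
      by (auto simp: sqint_zero)
  qed
qed (simp_all add: norm_l2_def dist_l2_def sgn_l2_def uniformity_l2_def open_l2_def)

end

lemma cls_add: "sqint f \<Longrightarrow> sqint g \<Longrightarrow> cls f + cls g = cls (\<lambda>x. f x + g x)"
  and cls_diff: "sqint f \<Longrightarrow> sqint g \<Longrightarrow> cls f - cls g = cls (\<lambda>x. f x - g x)"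
  and cls_scale: "sqint f \<Longrightarrow> c *\<^sub>R cls f = cls (\<lambda>x. c * f x)"
  and cls_minus: "sqint f \<Longrightarrow> - cls f = cls (\<lambda>x. - f x)"
  and inner_cls: "sqint f \<Longrightarrow> sqint g \<Longrightarrow> inner (cls f) (cls g) = (\<integral>x. f x * g x \<partial>lebesgue)"
  by (auto intro!: plus_l2.abs_eq minus_l2.abs_eq scaleR_l2.abs_eq uminus_l2.abs_eq inner_l2.abs_eq)

lemma cls_zero: "cls (\<lambda>x. 0) = 0" by (simp add: zero_l2_def)

lemma AE_rp_add: "AE x in lebesgue. rp (X + Y) x = rp X x + rp Y x"
  and AE_rp_diff: "AE x in lebesgue. rp (X - Y) x = rp X x - rp Y x"
  and AE_rp_scale: "AE x in lebesgue. rp (c *\<^sub>R X) x = c * rp X x"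
  and AE_rp_minus: "AE x in lebesgue. rp (- X) x = - rp X x"
  and AE_rp_zero: "AE x in lebesgue. rp 0 x = 0"
  using AE_rp_cls[OF sqint_add[OF sqint_rp sqint_rp], of X Y] AE_rp_cls[OF sqint_diff[OF sqint_rp sqint_rp], of X Y]
    AE_rp_cls[OF sqint_scale[OF sqint_rp], of c X] AE_rp_cls[OF sqint_minus[OF sqint_rp], of X] AE_rp_cls[OF sqint_zero]
  by (simp_all add: cls_zero flip: cls_add cls_diff cls_scale cls_minus)

lemma inner_rp: "inner X Y = (\<integral>x. rp X x * rp Y x \<partial>lebesgue)"
  using inner_cls[OF sqint_rp sqint_rp, of X Y] by simp

lemma norm_cls: "sqint f \<Longrightarrow> (norm (cls f))\<^sup>2 = (\<integral>x. (f x)\<^sup>2 \<partial>lebesgue)"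
  by (simp only: power2_norm_eq_inner inner_cls) (simp add: power2_eq_square)

lemma nn_norm_cls: "sqint f \<Longrightarrow> ennreal ((norm (cls f))\<^sup>2) = (\<integral>\<^sup>+ x. ennreal ((f x)\<^sup>2) \<partial>lebesgue)"
  by (simp add: norm_cls nn_integral_eq_integral sqint_integrable)

lemma norm_cls_mono:
  assumes "sqint f" "sqint g" "AE x in lebesgue. \<bar>f x\<bar> \<le> C * \<bar>g x\<bar>" "C \<ge> 0"
  shows "norm (cls f) \<le> C * norm (cls g)"
proof -
  have "(norm (cls f))\<^sup>2 \<le> (\<integral>x. (C * g x)\<^sup>2 \<partial>lebesgue)"
    unfolding norm_cls[OF assms(1)]
  proof (rule integral_mono_AE)
    show "AE x in lebesgue. (f x)\<^sup>2 \<le> (C * g x)\<^sup>2"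
    proof (rule AE_mp[OF assms(3)], rule AE_I2, rule impI)
      fix x assume "\<bar>f x\<bar> \<le> C * \<bar>g x\<bar>"
      then have "\<bar>f x\<bar>\<^sup>2 \<le> (C * \<bar>g x\<bar>)\<^sup>2" by (intro power_mono) auto
      then show "(f x)\<^sup>2 \<le> (C * g x)\<^sup>2" by (simp add: power_mult_distrib)
    qed
  qed (use assms sqint_integrable sqint_scale in blast)+
  also have "\<dots> = (C * norm (cls g))\<^sup>2" using assms by (simp add: power_mult_distrib norm_cls)
  finally show ?thesis by (rule power2_le_imp_le) (use assms in simp)
qed

lemma nn_norm_diff: "ennreal ((norm (X - Y))\<^sup>2) = (\<integral>\<^sup>+ x. ennreal ((rp X x - rp Y x)\<^sup>2) \<partial>lebesgue)"
  using nn_norm_cls[OF sqint_diff[OF sqint_rp sqint_rp], of X Y] cls_diff[OF sqint_rp sqint_rp, of X Y] by simp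

lemma LIMSEQ_norm_bound:
  fixes f :: "nat \<Rightarrow> 'a::real_normed_vector"
  assumes "\<And>n. norm (f n) \<le> g n" "g \<longlonglongrightarrow> 0" shows "f \<longlonglongrightarrow> 0"
  by (rule Lim_null_comparison[OF _ assms(2)]) (simp add: assms(1))

text \<open>The weight \<open>2 ^ n\<close> still leaves a convergent series of integrals. Hence
  almost everywhere the increments are at most a constant times \<open>(1 / sqrt 2) ^ n\<close>,
  which is summable. One monotone series of integrals suffices, without Minkowski's
  inequality.\<close>

lemma fast_Cauchy_AE_Cauchy:
  fixes X :: "nat \<Rightarrow> 'a::euclidean_space l2"
  assumes "\<And>n. norm (X (Suc n) - X n) \<le> C * (1/2) ^ n"
  shows "AE x in lebesgue. convergent (\<lambda>n. rp (X n) x)"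
proof -
  define d where "d n x = rp (X (Suc n)) x - rp (X n) x" for n x
  have [measurable]: "d n \<in> borel_measurable lebesgue" for n unfolding d_def[abs_def] by measurable
  have d2: "(\<integral>\<^sup>+ x. ennreal (2 ^ n * (d n x)\<^sup>2) \<partial>lebesgue) \<le> ennreal (C\<^sup>2 * (1/2) ^ n)" for n
  proof -
    have "(\<integral>\<^sup>+ x. ennreal (2 ^ n * (d n x)\<^sup>2) \<partial>lebesgue) = ennreal (2 ^ n) * (\<integral>\<^sup>+ x. ennreal ((d n x)\<^sup>2) \<partial>lebesgue)"
      by (subst nn_integral_cmult[symmetric]) (auto simp: ennreal_mult)
    also have "\<dots> = ennreal (2 ^ n * (norm (X (Suc n) - X n))\<^sup>2)"
      by (simp add: d_def nn_norm_diff ennreal_mult)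
    also have "\<dots> \<le> ennreal (2 ^ n * (C * (1/2) ^ n)\<^sup>2)"
      by (intro ennreal_leI mult_left_mono power_mono assms) auto
    also have "2 ^ n * (C * (1/2) ^ n)\<^sup>2 = C\<^sup>2 * (1/2) ^ n"
      by (simp add: power_mult_distrib power2_eq_square power_divide)
    finally show ?thesis .
  qed
  have "(\<integral>\<^sup>+ x. (\<Sum>n. ennreal (2 ^ n * (d n x)\<^sup>2)) \<partial>lebesgue) = (\<Sum>n. \<integral>\<^sup>+ x. ennreal (2 ^ n * (d n x)\<^sup>2) \<partial>lebesgue)"
    by (rule nn_integral_suminf) measurable
  also have "\<dots> \<le> (\<Sum>n. ennreal (C\<^sup>2 * (1/2) ^ n))" by (intro suminf_le d2) auto
  also have "\<dots> = ennreal (\<Sum>n. C\<^sup>2 * (1/2) ^ n)" by (intro suminf_ennreal2 summable_mult summable_geometric) auto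
  also have "\<dots> < top" by simp
  finally have "AE x in lebesgue. (\<Sum>n. ennreal (2 ^ n * (d n x)\<^sup>2)) \<noteq> \<infinity>"
    by (intro nn_integral_PInf_AE) auto
  then show ?thesis
  proof eventually_elim
    case (elim x)
    define B where "B = enn2real (\<Sum>n. ennreal (2 ^ n * (d n x)\<^sup>2))"
    have B: "(\<Sum>n. ennreal (2 ^ n * (d n x)\<^sup>2)) = ennreal B" "B \<ge> 0"
      using elim by (simp_all only: B_def ennreal_enn2real less_top infinity_ennreal_def enn2real_nonneg)
    have le: "\<bar>d n x\<bar> \<le> sqrt B * (1 / sqrt 2) ^ n" for n
    proof -
      have "sum (\<lambda>n. ennreal (2 ^ n * (d n x)\<^sup>2)) {n} \<le> (\<Sum>n. ennreal (2 ^ n * (d n x)\<^sup>2))"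
        by (rule sum_le_suminf) auto
      then have "ennreal (2 ^ n * (d n x)\<^sup>2) \<le> ennreal B" unfolding B by (simp only: sum.insert sum.empty finite.emptyI empty_iff not_False_eq_True add_0_right)
      then have "2 ^ n * (d n x)\<^sup>2 \<le> B" by (rule ennreal_le_iff[OF B(2), THEN iffD1])
      then have "(d n x)\<^sup>2 \<le> B / 2 ^ n" by (simp add: field_simps)
      then have "sqrt ((d n x)\<^sup>2) \<le> sqrt (B / 2 ^ n)" by (rule real_sqrt_le_mono)
      also have "sqrt (B / 2 ^ n) = sqrt B * (1 / sqrt 2) ^ n"
        by (simp only: real_sqrt_divide real_sqrt_power power_divide power_one times_divide_eq_right mult_1_right)
      finally show ?thesis by simp
    qed
    have "summable (\<lambda>n. sqrt B * (1 / sqrt 2) ^ n)"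
      by (intro summable_mult summable_geometric) auto
    then have "summable (\<lambda>n. d n x)"
      by (rule summable_comparison_test'[where N=0]) (use le in simp)
    then have "convergent (\<lambda>n. \<Sum>i<n. d i x)" by (simp add: summable_iff_convergent)
    moreover have "(\<Sum>i<n. d i x) = rp (X n) x - rp (X 0) x" for n
      unfolding d_def by (rule sum_lessThan_telescope)
    ultimately have "convergent (\<lambda>n. rp (X n) x - rp (X 0) x + rp (X 0) x)"
      by (intro convergent_add convergent_const) simp
    then show ?case by simp
  qed
qed

text \<open>Fatou's lemma bounds the distance from the pointwise limit by the geometric tail. The
  limit \<open>g\<close> is prescribed so that it can also be a section of a jointly measurable
  function.\<close>

lemma fast_Cauchy_limit:
  fixes X :: "nat \<Rightarrow> 'a::euclidean_space l2"
  assumes X: "\<And>n. norm (X (Suc n) - X n) \<le> C * (1/2) ^ n" and "g \<in> borel_measurable lebesgue"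
    and lim: "AE x in lebesgue. (\<lambda>n. rp (X n) x) \<longlonglongrightarrow> g x"
  shows "sqint g" "X \<longlonglongrightarrow> cls g"
proof -
  note [measurable] = assms(2)
  have C: "C \<ge> 0" using order_trans[OF norm_ge_zero X[of 0]] by simp
  have dist: "norm (X (k + m) - X k) \<le> 2 * C * (1/2) ^ k" for k m
  proof -
    have "norm (X (k + m) - X k) \<le> (\<Sum>i<m. norm (X (k + Suc i) - X (k + i)))"
      using sum_lessThan_telescope[of "\<lambda>i. X (k + i)" m] norm_sum[of "\<lambda>i. X (k + Suc i) - X (k + i)" "{..<m}"] by simp
    also have "\<dots> \<le> (\<Sum>i<m. C * (1/2) ^ k * (1/2) ^ i)"
    proof (rule sum_mono)
      fix i show "norm (X (k + Suc i) - X (k + i)) \<le> C * (1/2) ^ k * (1/2) ^ i"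
        using X[of "k + i"] by (simp add: power_add mult.assoc)
    qed
    also have "\<dots> = C * (1/2) ^ k * (2 - 2 * (1/2) ^ m)"
      by (simp add: sum_distrib_left[symmetric] sum_gp_strict)
    also have "\<dots> \<le> C * (1/2) ^ k * 2" using C by (intro mult_left_mono) auto
    finally show ?thesis by (simp add: mult_ac)
  qed
  have le: "(\<integral>\<^sup>+ x. ennreal ((g x - rp (X k) x)\<^sup>2) \<partial>lebesgue) \<le> ennreal ((2 * C * (1/2) ^ k)\<^sup>2)" for k
  proof -
    have "(\<integral>\<^sup>+ x. ennreal ((g x - rp (X k) x)\<^sup>2) \<partial>lebesgue)
      = (\<integral>\<^sup>+ x. liminf (\<lambda>m. ennreal ((rp (X m) x - rp (X k) x)\<^sup>2)) \<partial>lebesgue)"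
    proof (rule nn_integral_cong_AE, rule AE_mp[OF lim], rule AE_I2, rule impI)
      fix x assume "(\<lambda>n. rp (X n) x) \<longlonglongrightarrow> g x"
      then have "(\<lambda>m. ennreal ((rp (X m) x - rp (X k) x)\<^sup>2)) \<longlonglongrightarrow> ennreal ((g x - rp (X k) x)\<^sup>2)"
        by (intro tendsto_intros)
      then show "ennreal ((g x - rp (X k) x)\<^sup>2) = liminf (\<lambda>m. ennreal ((rp (X m) x - rp (X k) x)\<^sup>2))"
        by (rule lim_imp_Liminf[OF trivial_limit_sequentially, symmetric])
    qed
    also have "\<dots> \<le> liminf (\<lambda>m. \<integral>\<^sup>+ x. ennreal ((rp (X m) x - rp (X k) x)\<^sup>2) \<partial>lebesgue)"
      by (rule nn_integral_liminf) measurable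
    also have "\<dots> = liminf (\<lambda>m. ennreal ((norm (X m - X k))\<^sup>2))" by (simp add: nn_norm_diff)
    also have "\<dots> \<le> ennreal ((2 * C * (1/2) ^ k)\<^sup>2)"
    proof -
      have "\<forall>\<^sub>F m in sequentially. ennreal ((norm (X m - X k))\<^sup>2) \<le> ennreal ((2 * C * (1/2) ^ k)\<^sup>2)"
        unfolding eventually_sequentially
      proof (intro exI[of _ k] allI impI)
        fix m assume "m \<ge> k"
        then show "ennreal ((norm (X m - X k))\<^sup>2) \<le> ennreal ((2 * C * (1/2) ^ k)\<^sup>2)"
          using dist[of k "m - k"] by (intro ennreal_leI power_mono) auto
      qed
      then have "liminf (\<lambda>m. ennreal ((norm (X m - X k))\<^sup>2)) \<le> liminf (\<lambda>m. ennreal ((2 * C * (1/2) ^ k)\<^sup>2))"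
        by (rule Liminf_mono)
      then show ?thesis by (simp add: Liminf_const)
    qed
    finally show ?thesis .
  qed
  have "sqint (\<lambda>x. g x - rp (X 0) x)"
    unfolding sqint_nn_integral using le[of 0] by (auto intro: order.strict_trans1)
  from sqint_add[OF this sqint_rp[of "X 0"]] show g: "sqint g" by simp
  have "norm (X k - cls g) \<le> 2 * C * (1/2) ^ k" for k
  proof -
    have "cls (\<lambda>x. g x - rp (X k) x) = cls g - X k" using cls_diff[OF g sqint_rp, of "X k"] by simp
    then have "ennreal ((norm (cls g - X k))\<^sup>2) \<le> ennreal ((2 * C * (1/2) ^ k)\<^sup>2)"
      using le[of k] nn_norm_cls[OF sqint_diff[OF g sqint_rp], of "X k"] by simp
    then have "(norm (cls g - X k))\<^sup>2 \<le> (2 * C * (1/2) ^ k)\<^sup>2" by (simp add: ennreal_le_iff)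
    then have "norm (cls g - X k) \<le> 2 * C * (1/2) ^ k" by (rule power2_le_imp_le) (use C in simp)
    then show ?thesis by (simp add: norm_minus_commute)
  qed
  moreover have "(\<lambda>k. 2 * C * (1/2) ^ k) \<longlonglongrightarrow> 0" by (intro tendsto_mult_right_zero LIMSEQ_power_zero) simp
  ultimately have "(\<lambda>k. X k - cls g) \<longlonglongrightarrow> 0" by (rule LIMSEQ_norm_bound)
  then show "X \<longlonglongrightarrow> cls g" by (simp add: LIM_zero_iff)
qed

lemma fast_Cauchy_converges:
  fixes X :: "nat \<Rightarrow> 'a::euclidean_space l2"
  assumes X: "\<And>n. norm (X (Suc n) - X n) \<le> C * (1/2) ^ n"
  obtains L where "X \<longlonglongrightarrow> L" "AE x in lebesgue. (\<lambda>n. rp (X n) x) \<longlonglongrightarrow> rp L x"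
proof -
  define g where "g x = lim (\<lambda>n. rp (X n) x)" for x
  have g: "g \<in> borel_measurable lebesgue" unfolding g_def[abs_def] by (rule borel_measurable_lim_metric) measurable
  have lim: "AE x in lebesgue. (\<lambda>n. rp (X n) x) \<longlonglongrightarrow> g x"
    using fast_Cauchy_AE_Cauchy[OF X] by eventually_elim (simp add: g_def convergent_LIMSEQ_iff)
  note * = fast_Cauchy_limit[OF X g lim]
  have "AE x in lebesgue. (\<lambda>n. rp (X n) x) \<longlonglongrightarrow> rp (cls g) x"
    using lim AE_rp_cls[OF *(1)] by eventually_elim simp
  then show ?thesis using that *(2) by blast
qed

lemma Cauchy_fast_subsequence:
  fixes X :: "nat \<Rightarrow> 'a::real_normed_vector"
  assumes "Cauchy X"
  obtains r where "strict_mono r" "\<And>n. norm (X (r (Suc n)) - X (r n)) \<le> 1 * (1/2) ^ n"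
proof -
  have "\<exists>N. \<forall>m\<ge>N. \<forall>n\<ge>N. dist (X m) (X n) < (1/2) ^ k" for k
    using assms by (auto simp: Cauchy_def)
  then obtain N where N: "\<And>k m n. m \<ge> N k \<Longrightarrow> n \<ge> N k \<Longrightarrow> dist (X m) (X n) < (1/2) ^ k" by metis
  have "\<exists>r. \<forall>k. N k \<le> r k \<and> r k < r (Suc k)"
  proof (rule dependent_nat_choice)
    show "\<exists>x. N 0 \<le> x" by blast
    show "\<exists>y. N (Suc n) \<le> y \<and> x < y" for x n by (intro exI[of _ "max (N (Suc n)) (Suc x)"]) auto
  qed
  then obtain r where r: "\<And>k. N k \<le> r k" "\<And>k. r k < r (Suc k)" by blast
  show ?thesis
  proof (rule that)
    show "strict_mono r" using r(2) by (simp add: strict_mono_Suc_iff)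
    show "norm (X (r (Suc n)) - X (r n)) \<le> 1 * (1/2) ^ n" for n
      using N[of n "r (Suc n)" "r n"] r(1)[of n] r(2)[of n] by (simp add: dist_norm)
  qed
qed

instance l2 :: (euclidean_space) complete_space
proof
  fix X :: "nat \<Rightarrow> 'a l2" assume X: "Cauchy X"
  obtain r where r: "strict_mono r" "\<And>n. norm (X (r (Suc n)) - X (r n)) \<le> 1 * (1/2) ^ n"
    using Cauchy_fast_subsequence[OF X] by blast
  obtain L where "(\<lambda>n. X (r n)) \<longlonglongrightarrow> L" using fast_Cauchy_converges[OF r(2)] by blast
  then have "X \<longlonglongrightarrow> L" using Cauchy_converges_subseq[OF X r(1)] by (simp add: o_def)
  then show "convergent X" by (rule convergentI)
qed

instance l2 :: (euclidean_space) banach ..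

lemma l2_tendsto_AE_subseq:
  fixes X :: "nat \<Rightarrow> 'a::euclidean_space l2"
  assumes X: "X \<longlonglongrightarrow> L"
  obtains r where "strict_mono r" "AE x in lebesgue. (\<lambda>n. rp (X (r n)) x) \<longlonglongrightarrow> rp L x"
proof -
  have "Cauchy X" using X by (rule LIMSEQ_imp_Cauchy)
  then obtain r where r: "strict_mono r" "\<And>n. norm (X (r (Suc n)) - X (r n)) \<le> 1 * (1/2) ^ n"
    using Cauchy_fast_subsequence by blast
  obtain L' where L': "(\<lambda>n. X (r n)) \<longlonglongrightarrow> L'" "AE x in lebesgue. (\<lambda>n. rp (X (r n)) x) \<longlonglongrightarrow> rp L' x"
    using fast_Cauchy_converges[OF r(2)] by blast
  have "(\<lambda>n. X (r n)) \<longlonglongrightarrow> L" using LIMSEQ_subseq_LIMSEQ[OF X r(1)] by (simp add: o_def)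
  then have "L' = L" using L'(1) LIMSEQ_unique by blast
  then show ?thesis using that r(1) L'(2) by blast
qed

section \<open>Extension by zero and the norm of \<open>L\<^sup>2(\<Omega>)\<close>\<close>

definition ext :: "'a set \<Rightarrow> ('a \<Rightarrow> real) \<Rightarrow> 'a \<Rightarrow> real" where
  "ext \<Omega> f x = (if x \<in> \<Omega> then f x else 0)"

lemma ext_indicator: "ext \<Omega> f = (\<lambda>x. indicator \<Omega> x * f x)"
  by (auto simp: ext_def)

lemma measurable_ext:
  assumes "\<Omega> \<in> sets lebesgue"
  shows "ext \<Omega> f \<in> borel_measurable lebesgue \<longleftrightarrow> f \<in> borel_measurable (lebesgue_on \<Omega>)"
proof -
  have "f \<in> borel_measurable (lebesgue_on \<Omega>) \<longleftrightarrow> (\<lambda>x. indicator \<Omega> x *\<^sub>R f x) \<in> borel_measurable lebesgue"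
    using assms by (intro borel_measurable_restrict_space_iff) simp
  then show ?thesis by (simp add: ext_indicator)
qed

lemma nn_integral_lebesgue_on:
  assumes "\<Omega> \<in> sets lebesgue"
  shows "(\<integral>\<^sup>+ x. h x \<partial>lebesgue_on \<Omega>) = (\<integral>\<^sup>+ x. indicator \<Omega> x * h x \<partial>lebesgue)"
  using assms by (subst nn_integral_restrict_space) (auto simp: mult.commute)

lemma integral_lebesgue_on:
  fixes h :: "_ \<Rightarrow> real"
  assumes "\<Omega> \<in> sets lebesgue"
  shows "(\<integral>x. h x \<partial>lebesgue_on \<Omega>) = (\<integral>x. indicator \<Omega> x * h x \<partial>lebesgue)"
  using assms by (subst integral_restrict_space) auto

lemma epowr_simps:
  "epowr top p = top" "a \<ge> 0 \<Longrightarrow> epowr (ennreal a) p = ennreal (a powr p)"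
  by (auto simp: epowr_def)

lemma Lnorm_2_ext:
  fixes \<Omega> :: "(real ^ 'n) set"
  assumes "\<Omega> \<in> sets lebesgue"
  shows "Lnorm \<Omega> 2 f = epowr (\<integral>\<^sup>+ x. ennreal ((ext \<Omega> f x)\<^sup>2) \<partial>lebesgue) (1/2)"
  unfolding Lnorm_def Lnorm_enn_def nn_integral_lebesgue_on[OF assms]
  by (intro arg_cong2[where f=epowr] refl nn_integral_cong) (auto simp: ext_def epowr_simps indicator_def)

lemma Lspace_2_iff:
  fixes \<Omega> :: "(real ^ 'n) set"
  assumes \<Omega>: "\<Omega> \<in> sets lebesgue"
  shows "f \<in> Lspace \<Omega> 2 \<longleftrightarrow> sqint (ext \<Omega> f)"
  unfolding Lspace_def sqint_nn_integral Lnorm_2_ext[OF \<Omega>] measurable_ext[OF \<Omega>]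
  by (auto simp: epowr_def top.not_eq_extremum split: if_splits)

lemma Lnorm_2_norm:
  fixes \<Omega> :: "(real ^ 'n) set"
  assumes \<Omega>: "\<Omega> \<in> sets lebesgue" and f: "f \<in> Lspace \<Omega> 2"
  shows "Lnorm \<Omega> 2 f = ennreal (norm (cls (ext \<Omega> f)))"
proof -
  have "Lnorm \<Omega> 2 f = epowr (ennreal ((norm (cls (ext \<Omega> f)))\<^sup>2)) (1/2)"
    using f unfolding Lnorm_2_ext[OF \<Omega>] Lspace_2_iff[OF \<Omega>] by (simp add: nn_norm_cls)
  also have "\<dots> = ennreal (norm (cls (ext \<Omega> f)))"
    by (simp add: epowr_simps powr_half_sqrt)
  finally show ?thesis .
qed

section \<open>Test functions\<close>

lemma partial_eq: "(f has_derivative f') (at x) \<Longrightarrow> partial i f x = f' (axis i 1)"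
  unfolding partial_def by (drule frechet_derivative_at) simp

lemma Ck_SucI:
  assumes "\<And>x. (f has_derivative f' x) (at x)" "\<And>i. Ck k (\<lambda>x. f' x (axis i 1))"
  shows "Ck (Suc k) f"
proof -
  have "partial i f = (\<lambda>x. f' x (axis i 1))" for i using partial_eq[OF assms(1)] by blast
  moreover have "\<forall>x. f differentiable (at x)" using assms(1) by (auto simp: differentiable_def)
  ultimately show ?thesis using assms(2) by simp
qed

lemma Ck_Suc_has_derivative: "Ck (Suc k) f \<Longrightarrow> (f has_derivative frechet_derivative f (at x)) (at x)"
  by (simp add: frechet_derivative_works)

lemma Ck_Suc_partial: "Ck (Suc k) f \<Longrightarrow> Ck k (partial i f)" by simp

lemma Ck_Suc_D: "Ck (Suc k) f \<Longrightarrow> Ck k f"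
proof (induction k arbitrary: f)
  case 0
  then have "isCont f x" for x using differentiable_imp_continuous_within[of f x UNIV] by simp
  then show ?case by (auto intro: continuous_at_imp_continuous_on)
next
  case (Suc k)
  then have "Ck k (partial i f)" for i using Ck_Suc_partial by blast
  then show ?case using Suc.prems by simp
qed

lemma Ck_continuous: "Ck k f \<Longrightarrow> continuous_on UNIV f"
  by (induction k) (auto dest: Ck_Suc_D simp del: Ck.simps(2))

lemma Ck_const: "Ck k (\<lambda>x. c)"
proof (induction k arbitrary: c)
  case (Suc k)
  show ?case by (rule Ck_SucI[where f'="\<lambda>x h. 0"]) (auto simp: Suc)
qed simp

lemma Ck_coordinate: "Ck k (\<lambda>x. x $ i)"
proof (cases k)
  case (Suc m)
  show ?thesis unfolding Suc
    by (rule Ck_SucI[where f'="\<lambda>x h. h $ i"]) (auto simp: Ck_const intro: bounded_linear_imp_has_derivative bounded_linear_vec_nth)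
qed (simp add: continuous_on_component)

lemma Ck_add: "Ck k f \<Longrightarrow> Ck k g \<Longrightarrow> Ck k (\<lambda>x. f x + g x)"
proof (induction k arbitrary: f g)
  case (Suc k)
  show ?case
  proof (rule Ck_SucI)
    show "((\<lambda>x. f x + g x) has_derivative (\<lambda>h. frechet_derivative f (at x) h + frechet_derivative g (at x) h)) (at x)" for x
      by (intro has_derivative_add Ck_Suc_has_derivative[OF Suc.prems(1)] Ck_Suc_has_derivative[OF Suc.prems(2)])
    show "Ck k (\<lambda>x. frechet_derivative f (at x) (axis i 1) + frechet_derivative g (at x) (axis i 1))" for i
      using Suc.IH[OF Ck_Suc_partial[OF Suc.prems(1)] Ck_Suc_partial[OF Suc.prems(2)], of i i] by (simp add: partial_def[abs_def])
  qed
qed (auto intro: continuous_on_add)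

lemma Ck_mult: "Ck k f \<Longrightarrow> Ck k g \<Longrightarrow> Ck k (\<lambda>x. f x * g x)"
proof (induction k arbitrary: f g)
  case (Suc k)
  show ?case
  proof (rule Ck_SucI)
    show "((\<lambda>x. f x * g x) has_derivative (\<lambda>h. f x * frechet_derivative g (at x) h + frechet_derivative f (at x) h * g x)) (at x)" for x
      by (intro has_derivative_mult Ck_Suc_has_derivative[OF Suc.prems(1)] Ck_Suc_has_derivative[OF Suc.prems(2)])
    have "Ck k (\<lambda>x. f x * partial i g x + partial i f x * g x)" for i
      using Suc.prems by (intro Ck_add Suc.IH Ck_Suc_D[of k f] Ck_Suc_D[of k g] Ck_Suc_partial)
    then show "Ck k (\<lambda>x. f x * frechet_derivative g (at x) (axis i 1) + frechet_derivative f (at x) (axis i 1) * g x)" for i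
      by (simp add: partial_def)
  qed
qed (auto intro: continuous_on_mult)

lemma Ck_prod: "finite S \<Longrightarrow> (\<And>i. i \<in> S \<Longrightarrow> Ck k (f i)) \<Longrightarrow> Ck k (\<lambda>x. \<Prod>i\<in>S. f i x)"
  by (induction S rule: finite_induct) (auto simp: Ck_const Ck_mult)

lemma has_derivative_compose_real:
  assumes f: "(f has_derivative f') (at x)" and h: "(h has_real_derivative d) (at (f x))"
  shows "((\<lambda>x. h (f x)) has_derivative (\<lambda>v. d * f' v)) (at x)"
  using has_derivative_compose[OF f, of h "(*) d"] h by (simp add: has_field_derivative_def)

text \<open>The whole tower \<open>D\<close> of derivatives is carried along, since differentiating
  \<open>D j\<close> after \<open>f\<close> produces \<open>D (Suc j)\<close> after \<open>f\<close>
  times a partial derivative.\<close>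

lemma Ck_compose_smooth:
  assumes D: "\<And>j x. (D j has_real_derivative D (Suc j) x) (at x)"
  shows "Ck k f \<Longrightarrow> Ck k (\<lambda>x. D j (f x))"
proof (induction k arbitrary: j)
  case 0
  have "continuous_on UNIV (D j)" by (rule DERIV_continuous_on[where D="D (Suc j)"]) (use D in auto)
  then show ?case using 0 by (auto intro: continuous_on_compose2)
next
  case (Suc k)
  show ?case
  proof (rule Ck_SucI)
    show "((\<lambda>x. D j (f x)) has_derivative (\<lambda>v. D (Suc j) (f x) * frechet_derivative f (at x) v)) (at x)" for x
      by (intro has_derivative_compose_real Ck_Suc_has_derivative[OF Suc.prems] D)
    show "Ck k (\<lambda>x. D (Suc j) (f x) * frechet_derivative f (at x) (axis i 1))" for i
      using Ck_mult[OF Suc.IH[OF Ck_Suc_D[OF Suc.prems]] Ck_Suc_partial[OF Suc.prems]] by (simp add: partial_def)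
  qed
qed

lemma Ck_poly: "Ck k f \<Longrightarrow> Ck k (\<lambda>x. poly p (f x))"
  using Ck_compose_smooth[of "\<lambda>j. poly ((pderiv ^^ j) p)" k f 0] by (simp add: poly_DERIV)

lemma test_function_poly:
  assumes "test_function \<Omega> \<phi>" "poly p 0 = 0" shows "test_function \<Omega> (\<lambda>x. poly p (\<phi> x))"
  using assms unfolding test_function_def by (auto simp: Ck_poly)

lemma test_function_add:
  assumes "test_function \<Omega> \<phi>" "test_function \<Omega> \<psi>" shows "test_function \<Omega> (\<lambda>x. \<phi> x + \<psi> x)"
proof -
  obtain K L where K: "compact K" "K \<subseteq> \<Omega>" "\<forall>x. x \<notin> K \<longrightarrow> \<phi> x = 0" and L: "compact L" "L \<subseteq> \<Omega>" "\<forall>x. x \<notin> L \<longrightarrow> \<psi> x = 0"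
    using assms by (auto simp: test_function_def)
  have "compact (K \<union> L)" "K \<union> L \<subseteq> \<Omega>" "\<forall>x. x \<notin> K \<union> L \<longrightarrow> \<phi> x + \<psi> x = 0" using K L by (auto intro: compact_Un)
  then show ?thesis using assms unfolding test_function_def by (auto simp: Ck_add)
qed

lemma test_function_scale: "test_function \<Omega> \<phi> \<Longrightarrow> test_function \<Omega> (\<lambda>x. c * \<phi> x)"
  using test_function_poly[of \<Omega> \<phi> "[:0, c:]"] by (simp add: mult.commute)

lemma test_function_mult: "test_function \<Omega> \<phi> \<Longrightarrow> test_function \<Omega> \<psi> \<Longrightarrow> test_function \<Omega> (\<lambda>x. \<phi> x * \<psi> x)"
  unfolding test_function_def by (auto simp: Ck_mult)

lemma test_function_zero: "test_function \<Omega> (\<lambda>x. 0)"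
  unfolding test_function_def by (auto simp: Ck_const intro!: exI[of _ "{}"])

lemma test_function_has_derivative:
  "test_function \<Omega> \<phi> \<Longrightarrow> (\<phi> has_derivative frechet_derivative \<phi> (at x)) (at x)"
  unfolding test_function_def using Ck_Suc_has_derivative by blast

lemma test_function_partial:
  assumes "test_function \<Omega> \<phi>" shows "test_function \<Omega> (partial i \<phi>)"
proof -
  obtain K where K: "compact K" "K \<subseteq> \<Omega>" "\<forall>x. x \<notin> K \<longrightarrow> \<phi> x = 0" and C: "\<forall>k. Ck k \<phi>"
    using assms by (auto simp: test_function_def)
  have "partial i \<phi> x = 0" if "x \<notin> K" for x
  proof -
    have "(\<phi> has_derivative (\<lambda>h. 0)) (at x)"
    proof (rule has_derivative_transform_within_open)
      show "((\<lambda>x. 0) has_derivative (\<lambda>h. 0)) (at x)" by simp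
      show "open (- K)" using compact_imp_closed[OF K(1)] by (simp add: open_Compl)
    qed (use K that in auto)
    then show ?thesis using partial_eq by fastforce
  qed
  then show ?thesis unfolding test_function_def using C K Ck_Suc_partial by blast
qed

lemma partial_mult:
  assumes "(\<phi> has_derivative \<phi>') (at x)" "(\<psi> has_derivative \<psi>') (at x)"
  shows "partial i (\<lambda>x. \<phi> x * \<psi> x) x = \<phi> x * partial i \<psi> x + partial i \<phi> x * \<psi> x"
  using partial_eq[OF has_derivative_mult[OF assms]] partial_eq[OF assms(1)] partial_eq[OF assms(2)] by simp

section \<open>Integration by parts and a weighted Poincare inequality\<close>

lemma integrable_compact_support:
  fixes \<psi> :: "'a::euclidean_space \<Rightarrow> real"
  assumes c: "continuous_on UNIV \<psi>" and K: "compact K" "\<And>x. x \<notin> K \<Longrightarrow> \<psi> x = 0"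
  shows "integrable lborel \<psi>"
proof -
  have "integrable lborel (\<lambda>x. indicator K x *\<^sub>R \<psi> x)"
    by (rule borel_integrable_compact[OF K(1)]) (use c continuous_on_subset in blast)
  moreover have "(\<lambda>x. indicator K x *\<^sub>R \<psi> x) = \<psi>"
  proof
    fix x show "indicator K x *\<^sub>R \<psi> x = \<psi> x" using K(2)[of x] by (cases "x \<in> K") auto
  qed
  ultimately show ?thesis by simp
qed

lemma test_function_continuous: "test_function \<Omega> \<phi> \<Longrightarrow> continuous_on UNIV \<phi>"
  unfolding test_function_def using Ck_continuous by blast

lemma continuous_measurable_lebesgue:
  fixes \<psi> :: "'a::euclidean_space \<Rightarrow> real"
  shows "continuous_on UNIV \<psi> \<Longrightarrow> \<psi> \<in> borel_measurable lebesgue"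
  by (rule measurable_completion) (simp add: borel_measurable_continuous_onI)

lemma sqint_test_function:
  assumes "test_function \<Omega> \<phi>" shows "sqint \<phi>"
  unfolding sqint_def
proof
  obtain K where K: "compact K" "\<And>x. x \<notin> K \<Longrightarrow> \<phi> x = 0" using assms by (auto simp: test_function_def)
  note c = test_function_continuous[OF assms]
  show "\<phi> \<in> borel_measurable lebesgue" using c by (rule continuous_measurable_lebesgue)
  have "integrable lborel (\<lambda>x. (\<phi> x)\<^sup>2)"
    by (rule integrable_compact_support[OF _ K(1)]) (use c K in \<open>auto intro!: continuous_intros\<close>)
  then show "integrable lebesgue (\<lambda>x. (\<phi> x)\<^sup>2)" by (rule integrable_completion[THEN iffD2, rotated]) (use c in \<open>auto intro!: borel_measurable_continuous_onI continuous_intros\<close>)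
qed

text \<open>The difference quotients in direction \<open>e\<close> have integral 0 by translation
  invariance. The mean value theorem bounds them by the supremum of the derivative, and dominated
  convergence gives the claim without iterated integrals.\<close>

lemma integral_partial_zero:
  fixes \<psi> :: "real ^ 'n \<Rightarrow> real"
  assumes d: "\<And>x. (\<psi> has_derivative \<psi>' x) (at x)" and c: "continuous_on UNIV (partial i \<psi>)"
    and K: "compact K" "\<And>x. x \<notin> K \<Longrightarrow> \<psi> x = 0"
  shows "(\<integral>x. partial i \<psi> x \<partial>lborel) = 0"
proof -
  define e :: "real ^ 'n" where "e = axis i 1"
  define s where "s n = 1 / real (Suc n)" for n
  have s: "s n > 0" "s n \<le> 1" for n by (auto simp: s_def)
  have s0: "s \<longlonglongrightarrow> 0" unfolding s_def[abs_def] by (rule lim_inverse_Suc)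
  define q where "q n x = (\<psi> (x + s n *\<^sub>R e) - \<psi> x) / s n" for n x
  have dline: "((\<lambda>t. \<psi> (x + t *\<^sub>R e)) has_real_derivative partial i \<psi> (x + t *\<^sub>R e)) (at t)" for x t
  proof -
    have "((\<lambda>t. x + t *\<^sub>R e) has_derivative (\<lambda>t. t *\<^sub>R e)) (at t)" by (auto intro!: derivative_eq_intros)
    from has_derivative_compose[OF this d] have "((\<lambda>t. \<psi> (x + t *\<^sub>R e)) has_derivative (\<lambda>r. \<psi>' (x + t *\<^sub>R e) (r *\<^sub>R e))) (at t)" .
    moreover have "\<psi>' y (r *\<^sub>R e) = partial i \<psi> y * r" for y r
      using partial_eq[OF d] linear_cmul[OF has_derivative_linear[OF d]] by (simp add: e_def)
    ultimately show ?thesis by (simp add: has_field_derivative_def mult_commute_abs)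
  qed
  have cpsi: "continuous_on UNIV \<psi>" using d has_derivative_continuous continuous_at_imp_continuous_on by blast
  have "bounded (partial i \<psi> ` K)"
    by (intro compact_imp_bounded compact_continuous_image K continuous_on_subset[OF c]) auto
  then obtain M0 where M0: "\<And>x. x \<in> K \<Longrightarrow> \<bar>partial i \<psi> x\<bar> \<le> M0" by (auto simp: bounded_iff)
  define M where "M = max M0 0"
  have pz: "partial i \<psi> x = 0" if "x \<notin> K" for x
  proof -
    have "(\<psi> has_derivative (\<lambda>h. 0)) (at x)"
    proof (rule has_derivative_transform_within_open)
      show "((\<lambda>x. 0) has_derivative (\<lambda>h. 0)) (at x)" by simp
      show "open (- K)" using compact_imp_closed[OF K(1)] by (simp add: open_Compl)
    qed (use K that in auto)
    then show ?thesis using partial_eq by fastforce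
  qed
  have M: "\<bar>partial i \<psi> x\<bar> \<le> M" for x
    using M0[of x] pz[of x] by (cases "x \<in> K") (auto simp: M_def)
  \<comment> \<open>\<open>K\<close> swept backwards along \<open>e\<close> over length 1. It
    contains the support of every difference quotient because all steps \<open>s n\<close> are at
    most 1.\<close>
  define K' where "K' = (\<lambda>(y, t). y - t *\<^sub>R e) ` (K \<times> {0..1::real})"
  have K': "compact K'" unfolding K'_def case_prod_unfold
    by (intro compact_continuous_image compact_Times K compact_Icc continuous_intros)
  have qz: "q n x = 0" if "x \<notin> K'" for n x
  proof -
    have "x \<notin> K"
    proof
      assume "x \<in> K"
      then have "x \<in> K'" unfolding K'_def by (intro image_eqI[of _ _ "(x, 0)"]) auto
      then show False using that by simp
    qed
    moreover have "x + s n *\<^sub>R e \<notin> K"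
    proof
      assume "x + s n *\<^sub>R e \<in> K"
      then have "x \<in> K'" unfolding K'_def using s[of n] by (intro image_eqI[of _ _ "(x + s n *\<^sub>R e, s n)"]) auto
      then show False using that by simp
    qed
    ultimately show ?thesis using K by (simp add: q_def)
  qed
  have qM: "\<bar>q n x\<bar> \<le> M" for n x
  proof -
    obtain z where "\<psi> (x + s n *\<^sub>R e) - \<psi> (x + 0 *\<^sub>R e) = (s n - 0) * partial i \<psi> (x + z *\<^sub>R e)"
      using MVT2[OF s(1)[of n], of "\<lambda>t. \<psi> (x + t *\<^sub>R e)" "\<lambda>t. partial i \<psi> (x + t *\<^sub>R e)"] dline by blast
    then have "q n x = partial i \<psi> (x + z *\<^sub>R e)" using s(1)[of n] by (simp add: q_def)
    then show ?thesis using M by simp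
  qed
  have qlim: "(\<lambda>n. q n x) \<longlonglongrightarrow> partial i \<psi> x" for x
  proof -
    have "((\<lambda>h. (\<psi> (x + h *\<^sub>R e) - \<psi> x) / h) \<longlongrightarrow> partial i \<psi> x) (at 0)"
      using dline[of x 0] by (simp add: DERIV_def)
    moreover have "filterlim s (at 0) sequentially" using s0 s(1) by (auto simp: filterlim_at less_imp_neq intro!: always_eventually) (metis less_irrefl)
    ultimately show ?thesis unfolding q_def by (rule filterlim_compose)
  qed
  have [measurable]: "\<psi> \<in> borel_measurable borel" "partial i \<psi> \<in> borel_measurable borel"
    using cpsi c by (auto intro: borel_measurable_continuous_onI)
  have "(\<lambda>n. \<integral>x. q n x \<partial>lborel) \<longlonglongrightarrow> (\<integral>x. partial i \<psi> x \<partial>lborel)"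
  proof (rule integral_dominated_convergence[where w="\<lambda>x. M * indicator K' x"])
    have "emeasure lborel K' < \<infinity>" using K' by (intro emeasure_bounded_finite compact_imp_bounded)
    moreover have "K' \<in> sets lborel" using borel_closed[OF compact_imp_closed[OF K']] by simp
    ultimately show "integrable lborel (\<lambda>x. M * indicator K' x)" by (intro integrable_mult_right integrable_real_indicator)
    show "AE x in lborel. norm (q n x) \<le> M * indicator K' x" for n
    proof (rule AE_I2)
      fix x show "norm (q n x) \<le> M * indicator K' x" using qM[of n x] qz[of x n] by (cases "x \<in> K'") auto
    qed
    show "AE x in lborel. (\<lambda>n. q n x) \<longlonglongrightarrow> partial i \<psi> x" using qlim by simp
  qed (unfold q_def, measurable)
  moreover have "(\<integral>x. q n x \<partial>lborel) = 0" for n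
  proof -
    have int: "integrable lborel \<psi>" using integrable_compact_support[OF cpsi K] .
    have "(\<integral>x. \<psi> x \<partial>lborel) = (\<integral>x. \<psi> x \<partial>distr lborel borel ((+) (s n *\<^sub>R e)))" by (simp only: lborel_distr_plus)
    also have "\<dots> = (\<integral>x. \<psi> (s n *\<^sub>R e + x) \<partial>lborel)" by (intro integral_distr) auto
    finally have eq: "(\<integral>x. \<psi> (x + s n *\<^sub>R e) \<partial>lborel) = (\<integral>x. \<psi> x \<partial>lborel)" by (simp add: add.commute)
    have "integrable (distr lborel borel ((+) (s n *\<^sub>R e))) \<psi>" using int by (simp only: lborel_distr_plus)
    then have "integrable lborel (\<lambda>x. \<psi> (x + s n *\<^sub>R e))" by (subst (asm) integrable_distr_eq) (auto simp: add.commute)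
    then show ?thesis using int eq by (simp add: q_def)
  qed
  ultimately have "(\<lambda>n. 0) \<longlonglongrightarrow> (\<integral>x. partial i \<psi> x \<partial>lborel)" by simp
  then show ?thesis using LIMSEQ_unique tendsto_const by blast
qed

lemma integral_lebesgue_borel:
  fixes f :: "'a::euclidean_space \<Rightarrow> real"
  shows "f \<in> borel_measurable borel \<Longrightarrow> (\<integral>x. f x \<partial>lebesgue) = (\<integral>x. f x \<partial>lborel)"
  by (rule integral_completion) simp

lemma test_function_integration_by_parts:
  fixes \<phi> \<psi> :: "real ^ 'n \<Rightarrow> real"
  assumes \<phi>: "test_function \<Omega> \<phi>" and \<psi>: "test_function \<Omega>' \<psi>"
  shows "(\<integral>x. \<phi> x * partial i \<psi> x \<partial>lebesgue) = - (\<integral>x. partial i \<phi> x * \<psi> x \<partial>lebesgue)"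
proof -
  have t: "test_function UNIV \<phi>" "test_function UNIV \<psi>" using \<phi> \<psi> by (auto simp: test_function_def)
  note tm = test_function_mult[OF t]
  obtain K where K: "compact K" "\<And>x. x \<notin> K \<Longrightarrow> \<phi> x * \<psi> x = 0" using tm unfolding test_function_def by blast
  have p: "partial i (\<lambda>x. \<phi> x * \<psi> x) = (\<lambda>x. \<phi> x * partial i \<psi> x + partial i \<phi> x * \<psi> x)"
    using partial_mult[OF test_function_has_derivative[OF \<phi>] test_function_has_derivative[OF \<psi>]] by blast
  have c: "continuous_on UNIV (partial i (\<lambda>x. \<phi> x * \<psi> x))"
    by (rule test_function_continuous[OF test_function_partial[OF tm]])
  have "(\<integral>x. partial i (\<lambda>x. \<phi> x * \<psi> x) x \<partial>lborel) = 0"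
    by (rule integral_partial_zero[OF test_function_has_derivative[OF tm] c K])
  then have "(\<integral>x. \<phi> x * partial i \<psi> x + partial i \<phi> x * \<psi> x \<partial>lebesgue) = 0"
    using c by (subst integral_lebesgue_borel) (auto simp: p intro: borel_measurable_continuous_onI)
  moreover have "integrable lebesgue (\<lambda>x. \<phi> x * partial i \<psi> x)" "integrable lebesgue (\<lambda>x. partial i \<phi> x * \<psi> x)"
    using \<phi> \<psi> by (auto intro!: sqint_mult_integrable intro: sqint_test_function test_function_partial)
  ultimately show ?thesis by simp
qed

text \<open>Obtained by integrating \<open>\<partial>\<^sub>i (arctan x\<^sub>i * \<phi>\<^sup>2)\<close>, which avoids any Fubini argument.\<close>
lemma weighted_poincare:
  fixes \<phi> :: "real ^ 'n \<Rightarrow> real"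
  assumes \<phi>: "test_function \<Omega> \<phi>"
  shows "(\<integral>x. (1 / sqrt (1 + (x $ i)\<^sup>2) * \<phi> x)\<^sup>2 \<partial>lebesgue) \<le> pi * (norm (cls \<phi>) * norm (cls (partial i \<phi>)))"
    "sqint (\<lambda>x. 1 / sqrt (1 + (x $ i)\<^sup>2) * \<phi> x)"
proof -
  let ?w = "\<lambda>x :: real ^ 'n. 1 / (1 + (x $ i)\<^sup>2)"
  have sqi: "continuous_on UNIV (\<lambda>x::real^'n. x $ i)" by (intro continuous_on_component continuous_on_id)
  have pos: "1 + t\<^sup>2 > 0" for t :: real by (simp add: add_pos_nonneg)
  have cphi: "continuous_on UNIV \<phi>" "continuous_on UNIV (partial i \<phi>)"
    using \<phi> by (auto intro: test_function_continuous test_function_partial)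
  define \<psi> where "\<psi> x = arctan (x $ i) * (\<phi> x * \<phi> x)" for x
  let ?D = "\<lambda>x. frechet_derivative \<phi> (at x)"
  have darc: "((\<lambda>x. arctan (x $ i)) has_derivative (\<lambda>h. ?w x * (h $ i))) (at x)" for x
  proof (rule has_derivative_compose_real[where h=arctan])
    show "((\<lambda>x. x $ i) has_derivative (\<lambda>h. h $ i)) (at x)" by (intro bounded_linear_imp_has_derivative bounded_linear_vec_nth)
    show "(arctan has_real_derivative ?w x) (at (x $ i))" using DERIV_arctan[of "x $ i"] by (simp add: inverse_eq_divide)
  qed
  have d2: "((\<lambda>x. \<phi> x * \<phi> x) has_derivative (\<lambda>h. \<phi> x * ?D x h + ?D x h * \<phi> x)) (at x)" for x
    by (intro has_derivative_mult test_function_has_derivative[OF \<phi>])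
  have d: "(\<psi> has_derivative (\<lambda>h. arctan (x $ i) * (\<phi> x * ?D x h + ?D x h * \<phi> x) + ?w x * (h $ i) * (\<phi> x * \<phi> x))) (at x)" for x
    unfolding \<psi>_def by (rule has_derivative_mult[OF darc d2])
  have p: "partial i \<psi> = (\<lambda>x. 2 * arctan (x $ i) * (\<phi> x * partial i \<phi> x) + ?w x * (\<phi> x * \<phi> x))"
    using partial_eq[OF d, of i] by (intro ext) (simp add: partial_def axis_def)
  have cw: "continuous_on UNIV ?w" using pos by (intro continuous_intros sqi) (metis less_irrefl)
  have c: "continuous_on UNIV (partial i \<psi>)" unfolding p by (intro continuous_intros sqi cphi cw)
  obtain K where K: "compact K" "\<And>x. x \<notin> K \<Longrightarrow> \<phi> x = 0" using \<phi> unfolding test_function_def by blast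
  have "(\<integral>x. partial i \<psi> x \<partial>lborel) = 0"
    by (rule integral_partial_zero[OF d c K(1)]) (simp add: \<psi>_def K(2))
  then have zero: "(\<integral>x. partial i \<psi> x \<partial>lebesgue) = 0"
    using c by (subst integral_lebesgue_borel) (auto intro: borel_measurable_continuous_onI)
  note sq = sqint_test_function[OF \<phi>] sqint_test_function[OF test_function_partial[OF \<phi>], of i]
  have ms: "(\<lambda>x::real^'n. 1 / sqrt (1 + (x $ i)\<^sup>2)) \<in> borel_measurable lebesgue"
  proof (rule continuous_measurable_lebesgue)
    have "sqrt (1 + t\<^sup>2) \<noteq> 0" for t :: real using pos[of t] by (metis less_irrefl real_sqrt_eq_zero_cancel_iff)
    then show "continuous_on UNIV (\<lambda>x::real^'n. 1 / sqrt (1 + (x $ i)\<^sup>2))" by (intro continuous_intros sqi) auto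
  qed
  show s1: "sqint (\<lambda>x. 1 / sqrt (1 + (x $ i)\<^sup>2) * \<phi> x)"
  proof (rule sqint_bound[OF sq(1), where C=1])
    show "(\<lambda>x. 1 / sqrt (1 + (x $ i)\<^sup>2) * \<phi> x) \<in> borel_measurable lebesgue"
      using ms sqint_measurable[OF sq(1)] by (rule borel_measurable_times)
    have "1 / sqrt (1 + t\<^sup>2) \<le> 1" for t :: real using pos[of t] by (simp add: divide_le_eq)
    then have "1 / sqrt (1 + t\<^sup>2) * \<bar>a\<bar> \<le> 1 * \<bar>a\<bar>" for t a :: real by (intro mult_right_mono) auto
    then show "AE x in lebesgue. \<bar>1 / sqrt (1 + (x $ i)\<^sup>2) * \<phi> x\<bar> \<le> 1 * \<bar>\<phi> x\<bar>" by (simp add: abs_mult)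
  qed
  \<comment> \<open>The bound pi / 2 for arctan, times the factor 2 from differentiating
    \<open>\<phi>\<^sup>2\<close>, is the constant pi of the claim.\<close>
  have s2: "sqint (\<lambda>x. arctan (x $ i) * \<phi> x)" and s2le: "norm (cls (\<lambda>x. arctan (x $ i) * \<phi> x)) \<le> (pi / 2) * norm (cls \<phi>)"
  proof -
    have "\<bar>arctan t\<bar> * \<bar>a\<bar> \<le> (pi / 2) * \<bar>a\<bar>" for t a :: real
      using arctan_bounded[of t] by (intro mult_right_mono) auto
    then have ae: "AE x in lebesgue. \<bar>arctan (x $ i) * \<phi> x\<bar> \<le> (pi / 2) * \<bar>\<phi> x\<bar>" by (simp add: abs_mult)
    have "(\<lambda>x. arctan (x $ i) * \<phi> x) \<in> borel_measurable lebesgue"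
      by (intro continuous_measurable_lebesgue continuous_intros sqi cphi)
    then show s: "sqint (\<lambda>x. arctan (x $ i) * \<phi> x)" using sqint_bound[OF sq(1) _ ae] by blast
    show "norm (cls (\<lambda>x. arctan (x $ i) * \<phi> x)) \<le> (pi / 2) * norm (cls \<phi>)"
      by (rule norm_cls_mono[OF s sq(1) ae]) simp
  qed
  have e1: "(1 / sqrt (1 + (x $ i)\<^sup>2) * \<phi> x)\<^sup>2 = ?w x * (\<phi> x * \<phi> x)" for x :: "real ^ 'n"
    using pos[of "x $ i"] by (simp add: power_mult_distrib power_divide power2_eq_square[of "\<phi> x"])
  have i1: "integrable lebesgue (\<lambda>x. ?w x * (\<phi> x * \<phi> x))" using sqint_integrable[OF s1] unfolding e1 .
  have i2: "integrable lebesgue (\<lambda>x. (arctan (x $ i) * \<phi> x) * partial i \<phi> x)" using sqint_mult_integrable[OF s2 sq(2)] .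
  have "(\<integral>x. 2 * ((arctan (x $ i) * \<phi> x) * partial i \<phi> x) + ?w x * (\<phi> x * \<phi> x) \<partial>lebesgue) = 0"
    using zero unfolding p by (simp add: mult_ac)
  then have "(\<integral>x. ?w x * (\<phi> x * \<phi> x) \<partial>lebesgue) = - 2 * (\<integral>x. (arctan (x $ i) * \<phi> x) * partial i \<phi> x \<partial>lebesgue)"
    using i1 i2 by simp
  also have "\<dots> = - 2 * inner (cls (\<lambda>x. arctan (x $ i) * \<phi> x)) (cls (partial i \<phi>))" by (simp add: inner_cls s2 sq)
  also have "\<dots> \<le> 2 * \<bar>inner (cls (\<lambda>x. arctan (x $ i) * \<phi> x)) (cls (partial i \<phi>))\<bar>" by simp
  also have "\<dots> \<le> 2 * (norm (cls (\<lambda>x. arctan (x $ i) * \<phi> x)) * norm (cls (partial i \<phi>)))"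
    by (intro mult_left_mono Cauchy_Schwarz_ineq2) auto
  also have "\<dots> \<le> 2 * ((pi / 2 * norm (cls \<phi>)) * norm (cls (partial i \<phi>)))"
    by (intro mult_left_mono mult_right_mono s2le) auto
  finally show "(\<integral>x. (1 / sqrt (1 + (x $ i)\<^sup>2) * \<phi> x)\<^sup>2 \<partial>lebesgue) \<le> pi * (norm (cls \<phi>) * norm (cls (partial i \<phi>)))"
    unfolding e1 by simp
qed

section \<open>Smooth bump functions and the fundamental lemma of the calculus of variations\<close>

primrec flat_poly :: "real \<Rightarrow> nat \<Rightarrow> real poly" where
  "flat_poly c 0 = [:1:]"
| "flat_poly c (Suc j) = [:0, 0, 1:] * (smult c (flat_poly c j) - pderiv (flat_poly c j))"

text \<open>\<open>flat c j\<close> is the \<open>j\<close>-th derivative of \<open>exp (- c / x)\<close>, continued by \<open>0\<close>.\<close>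

definition flat :: "real \<Rightarrow> nat \<Rightarrow> real \<Rightarrow> real" where
  "flat c j x = (if x \<le> 0 then 0 else poly (flat_poly c j) (1 / x) * exp (- (c / x)))"

lemma poly_times_exp_tendsto_0:
  fixes p :: "real poly"
  assumes "c > 0" shows "((\<lambda>y. poly p y * exp (- (c * y))) \<longlongrightarrow> 0) at_top"
proof -
  have "((\<lambda>y. coeff p k * (1 / c ^ k) * ((c * y) ^ k / exp (c * y))) \<longlongrightarrow> 0) at_top" for k
  proof -
    have "filterlim (\<lambda>y. c * y) at_top at_top" using assms by (intro filterlim_tendsto_pos_mult_at_top[OF tendsto_const] filterlim_ident)
    from filterlim_compose[OF tendsto_power_div_exp_0 this] show ?thesis by (intro tendsto_mult_right_zero)
  qed
  then have "((\<lambda>y. \<Sum>k\<le>degree p. coeff p k * (1 / c ^ k) * ((c * y) ^ k / exp (c * y))) \<longlongrightarrow> 0) at_top"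
    by (intro tendsto_null_sum)
  moreover have "(\<Sum>k\<le>degree p. coeff p k * (1 / c ^ k) * ((c * y) ^ k / exp (c * y))) = poly p y * exp (- (c * y))" for y
    unfolding poly_altdef sum_distrib_right
    using assms by (intro sum.cong refl) (simp add: exp_minus power_mult_distrib field_simps)
  ultimately show ?thesis by simp
qed

lemma flat_has_derivative:
  assumes c: "c > 0" shows "(flat c j has_real_derivative flat c (Suc j) x) (at x)"
proof -
  consider "x < 0" | "x = 0" | "x > 0" by linarith
  then show ?thesis
  proof cases
    case 1
    have "((\<lambda>x. 0) has_real_derivative 0) (at x)" by simp
    then have "(flat c j has_real_derivative 0) (at x)"
      by (rule has_field_derivative_transform_within_open[where S="{..<0}"]) (use 1 in \<open>auto simp: flat_def\<close>)
    then show ?thesis using 1 by (simp add: flat_def)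
  next
    case 3
    let ?p = "flat_poly c j"
    \<comment> \<open>With y = 1/x the derivative of P(y) e^(-cy) with respect to x is y^2 (c P(y) -
      P'(y)) e^(-cy). This is the recursion of \<open>flat_poly\<close>, where
      \<open>[:0, 0, 1:]\<close> is y^2.\<close>
    have "((\<lambda>x. poly ?p (1 / x) * exp (- (c / x))) has_real_derivative
        (poly (pderiv ?p) (1 / x) * (- 1 / x\<^sup>2)) * exp (- (c / x)) + exp (- (c / x)) * (c / x\<^sup>2) * poly ?p (1 / x)) (at x)"
      using 3 by (auto intro!: derivative_eq_intros DERIV_chain2[OF poly_DERIV] simp: power2_eq_square)
    moreover have "(poly (pderiv ?p) (1 / x) * (- 1 / x\<^sup>2)) * exp (- (c / x)) + exp (- (c / x)) * (c / x\<^sup>2) * poly ?p (1 / x) = flat c (Suc j) x"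
      using 3 by (simp add: flat_def power2_eq_square field_simps)
    ultimately have "((\<lambda>x. poly ?p (1 / x) * exp (- (c / x))) has_real_derivative flat c (Suc j) x) (at x)" by simp
    then show ?thesis
      by (rule has_field_derivative_transform_within_open[where S="{0<..}"]) (use 3 in \<open>auto simp: flat_def\<close>)
  next
    case 2
    have "((\<lambda>h. flat c j h / h) \<longlongrightarrow> 0) (at_right 0)"
    proof -
      \<comment> \<open>The extra factor \<open>[:0, 1:]\<close> is the division by \<open>h\<close>
        in the difference quotient at 0, after the substitution \<open>y = 1 / h\<close>.\<close>
      have "((\<lambda>y. poly ([:0, 1:] * flat_poly c j) y * exp (- (c * y))) \<longlongrightarrow> 0) at_top"
        by (rule poly_times_exp_tendsto_0[OF c])
      from filterlim_compose[OF this filterlim_inverse_at_top_right]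
      have "((\<lambda>h. poly ([:0, 1:] * flat_poly c j) (inverse h) * exp (- (c * inverse h))) \<longlongrightarrow> 0) (at_right 0)" .
      moreover have "\<forall>\<^sub>F h in at_right 0. poly ([:0, 1:] * flat_poly c j) (inverse h) * exp (- (c * inverse h)) = flat c j h / h"
        by (auto simp: eventually_at_filter flat_def divide_inverse)
      ultimately show ?thesis by (rule Lim_transform_eventually)
    qed
    moreover have "((\<lambda>h. flat c j h / h) \<longlongrightarrow> 0) (at_left 0)"
      by (rule tendsto_eventually) (auto simp: eventually_at_filter flat_def)
    ultimately have "((\<lambda>h. flat c j h / h) \<longlongrightarrow> 0) (at 0)" by (simp add: filterlim_split_at)
    then show ?thesis using 2 by (simp add: DERIV_def flat_def)
  qed
qed

lemma flat_0: "flat c 0 x = (if x \<le> 0 then 0 else exp (- (c / x)))"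
  by (simp add: flat_def)

text \<open>Each factor is exp (-c / distance to one face). For c tending to 0 the products converge
  to the indicator of the open box, so neither mollification nor normalisation is required.\<close>

definition box_bump :: "real \<Rightarrow> real ^ 'n \<Rightarrow> real ^ 'n \<Rightarrow> real ^ 'n \<Rightarrow> real" where
  "box_bump c a b x = (\<Prod>i\<in>UNIV. flat c 0 (x $ i - a $ i) * flat c 0 (b $ i - x $ i))"

lemma box_bump_test_function:
  assumes "c > 0" "cbox a b \<subseteq> \<Omega>" shows "test_function \<Omega> (box_bump c a b)"
proof -
  have "Ck k (box_bump c a b)" for k
    unfolding box_bump_def
  proof (intro Ck_prod Ck_mult Ck_compose_smooth[of "flat c"] flat_has_derivative assms)
    show "Ck k (\<lambda>x. x $ i - a $ i)" "Ck k (\<lambda>x. b $ i - x $ i)" for i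
      using Ck_poly[OF Ck_coordinate, of k "[:- a $ i, 1:]" i] Ck_poly[OF Ck_coordinate, of k "[:b $ i, -1:]" i] by simp_all
  qed simp
  moreover have "box_bump c a b x = 0" if nx: "x \<notin> cbox a b" for x
  proof -
    obtain i where "x $ i < a $ i \<or> b $ i < x $ i" using nx by (auto simp: mem_box_cart not_le)
    then show ?thesis unfolding box_bump_def by (intro prod_zero bexI[of _ i]) (auto simp: flat_0)
  qed
  ultimately show ?thesis using assms(2) by (auto simp: test_function_def intro!: exI[of _ "cbox a b"])
qed

lemma flat_0_bounds: "c > 0 \<Longrightarrow> 0 \<le> flat c 0 x" "c > 0 \<Longrightarrow> flat c 0 x \<le> 1"
  by (auto simp: flat_0)

lemma flat_0_tendsto: "(\<lambda>n. flat (1 / real (Suc n)) 0 t) \<longlonglongrightarrow> (if t > 0 then 1 else 0)"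
proof (cases "t > 0")
  case True
  have "(\<lambda>n. exp (- (1 / real (Suc n) / t))) \<longlonglongrightarrow> exp (- (0 / t))"
    using True by (intro tendsto_intros lim_inverse_Suc) auto
  then show ?thesis using True by (simp add: flat_0)
qed (simp add: flat_0)

lemma box_bump_tendsto: "(\<lambda>n. box_bump (1 / real (Suc n)) a b x) \<longlonglongrightarrow> indicator (box a b) x"
proof -
  have "(\<lambda>n. box_bump (1 / real (Suc n)) a b x) \<longlonglongrightarrow>
     (\<Prod>i\<in>UNIV. (if x $ i - a $ i > 0 then 1 else 0) * (if b $ i - x $ i > 0 then 1 else 0))"
    unfolding box_bump_def by (intro tendsto_intros flat_0_tendsto)
  also have "(\<Prod>i\<in>UNIV. (if x $ i - a $ i > 0 then 1 else 0) * (if b $ i - x $ i > 0 then 1 else 0)) = (indicator (box a b) x :: real)"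
  proof (cases "x \<in> box a b")
    case True
    then show ?thesis by (auto simp: mem_box_cart)
  next
    case False
    then obtain i where "\<not> (a $ i < x $ i \<and> x $ i < b $ i)" by (auto simp: mem_box_cart)
    then have "(\<Prod>i\<in>UNIV. (if x $ i - a $ i > 0 then 1 else 0) * (if b $ i - x $ i > 0 then 1 else 0 :: real)) = 0"
      by (intro prod_zero bexI[of _ i]) auto
    then show ?thesis using False by simp
  qed
  finally show ?thesis .
qed

lemma box_bump_bounds: "c > 0 \<Longrightarrow> \<bar>box_bump c a b x\<bar> \<le> indicator (cbox a b) x"
proof (cases "x \<in> cbox a b")
  case True
  assume c: "c > 0"
  have "\<bar>box_bump c a b x\<bar> = (\<Prod>i\<in>UNIV. \<bar>flat c 0 (x $ i - a $ i) * flat c 0 (b $ i - x $ i)\<bar>)"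
    by (simp add: box_bump_def abs_prod)
  also have "\<dots> \<le> 1" using flat_0_bounds[OF c] by (intro prod_le_1) (auto simp: abs_mult intro!: mult_le_one)
  finally show ?thesis using True by simp
next
  case False
  assume c: "c > 0"
  obtain i where "x $ i < a $ i \<or> b $ i < x $ i" using False by (auto simp: mem_box_cart not_le)
  then have "box_bump c a b x = 0" unfolding box_bump_def by (intro prod_zero bexI[of _ i]) (auto simp: flat_0)
  then show ?thesis by simp
qed

lemma sqint_integrable_bounded_set:
  assumes g: "sqint g" and S: "S \<in> lmeasurable"
  shows "integrable lebesgue (\<lambda>x. \<bar>g x\<bar> * indicator S x)"
proof -
  have m: "S \<in> sets lebesgue" "emeasure lebesgue S < \<infinity>" using S by (auto simp: fmeasurable_def)
  then have "integrable lebesgue (\<lambda>x. indicator S x :: real)" by (intro integrable_real_indicator)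
  then have "sqint (indicator S :: _ \<Rightarrow> real)"
    using m by (auto simp: sqint_def power2_eq_square indicator_inter_arith[symmetric])
  moreover have "sqint (\<lambda>x. \<bar>g x\<bar>)" using g by (auto simp: sqint_def)
  ultimately show ?thesis using sqint_mult_integrable by blast
qed

text \<open>Testing with \<open>box_bump\<close> and letting its parameter tend to 0 shows that the
  integral of \<open>g\<close> over every box inside \<open>\<Omega>\<close> vanishes. Lebesgue
  differentiation along the cubes with corner \<open>x\<close> then gives \<open>g x = 0\<close> for
  almost every \<open>x\<close>.\<close>

lemma fundamental_lemma:
  fixes \<Omega> :: "(real ^ 'n) set"
  assumes \<Omega>: "open \<Omega>" and g: "sqint g"
    and zero: "\<And>\<phi>. test_function \<Omega> \<phi> \<Longrightarrow> (\<integral>x. g x * \<phi> x \<partial>lebesgue) = 0"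
  shows "AE x in lebesgue. x \<in> \<Omega> \<longrightarrow> g x = 0"
proof -
  note [measurable] = sqint_measurable[OF g]
  have int: "integrable lebesgue (\<lambda>x. \<bar>g x\<bar> * indicator (cbox a b) x)" for a b
    by (rule sqint_integrable_bounded_set[OF g]) simp
  have set_int: "set_integrable lebesgue (cbox a b) g" for a b
    unfolding set_integrable_def
  proof (rule Bochner_Integration.integrable_bound[OF int[of a b]])
    show "(\<lambda>x. indicator (cbox a b) x *\<^sub>R g x) \<in> borel_measurable lebesgue"
      by (intro borel_measurable_scaleR borel_measurable_indicator sqint_measurable[OF g]) auto
  qed (simp add: abs_mult mult.commute)
  have box0: "integral (cbox a b) g = 0" if sub: "cbox a b \<subseteq> \<Omega>" for a b
  proof -
    have "(\<lambda>n. \<integral>x. g x * box_bump (1 / real (Suc n)) a b x \<partial>lebesgue) \<longlonglongrightarrow> (\<integral>x. g x * indicator (box a b) x \<partial>lebesgue)"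
    proof (rule integral_dominated_convergence[OF _ _ int])
      show "(\<lambda>x. g x * indicator (box a b) x) \<in> borel_measurable lebesgue"
        by (intro borel_measurable_times borel_measurable_indicator sqint_measurable[OF g]) auto
      show "(\<lambda>x. g x * box_bump (1 / real (Suc n)) a b x) \<in> borel_measurable lebesgue" for n
        using sqint_measurable[OF sqint_test_function[OF box_bump_test_function[OF _ sub, of "1 / real (Suc n)"]]]
        by (intro borel_measurable_times) auto
      show "AE x in lebesgue. (\<lambda>n. g x * box_bump (1 / real (Suc n)) a b x) \<longlonglongrightarrow> g x * indicator (box a b) x"
        by (intro AE_I2 tendsto_mult_left box_bump_tendsto)
      show "AE x in lebesgue. norm (g x * box_bump (1 / real (Suc n)) a b x) \<le> \<bar>g x\<bar> * indicator (cbox a b) x" for n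
        by (intro AE_I2) (auto simp: abs_mult simp del: of_nat_Suc intro!: mult_left_mono box_bump_bounds)
    qed
    moreover have "(\<integral>x. g x * box_bump (1 / real (Suc n)) a b x \<partial>lebesgue) = 0" for n
      by (rule zero[OF box_bump_test_function[OF _ sub]]) simp
    ultimately have "(\<integral>x. g x * indicator (box a b) x \<partial>lebesgue) = 0"
      using LIMSEQ_unique[OF _ tendsto_const] by force
    moreover have "set_integrable lebesgue (box a b) g"
      by (rule set_integrable_subset[OF set_int[of a b]]) (auto intro: box_subset_cbox[THEN subsetD])
    ultimately have "integral (box a b) g = 0"
      using set_lebesgue_integral_eq_integral(2)[of "box a b" g] by (simp add: set_lebesgue_integral_def mult.commute)
    then show ?thesis by (simp add: integral_open_interval)
  qed
  have "g integrable_on cbox a b" for a b using set_lebesgue_integral_eq_integral(1)[OF set_int] .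
  then obtain N where N: "negligible N"
    "\<And>x e. x \<notin> N \<Longrightarrow> 0 < e \<Longrightarrow> \<exists>d>0. \<forall>h. 0 < h \<and> h < d \<longrightarrow>
       norm (integral (cbox x (x + h *\<^sub>R One)) g /\<^sub>R h ^ DIM(real ^ 'n) - g x) < e"
    using integrable_ccontinuous_explicit[of g] by metis
  have "g x = 0" if x: "x \<in> \<Omega>" "x \<notin> N" for x
  proof (rule ccontr)
    assume "g x \<noteq> 0"
    then obtain d where d: "d > 0" "\<And>h. 0 < h \<Longrightarrow> h < d \<Longrightarrow> norm (integral (cbox x (x + h *\<^sub>R One)) g /\<^sub>R h ^ DIM(real ^ 'n) - g x) < \<bar>g x\<bar>"
      using N(2)[OF x(2), of "\<bar>g x\<bar>"] by auto
    obtain r where r: "r > 0" "ball x r \<subseteq> \<Omega>" using \<Omega> x openE by blast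
    \<comment> \<open>Below \<open>d\<close> for the differentiation estimate, and small enough for
      the cube, of diameter \<open>h * norm One\<close>, to lie in the ball of radius
      \<open>r\<close>. The added 1 keeps the denominator visibly positive.\<close>
    define h where "h = min (d / 2) (r / (2 * (norm (One :: real ^ 'n) + 1)))"
    have h: "0 < h" "h < d" using d r by (auto simp: h_def intro!: divide_pos_pos add_nonneg_pos mult_pos_pos)
    have "cbox x (x + h *\<^sub>R One) \<subseteq> \<Omega>"
    proof
      fix y assume y: "y \<in> cbox x (x + h *\<^sub>R One)"
      have "norm (y - x) \<le> norm (h *\<^sub>R One :: real ^ 'n)"
      proof (rule norm_le_componentwise_cart)
        fix i
        have "x $ i \<le> y $ i" "y $ i \<le> (x + h *\<^sub>R One) $ i" using y unfolding mem_box_cart by blast+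
        then show "norm ((y - x) $ i) \<le> norm ((h *\<^sub>R One :: real ^ 'n) $ i)"
          unfolding vector_add_component vector_minus_component real_norm_def by linarith
      qed
      also have "\<dots> = h * norm (One :: real ^ 'n)" using h by simp
      also have "\<dots> \<le> r / (2 * (norm (One :: real ^ 'n) + 1)) * norm (One :: real ^ 'n)"
        by (intro mult_right_mono) (auto simp: h_def)
      also have "\<dots> < r" using r
        by (simp add: pos_divide_less_eq add_nonneg_pos)
      finally show "y \<in> \<Omega>" using r by (auto simp: dist_norm norm_minus_commute)
    qed
    from box0[OF this] d(2)[OF h] show False by simp
  qed
  moreover have "AE x in lebesgue. x \<notin> N" using N(1) by (simp add: negligible_iff_null_sets AE_not_in)
  ultimately show ?thesis by (auto elim: eventually_mono)
qed

section \<open>The Dirichlet form\<close>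

lemma sqint_mult_bounded:
  assumes "sqint f" "m \<in> borel_measurable lebesgue" "\<And>x. \<bar>m x\<bar> \<le> C"
  shows "sqint (\<lambda>x. m x * f x)" and "norm (cls (\<lambda>x. m x * f x)) \<le> C * norm (cls f)"
proof -
  have C: "C \<ge> 0" using order_trans[OF abs_ge_zero assms(3)] .
  have "\<bar>m x\<bar> * \<bar>f x\<bar> \<le> C * \<bar>f x\<bar>" for x by (intro mult_right_mono assms) auto
  then have ae: "AE x in lebesgue. \<bar>m x * f x\<bar> \<le> C * \<bar>f x\<bar>" by (simp add: abs_mult)
  show s: "sqint (\<lambda>x. m x * f x)"
    by (rule sqint_bound[OF assms(1) _ ae]) (intro borel_measurable_times assms sqint_measurable)
  show "norm (cls (\<lambda>x. m x * f x)) \<le> C * norm (cls f)" by (rule norm_cls_mono[OF s assms(1) ae C])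
qed

definition mulop :: "('a::euclidean_space \<Rightarrow> real) \<Rightarrow> 'a l2 \<Rightarrow> 'a l2" where
  "mulop m X = cls (\<lambda>x. m x * rp X x)"

lemma
  assumes m: "m \<in> borel_measurable lebesgue" and bd: "\<And>x. \<bar>m x\<bar> \<le> C"
  shows AE_mulop: "AE x in lebesgue. rp (mulop m X) x = m x * rp X x"
    and norm_mulop_le: "norm (mulop m X) \<le> C * norm X"
    and mulop_bounded_linear: "bounded_linear (mulop m)"
    and mulop_cls: "sqint f \<Longrightarrow> mulop m (cls f) = cls (\<lambda>x. m x * f x)"
proof -
  note s = sqint_mult_bounded(1)[OF _ m bd]
  show le: "norm (mulop m X) \<le> C * norm X" for X
    unfolding mulop_def using sqint_mult_bounded(2)[OF sqint_rp m bd] by simp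
  show "AE x in lebesgue. rp (mulop m X) x = m x * rp X x" unfolding mulop_def by (rule AE_rp_cls[OF s[OF sqint_rp]])
  show "bounded_linear (mulop m)"
  proof (rule bounded_linear_intro)
    fix X Y :: "'a l2" and r :: real
    show "mulop m (X + Y) = mulop m X + mulop m Y"
      unfolding mulop_def cls_add[OF s[OF sqint_rp] s[OF sqint_rp]]
      by (subst cls_eq_iff[OF s[OF sqint_rp] sqint_add[OF s[OF sqint_rp] s[OF sqint_rp]]])
        (rule AE_mp[OF AE_rp_add[of X Y]], simp add: distrib_left)
    show "mulop m (r *\<^sub>R X) = r *\<^sub>R mulop m X"
      unfolding mulop_def cls_scale[OF s[OF sqint_rp]]
      by (subst cls_eq_iff[OF s[OF sqint_rp] sqint_scale[OF s[OF sqint_rp]]])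
        (rule AE_mp[OF AE_rp_scale[of r X]], simp)
    show "norm (mulop m X) \<le> norm X * C" using le[of X] by (simp add: mult.commute)
  qed
  show "mulop m (cls f) = cls (\<lambda>x. m x * f x)" if f: "sqint f"
    unfolding mulop_def
    by (subst cls_eq_iff[OF s[OF sqint_rp] s[OF f]]) (rule AE_mp[OF AE_rp_cls[OF f]], simp)
qed

lemma bounded_bilinear_sum:
  assumes "finite S" "\<And>i. i \<in> S \<Longrightarrow> bounded_bilinear (f i)"
  shows "bounded_bilinear (\<lambda>x y. \<Sum>i\<in>S. f i x y)"
  using assms
proof (induction S rule: finite_induct)
  case empty
  show ?case by standard (auto intro: exI[of _ 0])
next
  case (insert i S)
  then show ?case by (simp add: bounded_bilinear_add)
qed

definition test_graph :: "(real ^ 'n \<Rightarrow> real) \<Rightarrow> (real ^ 'n) l2 \<times> ((real ^ 'n) l2 ^ 'n)" where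
  "test_graph \<phi> = (cls \<phi>, \<chi> i. cls (partial i \<phi>))"

text \<open>This is W_0^(1,2) as the graph of the gradient: the norm of the product space is the
  Sobolev norm, so the closure of the test functions is taken in the right sense.\<close>

definition sobolev_graph :: "(real ^ 'n) set \<Rightarrow> ((real ^ 'n) l2 \<times> ((real ^ 'n) l2 ^ 'n)) set" where
  "sobolev_graph \<Omega> = closure (test_graph ` Collect (test_function \<Omega>))"

lemma partial_add_test:
  assumes "test_function \<Omega> \<phi>" "test_function \<Omega> \<psi>"
  shows "partial i (\<lambda>x. \<phi> x + \<psi> x) = (\<lambda>x. partial i \<phi> x + partial i \<psi> x)"
  using partial_eq[OF has_derivative_add[OF test_function_has_derivative[OF assms(1)] test_function_has_derivative[OF assms(2)]]]
  by (intro ext) (simp add: partial_def)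

lemma partial_compose_test:
  assumes "test_function \<Omega> \<phi>" "\<And>y. (h has_real_derivative h' y) (at y)"
  shows "partial i (\<lambda>x. h (\<phi> x)) = (\<lambda>x. h' (\<phi> x) * partial i \<phi> x)"
  using partial_eq[OF has_derivative_compose_real[OF test_function_has_derivative[OF assms(1)] assms(2)]]
  by (intro ext) (simp add: partial_def)

lemma partial_scale_test:
  assumes "test_function \<Omega> \<phi>"
  shows "partial i (\<lambda>x. c * \<phi> x) = (\<lambda>x. c * partial i \<phi> x)"
  by (rule partial_compose_test[OF assms]) (auto intro!: derivative_eq_intros)

lemma sobolev_graph_closed: "closed (sobolev_graph \<Omega>)" by (simp add: sobolev_graph_def)

lemma sobolev_graph_subspace: "subspace (sobolev_graph (\<Omega> :: (real ^ 'n) set))"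
  unfolding sobolev_graph_def
proof (rule closure_subspace, unfold subspace_def, intro conjI ballI allI)
  have sq: "sqint \<phi>" "sqint (partial i \<phi>)" if "test_function \<Omega> \<phi>" for \<phi> i
    using that by (auto intro: sqint_test_function test_function_partial)
  have "partial i (\<lambda>x :: real ^ 'n. 0) = (\<lambda>x. 0)" for i :: 'n
    using partial_eq[OF has_derivative_const] by (intro ext) blast
  then have "0 = test_graph (\<lambda>x :: real ^ 'n. 0)" by (simp add: test_graph_def vec_eq_iff zero_prod_def cls_zero)
  then show "0 \<in> test_graph ` Collect (test_function \<Omega>)" using test_function_zero by blast
next
  have sq: "sqint \<phi>" "sqint (partial i \<phi>)" if "test_function \<Omega> \<phi>" for \<phi> i
    using that by (auto intro: sqint_test_function test_function_partial)
  fix v w assume "v \<in> test_graph ` Collect (test_function \<Omega>)" "w \<in> test_graph ` Collect (test_function \<Omega>)"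
  then obtain \<phi> \<psi> where t: "test_function \<Omega> \<phi>" "test_function \<Omega> \<psi>" and vw: "v = test_graph \<phi>" "w = test_graph \<psi>" by auto
  have "v + w = test_graph (\<lambda>x. \<phi> x + \<psi> x)"
    unfolding vw test_graph_def partial_add_test[OF t] using t by (simp add: vec_eq_iff cls_add sq)
  then show "v + w \<in> test_graph ` Collect (test_function \<Omega>)" using test_function_add[OF t] by blast
next
  have sq: "sqint \<phi>" "sqint (partial i \<phi>)" if "test_function \<Omega> \<phi>" for \<phi> i
    using that by (auto intro: sqint_test_function test_function_partial)
  fix c :: real and v assume "v \<in> test_graph ` Collect (test_function \<Omega>)"
  then obtain \<phi> where t: "test_function \<Omega> \<phi>" and v: "v = test_graph \<phi>" by auto
  have "c *\<^sub>R v = test_graph (\<lambda>x. c * \<phi> x)"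
    unfolding v test_graph_def partial_scale_test[OF t] using t by (simp add: vec_eq_iff cls_scale sq)
  then show "c *\<^sub>R v \<in> test_graph ` Collect (test_function \<Omega>)" using test_function_scale[OF t] by blast
qed

lemma sobolev_graph_sequence:
  assumes "(u, G) \<in> sobolev_graph \<Omega>"
  shows "\<exists>\<phi>. (\<forall>m::nat. test_function \<Omega> (\<phi> m)) \<and> (\<lambda>m. cls (\<phi> m)) \<longlonglongrightarrow> u \<and> (\<forall>i. (\<lambda>m. cls (partial i (\<phi> m))) \<longlonglongrightarrow> G $ i)"
proof -
  obtain X where X: "\<And>m. X m \<in> test_graph ` Collect (test_function \<Omega>)" "X \<longlonglongrightarrow> (u, G)"
    using assms unfolding sobolev_graph_def closure_sequential by blast
  then have "\<forall>m. \<exists>\<phi>. test_function \<Omega> \<phi> \<and> X m = test_graph \<phi>" by auto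
  then obtain \<phi> where \<phi>: "\<And>m. test_function \<Omega> (\<phi> m)" "\<And>m. X m = test_graph (\<phi> m)" by metis
  have "(\<lambda>m. cls (\<phi> m)) \<longlonglongrightarrow> u" using tendsto_fst[OF X(2)] by (simp add: \<phi>(2) test_graph_def)
  moreover have "(\<lambda>m. cls (partial i (\<phi> m))) \<longlonglongrightarrow> G $ i" for i
    using tendsto_vec_nth[OF tendsto_snd[OF X(2)], of i] by (simp add: \<phi>(2) test_graph_def)
  ultimately show ?thesis using \<phi>(1) by blast
qed

lemma sobolev_graphI:
  assumes \<phi>: "\<And>m::nat. test_function \<Omega> (\<phi> m)" and u: "(\<lambda>m. cls (\<phi> m)) \<longlonglongrightarrow> u"
    and G: "\<And>i. (\<lambda>m. cls (partial i (\<phi> m))) \<longlonglongrightarrow> G $ i"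
  shows "(u, G) \<in> sobolev_graph \<Omega>"
proof -
  have "(\<lambda>m. (\<chi> i. cls (partial i (\<phi> m)))) \<longlonglongrightarrow> G" by (rule vec_tendstoI) (simp add: G)
  then have "(\<lambda>m. test_graph (\<phi> m)) \<longlonglongrightarrow> (u, G)" unfolding test_graph_def by (intro tendsto_Pair u)
  moreover have "test_graph (\<phi> m) \<in> test_graph ` Collect (test_function \<Omega>)" for m using \<phi> by blast
  ultimately show ?thesis unfolding sobolev_graph_def closure_sequential
    by (intro exI[of _ "\<lambda>m. test_graph (\<phi> m)"] conjI allI)
qed

lemma test_graph_in: "test_function \<Omega> \<phi> \<Longrightarrow> test_graph \<phi> \<in> sobolev_graph \<Omega>"
  unfolding sobolev_graph_def by (rule closure_subset[THEN subsetD]) blast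

lemma sobolev_graph_weak:
  assumes "(u, G) \<in> sobolev_graph \<Omega>" "test_function \<Omega>' \<psi>"
  shows "inner u (cls (partial i \<psi>)) = - inner (G $ i) (cls \<psi>)"
proof -
  obtain \<phi> where \<phi>: "\<And>m::nat. test_function \<Omega> (\<phi> m)" "(\<lambda>m. cls (\<phi> m)) \<longlonglongrightarrow> u" "\<And>i. (\<lambda>m. cls (partial i (\<phi> m))) \<longlonglongrightarrow> G $ i"
    using sobolev_graph_sequence[OF assms(1)] by blast
  have "inner (cls (\<phi> m)) (cls (partial i \<psi>)) = - inner (cls (partial i (\<phi> m))) (cls \<psi>)" for m
    using test_function_integration_by_parts[OF \<phi>(1)[of m] assms(2), of i]
    by (simp add: inner_cls sqint_test_function[OF \<phi>(1)] sqint_test_function[OF assms(2)]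
        sqint_test_function[OF test_function_partial[OF \<phi>(1)]] sqint_test_function[OF test_function_partial[OF assms(2)]])
  moreover have "(\<lambda>m. inner (cls (\<phi> m)) (cls (partial i \<psi>))) \<longlonglongrightarrow> inner u (cls (partial i \<psi>))"
    "(\<lambda>m. - inner (cls (partial i (\<phi> m))) (cls \<psi>)) \<longlonglongrightarrow> - inner (G $ i) (cls \<psi>)"
    by (intro tendsto_intros \<phi>)+
  ultimately show ?thesis using LIMSEQ_unique by simp
qed

text \<open>The weighted Poincare inequality survives the limit, where its right-hand side becomes
  0, and the weight is positive everywhere. The plain Poincare inequality would fail for unbounded
  \<open>\<Omega>\<close>. A single coordinate is enough and any one will do, hence
  \<open>undefined\<close>.\<close>

lemma sobolev_graph_kernel:
  assumes "(u, 0) \<in> sobolev_graph (\<Omega> :: (real ^ 'n) set)" shows "u = 0"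
proof -
  obtain \<phi> where \<phi>: "\<And>m::nat. test_function \<Omega> (\<phi> m)" "(\<lambda>m. cls (\<phi> m)) \<longlonglongrightarrow> u" "\<And>i. (\<lambda>m. cls (partial i (\<phi> m))) \<longlonglongrightarrow> (0 :: ((real ^ 'n) l2 ^ 'n)) $ i"
    using sobolev_graph_sequence[OF assms] by blast
  define i where "i = (undefined :: 'n)"
  define w where "w x = 1 / sqrt (1 + (x $ i)\<^sup>2)" for x :: "real ^ 'n"
  have pos: "1 + t\<^sup>2 > 0" for t :: real by (simp add: add_pos_nonneg)
  have w0: "w x > 0" for x using pos by (simp add: w_def)
  have w1: "\<bar>w x\<bar> \<le> 1" for x using pos[of "x $ i"] by (simp add: w_def divide_le_eq)
  have wm: "w \<in> borel_measurable lebesgue"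
    unfolding w_def[abs_def]
  proof (rule continuous_measurable_lebesgue)
    have "sqrt (1 + t\<^sup>2) \<noteq> 0" for t :: real using pos[of t] by (metis less_irrefl real_sqrt_eq_zero_cancel_iff)
    then show "continuous_on UNIV (\<lambda>x::real^'n. 1 / sqrt (1 + (x $ i)\<^sup>2))"
      by (intro continuous_intros continuous_on_component continuous_on_id) auto
  qed
  have le: "(norm (mulop w (cls (\<phi> m))))\<^sup>2 \<le> pi * (norm (cls (\<phi> m)) * norm (cls (partial i (\<phi> m))))" for m
  proof -
    have "mulop w (cls (\<phi> m)) = cls (\<lambda>x. 1 / sqrt (1 + (x $ i)\<^sup>2) * \<phi> m x)"
      by (simp only: mulop_cls[OF wm w1 sqint_test_function[OF \<phi>(1)]]) (simp only: w_def)
    then show ?thesis using weighted_poincare[OF \<phi>(1)[of m], of i] by (simp add: norm_cls)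
  qed
  have "(\<lambda>m. pi * (norm (cls (\<phi> m)) * norm (cls (partial i (\<phi> m))))) \<longlonglongrightarrow> pi * (norm u * norm ((0 :: ((real ^ 'n) l2 ^ 'n)) $ i))"
    by (intro tendsto_intros \<phi>)
  note L1 = this
  have L2: "(\<lambda>m. (norm (mulop w (cls (\<phi> m))))\<^sup>2) \<longlonglongrightarrow> (norm (mulop w u))\<^sup>2"
    by (intro tendsto_intros bounded_linear.tendsto[OF mulop_bounded_linear[OF wm w1]] \<phi>)
  have "(norm (mulop w u))\<^sup>2 \<le> pi * (norm u * norm ((0 :: ((real ^ 'n) l2 ^ 'n)) $ i))"
    by (rule LIMSEQ_le[OF L2 L1], rule exI[of _ 0], intro allI impI, rule le)
  then have "mulop w u = 0" by simp
  then have "AE x in lebesgue. w x * rp u x = rp 0 x" using AE_mulop[OF wm w1, of u] by (auto elim!: AE_mp)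
  then have "AE x in lebesgue. rp u x = rp 0 x"
    using AE_rp_zero
  proof eventually_elim
    case (elim x)
    then show ?case using w0[of x] by simp
  qed
  then show ?thesis by (simp add: l2_eq_iff)
qed

section \<open>Functions vanishing outside \<open>\<Omega>\<close>, and the extended
  coefficients\<close>

definition supp_in :: "(real ^ 'n) set \<Rightarrow> (real ^ 'n) l2 set" where
  "supp_in \<Omega> = {X. AE x in lebesgue. x \<notin> \<Omega> \<longrightarrow> rp X x = 0}"

text \<open>Written as the kernel of a bounded operator, the set is evidently a closed
  subspace.\<close>

lemma supp_in_mulop:
  fixes \<Omega> :: "(real ^ 'n) set"
  assumes "\<Omega> \<in> sets lebesgue" shows "supp_in \<Omega> = {X. mulop (indicator (- \<Omega>)) X = 0}"
proof -
  define m :: "real ^ 'n \<Rightarrow> real" where "m = indicator (- \<Omega>)"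
  have m: "m \<in> borel_measurable lebesgue"
    using assms unfolding m_def by (intro borel_measurable_indicator) (simp add: Compl_in_sets_lebesgue)
  have b: "\<bar>m x\<bar> \<le> 1" for x by (simp add: m_def indicator_def)
  have mx: "m x = (if x \<in> \<Omega> then 0 else 1)" for x by (simp add: m_def)
  have "mulop m X = 0 \<longleftrightarrow> (AE x in lebesgue. x \<notin> \<Omega> \<longrightarrow> rp X x = 0)" for X
    unfolding l2_eq_iff[of _ 0]
  proof
    assume "AE x in lebesgue. rp (mulop m X) x = rp 0 x"
    with AE_mulop[OF m b, of X] AE_rp_zero show "AE x in lebesgue. x \<notin> \<Omega> \<longrightarrow> rp X x = 0"
    proof eventually_elim
      case (elim x) then show ?case using mx[of x] by (auto split: if_splits)
    qed
  next
    assume "AE x in lebesgue. x \<notin> \<Omega> \<longrightarrow> rp X x = 0"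
    with AE_mulop[OF m b, of X] AE_rp_zero show "AE x in lebesgue. rp (mulop m X) x = rp 0 x"
    proof eventually_elim
      case (elim x) then show ?case using mx[of x] by (auto split: if_splits)
    qed
  qed
  then show ?thesis by (simp add: supp_in_def m_def)
qed

lemma supp_in_closed_subspace:
  fixes \<Omega> :: "(real ^ 'n) set"
  assumes "\<Omega> \<in> sets lebesgue" shows "closed (supp_in \<Omega>)" "subspace (supp_in \<Omega>)"
proof -
  have m: "indicator (- \<Omega>) \<in> borel_measurable lebesgue"
    using assms by (intro borel_measurable_indicator) (simp add: Compl_in_sets_lebesgue)
  have b: "\<bar>indicator (- \<Omega>) x :: real\<bar> \<le> 1" for x by (simp add: indicator_def)
  note bl = mulop_bounded_linear[OF m b]
  show "closed (supp_in \<Omega>)" unfolding supp_in_mulop[OF assms]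
    by (intro closed_Collect_eq linear_continuous_on[OF bl] continuous_on_const)
  show "subspace (supp_in \<Omega>)" unfolding supp_in_mulop[OF assms]
    by (rule linear_subspace_kernel[OF bounded_linear.linear[OF bl]])
qed

lemma test_function_outside: "test_function \<Omega> \<phi> \<Longrightarrow> x \<notin> \<Omega> \<Longrightarrow> \<phi> x = 0"
  unfolding test_function_def by blast

lemma test_function_supp_in: "test_function \<Omega> \<phi> \<Longrightarrow> cls \<phi> \<in> supp_in \<Omega>"
proof -
  assume t: "test_function \<Omega> \<phi>"
  from AE_rp_cls[OF sqint_test_function[OF t]] show ?thesis
    unfolding supp_in_def mem_Collect_eq by eventually_elim (use test_function_outside[OF t] in auto)
qed

lemma sobolev_graph_supp_in:
  assumes \<Omega>: "\<Omega> \<in> sets lebesgue" and "(u, G) \<in> sobolev_graph \<Omega>"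
  shows "u \<in> supp_in \<Omega>" "G $ i \<in> supp_in \<Omega>"
proof -
  obtain \<phi> where \<phi>: "\<And>m::nat. test_function \<Omega> (\<phi> m)" "(\<lambda>m. cls (\<phi> m)) \<longlonglongrightarrow> u" "\<And>i. (\<lambda>m. cls (partial i (\<phi> m))) \<longlonglongrightarrow> G $ i"
    using sobolev_graph_sequence[OF assms(2)] by blast
  show "u \<in> supp_in \<Omega>"
    by (rule closed_sequentially[OF supp_in_closed_subspace(1)[OF \<Omega>] _ \<phi>(2)]) (intro test_function_supp_in \<phi>)
  show "G $ i \<in> supp_in \<Omega>"
    by (rule closed_sequentially[OF supp_in_closed_subspace(1)[OF \<Omega>] _ \<phi>(3)]) (intro test_function_supp_in test_function_partial \<phi>)
qed

text \<open>Outside \<open>\<Omega>\<close> the coefficients are continued by \<open>\<nu>\<close> times the identity, so that the form is coercive on all of \<open>L\<^sup>2\<close>.\<close>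

locale elliptic_coefficients =
  fixes \<Omega> :: "(real ^ 'n) set" and A :: "real ^ 'n \<Rightarrow> real ^ 'n ^ 'n" and \<nu> :: real
  assumes open_\<Omega>: "open \<Omega>"
    and A_measurable: "\<forall>k l. (\<lambda>x. A x $ k $ l) \<in> borel_measurable (lebesgue_on \<Omega>)"
    and A_bounded: "\<forall>k l. \<exists>M. \<forall>x\<in>\<Omega>. \<bar>A x $ k $ l\<bar> \<le> M"
    and A_sym: "\<forall>k l. \<forall>x\<in>\<Omega>. A x $ k $ l = A x $ l $ k"
    and nu_pos: "\<nu> > 0"
    and A_elliptic: "\<forall>x\<in>\<Omega>. \<forall>\<xi>. (\<Sum>k\<in>UNIV. \<Sum>l\<in>UNIV. A x $ k $ l * \<xi> $ k * \<xi> $ l) \<ge> \<nu> * (norm \<xi>)\<^sup>2"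
begin

lemma \<Omega>_sets: "\<Omega> \<in> sets lebesgue" using open_\<Omega> by simp

definition a :: "'n \<Rightarrow> 'n \<Rightarrow> real ^ 'n \<Rightarrow> real" where
  "a k l x = (if x \<in> \<Omega> then A x $ k $ l else if k = l then \<nu> else 0)"

lemma a_measurable: "a k l \<in> borel_measurable lebesgue"
proof -
  have "ext \<Omega> (\<lambda>x. A x $ k $ l) \<in> borel_measurable lebesgue" using A_measurable measurable_ext[OF \<Omega>_sets] by blast
  moreover have "(\<lambda>x. (if k = l then \<nu> else 0) * indicator (- \<Omega>) x) \<in> borel_measurable lebesgue"
    using \<Omega>_sets by (intro borel_measurable_times borel_measurable_const borel_measurable_indicator) (simp add: Compl_in_sets_lebesgue)
  ultimately have "(\<lambda>x. ext \<Omega> (\<lambda>x. A x $ k $ l) x + (if k = l then \<nu> else 0) * indicator (- \<Omega>) x) \<in> borel_measurable lebesgue"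
    by (rule borel_measurable_add)
  also have "(\<lambda>x. ext \<Omega> (\<lambda>x. A x $ k $ l) x + (if k = l then \<nu> else 0) * indicator (- \<Omega>) x) = a k l"
    by (intro ext) (simp add: a_def ext_def)
  finally show ?thesis .
qed

lemma ex_bound: "\<exists>M. \<forall>k l x. \<bar>a k l x\<bar> \<le> M"
proof -
  obtain m where m: "\<And>k l x. x \<in> \<Omega> \<Longrightarrow> \<bar>A x $ k $ l\<bar> \<le> m k l" using A_bounded by metis
  have "\<bar>a k l x\<bar> \<le> (\<Sum>k\<in>UNIV. \<Sum>l\<in>UNIV. \<bar>m k l\<bar>) + \<nu>" for k l x
  proof -
    have "\<bar>m k l\<bar> \<le> (\<Sum>l\<in>UNIV. \<bar>m k l\<bar>)" by (rule member_le_sum) auto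
    also have "\<dots> \<le> (\<Sum>k\<in>UNIV. \<Sum>l\<in>UNIV. \<bar>m k l\<bar>)" by (rule member_le_sum) (auto intro: sum_nonneg)
    finally have "\<bar>m k l\<bar> \<le> (\<Sum>k\<in>UNIV. \<Sum>l\<in>UNIV. \<bar>m k l\<bar>)" .
    then show ?thesis using m[of x k l] nu_pos by (cases "x \<in> \<Omega>") (auto simp: a_def)
  qed
  then show ?thesis by blast
qed

definition M where "M = (SOME M. \<forall>k l x. \<bar>a k l x\<bar> \<le> M)"

lemma a_bound: "\<bar>a k l x\<bar> \<le> M" using someI_ex[OF ex_bound] unfolding M_def by blast

lemma a_sym: "a k l x = a l k x" using A_sym by (auto simp: a_def)

lemma a_elliptic: "(\<Sum>k\<in>UNIV. \<Sum>l\<in>UNIV. a k l x * \<xi> $ k * \<xi> $ l) \<ge> \<nu> * (norm \<xi>)\<^sup>2"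
proof (cases "x \<in> \<Omega>")
  case True
  then show ?thesis using A_elliptic by (simp add: a_def)
next
  case False
  have "(\<Sum>k\<in>UNIV. \<Sum>l\<in>UNIV. a k l x * \<xi> $ k * \<xi> $ l) = (\<Sum>k\<in>UNIV. \<Sum>l\<in>UNIV. if l = k then \<nu> * (\<xi> $ k)\<^sup>2 else 0)"
    using False by (intro sum.cong refl) (auto simp: a_def power2_eq_square)
  also have "\<dots> = \<nu> * (norm \<xi>)\<^sup>2"
    unfolding power2_norm_eq_inner inner_vec_def by (simp add: power2_eq_square sum_distrib_left)
  finally show ?thesis by simp
qed

definition bform :: "((real ^ 'n) l2 ^ 'n) \<Rightarrow> ((real ^ 'n) l2 ^ 'n) \<Rightarrow> real" where
  "bform G G' = (\<Sum>k\<in>UNIV. \<Sum>l\<in>UNIV. inner (mulop (a k l) (G $ k)) (G' $ l))"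

lemma inner_mulop_a:
  "inner (mulop (a k l) X) Y = (\<integral>x. a k l x * rp X x * rp Y x \<partial>lebesgue)"
  "integrable lebesgue (\<lambda>x. a k l x * rp X x * rp Y x)"
proof -
  note s = sqint_mult_bounded(1)[OF sqint_rp[of X] a_measurable[of k l] a_bound]
  have "inner (mulop (a k l) X) (cls (rp Y)) = (\<integral>x. a k l x * rp X x * rp Y x \<partial>lebesgue)"
    unfolding mulop_def by (rule inner_cls[OF s sqint_rp])
  then show "inner (mulop (a k l) X) Y = (\<integral>x. a k l x * rp X x * rp Y x \<partial>lebesgue)" by simp
  show "integrable lebesgue (\<lambda>x. a k l x * rp X x * rp Y x)" by (rule sqint_mult_integrable[OF s sqint_rp])
qed

lemma bform_integral:
  "bform G G' = (\<integral>x. (\<Sum>k\<in>UNIV. \<Sum>l\<in>UNIV. a k l x * rp (G $ k) x * rp (G' $ l) x) \<partial>lebesgue)"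
  "integrable lebesgue (\<lambda>x. (\<Sum>k\<in>UNIV. \<Sum>l\<in>UNIV. a k l x * rp (G $ k) x * rp (G' $ l) x))"
  by (simp_all add: bform_def inner_mulop_a)

lemma bform_bilinear: "bounded_bilinear bform"
  unfolding bform_def[abs_def]
  by (intro bounded_bilinear_sum bounded_bilinear.comp[OF bounded_bilinear_inner]
      bounded_linear_compose[OF mulop_bounded_linear[OF a_measurable a_bound]] bounded_linear_vec_nth) auto

lemma bform_sym: "bform G G' = bform G' G"
proof -
  have "bform G G' = (\<Sum>l\<in>UNIV. \<Sum>k\<in>UNIV. inner (mulop (a k l) (G $ k)) (G' $ l))"
    unfolding bform_def by (rule sum.swap)
  also have "\<dots> = bform G' G" unfolding bform_def inner_mulop_a
    by (intro sum.cong refl arg_cong[where f="integral\<^sup>L lebesgue"]) (auto simp: a_sym mult_ac)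
  finally show ?thesis .
qed

lemma bform_coercive: "bform G G \<ge> \<nu> * (norm G)\<^sup>2"
proof -
  have "(norm G)\<^sup>2 = (\<Sum>i\<in>UNIV. \<integral>x. rp (G $ i) x * rp (G $ i) x \<partial>lebesgue)"
    unfolding power2_norm_eq_inner inner_vec_def by (simp add: inner_rp)
  also have "\<dots> = (\<integral>x. (\<Sum>i\<in>UNIV. rp (G $ i) x * rp (G $ i) x) \<partial>lebesgue)"
    by (simp add: sqint_mult_integrable)
  finally have "\<nu> * (norm G)\<^sup>2 = (\<integral>x. \<nu> * (\<Sum>i\<in>UNIV. rp (G $ i) x * rp (G $ i) x) \<partial>lebesgue)" by simp
  also have "\<dots> \<le> bform G G"
    unfolding bform_integral
  proof (rule integral_mono[OF _ bform_integral(2)])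
    show "integrable lebesgue (\<lambda>x. \<nu> * (\<Sum>i\<in>UNIV. rp (G $ i) x * rp (G $ i) x))"
      by (intro integrable_mult_right Bochner_Integration.integrable_sum sqint_mult_integrable sqint_rp)
    fix x
    have "\<nu> * (norm (\<chi> i. rp (G $ i) x))\<^sup>2 \<le> (\<Sum>k\<in>UNIV. \<Sum>l\<in>UNIV. a k l x * (\<chi> i. rp (G $ i) x) $ k * (\<chi> i. rp (G $ i) x) $ l)"
      by (rule a_elliptic)
    then show "\<nu> * (\<Sum>i\<in>UNIV. rp (G $ i) x * rp (G $ i) x) \<le> (\<Sum>k\<in>UNIV. \<Sum>l\<in>UNIV. a k l x * rp (G $ k) x * rp (G $ l) x)"
      by (simp add: power2_norm_eq_inner inner_vec_def)
  qed
  finally show ?thesis .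
qed

sublocale energy_form "sobolev_graph \<Omega>" bform \<nu>
  by (rule energy_form.intro)
    (simp_all add: sobolev_graph_closed sobolev_graph_subspace bform_bilinear bform_sym nu_pos bform_coercive)

text \<open>Test functions are dense in \<open>L\<^sup>2(\<Omega>)\<close>: the component of
  \<open>f\<close> orthogonal to \<open>H0\<close> integrates to 0 against every test function,
  hence vanishes by the fundamental lemma. So the abstract semigroup is strongly continuous on all
  of \<open>L\<^sup>2(\<Omega>)\<close>.\<close>

lemma H0_eq: "H0 = supp_in \<Omega>"
proof
  have "fst ` sobolev_graph \<Omega> \<subseteq> supp_in \<Omega>" using sobolev_graph_supp_in(1)[OF \<Omega>_sets] by auto
  then show "H0 \<subseteq> supp_in \<Omega>" unfolding H0_def by (rule closure_minimal) (rule supp_in_closed_subspace(1)[OF \<Omega>_sets])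
  show "supp_in \<Omega> \<subseteq> H0"
  proof
    fix f assume f: "f \<in> supp_in \<Omega>"
    obtain w where w: "w \<in> H0" "\<And>v. v \<in> H0 \<Longrightarrow> inner w v = inner f v"
      by (rule symmetric_lax_milgram[OF H0_closed H0_subspace bounded_bilinear_inner inner_commute, of 1 "inner f"])
         (auto simp: dot_square_norm bounded_linear_inner_right)
    define g where "g = f - w"
    have g: "g \<in> supp_in \<Omega>" unfolding g_def
      using f w(1) \<open>H0 \<subseteq> supp_in \<Omega>\<close> by (intro subspace_diff supp_in_closed_subspace(2) \<Omega>_sets) auto
    have "AE x in lebesgue. x \<in> \<Omega> \<longrightarrow> rp g x = 0"
    proof (rule fundamental_lemma[OF open_\<Omega> sqint_rp])
      fix \<phi> assume t: "test_function \<Omega> \<phi>"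
      have "fst (test_graph \<phi>) \<in> H0" by (rule V_H0[OF test_graph_in[OF t]])
      then have "inner g (cls \<phi>) = 0" using w(2) by (simp add: g_def inner_diff_left test_graph_def)
      then show "(\<integral>x. rp g x * \<phi> x \<partial>lebesgue) = 0"
        using inner_cls[OF sqint_rp sqint_test_function[OF t], of g] by simp
    qed
    then have "AE x in lebesgue. rp g x = rp 0 x"
      using g AE_rp_zero unfolding supp_in_def mem_Collect_eq by eventually_elim auto
    then have "g = 0" by (simp add: l2_eq_iff)
    then show "f \<in> H0" using w(1) by (simp add: g_def)
  qed
qed

end

section \<open>Identification of the heat semigroup\<close>

context elliptic_coefficients
begin

text \<open>The dictionary between representatives on \<open>\<Omega>\<close>, in which the
  statement is phrased, and the Hilbert space, in which the operators live.\<close>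

definition E :: "(real ^ 'n \<Rightarrow> real) \<Rightarrow> (real ^ 'n) l2" where "E f = cls (ext \<Omega> f)"

definition GE :: "(real ^ 'n \<Rightarrow> real ^ 'n) \<Rightarrow> ((real ^ 'n) l2 ^ 'n)" where "GE G = (\<chi> i. E (\<lambda>x. G x $ i))"

lemmas Lspace_iff = Lspace_2_iff[OF \<Omega>_sets]

lemma Lnorm_E: "f \<in> Lspace \<Omega> 2 \<Longrightarrow> Lnorm \<Omega> 2 f = ennreal (norm (E f))"
  unfolding E_def by (rule Lnorm_2_norm[OF \<Omega>_sets])

lemma AE_E: "f \<in> Lspace \<Omega> 2 \<Longrightarrow> AE x in lebesgue. rp (E f) x = ext \<Omega> f x"
  unfolding E_def Lspace_iff by (rule AE_rp_cls)

lemma E_H0: "f \<in> Lspace \<Omega> 2 \<Longrightarrow> E f \<in> H0"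
  unfolding H0_eq supp_in_def mem_Collect_eq
  by (drule AE_E) (erule AE_mp, simp add: ext_def)

lemma rp_Lspace: "rp X \<in> Lspace \<Omega> 2"
  unfolding Lspace_iff
proof (rule sqint_bound[OF sqint_rp[of X]])
  show "ext \<Omega> (rp X) \<in> borel_measurable lebesgue"
    unfolding ext_indicator using \<Omega>_sets by (intro borel_measurable_times borel_measurable_indicator rp_measurable)
  show "AE x in lebesgue. \<bar>ext \<Omega> (rp X) x\<bar> \<le> 1 * \<bar>rp X x\<bar>" by (simp add: ext_def)
qed

lemma E_rp: "X \<in> H0 \<Longrightarrow> E (rp X) = X"
proof -
  assume "X \<in> H0"
  then have "AE x in lebesgue. x \<notin> \<Omega> \<longrightarrow> rp X x = 0" by (simp add: H0_eq supp_in_def)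
  with AE_E[OF rp_Lspace[of X]] have "AE x in lebesgue. rp (E (rp X)) x = rp X x"
    by eventually_elim (auto simp: ext_def)
  then show ?thesis by (simp add: l2_eq_iff)
qed

lemma AE_on_iff: "(AE x in lebesgue_on \<Omega>. P x) \<longleftrightarrow> (AE x in lebesgue. x \<in> \<Omega> \<longrightarrow> P x)"
  using \<Omega>_sets by (simp add: AE_restrict_space_iff)

lemma E_eq_iff:
  assumes "f \<in> Lspace \<Omega> 2" "g \<in> Lspace \<Omega> 2"
  shows "E f = E g \<longleftrightarrow> (AE x in lebesgue_on \<Omega>. f x = g x)"
  unfolding E_def cls_eq_iff[OF assms[unfolded Lspace_iff]] AE_on_iff
  by (intro AE_cong) (simp add: ext_def)

lemma E_linear_comb:
  assumes f: "f \<in> Lspace \<Omega> 2" and g: "g \<in> Lspace \<Omega> 2"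
  shows "(\<lambda>x. c * f x + g x) \<in> Lspace \<Omega> 2" "E (\<lambda>x. c * f x + g x) = c *\<^sub>R E f + E g"
proof -
  note s = f[unfolded Lspace_iff] g[unfolded Lspace_iff]
  have e: "ext \<Omega> (\<lambda>x. c * f x + g x) = (\<lambda>x. c * ext \<Omega> f x + ext \<Omega> g x)" by (auto simp: ext_def)
  show "(\<lambda>x. c * f x + g x) \<in> Lspace \<Omega> 2" unfolding Lspace_iff e by (intro sqint_add sqint_scale s)
  show "E (\<lambda>x. c * f x + g x) = c *\<^sub>R E f + E g" unfolding E_def e by (simp add: cls_scale cls_add sqint_scale s)
qed

lemma E_diff:
  assumes f: "f \<in> Lspace \<Omega> 2" and g: "g \<in> Lspace \<Omega> 2"
  shows "(\<lambda>x. f x - g x) \<in> Lspace \<Omega> 2" "E (\<lambda>x. f x - g x) = E f - E g"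
  using E_linear_comb[OF g f, of "-1"] by simp_all

lemma E_minus:
  assumes f: "f \<in> Lspace \<Omega> 2"
  shows "(\<lambda>x. - f x) \<in> Lspace \<Omega> 2" "E (\<lambda>x. - f x) = - E f"
proof -
  have e: "ext \<Omega> (\<lambda>x. - f x) = (\<lambda>x. - ext \<Omega> f x)" by (auto simp: ext_def)
  show "(\<lambda>x. - f x) \<in> Lspace \<Omega> 2" "E (\<lambda>x. - f x) = - E f"
    using f unfolding Lspace_iff E_def e by (simp_all add: sqint_minus cls_minus)
qed

lemma Lnorm_tendsto_iff:
  assumes "\<forall>\<^sub>F t in F. h t \<in> Lspace \<Omega> 2"
  shows "((\<lambda>t. Lnorm \<Omega> 2 (h t)) \<longlongrightarrow> 0) F \<longleftrightarrow> ((\<lambda>t. E (h t)) \<longlongrightarrow> 0) F"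
proof -
  have "((\<lambda>t. Lnorm \<Omega> 2 (h t)) \<longlongrightarrow> 0) F \<longleftrightarrow> ((\<lambda>t. ennreal (norm (E (h t)))) \<longlongrightarrow> 0) F"
    by (rule tendsto_cong, rule eventually_mono[OF assms], rule Lnorm_E)
  also have "\<dots> \<longleftrightarrow> ((\<lambda>t. norm (E (h t))) \<longlongrightarrow> 0) F"
    using tendsto_ennreal_iff[of "\<lambda>t. norm (E (h t))" F 0] by simp
  also have "\<dots> \<longleftrightarrow> ((\<lambda>t. E (h t)) \<longlongrightarrow> 0) F" by (rule tendsto_norm_zero_iff)
  finally show ?thesis .
qed

lemma Lnorm_LIMSEQ_iff:
  fixes h :: "nat \<Rightarrow> real ^ 'n \<Rightarrow> real"
  shows "(\<And>m. h m \<in> Lspace \<Omega> 2) \<Longrightarrow> (\<lambda>m. Lnorm \<Omega> 2 (h m)) \<longlonglongrightarrow> 0 \<longleftrightarrow> (\<lambda>m. E (h m)) \<longlonglongrightarrow> 0"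
  by (rule Lnorm_tendsto_iff) simp

lemma integral_on_test:
  assumes "u \<in> Lspace \<Omega> 2" "sqint \<psi>"
  shows "(\<integral>x. u x * \<psi> x \<partial>lebesgue_on \<Omega>) = inner (E u) (cls \<psi>)"
proof -
  have "(\<integral>x. u x * \<psi> x \<partial>lebesgue_on \<Omega>) = (\<integral>x. ext \<Omega> u x * \<psi> x \<partial>lebesgue)"
    unfolding integral_lebesgue_on[OF \<Omega>_sets] by (simp add: ext_indicator mult.assoc)
  also have "\<dots> = inner (E u) (cls \<psi>)" using assms by (simp add: E_def inner_cls Lspace_iff)
  finally show ?thesis .
qed

lemma has_weak_gradient_iff:
  "has_weak_gradient \<Omega> u G \<longleftrightarrow> u \<in> Lspace \<Omega> 2 \<and> (\<forall>i. (\<lambda>x. G x $ i) \<in> Lspace \<Omega> 2) \<and>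
     (\<forall>\<phi> i. test_function \<Omega> \<phi> \<longrightarrow> inner (E u) (cls (partial i \<phi>)) = - inner (GE G $ i) (cls \<phi>))"
proof -
  have "(LINT x|lebesgue_on \<Omega>. u x * partial i \<phi> x) = - (LINT x|lebesgue_on \<Omega>. G x $ i * \<phi> x) \<longleftrightarrow>
      inner (E u) (cls (partial i \<phi>)) = - inner (GE G $ i) (cls \<phi>)"
    if "u \<in> Lspace \<Omega> 2" "\<forall>i. (\<lambda>x. G x $ i) \<in> Lspace \<Omega> 2" "test_function \<Omega> \<phi>" for \<phi> i
    using integral_on_test[OF that(1) sqint_test_function[OF test_function_partial[OF that(3)]]]
      integral_on_test[OF that(2)[rule_format] sqint_test_function[OF that(3)]] by (simp add: GE_def)
  then show ?thesis unfolding has_weak_gradient_def by blast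
qed

text \<open>By the fundamental lemma. Consequently the choices made in \<open>weak_gradient\<close>
  and \<open>heat_gradient\<close> are determined up to null sets.\<close>

lemma has_weak_gradient_unique:
  assumes G: "has_weak_gradient \<Omega> u G" and G': "has_weak_gradient \<Omega> u' G'" and eq: "E u = E u'"
  shows "GE G = GE G'"
proof -
  have "GE G $ i = GE G' $ i" for i
  proof -
    define Y where "Y = GE G $ i - GE G' $ i"
    have Li: "(\<lambda>x. G x $ i) \<in> Lspace \<Omega> 2" "(\<lambda>x. G' x $ i) \<in> Lspace \<Omega> 2"
      using G G' by (auto simp: has_weak_gradient_iff)
    have "AE x in lebesgue. x \<in> \<Omega> \<longrightarrow> rp Y x = 0"
    proof (rule fundamental_lemma[OF open_\<Omega> sqint_rp])
      fix \<phi> assume t: "test_function \<Omega> \<phi>"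
      have "inner Y (cls \<phi>) = 0" using t G G' eq by (simp add: has_weak_gradient_iff Y_def inner_diff_left)
      then show "(\<integral>x. rp Y x * \<phi> x \<partial>lebesgue) = 0" using inner_cls[OF sqint_rp sqint_test_function[OF t], of Y] by simp
    qed
    moreover have "Y \<in> supp_in \<Omega>"
      unfolding Y_def GE_def using E_H0[OF Li(1)] E_H0[OF Li(2)] by (simp add: H0_eq subspace_diff supp_in_closed_subspace(2)[OF \<Omega>_sets])
    ultimately have "AE x in lebesgue. rp Y x = rp 0 x"
      unfolding supp_in_def mem_Collect_eq using AE_rp_zero by eventually_elim auto
    then have "Y = 0" by (simp add: l2_eq_iff)
    then show ?thesis by (simp add: Y_def)
  qed
  then show ?thesis by (simp add: vec_eq_iff)
qed

lemma sobolev_has_weak_gradient: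
  assumes "u \<in> Lspace \<Omega> 2" "(E u, GE G) \<in> sobolev_graph \<Omega>" "\<And>i. (\<lambda>x. G x $ i) \<in> Lspace \<Omega> 2"
  shows "has_weak_gradient \<Omega> u G"
  unfolding has_weak_gradient_iff using assms sobolev_graph_weak[OF assms(2)] by blast

lemma GE_rp:
  assumes "\<And>i. GG $ i \<in> H0" shows "GE (\<lambda>x. \<chi> i. rp (GG $ i) x) = GG"
  by (simp add: GE_def vec_eq_iff E_rp[OF assms])

lemma weak_gradient_eq:
  assumes u: "u \<in> Lspace \<Omega> 2" and g: "(E u, GG) \<in> sobolev_graph \<Omega>"
  shows "has_weak_gradient \<Omega> u (weak_gradient \<Omega> u)" "GE (weak_gradient \<Omega> u) = GG"
proof -
  define G where "G x = (\<chi> i. rp (GG $ i) x)" for x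
  have H: "GG $ i \<in> H0" for i using sobolev_graph_supp_in(2)[OF \<Omega>_sets g] by (simp add: H0_eq)
  have GG: "GE G = GG" unfolding G_def by (rule GE_rp[OF H])
  have h: "has_weak_gradient \<Omega> u G"
    by (rule sobolev_has_weak_gradient[OF u]) (simp_all add: GG g G_def rp_Lspace)
  then show w: "has_weak_gradient \<Omega> u (weak_gradient \<Omega> u)"
    unfolding weak_gradient_def by (rule someI[of "has_weak_gradient \<Omega> u"])
  show "GE (weak_gradient \<Omega> u) = GG" using has_weak_gradient_unique[OF w h refl] GG by simp
qed

lemma W12_0_iff: "u \<in> W12_0 \<Omega> \<longleftrightarrow> u \<in> Lspace \<Omega> 2 \<and> (\<exists>GG. (E u, GG) \<in> sobolev_graph \<Omega>)"
proof
  assume "u \<in> W12_0 \<Omega>"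
  then obtain G \<phi> where G: "has_weak_gradient \<Omega> u G" and \<phi>: "\<And>m::nat. test_function \<Omega> (\<phi> m)"
    and l1: "(\<lambda>m. Lnorm \<Omega> 2 (\<lambda>x. \<phi> m x - u x)) \<longlonglongrightarrow> 0"
    and l2: "\<And>i. (\<lambda>m. Lnorm \<Omega> 2 (\<lambda>x. partial i (\<phi> m) x - G x $ i)) \<longlonglongrightarrow> 0"
    unfolding W12_0_def by blast
  have u: "u \<in> Lspace \<Omega> 2" and Gi: "(\<lambda>x. G x $ i) \<in> Lspace \<Omega> 2" for i using G by (auto simp: has_weak_gradient_iff)
  have ext_t: "ext \<Omega> \<psi> = \<psi>" if "test_function \<Omega> \<psi>" for \<psi> using test_function_outside[OF that] by (auto simp: ext_def)
  have Lt: "\<psi> \<in> Lspace \<Omega> 2" "E \<psi> = cls \<psi>" if "test_function \<Omega> \<psi>" for \<psi>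
    using ext_t[OF that] sqint_test_function[OF that] by (simp_all add: Lspace_iff E_def)
  have "(\<lambda>m. E (\<lambda>x. \<phi> m x - u x)) \<longlonglongrightarrow> 0" using l1 Lnorm_LIMSEQ_iff[where h="\<lambda>m x. \<phi> m x - u x", OF E_diff(1)[OF Lt(1)[OF \<phi>] u]] by blast
  then have c1: "(\<lambda>m. cls (\<phi> m)) \<longlonglongrightarrow> E u" by (simp add: E_diff(2)[OF Lt(1)[OF \<phi>] u] Lt(2)[OF \<phi>] LIM_zero_iff)
  have c2: "(\<lambda>m. cls (partial i (\<phi> m))) \<longlonglongrightarrow> GE G $ i" for i
  proof -
    note tp = test_function_partial[where i=i, OF \<phi>]
    have "(\<lambda>m. E (\<lambda>x. partial i (\<phi> m) x - G x $ i)) \<longlonglongrightarrow> 0" using l2[of i] Lnorm_LIMSEQ_iff[where h="\<lambda>m x. partial i (\<phi> m) x - G x $ i", OF E_diff(1)[OF Lt(1)[OF tp] Gi]] by blast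
    then show ?thesis by (simp add: E_diff(2)[OF Lt(1)[OF tp] Gi] Lt(2)[OF tp] LIM_zero_iff GE_def)
  qed
  have "(E u, GE G) \<in> sobolev_graph \<Omega>" by (rule sobolev_graphI[OF \<phi> c1 c2])
  then show "u \<in> Lspace \<Omega> 2 \<and> (\<exists>GG. (E u, GG) \<in> sobolev_graph \<Omega>)" using u by blast
next
  assume "u \<in> Lspace \<Omega> 2 \<and> (\<exists>GG. (E u, GG) \<in> sobolev_graph \<Omega>)"
  then obtain GG where u: "u \<in> Lspace \<Omega> 2" and GG: "(E u, GG) \<in> sobolev_graph \<Omega>" by blast
  define G where "G = weak_gradient \<Omega> u"
  have G: "has_weak_gradient \<Omega> u G" "GE G = GG" using weak_gradient_eq[OF u GG] by (simp_all add: G_def)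
  have Gi: "(\<lambda>x. G x $ i) \<in> Lspace \<Omega> 2" for i using G by (auto simp: has_weak_gradient_iff)
  obtain \<phi> where \<phi>: "\<And>m::nat. test_function \<Omega> (\<phi> m)" "(\<lambda>m. cls (\<phi> m)) \<longlonglongrightarrow> E u" "\<And>i. (\<lambda>m. cls (partial i (\<phi> m))) \<longlonglongrightarrow> GG $ i"
    using sobolev_graph_sequence[OF GG] by blast
  have ext_t: "ext \<Omega> \<psi> = \<psi>" if "test_function \<Omega> \<psi>" for \<psi> using test_function_outside[OF that] by (auto simp: ext_def)
  have Lt: "\<psi> \<in> Lspace \<Omega> 2" "E \<psi> = cls \<psi>" if "test_function \<Omega> \<psi>" for \<psi>
    using ext_t[OF that] sqint_test_function[OF that] by (simp_all add: Lspace_iff E_def)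
  have "(\<lambda>m. E (\<lambda>x. \<phi> m x - u x)) \<longlonglongrightarrow> 0" using \<phi>(2) by (simp add: E_diff(2)[OF Lt(1)[OF \<phi>(1)] u] Lt(2)[OF \<phi>(1)] LIM_zero_iff)
  then have l1: "(\<lambda>m. Lnorm \<Omega> 2 (\<lambda>x. \<phi> m x - u x)) \<longlonglongrightarrow> 0" using Lnorm_LIMSEQ_iff[where h="\<lambda>m x. \<phi> m x - u x", OF E_diff(1)[OF Lt(1)[OF \<phi>(1)] u]] by blast
  have l2: "(\<lambda>m. Lnorm \<Omega> 2 (\<lambda>x. partial i (\<phi> m) x - G x $ i)) \<longlonglongrightarrow> 0" for i
  proof -
    note tp = test_function_partial[where i=i, OF \<phi>(1)]
    have "GG $ i = E (\<lambda>x. G x $ i)" using G(2) by (simp add: GE_def flip: G(2))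
    then have "(\<lambda>m. E (\<lambda>x. partial i (\<phi> m) x - G x $ i)) \<longlonglongrightarrow> 0" using \<phi>(3)[of i]
      by (simp add: E_diff(2)[OF Lt(1)[OF tp] Gi] Lt(2)[OF tp] LIM_zero_iff)
    then show ?thesis using Lnorm_LIMSEQ_iff[where h="\<lambda>m x. partial i (\<phi> m) x - G x $ i", OF E_diff(1)[OF Lt(1)[OF tp] Gi]] by blast
  qed
  show "u \<in> W12_0 \<Omega>" unfolding W12_0_def using G(1) \<phi>(1) l1 l2 by blast
qed

lemma dirichlet_form_eq:
  assumes u: "u \<in> Lspace \<Omega> 2" "(E u, GU) \<in> sobolev_graph \<Omega>" and v: "v \<in> Lspace \<Omega> 2" "(E v, GV) \<in> sobolev_graph \<Omega>"
  shows "dirichlet_form \<Omega> A u v = bform GU GV"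
  unfolding dirichlet_form_def bform_def
proof (intro sum.cong refl)
  fix k l
  let ?f = "\<lambda>x. weak_gradient \<Omega> u x $ k" and ?g = "\<lambda>x. weak_gradient \<Omega> v x $ l"
  have L: "?f \<in> Lspace \<Omega> 2" "?g \<in> Lspace \<Omega> 2"
    using weak_gradient_eq(1)[OF u] weak_gradient_eq(1)[OF v] by (auto simp: has_weak_gradient_iff)
  have G: "GU $ k = E ?f" "GV $ l = E ?g"
    using weak_gradient_eq(2)[OF u] weak_gradient_eq(2)[OF v] by (auto simp: GE_def)
  note s = L[unfolded Lspace_iff]
  have "inner (mulop (a k l) (GU $ k)) (GV $ l) = (\<integral>x. a k l x * ext \<Omega> ?f x * ext \<Omega> ?g x \<partial>lebesgue)"
    unfolding G E_def mulop_cls[OF a_measurable a_bound s(1)]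
    by (rule inner_cls[OF sqint_mult_bounded(1)[OF s(1) a_measurable a_bound] s(2)])
  also have "\<dots> = (\<integral>x. indicator \<Omega> x * (A x $ k $ l * ?f x * ?g x) \<partial>lebesgue)"
    by (intro arg_cong[where f="integral\<^sup>L lebesgue"] ext) (simp add: a_def ext_def)
  also have "\<dots> = (LINT x|lebesgue_on \<Omega>. A x $ k $ l * ?f x * ?g x)" by (rule integral_lebesgue_on[OF \<Omega>_sets, symmetric])
  finally show "(LINT x|lebesgue_on \<Omega>. A x $ k $ l * ?f x * ?g x) = inner (mulop (a k l) (GU $ k)) (GV $ l)" by simp
qed

text \<open>Adding the inner product of \<open>u\<close> and \<open>v\<close> to both sides of the
  weak equation turns L u = g into the equation that defines \<open>R (E u + E g)\<close>.\<close>

lemma div_operator_iff: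
  "div_operator \<Omega> A u g \<longleftrightarrow> u \<in> Lspace \<Omega> 2 \<and> g \<in> Lspace \<Omega> 2 \<and> J (E u + E g) = E u"
proof
  assume d: "div_operator \<Omega> A u g"
  then have u: "u \<in> Lspace \<Omega> 2" and g: "g \<in> Lspace \<Omega> 2" by (auto simp: div_operator_def W12_0_iff)
  obtain GU where GU: "(E u, GU) \<in> sobolev_graph \<Omega>" using d by (auto simp: div_operator_def W12_0_iff)
  have "R (E u + E g) = (E u, GU)"
  proof (rule R_unique[OF GU])
    fix v assume v: "v \<in> sobolev_graph \<Omega>"
    define w where "w = rp (fst v)"
    have w: "w \<in> Lspace \<Omega> 2" "E w = fst v" using V_H0[OF v] by (simp_all add: w_def rp_Lspace E_rp)
    then have vg: "(E w, snd v) \<in> sobolev_graph \<Omega>" using v by simp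
    then have "w \<in> W12_0 \<Omega>" unfolding W12_0_iff using w(1) by blast
    then have "dirichlet_form \<Omega> A u w = (LINT x|lebesgue_on \<Omega>. g x * w x)" using d by (simp add: div_operator_def)
    then have "bform GU (snd v) = inner (E g) (cls w)"
      using dirichlet_form_eq[OF u GU w(1) vg] integral_on_test[OF g, of w] by (simp add: w_def)
    then show "Q (E u, GU) v = inner (E u + E g) (fst v)" by (simp add: Q_def w_def inner_add_left)
  qed
  then show "u \<in> Lspace \<Omega> 2 \<and> g \<in> Lspace \<Omega> 2 \<and> J (E u + E g) = E u" using u g by (simp add: J_def)
next
  assume *: "u \<in> Lspace \<Omega> 2 \<and> g \<in> Lspace \<Omega> 2 \<and> J (E u + E g) = E u"
  then have u: "u \<in> Lspace \<Omega> 2" and g: "g \<in> Lspace \<Omega> 2" by auto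
  define GU where "GU = snd (R (E u + E g))"
  have RU: "R (E u + E g) = (E u, GU)" using * by (simp add: J_def GU_def prod_eq_iff)
  have GU: "(E u, GU) \<in> sobolev_graph \<Omega>" using R(1)[of "E u + E g"] by (simp add: RU)
  have "dirichlet_form \<Omega> A u v = (LINT x|lebesgue_on \<Omega>. g x * v x)" if vW: "v \<in> W12_0 \<Omega>" for v
  proof -
    obtain GV where v: "v \<in> Lspace \<Omega> 2" "(E v, GV) \<in> sobolev_graph \<Omega>" using vW by (auto simp: W12_0_iff)
    have "Q (E u, GU) (E v, GV) = inner (E u + E g) (E v)" using R(2)[OF v(2), of "E u + E g"] by (simp add: RU)
    then have "bform GU GV = inner (E g) (E v)" by (simp add: Q_def inner_add_left)
    also have "\<dots> = (\<integral>x. ext \<Omega> g x * ext \<Omega> v x \<partial>lebesgue)" using v g by (simp add: E_def inner_cls Lspace_iff)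
    also have "\<dots> = (LINT x|lebesgue_on \<Omega>. g x * v x)"
      unfolding integral_lebesgue_on[OF \<Omega>_sets] by (intro arg_cong[where f="integral\<^sup>L lebesgue"] ext) (simp add: ext_def)
    finally show ?thesis using dirichlet_form_eq[OF u GU v] by simp
  qed
  note form = this
  have "u \<in> W12_0 \<Omega>" unfolding W12_0_iff using u GU by blast
  then show "div_operator \<Omega> A u g" unfolding div_operator_def by (intro conjI ballI g form)
qed

lemma E_quotient:
  assumes "f \<in> Lspace \<Omega> 2" "u \<in> Lspace \<Omega> 2" "g \<in> Lspace \<Omega> 2"
  shows "(\<lambda>x. (f x - u x) / t - g x) \<in> Lspace \<Omega> 2" "E (\<lambda>x. (f x - u x) / t - g x) = (1 / t) *\<^sub>R (E f - E u) - E g"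
proof -
  note 1 = E_linear_comb[OF E_diff(1)[OF assms(1,2)] E_minus(1)[OF assms(3)], of "1 / t"]
  have e: "(\<lambda>x. (f x - u x) / t - g x) = (\<lambda>x. (1 / t) * (f x - u x) + - g x)" by auto
  show "(\<lambda>x. (f x - u x) / t - g x) \<in> Lspace \<Omega> 2" unfolding e by (rule 1)
  show "E (\<lambda>x. (f x - u x) / t - g x) = (1 / t) *\<^sub>R (E f - E u) - E g"
    unfolding e 1 E_diff(2)[OF assms(1,2)] E_minus(2)[OF assms(3)] by simp
qed

lemma generator_iff:
  assumes L: "\<And>t f. t \<ge> 0 \<Longrightarrow> f \<in> Lspace \<Omega> 2 \<Longrightarrow> S t f \<in> Lspace \<Omega> 2"
  shows "generator \<Omega> S u g \<longleftrightarrow> u \<in> Lspace \<Omega> 2 \<and> g \<in> Lspace \<Omega> 2 \<and>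
    ((\<lambda>t. (1 / t) *\<^sub>R (E (S t u) - E u)) \<longlongrightarrow> E g) (at_right 0)"
proof -
  have "((\<lambda>t. Lnorm \<Omega> 2 (\<lambda>x. (S t u x - u x) / t - g x)) \<longlongrightarrow> 0) (at_right 0) \<longleftrightarrow>
    ((\<lambda>t. (1 / t) *\<^sub>R (E (S t u) - E u)) \<longlongrightarrow> E g) (at_right 0)" if u: "u \<in> Lspace \<Omega> 2" and g: "g \<in> Lspace \<Omega> 2"
  proof -
    have ev: "\<forall>\<^sub>F t in at_right (0::real). (\<lambda>x. (S t u x - u x) / t - g x) \<in> Lspace \<Omega> 2"
      using E_quotient(1)[OF L[OF _ u] u g] by (auto simp: eventually_at_filter)
    have ev2: "\<forall>\<^sub>F t in at_right (0::real). E (\<lambda>x. (S t u x - u x) / t - g x) = (1 / t) *\<^sub>R (E (S t u) - E u) - E g"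
      using E_quotient(2)[OF L[OF _ u] u g] by (auto simp: eventually_at_filter)
    show ?thesis unfolding Lnorm_tendsto_iff[OF ev] tendsto_cong[OF ev2] by (rule LIM_zero_iff)
  qed
  then show ?thesis unfolding generator_def by blast
qed

text \<open>Both sides of the generator condition become statements about classes; the result is the
  hypothesis of \<open>semigroup_unique\<close>, with \<open>- g\<close> in the role of L u.\<close>

lemma generator_div_operator:
  assumes L: "\<And>t f. t \<ge> 0 \<Longrightarrow> f \<in> Lspace \<Omega> 2 \<Longrightarrow> S t f \<in> Lspace \<Omega> 2"
  shows "(\<forall>u g. generator \<Omega> S u g \<longleftrightarrow> div_operator \<Omega> A u (\<lambda>x. - g x)) \<longleftrightarrow>
    (\<forall>u\<in>Lspace \<Omega> 2. \<forall>g\<in>Lspace \<Omega> 2.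
      ((\<lambda>t. (1 / t) *\<^sub>R (E (S t u) - E u)) \<longlongrightarrow> E g) (at_right 0) \<longleftrightarrow> J (E u - E g) = E u)"
proof -
  have m: "(\<lambda>x. - g x) \<in> Lspace \<Omega> 2 \<longleftrightarrow> g \<in> Lspace \<Omega> 2" for g
    using E_minus(1)[of g] E_minus(1)[of "\<lambda>x. - g x"] by auto
  have "div_operator \<Omega> A u (\<lambda>x. - g x) \<longleftrightarrow> u \<in> Lspace \<Omega> 2 \<and> g \<in> Lspace \<Omega> 2 \<and> J (E u - E g) = E u" for u g
    unfolding div_operator_iff m by (auto simp: E_minus(2))
  note dv = this
  have gi: "generator \<Omega> S u g \<longleftrightarrow> u \<in> Lspace \<Omega> 2 \<and> g \<in> Lspace \<Omega> 2 \<and>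
    ((\<lambda>t. (1 / t) *\<^sub>R (E (S t u) - E u)) \<longlongrightarrow> E g) (at_right 0)" for u g
    by (rule generator_iff) (rule L)
  show ?thesis
  proof (rule iffI; intro allI ballI)
    fix u g assume H: "\<forall>u g. generator \<Omega> S u g \<longleftrightarrow> div_operator \<Omega> A u (\<lambda>x. - g x)" and ug: "u \<in> Lspace \<Omega> 2" "g \<in> Lspace \<Omega> 2"
    from H[rule_format, of u g] show "((\<lambda>t. (1 / t) *\<^sub>R (E (S t u) - E u)) \<longlongrightarrow> E g) (at_right 0) \<longleftrightarrow> J (E u - E g) = E u"
      using ug by (simp only: gi dv simp_thms)
  next
    fix u g assume H: "\<forall>u\<in>Lspace \<Omega> 2. \<forall>g\<in>Lspace \<Omega> 2.
      ((\<lambda>t. (1 / t) *\<^sub>R (E (S t u) - E u)) \<longlongrightarrow> E g) (at_right 0) \<longleftrightarrow> J (E u - E g) = E u"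
    show "generator \<Omega> S u g \<longleftrightarrow> div_operator \<Omega> A u (\<lambda>x. - g x)"
      unfolding dv gi by (intro conj_cong refl H[rule_format])
  qed
qed

section \<open>Existence of the heat semigroup, and its uniqueness\<close>

definition heat0 :: "real \<Rightarrow> (real ^ 'n \<Rightarrow> real) \<Rightarrow> real ^ 'n \<Rightarrow> real" where
  "heat0 t f = rp (T t (E f))"

lemma heat0_Lspace: "heat0 t f \<in> Lspace \<Omega> 2" by (simp add: heat0_def rp_Lspace)

lemma E_heat0: "f \<in> Lspace \<Omega> 2 \<Longrightarrow> E (heat0 t f) = T t (E f)"
  unfolding heat0_def by (intro E_rp T_H0' E_H0)

lemma heat0_semigroup: "C0_semigroup \<Omega> heat0"
  unfolding C0_semigroup_def
proof (intro conjI allI ballI impI)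
  show "heat0 t f \<in> Lspace \<Omega> 2" for t f by (rule heat0_Lspace)
  show "AE x in lebesgue_on \<Omega>. heat0 t (\<lambda>y. c * f y + g y) x = c * heat0 t f x + heat0 t g x"
    if f: "f \<in> Lspace \<Omega> 2" and g: "g \<in> Lspace \<Omega> 2" for t f g c
  proof (subst E_eq_iff[symmetric])
    show "E (heat0 t (\<lambda>y. c * f y + g y)) = E (\<lambda>x. c * heat0 t f x + heat0 t g x)"
      by (simp add: E_heat0 E_linear_comb f g heat0_Lspace linear_add[OF bounded_linear.linear[OF T_bounded_linear]]
          linear_cmul[OF bounded_linear.linear[OF T_bounded_linear]])
  qed (simp_all add: heat0_Lspace E_linear_comb)
  show "\<exists>M. \<forall>f\<in>Lspace \<Omega> 2. Lnorm \<Omega> 2 (heat0 t f) \<le> ennreal M * Lnorm \<Omega> 2 f" for t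
    by (intro exI[of _ 1] ballI) (simp add: Lnorm_E heat0_Lspace E_heat0 T_norm_le)
  show "AE x in lebesgue_on \<Omega>. heat0 0 f x = f x" if "f \<in> Lspace \<Omega> 2" for f
    using that by (subst E_eq_iff[symmetric]) (simp_all add: heat0_Lspace E_heat0)
  show "AE x in lebesgue_on \<Omega>. heat0 (s + t) f x = heat0 s (heat0 t f) x" if "0 \<le> s" "0 \<le> t" "f \<in> Lspace \<Omega> 2" for s t f
    using that by (subst E_eq_iff[symmetric]) (simp_all add: heat0_Lspace E_heat0 T_add)
  show "((\<lambda>t. Lnorm \<Omega> 2 (\<lambda>x. heat0 t f x - f x)) \<longlongrightarrow> 0) (at_right 0)" if f: "f \<in> Lspace \<Omega> 2" for f
    using T_strong[OF E_H0[OF f]]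
    by (subst Lnorm_tendsto_iff) (simp_all add: E_diff heat0_Lspace E_heat0 f LIM_zero_iff)
qed

text \<open>The witness for the choice operator in \<open>heat\<close>; without it the definition
  would give no information.\<close>

lemma heat_exists: "C0_semigroup \<Omega> heat0 \<and> (\<forall>u g. generator \<Omega> heat0 u g \<longleftrightarrow> div_operator \<Omega> A u (\<lambda>x. - g x))"
  unfolding generator_div_operator[of heat0, OF heat0_Lspace]
  using heat0_semigroup T_generator[OF E_H0 E_H0] by (simp add: E_heat0)

lemma heat_spec: "C0_semigroup \<Omega> (heat \<Omega> A)" "\<forall>u g. generator \<Omega> (heat \<Omega> A) u g \<longleftrightarrow> div_operator \<Omega> A u (\<lambda>x. - g x)"
  using someI[of "\<lambda>T. C0_semigroup \<Omega> T \<and> (\<forall>u g. generator \<Omega> T u g \<longleftrightarrow> div_operator \<Omega> A u (\<lambda>x. - g x))", OF heat_exists]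
  unfolding heat_def by blast+

lemma heat_Lspace: "t \<ge> 0 \<Longrightarrow> f \<in> Lspace \<Omega> 2 \<Longrightarrow> heat \<Omega> A t f \<in> Lspace \<Omega> 2"
  using heat_spec(1) unfolding C0_semigroup_def by blast

lemma heat_E_linear:
  assumes "t \<ge> 0" "f \<in> Lspace \<Omega> 2" "g \<in> Lspace \<Omega> 2"
  shows "E (heat \<Omega> A t (\<lambda>y. c * f y + g y)) = c *\<^sub>R E (heat \<Omega> A t f) + E (heat \<Omega> A t g)"
proof -
  have "AE x in lebesgue_on \<Omega>. heat \<Omega> A t (\<lambda>y. c * f y + g y) x = c * heat \<Omega> A t f x + heat \<Omega> A t g x"
    using heat_spec(1) assms unfolding C0_semigroup_def by blast
  then have "E (heat \<Omega> A t (\<lambda>y. c * f y + g y)) = E (\<lambda>x. c * heat \<Omega> A t f x + heat \<Omega> A t g x)"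
    using assms by (subst E_eq_iff) (simp_all add: heat_Lspace E_linear_comb)
  then show ?thesis using assms by (simp add: E_linear_comb heat_Lspace)
qed

lemma heat_E_bound:
  assumes "t \<ge> 0" shows "\<exists>M. \<forall>f\<in>Lspace \<Omega> 2. norm (E (heat \<Omega> A t f)) \<le> M * norm (E f)"
proof -
  obtain M :: real where M: "\<forall>f\<in>Lspace \<Omega> 2. Lnorm \<Omega> 2 (heat \<Omega> A t f) \<le> ennreal M * Lnorm \<Omega> 2 f"
    using heat_spec(1) assms unfolding C0_semigroup_def by blast
  have "norm (E (heat \<Omega> A t f)) \<le> max M 0 * norm (E f)" if f: "f \<in> Lspace \<Omega> 2" for f
  proof -
    have "ennreal (norm (E (heat \<Omega> A t f))) \<le> ennreal M * ennreal (norm (E f))"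
      using M f assms by (simp add: Lnorm_E heat_Lspace)
    also have "ennreal M = ennreal (max M 0)" by (simp add: max_def ennreal_neg)
    also have "ennreal (max M 0) * ennreal (norm (E f)) = ennreal (max M 0 * norm (E f))" by (simp add: ennreal_mult)
    finally show ?thesis by (simp add: ennreal_le_iff)
  qed
  then show ?thesis by blast
qed

lemma heat_E_cong:
  assumes "t \<ge> 0" "f \<in> Lspace \<Omega> 2" "g \<in> Lspace \<Omega> 2" "E f = E g"
  shows "E (heat \<Omega> A t f) = E (heat \<Omega> A t g)"
proof -
  obtain M where M: "\<forall>f\<in>Lspace \<Omega> 2. norm (E (heat \<Omega> A t f)) \<le> M * norm (E f)" using heat_E_bound[OF assms(1)] by blast
  have l: "(\<lambda>y. (-1) * f y + g y) \<in> Lspace \<Omega> 2" "E (\<lambda>y. (-1) * f y + g y) = 0"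
    using E_linear_comb[OF assms(2,3), of "-1"] assms(4) by simp_all
  have "norm (E (heat \<Omega> A t (\<lambda>y. (-1) * f y + g y))) \<le> 0" using bspec[OF M l(1)] l(2) by simp
  then show ?thesis using heat_E_linear[OF assms(1-3), of "-1"] by simp
qed

lemma E_rp_bounded_linear: "bounded_linear (\<lambda>X. E (rp X))"
proof (rule bounded_linear_intro)
  have c: "E (rp (c *\<^sub>R X + Y)) = c *\<^sub>R E (rp X) + E (rp Y)" for c X Y
  proof -
    have "AE x in lebesgue. rp (c *\<^sub>R X + Y) x = c * rp X x + rp Y x"
      using AE_rp_add[of "c *\<^sub>R X" Y] AE_rp_scale[of c X] by eventually_elim simp
    then have "AE x in lebesgue_on \<Omega>. rp (c *\<^sub>R X + Y) x = c * rp X x + rp Y x"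
      unfolding AE_on_iff by eventually_elim simp
    then show ?thesis by (simp add: E_eq_iff[symmetric] rp_Lspace E_linear_comb)
  qed
  show "E (rp (X + Y)) = E (rp X) + E (rp Y)" for X Y using c[of 1 X Y] by simp
  have "E (rp 0) = 0" by (rule E_rp[OF subspace_0[OF H0_subspace]])
  then show "E (rp (r *\<^sub>R X)) = r *\<^sub>R E (rp X)" for r X using c[of r X 0] by simp
  show "norm (E (rp X)) \<le> norm X * 1" for X
  proof -
    have "norm (E (rp X)) \<le> 1 * norm (cls (rp X))" unfolding E_def
      by (rule norm_cls_mono) (use rp_Lspace[of X, unfolded Lspace_iff] in \<open>auto simp: ext_def\<close>)
    then show ?thesis by simp
  qed
qed

text \<open>A semigroup is determined by its generator, hence the one picked by \<open>heat\<close> is the one given by the functional calculus.\<close>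

lemma heat_eq:
  assumes t: "t \<ge> 0" and f: "f \<in> Lspace \<Omega> 2"
  shows "E (heat \<Omega> A t f) = T t (E f)"
proof -
  \<comment> \<open>The chosen semigroup is linear and bounded only up to null sets. Passing to
    classes through representatives gives genuine operators, and \<open>heat_E_cong\<close> shows
    that the representative does not matter.\<close>
  define S where "S t X = E (heat \<Omega> A t (rp X))" for t X
  have SE: "S t (E f) = E (heat \<Omega> A t f)" if "t \<ge> 0" "f \<in> Lspace \<Omega> 2" for t f
    unfolding S_def by (rule heat_E_cong[OF that(1) rp_Lspace that(2)]) (rule E_rp[OF E_H0[OF that(2)]])
  have S_H0: "S t X \<in> H0" if "t \<ge> 0" for t X unfolding S_def by (intro E_H0 heat_Lspace rp_Lspace that)
  \<comment> \<open>This is restriction to \<open>\<Omega>\<close> and the identity on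
    \<open>H0\<close> only, which is why the locale demands the laws on a subspace.\<close>
  have S0: "S 0 X = E (rp X)" for X
  proof -
    have "AE x in lebesgue_on \<Omega>. heat \<Omega> A 0 (rp X) x = rp X x"
      using heat_spec(1) rp_Lspace[of X] unfolding C0_semigroup_def by blast
    then show ?thesis unfolding S_def by (simp add: E_eq_iff heat_Lspace rp_Lspace)
  qed
  have lin: "bounded_linear (S t)" if t: "t \<ge> 0" for t
  proof -
    obtain M where M: "\<forall>f\<in>Lspace \<Omega> 2. norm (E (heat \<Omega> A t f)) \<le> M * norm (E f)" using heat_E_bound[OF t] by blast
    have c: "S t (c *\<^sub>R X + Y) = c *\<^sub>R S t X + S t Y" for c X Y
    proof -
      have "E (rp (c *\<^sub>R X + Y)) = c *\<^sub>R E (rp X) + E (rp Y)"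
        by (simp only: linear_add[OF bounded_linear.linear[OF E_rp_bounded_linear]] linear_cmul[OF bounded_linear.linear[OF E_rp_bounded_linear]])
      then have "E (rp (c *\<^sub>R X + Y)) = E (\<lambda>y. c * rp X y + rp Y y)" by (simp add: E_linear_comb rp_Lspace)
      then have "S t (c *\<^sub>R X + Y) = E (heat \<Omega> A t (\<lambda>y. c * rp X y + rp Y y))"
        unfolding S_def by (intro heat_E_cong t rp_Lspace E_linear_comb)
      then show ?thesis by (simp add: heat_E_linear t rp_Lspace S_def)
    qed
    show ?thesis
    proof (rule bounded_linear_intro)
      show "S t (X + Y) = S t X + S t Y" for X Y using c[of 1 X Y] by simp
      have "S t 0 = 0" using c[of "-1" 0 0] by simp
      then show "S t (r *\<^sub>R X) = r *\<^sub>R S t X" for r X using c[of r X 0] by simp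
      show "norm (S t X) \<le> norm X * max M 0" for X
      proof -
        have "norm (S t X) \<le> M * norm (E (rp X))" unfolding S_def using M rp_Lspace by blast
        also have "\<dots> \<le> max M 0 * norm (E (rp X))" by (intro mult_right_mono) auto
        also have "\<dots> \<le> max M 0 * norm X"
        proof (intro mult_left_mono)
          have "norm (E (rp X)) \<le> 1 * norm (cls (rp X))" unfolding E_def
            by (rule norm_cls_mono) (use rp_Lspace[of X, unfolded Lspace_iff] in \<open>auto simp: ext_def\<close>)
          then show "norm (E (rp X)) \<le> norm X" by simp
        qed simp
        finally show ?thesis by (simp add: mult.commute)
      qed
    qed
  qed
  have strong: "((\<lambda>t. S t X) \<longlongrightarrow> S 0 X) (at_right 0)" for X
  proof -
    have "((\<lambda>t. Lnorm \<Omega> 2 (\<lambda>x. heat \<Omega> A t (rp X) x - rp X x)) \<longlongrightarrow> 0) (at_right 0)"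
      using heat_spec(1) rp_Lspace[of X] unfolding C0_semigroup_def by blast
    moreover have ev: "\<forall>\<^sub>F t in at_right (0::real). (\<lambda>x. heat \<Omega> A t (rp X) x - rp X x) \<in> Lspace \<Omega> 2"
      using E_diff(1)[OF heat_Lspace[OF _ rp_Lspace] rp_Lspace] by (auto simp: eventually_at_filter)
    ultimately have "((\<lambda>t. E (\<lambda>x. heat \<Omega> A t (rp X) x - rp X x)) \<longlongrightarrow> 0) (at_right 0)" by (simp add: Lnorm_tendsto_iff)
    moreover have "\<forall>\<^sub>F t in at_right (0::real). E (\<lambda>x. heat \<Omega> A t (rp X) x - rp X x) = S t X - S 0 X"
      using E_diff(2)[OF heat_Lspace[OF _ rp_Lspace] rp_Lspace] by (auto simp: eventually_at_filter S_def[of _ X] S0[unfolded S_def])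
    ultimately have "((\<lambda>t. S t X - S 0 X) \<longlongrightarrow> 0) (at_right 0)" by (rule Lim_transform_eventually)
    then show ?thesis by (simp add: LIM_zero_iff)
  qed
  obtain \<delta> M where \<delta>: "\<delta> > 0" "\<forall>t f. 0 \<le> t \<longrightarrow> t \<le> \<delta> \<longrightarrow> norm (S t f) \<le> M * norm f"
    using semigroup_locally_bounded[of S, OF lin strong] by blast
  have S0H: "S 0 X = X" if "X \<in> H0" for X using S0 E_rp[OF that] by simp
  have "strongly_continuous_semigroup_on H0 S \<delta> M"
  proof (rule strongly_continuous_semigroup_on.intro)
    show "S (s + t) X = S s (S t X)" if st: "s \<ge> 0" "t \<ge> 0" for s t X
    proof -
      have L: "heat \<Omega> A t (rp X) \<in> Lspace \<Omega> 2" by (intro heat_Lspace rp_Lspace st)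
      have "AE x in lebesgue_on \<Omega>. heat \<Omega> A (s + t) (rp X) x = heat \<Omega> A s (heat \<Omega> A t (rp X)) x"
        using heat_spec(1) rp_Lspace[of X] st unfolding C0_semigroup_def by blast
      then have "S (s + t) X = E (heat \<Omega> A s (heat \<Omega> A t (rp X)))"
        unfolding S_def using st by (subst E_eq_iff) (simp_all add: heat_Lspace rp_Lspace)
      also have "\<dots> = S s (E (heat \<Omega> A t (rp X)))" using SE[OF st(1) L] by simp
      finally show ?thesis by (simp add: S_def)
    qed
    show "((\<lambda>t. S t X) \<longlongrightarrow> X) (at_right 0)" if "X \<in> H0" for X using strong[of X] S0H[OF that] by simp
    show "norm (S t X) \<le> M * norm X" if "0 \<le> t" "t \<le> \<delta>" for t X using \<delta>(2) that by blast
    show "bounded_linear (S t)" if "0 \<le> t" for t by (rule lin[OF that])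
    show "S t X \<in> H0" if "0 \<le> t" "X \<in> H0" for t X by (rule S_H0[OF that(1)])
    show "S 0 X = X" if "X \<in> H0" for X by (rule S0H[OF that])
  qed (rule \<delta>(1))
  moreover have "((\<lambda>h. (1 / h) *\<^sub>R (S h u - u)) \<longlongrightarrow> g) (at_right 0) \<longleftrightarrow> J (u - g) = u" if u: "u \<in> H0" and g: "g \<in> H0" for u g
  proof -
    have *: "((\<lambda>t. (1 / t) *\<^sub>R (E (heat \<Omega> A t (rp u)) - E (rp u))) \<longlongrightarrow> E (rp g)) (at_right 0) \<longleftrightarrow> J (E (rp u) - E (rp g)) = E (rp u)"
    proof -
      have "(\<forall>u g. generator \<Omega> (heat \<Omega> A) u g \<longleftrightarrow> div_operator \<Omega> A u (\<lambda>x. - g x)) \<longleftrightarrow>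
        (\<forall>u\<in>Lspace \<Omega> 2. \<forall>g\<in>Lspace \<Omega> 2.
          ((\<lambda>t. (1 / t) *\<^sub>R (E (heat \<Omega> A t u) - E u)) \<longlongrightarrow> E g) (at_right 0) \<longleftrightarrow> J (E u - E g) = E u)"
        by (rule generator_div_operator) (rule heat_Lspace)
      from this[THEN iffD1, OF heat_spec(2), rule_format, OF rp_Lspace rp_Lspace] show ?thesis .
    qed
    then show ?thesis by (simp add: S_def[symmetric] E_rp[OF u] E_rp[OF g])
  qed
  ultimately have "S t (E f) = T t (E f)" by (intro semigroup_unique t E_H0 f)
  then show ?thesis using SE[OF t f] by simp
qed

end

section \<open>Entropies and the chain rule\<close>

lemma ex_borel_representative:
  fixes X :: "'a::euclidean_space l2"
  shows "\<exists>b. b \<in> borel_measurable borel \<and> (AE x in lebesgue. rp X x = b x)"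
proof -
  have "rp X \<in> borel_measurable (completion lborel)" by (rule rp_measurable)
  from completion_ex_borel_measurable_real[OF this] obtain b where "b \<in> borel_measurable lborel" "AE x in lborel. rp X x = b x" by blast
  then show ?thesis by (auto intro: AE_completion)
qed

text \<open>Time is rounded down to a multiple of \<open>2 ^ (- n)\<close>. The rounded path takes
  countably many values, so Borel representatives of these yield a jointly measurable function. By
  the Lipschitz bound the rounded values at a fixed \<open>t\<close> converge geometrically, hence
  almost everywhere in \<open>x\<close>, and this holds for every \<open>t > 0\<close>, not just for
  almost every one.\<close>

lemma jointly_measurable_path:
  fixes X :: "real \<Rightarrow> 'a::euclidean_space l2"
  assumes Lip: "\<And>\<delta>. \<delta> > 0 \<Longrightarrow> \<exists>C. \<forall>t r. \<delta> \<le> t \<longrightarrow> \<delta> \<le> r \<longrightarrow> norm (X t - X r) \<le> C * \<bar>t - r\<bar>"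
  shows "\<exists>g. g \<in> borel_measurable (borel :: (real \<times> 'a) measure) \<and> (\<forall>t>0. sqint (\<lambda>x. g (t, x)) \<and> cls (\<lambda>x. g (t, x)) = X t)"
proof -
  obtain bor :: "'a l2 \<Rightarrow> 'a \<Rightarrow> real" where bor: "\<And>Y. bor Y \<in> borel_measurable borel" "\<And>Y. AE x in lebesgue. rp Y x = bor Y x"
    using ex_borel_representative by metis
  define \<theta> where "\<theta> n t = real_of_int \<lfloor>t * 2 ^ n\<rfloor> / 2 ^ n" for n :: nat and t :: real
  define G where "G n = (\<lambda>p :: real \<times> 'a. bor (X (\<theta> n (fst p))) (snd p))" for n
  have Gm: "G n \<in> borel_measurable borel" for n
  proof -
    have "(\<lambda>p :: real \<times> 'a. bor (X (real_of_int i / 2 ^ n)) (snd p)) \<in> borel_measurable borel" for i :: int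
      by (rule measurable_compose[OF _ bor(1)], rule borel_measurable_continuous_onI) (intro continuous_intros)
    moreover have "(\<lambda>p :: real \<times> 'a. \<lfloor>fst p * 2 ^ n\<rfloor>) \<in> measurable borel (count_space UNIV)"
      by (rule measurable_compose[OF _ measurable_real_floor]) (intro borel_measurable_continuous_onI continuous_intros)
    ultimately show ?thesis unfolding G_def \<theta>_def by (rule measurable_compose_countable)
  qed
  define g where "g p = lim (\<lambda>n. G n p)" for p
  have gm: "g \<in> borel_measurable borel" unfolding g_def[abs_def] by (rule borel_measurable_lim_metric) (rule Gm)
  have \<theta>: "\<theta> n t \<le> t" "t - \<theta> n t \<le> (1/2) ^ n" for n t
  proof -
    have a: "real_of_int \<lfloor>t * 2 ^ n\<rfloor> \<le> t * 2 ^ n" and b: "t * 2 ^ n - real_of_int \<lfloor>t * 2 ^ n\<rfloor> \<le> 1" by linarith+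
    have "(t * 2 ^ n - real_of_int \<lfloor>t * 2 ^ n\<rfloor>) / 2 ^ n \<le> 1 / 2 ^ n" by (rule divide_right_mono[OF b]) simp
    moreover have "real_of_int \<lfloor>t * 2 ^ n\<rfloor> / 2 ^ n \<le> t * 2 ^ n / 2 ^ n" by (rule divide_right_mono[OF a]) simp
    ultimately show "\<theta> n t \<le> t" "t - \<theta> n t \<le> (1/2) ^ n"
      by (simp_all add: \<theta>_def diff_divide_distrib power_one_over)
  qed
  have "sqint (\<lambda>x. g (t, x)) \<and> cls (\<lambda>x. g (t, x)) = X t" if t: "t > 0" for t
  proof -
    obtain C where C: "\<And>r s. t / 2 \<le> r \<Longrightarrow> t / 2 \<le> s \<Longrightarrow> norm (X r - X s) \<le> C * \<bar>r - s\<bar>"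
      using Lip[of "t / 2"] t by auto
    have "0 \<le> C * \<bar>t - (t + 1)\<bar>" by (rule order_trans[OF norm_ge_zero C]) (use t in auto)
    then have C0: "C \<ge> 0" by simp
    \<comment> \<open>Discards the coarse roundings that could fall below \<open>t / 2\<close>,
      where the constant \<open>C\<close> is not valid. A finite shift does not change the
      limit.\<close>
    obtain k where k: "(1/2) ^ k < t / 2" using real_arch_pow_inv[of "t / 2" "1/2"] t by auto
    define Y where "Y n = X (\<theta> (n + k) t)" for n
    have \<theta>2: "t / 2 \<le> \<theta> (n + k) t" for n
    proof -
      have "(1/2 :: real) ^ (n + k) \<le> (1/2) ^ k" by (intro power_decreasing) auto
      then show ?thesis using \<theta>(2)[of t "n + k"] k by linarith
    qed
    have Yt: "norm (Y n - X t) \<le> C * (1/2) ^ n" for n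
    proof -
      have "norm (Y n - X t) \<le> C * \<bar>\<theta> (n + k) t - t\<bar>" unfolding Y_def using C[OF \<theta>2, of t n] t by simp
      also have "\<dots> \<le> C * (1/2) ^ (n + k)" using \<theta>[where n="n + k" and t=t] by (intro mult_left_mono C0) auto
      also have "\<dots> \<le> C * (1/2) ^ n" by (intro mult_left_mono C0 power_decreasing) auto
      finally show ?thesis .
    qed
    have fast: "norm (Y (Suc n) - Y n) \<le> (2 * C) * (1/2) ^ n" for n
    proof -
      have "norm (Y (Suc n) - Y n) \<le> norm (Y (Suc n) - X t) + norm (Y n - X t)"
        using norm_triangle_ineq4[of "Y (Suc n) - X t" "Y n - X t"] by simp
      also have "\<dots> \<le> C * (1/2) ^ Suc n + C * (1/2) ^ n" by (intro add_mono Yt)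
      also have "\<dots> \<le> (2 * C) * (1/2) ^ n" using C0 by simp
      finally show ?thesis .
    qed
    have gtm: "(\<lambda>x. g (t, x)) \<in> borel_measurable lebesgue"
    proof -
      have "(\<lambda>x. g (t, x)) \<in> borel_measurable borel"
        by (rule measurable_compose[OF _ gm]) (intro borel_measurable_continuous_onI continuous_intros)
      then show ?thesis by (intro measurable_completion) simp
    qed
    have "AE x in lebesgue. \<forall>n. rp (Y n) x = bor (Y n) x" by (simp add: AE_all_countable bor)
    with fast_Cauchy_AE_Cauchy[OF fast] have lim: "AE x in lebesgue. (\<lambda>n. rp (Y n) x) \<longlonglongrightarrow> g (t, x)"
    proof eventually_elim
      case (elim x)
      then have "(\<lambda>n. rp (Y n) x) \<longlonglongrightarrow> lim (\<lambda>n. rp (Y n) x)" by (simp add: convergent_LIMSEQ_iff)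
      moreover have "(\<lambda>n. rp (Y n) x) = (\<lambda>n. G (n + k) (t, x))" using elim by (simp add: G_def Y_def)
      ultimately have "(\<lambda>n. G (n + k) (t, x)) \<longlonglongrightarrow> lim (\<lambda>n. rp (Y n) x)" by simp
      then have l: "(\<lambda>n. G n (t, x)) \<longlonglongrightarrow> lim (\<lambda>n. rp (Y n) x)" by (rule LIMSEQ_offset)
      then have "g (t, x) = lim (\<lambda>n. rp (Y n) x)" unfolding g_def by (rule limI)
      then show ?case using \<open>(\<lambda>n. rp (Y n) x) \<longlonglongrightarrow> lim (\<lambda>n. rp (Y n) x)\<close> by simp
    qed
    note F = fast_Cauchy_limit[OF fast gtm lim]
    have "(\<lambda>n. C * (1/2) ^ n) \<longlonglongrightarrow> 0" by (intro tendsto_mult_right_zero LIMSEQ_power_zero) simp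
    then have "(\<lambda>n. Y n - X t) \<longlonglongrightarrow> 0" by (rule LIMSEQ_norm_bound[OF Yt])
    then have "Y \<longlonglongrightarrow> X t" by (simp add: LIM_zero_iff)
    then show ?thesis using F LIMSEQ_unique by blast
  qed
  then show ?thesis using gm by blast
qed

lemma poly_antiderivative: "\<exists>p :: real poly. pderiv p = q \<and> poly p 0 = 0"
proof -
  define p where "p = (\<Sum>i\<le>degree q. monom (coeff q i / real (Suc i)) (Suc i))"
  have "pderiv p = (\<Sum>i\<le>degree q. monom (coeff q i) i)"
  proof -
    have s: "pderiv (sum f S) = (\<Sum>i\<in>S. pderiv (f i))" for f :: "nat \<Rightarrow> real poly" and S
      by (induction S rule: infinite_finite_induct) (simp_all add: pderiv_add)
    show ?thesis unfolding p_def s by (intro sum.cong refl) (simp add: pderiv_monom)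
  qed
  moreover have "poly p 0 = 0" by (simp add: p_def poly_sum poly_monom)
  ultimately show ?thesis by (auto simp: poly_as_sum_of_monoms)
qed

text \<open>The derivative is approximated and then integrated from 0, which makes
  \<open>poly p 0 = 0\<close> exact. Without it the composition with a test function would lose its
  compact support.\<close>

lemma poly_approx_C1:
  fixes h' :: "real \<Rightarrow> real"
  assumes h': "continuous_on UNIV h'" and e: "e > 0"
  shows "\<exists>p :: real poly. poly p 0 = 0 \<and> (\<forall>y. \<bar>y\<bar> \<le> r \<longrightarrow> \<bar>poly (pderiv p) y - h' y\<bar> \<le> e)"
proof -
  define c where "c = \<bar>r\<bar> + 1"
  have c: "c > 0" "r \<le> c" by (auto simp: c_def)
  have "continuous_on {0..1} (\<lambda>s. h' (c * (2 * s - 1)))"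
    by (rule continuous_on_compose2[OF h']) (auto intro!: continuous_intros)
  from poly_dense_Icc[OF this e] obtain P :: "real poly" where P: "\<And>s. s \<in> {0..1} \<Longrightarrow> \<bar>poly P s - h' (c * (2 * s - 1))\<bar> \<le> e" by blast
  obtain p :: "real poly" where p: "pderiv p = pcompose P [:1/2, 1 / (2 * c):]" "poly p 0 = 0" using poly_antiderivative by blast
  have "\<bar>poly (pderiv p) y - h' y\<bar> \<le> e" if "\<bar>y\<bar> \<le> r" for y
  proof -
    define s where "s = 1/2 + y * (1 / (2 * c))"
    have "\<bar>y\<bar> \<le> c" using that c by linarith
    then have "s \<in> {0..1}" using c by (auto simp: s_def field_simps abs_le_iff)
    moreover have "c * (2 * s - 1) = y" using c by (simp add: s_def field_simps)
    ultimately show ?thesis using P[of s] by (simp add: p(1) poly_pcompose s_def)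
  qed
  then show ?thesis using p(2) by blast
qed

lemma mulop_dominated:
  fixes d :: "nat \<Rightarrow> 'a::euclidean_space \<Rightarrow> real"
  assumes m: "\<And>n. d n \<in> borel_measurable lebesgue" and bd: "\<And>n x. \<bar>d n x\<bar> \<le> C"
    and lim: "AE x in lebesgue. (\<lambda>n. d n x) \<longlonglongrightarrow> 0"
  shows "(\<lambda>n. mulop (d n) X) \<longlonglongrightarrow> 0"
proof -
  have "(\<lambda>n. \<integral>x. (d n x * rp X x)\<^sup>2 \<partial>lebesgue) \<longlonglongrightarrow> (\<integral>x. 0 \<partial>(lebesgue :: 'a measure))"
  proof (rule integral_dominated_convergence[where w="\<lambda>x. (C * rp X x)\<^sup>2"])
    show "(\<lambda>x. (d n x * rp X x)\<^sup>2) \<in> borel_measurable lebesgue" for n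
      by (intro borel_measurable_power borel_measurable_times m rp_measurable)
    show "integrable lebesgue (\<lambda>x. (C * rp X x)\<^sup>2)" by (intro sqint_integrable sqint_scale sqint_rp)
    show "AE x in lebesgue. (\<lambda>n. (d n x * rp X x)\<^sup>2) \<longlonglongrightarrow> 0"
      using lim
    proof eventually_elim
      case (elim x)
      have "(\<lambda>n. (d n x * rp X x)\<^sup>2) \<longlonglongrightarrow> (0 * rp X x)\<^sup>2" by (intro tendsto_intros elim)
      then show ?case by simp
    qed
    show "AE x in lebesgue. norm ((d n x * rp X x)\<^sup>2) \<le> (C * rp X x)\<^sup>2" for n
    proof (rule AE_I2)
      fix x
      have "\<bar>d n x\<bar>\<^sup>2 \<le> C\<^sup>2" using bd by (intro power_mono) auto
      then show "norm ((d n x * rp X x)\<^sup>2) \<le> (C * rp X x)\<^sup>2" by (simp add: power_mult_distrib mult_right_mono)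
    qed
  qed simp
  then have "(\<lambda>n. (norm (mulop (d n) X))\<^sup>2) \<longlonglongrightarrow> 0"
    by (simp add: mulop_def norm_cls[OF sqint_mult_bounded(1)[OF sqint_rp m bd]])
  then have "(\<lambda>n. sqrt ((norm (mulop (d n) X))\<^sup>2)) \<longlonglongrightarrow> sqrt 0" by (rule tendsto_real_sqrt)
  then show ?thesis by (simp add: tendsto_norm_zero_iff)
qed

section \<open>The chain rule in W_0^(1,2)\<close>

locale C1_bounded =
  fixes h h' :: "real \<Rightarrow> real" and M :: real
  assumes h_deriv: "(h has_real_derivative h' y) (at y)" and h'_cont: "continuous_on UNIV h'"
    and h'_bound: "\<bar>h' y\<bar> \<le> M" and h_0: "h 0 = 0"
begin

lemma h_Lipschitz: "\<bar>h x - h y\<bar> \<le> M * \<bar>x - y\<bar>"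
  using field_differentiable_bound[of UNIV h h' M x y] h_deriv h'_bound by simp

lemma h_le: "\<bar>h x\<bar> \<le> M * \<bar>x\<bar>" using h_Lipschitz[of x 0] h_0 by simp

lemma M_nonneg: "M \<ge> 0" using order_trans[OF abs_ge_zero h'_bound] .

lemma h_cont: "continuous_on UNIV h"
  using h_deriv DERIV_isCont continuous_at_imp_continuous_on by blast

lemma h_measurable: "h \<in> borel_measurable borel" "h' \<in> borel_measurable borel"
  using h_cont h'_cont by (auto intro: borel_measurable_continuous_onI)

lemma comp_measurable:
  "f \<in> borel_measurable N \<Longrightarrow> (\<lambda>x. h (f x)) \<in> borel_measurable N"
  "f \<in> borel_measurable N \<Longrightarrow> (\<lambda>x. h' (f x)) \<in> borel_measurable N"
  by (auto intro: measurable_compose[OF _ h_measurable(1)] measurable_compose[OF _ h_measurable(2)])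

lemma sqint_h: "sqint f \<Longrightarrow> sqint (\<lambda>x. h (f x))"
  by (rule sqint_bound[where C=M, OF _ comp_measurable(1)[OF sqint_measurable]], assumption, assumption, rule AE_I2, rule h_le)

definition hop :: "'a::euclidean_space l2 \<Rightarrow> 'a l2" where "hop X = cls (\<lambda>x. h (rp X x))"

lemma hop_cls: "sqint f \<Longrightarrow> hop (cls f) = cls (\<lambda>x. h (f x))"
proof -
  assume f: "sqint f"
  have "AE x in lebesgue. h (rp (cls f) x) = h (f x)" using AE_rp_cls[OF f] by eventually_elim simp
  then show ?thesis unfolding hop_def by (subst cls_eq_iff) (auto intro: sqint_h f)
qed

lemma hop_Lipschitz: "norm (hop X - hop Y) \<le> M * norm (X - Y)"
proof -
  have "norm (cls (\<lambda>x. h (rp X x) - h (rp Y x))) \<le> M * norm (cls (\<lambda>x. rp X x - rp Y x))"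
    by (rule norm_cls_mono[OF sqint_diff[OF sqint_h[OF sqint_rp] sqint_h[OF sqint_rp]] sqint_diff[OF sqint_rp sqint_rp] _ M_nonneg])
      (simp add: h_Lipschitz)
  then show ?thesis by (simp add: hop_def cls_diff[symmetric] sqint_h)
qed

text \<open>As \<open>h\<close> is only continuously differentiable, \<open>h\<close> of a test
  function is not a test function. So \<open>h\<close> is replaced by polynomials \<open>p n\<close>
  vanishing at 0 that approximate it in the C^1 sense on the range of \<open>\<phi> n\<close>. An
  almost everywhere convergent subsequence of the \<open>\<phi> n\<close> identifies the limit of
  \<open>h'\<close> along them.\<close>

lemma sobolev_chain_rule:
  fixes u :: "(real ^ 'n) l2"
  assumes uG: "(u, G) \<in> sobolev_graph \<Omega>"
  shows "(hop u, \<chi> i. mulop (\<lambda>x. h' (rp u x)) (G $ i)) \<in> sobolev_graph \<Omega>"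
proof -
  obtain \<phi>0 where \<phi>0: "\<And>m::nat. test_function \<Omega> (\<phi>0 m)" "(\<lambda>m. cls (\<phi>0 m)) \<longlonglongrightarrow> u" "\<And>i. (\<lambda>m. cls (partial i (\<phi>0 m))) \<longlonglongrightarrow> G $ i"
    using sobolev_graph_sequence[OF uG] by blast
  obtain r where r: "strict_mono r" "AE x in lebesgue. (\<lambda>n. rp (cls (\<phi>0 (r n))) x) \<longlonglongrightarrow> rp u x"
    using l2_tendsto_AE_subseq[OF \<phi>0(2)] by blast
  define \<phi> where "\<phi> n = \<phi>0 (r n)" for n
  have \<phi>: "\<And>m::nat. test_function \<Omega> (\<phi> m)" "(\<lambda>m. cls (\<phi> m)) \<longlonglongrightarrow> u" "\<And>i. (\<lambda>m. cls (partial i (\<phi> m))) \<longlonglongrightarrow> G $ i"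
    using \<phi>0(1) LIMSEQ_subseq_LIMSEQ[OF \<phi>0(2) r(1)] LIMSEQ_subseq_LIMSEQ[OF \<phi>0(3) r(1)] by (simp_all add: \<phi>_def o_def)
  note sq = sqint_test_function[OF \<phi>(1)] and sqp = sqint_test_function[OF test_function_partial[OF \<phi>(1)]]
  have "AE x in lebesgue. \<forall>n. rp (cls (\<phi> n)) x = \<phi> n x" by (simp add: AE_all_countable AE_rp_cls sq)
  then have ae: "AE x in lebesgue. (\<lambda>n. \<phi> n x) \<longlonglongrightarrow> rp u x" using r(2) by eventually_elim (simp add: \<phi>_def)
  \<comment> \<open>The error of \<open>p\<close> is measured relative to
    \<open>\<bar>\<phi> n x\<bar>\<close>. A constant error would not be square integrable over a
    set of infinite measure.\<close>
  have "\<exists>p :: real poly. poly p 0 = 0 \<and> (\<forall>x. \<bar>poly (pderiv p) (\<phi> n x) - h' (\<phi> n x)\<bar> \<le> 1 / real (Suc n)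
     \<and> \<bar>poly p (\<phi> n x) - h (\<phi> n x)\<bar> \<le> 1 / real (Suc n) * \<bar>\<phi> n x\<bar>)" for n
  proof -
    obtain K where K: "compact K" "\<And>x. x \<notin> K \<Longrightarrow> \<phi> n x = 0" using \<phi>(1)[of n] by (auto simp: test_function_def)
    have "bounded (\<phi> n ` K)"
      by (intro compact_imp_bounded compact_continuous_image K continuous_on_subset[OF test_function_continuous[OF \<phi>(1)]]) auto
    then obtain B where B: "\<And>x. x \<in> K \<Longrightarrow> \<bar>\<phi> n x\<bar> \<le> B" by (auto simp: bounded_iff)
    have B': "\<bar>\<phi> n x\<bar> \<le> \<bar>B\<bar>" for x using B[of x] K(2)[of x] by (cases "x \<in> K") auto
    obtain p :: "real poly" where p: "poly p 0 = 0" "\<And>y. \<bar>y\<bar> \<le> \<bar>B\<bar> \<Longrightarrow> \<bar>poly (pderiv p) y - h' y\<bar> \<le> 1 / real (Suc n)"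
      using poly_approx_C1[OF h'_cont, of "1 / real (Suc n)" "\<bar>B\<bar>"] by auto
    have "\<bar>poly p y - h y\<bar> \<le> 1 / real (Suc n) * \<bar>y\<bar>" if "\<bar>y\<bar> \<le> \<bar>B\<bar>" for y
    proof -
      have "norm ((poly p y - h y) - (poly p 0 - h 0)) \<le> 1 / real (Suc n) * norm (y - 0)"
      proof (rule field_differentiable_bound[where S="{-\<bar>B\<bar>..\<bar>B\<bar>}" and f="\<lambda>y. poly p y - h y" and f'="\<lambda>y. poly (pderiv p) y - h' y"])
        show "((\<lambda>y. poly p y - h y) has_real_derivative poly (pderiv p) z - h' z) (at z within {-\<bar>B\<bar>..\<bar>B\<bar>})" for z
          by (intro derivative_intros DERIV_subset[OF poly_DERIV] DERIV_subset[OF h_deriv]) auto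
        show "norm (poly (pderiv p) z - h' z) \<le> 1 / real (Suc n)" if "z \<in> {-\<bar>B\<bar>..\<bar>B\<bar>}" for z
          using p(2)[of z] that by (simp add: abs_le_iff)
      qed (use that in auto)
      then show ?thesis using p(1) h_0 by simp
    qed
    then show ?thesis using p B' by blast
  qed
  then obtain p :: "nat \<Rightarrow> real poly" where p0: "\<And>n. poly (p n) 0 = 0"
    and p1: "\<And>n x. \<bar>poly (pderiv (p n)) (\<phi> n x) - h' (\<phi> n x)\<bar> \<le> 1 / real (Suc n)"
    and p2: "\<And>n x. \<bar>poly (p n) (\<phi> n x) - h (\<phi> n x)\<bar> \<le> 1 / real (Suc n) * \<bar>\<phi> n x\<bar>" by metis
  define \<psi> where "\<psi> n x = poly (p n) (\<phi> n x)" for n x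
  have t\<psi>: "test_function \<Omega> (\<psi> n)" for n unfolding \<psi>_def by (rule test_function_poly[OF \<phi>(1) p0])
  have p\<psi>: "partial i (\<psi> n) = (\<lambda>x. poly (pderiv (p n)) (\<phi> n x) * partial i (\<phi> n) x)" for n i
    unfolding \<psi>_def by (rule partial_compose_test[OF \<phi>(1) poly_DERIV])
  show ?thesis
  proof (rule sobolev_graphI[OF t\<psi>])
    have "(\<lambda>n. cls (\<psi> n) - hop u) \<longlonglongrightarrow> 0"
    proof (rule LIMSEQ_norm_bound)
      show "norm (cls (\<psi> n) - hop u) \<le> 1 / real (Suc n) * norm (cls (\<phi> n)) + M * norm (cls (\<phi> n) - u)" for n
      proof -
        have "norm (cls (\<psi> n) - hop (cls (\<phi> n))) \<le> 1 / real (Suc n) * norm (cls (\<phi> n))"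
          unfolding hop_cls[OF sq] cls_diff[OF sqint_test_function[OF t\<psi>] sqint_h[OF sq]]
        proof (rule norm_cls_mono[OF sqint_diff[OF sqint_test_function[OF t\<psi>] sqint_h[OF sq]] sq])
          show "AE x in lebesgue. \<bar>\<psi> n x - h (\<phi> n x)\<bar> \<le> 1 / real (Suc n) * \<bar>\<phi> n x\<bar>"
            by (rule AE_I2) (simp only: \<psi>_def p2)
        qed simp
        moreover have "norm (hop (cls (\<phi> n)) - hop u) \<le> M * norm (cls (\<phi> n) - u)" by (rule hop_Lipschitz)
        ultimately show ?thesis using norm_triangle_ineq[of "cls (\<psi> n) - hop (cls (\<phi> n))" "hop (cls (\<phi> n)) - hop u"] by simp
      qed
      have "(\<lambda>n. 1 / real (Suc n) * norm (cls (\<phi> n)) + M * norm (cls (\<phi> n) - u)) \<longlonglongrightarrow> 0 * norm u + M * norm (u - u)"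
        by (intro tendsto_intros lim_inverse_Suc \<phi>)
      then show "(\<lambda>n. 1 / real (Suc n) * norm (cls (\<phi> n)) + M * norm (cls (\<phi> n) - u)) \<longlonglongrightarrow> 0" by simp
    qed
    then show "(\<lambda>n. cls (\<psi> n)) \<longlonglongrightarrow> hop u" by (simp add: LIM_zero_iff)
    fix i
    define a where "a n x = poly (pderiv (p n)) (\<phi> n x)" for n x
    have \<phi>m: "\<phi> n \<in> borel_measurable lebesgue" for n by (rule sqint_measurable[OF sq])
    have am: "a n \<in> borel_measurable lebesgue" for n
      unfolding a_def[abs_def] by (intro measurable_compose[OF \<phi>m] borel_measurable_continuous_onI continuous_on_poly continuous_on_id)
    have h'\<phi>m: "(\<lambda>x. h' (\<phi> n x)) \<in> borel_measurable lebesgue" "(\<lambda>x. h' (rp u x)) \<in> borel_measurable lebesgue" for n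
      by (intro comp_measurable \<phi>m rp_measurable)+
    have ab: "\<bar>a n x\<bar> \<le> M + 1" for n x
    proof -
      have "1 / real (Suc n) \<le> 1" by simp
      then show ?thesis using p1[of n x] h'_bound[of "\<phi> n x"] unfolding a_def by linarith
    qed
    have d1: "(\<lambda>n. mulop (a n) (cls (partial i (\<phi> n)) - G $ i)) \<longlonglongrightarrow> 0"
    proof (rule LIMSEQ_norm_bound)
      show "norm (mulop (a n) (cls (partial i (\<phi> n)) - G $ i)) \<le> (M + 1) * norm (cls (partial i (\<phi> n)) - G $ i)" for n
        by (rule norm_mulop_le[OF am ab])
      show "(\<lambda>n. (M + 1) * norm (cls (partial i (\<phi> n)) - G $ i)) \<longlonglongrightarrow> 0"
        using \<phi>(3)[of i] by (intro tendsto_mult_right_zero tendsto_norm_zero) (simp add: LIM_zero)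
    qed
    have d2: "(\<lambda>n. mulop (\<lambda>x. a n x - h' (rp u x)) (G $ i)) \<longlonglongrightarrow> 0"
    proof (rule mulop_dominated[where C="2 * M + 1"])
      show "(\<lambda>x. a n x - h' (rp u x)) \<in> borel_measurable lebesgue" for n by (intro borel_measurable_diff am h'\<phi>m)
      show "\<bar>a n x - h' (rp u x)\<bar> \<le> 2 * M + 1" for n x using ab[of n x] h'_bound[of "rp u x"] by linarith
      show "AE x in lebesgue. (\<lambda>n. a n x - h' (rp u x)) \<longlonglongrightarrow> 0"
        using ae
      proof eventually_elim
        case (elim x)
        have "isCont h' (rp u x)" using h'_cont by (simp add: continuous_on_eq_continuous_at)
        then have l: "(\<lambda>n. h' (\<phi> n x)) \<longlonglongrightarrow> h' (rp u x)" using elim by (rule isCont_tendsto_compose)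
        have "(\<lambda>n. a n x - h' (\<phi> n x)) \<longlonglongrightarrow> 0"
          by (rule LIMSEQ_norm_bound[OF _ lim_inverse_Suc]) (use p1 in \<open>simp add: a_def del: of_nat_Suc\<close>)
        from tendsto_add[OF this l] show ?case by (simp add: LIM_zero)
      qed
    qed
    have mb: "\<bar>a n x - h' (rp u x)\<bar> \<le> 2 * M + 1" for n x using ab[of n x] h'_bound[of "rp u x"] by linarith
    \<comment> \<open>The first term on the right is small because its multipliers are uniformly
      bounded and the gradients converge in norm, the second by dominated convergence with
      \<open>G $ i\<close> held fixed.\<close>
    have eq: "cls (partial i (\<psi> n)) - mulop (\<lambda>x. h' (rp u x)) (G $ i)
       = mulop (a n) (cls (partial i (\<phi> n)) - G $ i) + mulop (\<lambda>x. a n x - h' (rp u x)) (G $ i)" for n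
    proof -
      have e1: "cls (partial i (\<psi> n)) = mulop (a n) (cls (partial i (\<phi> n)))"
        unfolding p\<psi> mulop_cls[OF am ab sqp] a_def ..
      have e2: "mulop (\<lambda>x. a n x - h' (rp u x)) (G $ i) = mulop (a n) (G $ i) - mulop (\<lambda>x. h' (rp u x)) (G $ i)"
        unfolding mulop_def
          cls_diff[OF sqint_mult_bounded(1)[OF sqint_rp am ab] sqint_mult_bounded(1)[OF sqint_rp h'\<phi>m(2) h'_bound]]
        by (simp add: left_diff_distrib)
      show ?thesis unfolding e1 e2
        by (simp add: linear_diff[OF bounded_linear.linear[OF mulop_bounded_linear[OF am ab]]])
    qed
    have "(\<lambda>n. cls (partial i (\<psi> n)) - mulop (\<lambda>x. h' (rp u x)) (G $ i)) \<longlonglongrightarrow> 0 + 0"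
      unfolding eq by (intro tendsto_add d1 d2)
    then show "(\<lambda>n. cls (partial i (\<psi> n))) \<longlonglongrightarrow> (\<chi> i. mulop (\<lambda>x. h' (rp u x)) (G $ i)) $ i"
      by (simp add: LIM_zero_iff)
  qed
qed

end

text \<open>A convex density with bounded second derivative: \<open>h\<close> is its first and
  \<open>h'\<close> its second derivative. Boundedness keeps it below a multiple of the square, so
  that the entropy is finite and differentiable on all of L^2.\<close>

locale C2_entropy = C1_bounded h h' M for h h' M +
  fixes \<Phi> :: "real \<Rightarrow> real"
  assumes \<Phi>_deriv: "(\<Phi> has_real_derivative h y) (at y)" and \<Phi>_0: "\<Phi> 0 = 0" and h'_nonneg: "h' y \<ge> 0"
begin

lemma \<Phi>_quadratic: "\<bar>\<Phi> b - \<Phi> a - h a * (b - a)\<bar> \<le> M * (b - a)\<^sup>2"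
proof -
  have "norm ((\<Phi> b - h a * b) - (\<Phi> a - h a * a)) \<le> (M * \<bar>b - a\<bar>) * norm (b - a)"
  proof (rule field_differentiable_bound[where S="closed_segment a b" and f="\<lambda>y. \<Phi> y - h a * y" and f'="\<lambda>y. h y - h a"])
    show "((\<lambda>y. \<Phi> y - h a * y) has_real_derivative h z - h a) (at z within closed_segment a b)" for z
      using DERIV_subset[OF \<Phi>_deriv] by (auto intro!: derivative_eq_intros)
    show "norm (h z - h a) \<le> M * \<bar>b - a\<bar>" if "z \<in> closed_segment a b" for z
    proof -
      have "\<bar>h z - h a\<bar> \<le> M * \<bar>z - a\<bar>" by (rule h_Lipschitz)
      also have "\<bar>z - a\<bar> \<le> \<bar>b - a\<bar>" using that segment_bound(1)[of z a b] by (simp add: abs_minus_commute)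
      finally show ?thesis using M_nonneg by (simp add: mult_left_mono)
    qed
  qed auto
  then show ?thesis by (simp add: power2_eq_square algebra_simps abs_mult_self_eq flip: abs_mult)
qed

lemma \<Phi>_le: "\<bar>\<Phi> a\<bar> \<le> M * a\<^sup>2" using \<Phi>_quadratic[of a 0] by (simp add: \<Phi>_0 h_0)

lemma \<Phi>_measurable: "\<Phi> \<in> borel_measurable borel"
  using \<Phi>_deriv DERIV_isCont continuous_at_imp_continuous_on borel_measurable_continuous_onI by metis

definition entropy :: "'a::euclidean_space l2 \<Rightarrow> real" where "entropy X = (\<integral>x. \<Phi> (rp X x) \<partial>lebesgue)"

lemma \<Phi>_integrable: "sqint f \<Longrightarrow> integrable lebesgue (\<lambda>x. \<Phi> (f x))"
proof (rule Bochner_Integration.integrable_bound)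
  assume f: "sqint f"
  show "integrable lebesgue (\<lambda>x. M * (f x)\<^sup>2)" by (intro integrable_mult_right sqint_integrable f)
  show "(\<lambda>x. \<Phi> (f x)) \<in> borel_measurable lebesgue" by (rule measurable_compose[OF sqint_measurable[OF f] \<Phi>_measurable])
  show "AE x in lebesgue. norm (\<Phi> (f x)) \<le> norm (M * (f x)\<^sup>2)" using \<Phi>_le M_nonneg by (simp add: abs_mult)
qed

lemma entropy_le: "\<bar>entropy X\<bar> \<le> M * (norm X)\<^sup>2"
proof -
  have "\<bar>entropy X\<bar> \<le> (\<integral>x. M * (rp X x)\<^sup>2 \<partial>lebesgue)"
    unfolding entropy_def
    by (rule order_trans[OF integral_abs_bound], rule integral_mono)
      (intro integrable_abs integrable_mult_right \<Phi>_integrable sqint_integrable sqint_rp \<Phi>_le)+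
  also have "\<dots> = M * (norm X)\<^sup>2" using norm_cls[OF sqint_rp, of X] by simp
  finally show ?thesis .
qed

lemma entropy_quadratic: "\<bar>entropy Y - entropy X - inner (hop X) (Y - X)\<bar> \<le> M * (norm (Y - X))\<^sup>2"
proof -
  have s: "sqint (\<lambda>x. rp Y x - rp X x)" "sqint (\<lambda>x. h (rp X x))" by (intro sqint_diff sqint_rp sqint_h)+
  have i: "inner (hop X) (Y - X) = (\<integral>x. h (rp X x) * (rp Y x - rp X x) \<partial>lebesgue)"
    using inner_cls[OF s(2,1)] cls_diff[OF sqint_rp sqint_rp, of Y X] by (simp add: hop_def)
  have I: "integrable lebesgue (\<lambda>x. \<Phi> (rp Y x) - \<Phi> (rp X x) - h (rp X x) * (rp Y x - rp X x))"
    by (intro Bochner_Integration.integrable_diff \<Phi>_integrable sqint_rp sqint_mult_integrable s)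
  have "entropy Y - entropy X - inner (hop X) (Y - X) = (\<integral>x. \<Phi> (rp Y x) - \<Phi> (rp X x) - h (rp X x) * (rp Y x - rp X x) \<partial>lebesgue)"
    unfolding i entropy_def
    using \<Phi>_integrable[OF sqint_rp[of X]] \<Phi>_integrable[OF sqint_rp[of Y]] sqint_mult_integrable[OF s(2,1)] by simp
  also have "\<bar>\<dots>\<bar> \<le> (\<integral>x. M * (rp Y x - rp X x)\<^sup>2 \<partial>lebesgue)"
    by (rule order_trans[OF integral_abs_bound], rule integral_mono)
      (intro integrable_abs integrable_mult_right I sqint_integrable s \<Phi>_quadratic)+
  also have "\<dots> = M * (norm (Y - X))\<^sup>2" using norm_cls[OF s(1)] cls_diff[OF sqint_rp sqint_rp, of Y X] by simp
  finally show ?thesis .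
qed

lemma entropy_has_derivative: "(entropy has_derivative (\<lambda>V. inner (hop X) V)) (at X)"
proof (rule has_derivativeI_sandwich[where e=1 and H="\<lambda>Y. M * norm (Y - X)"])
  show "bounded_linear (\<lambda>V. inner (hop X) V)" by (rule bounded_linear_inner_right)
  fix Y assume "Y \<noteq> X"
  then have p: "norm (Y - X) > 0" by simp
  have "norm (entropy Y - entropy X - inner (hop X) (Y - X)) / norm (Y - X) \<le> M * (norm (Y - X))\<^sup>2 / norm (Y - X)"
    using entropy_quadratic[of Y X] by (intro divide_right_mono) auto
  also have "\<dots> = M * norm (Y - X)" using p by (simp add: power2_eq_square)
  finally show "norm (entropy Y - entropy X - inner (hop X) (Y - X)) / norm (Y - X) \<le> M * norm (Y - X)" .
next
  show "((\<lambda>Y. M * norm (Y - X)) \<longlongrightarrow> 0) (at X)" by (auto intro!: tendsto_eq_intros)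
qed simp

lemma entropy_isCont: "isCont entropy X"
  using entropy_has_derivative has_derivative_continuous by blast

end

lemma ex_antiderivative:
  fixes f :: "real \<Rightarrow> real"
  assumes "continuous_on UNIV f"
  shows "\<exists>F. (\<forall>x. (F has_real_derivative f x) (at x)) \<and> F 0 = 0"
proof -
  have "\<exists>F. \<forall>x :: real. - \<infinity> < ereal x \<longrightarrow> ereal x < \<infinity> \<longrightarrow> (F has_vector_derivative f x) (at x)"
    using assms by (intro einterval_antiderivative) (auto simp: continuous_on_eq_continuous_at)
  then obtain F where F: "\<And>x. (F has_real_derivative f x) (at x)"
    by (auto simp: has_real_derivative_iff_has_vector_derivative)
  have "((\<lambda>x. F x - F 0) has_real_derivative f x) (at x)" for x
    using F[of x] by (auto intro!: derivative_eq_intros)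
  then show ?thesis by (intro exI[of _ "\<lambda>x. F x - F 0"]) simp
qed

lemma ex_C2_entropy:
  assumes "continuous_on UNIV h'" "\<And>y. 0 \<le> h' y" "\<And>y. h' y \<le> K"
  shows "\<exists>h \<Phi>. C2_entropy h h' K \<Phi>"
proof -
  obtain h where h: "\<And>x. (h has_real_derivative h' x) (at x)" "h 0 = 0" using ex_antiderivative[OF assms(1)] by blast
  have "continuous_on UNIV h" using h(1) DERIV_isCont continuous_at_imp_continuous_on by blast
  then obtain \<Phi> where \<Phi>: "\<And>x. (\<Phi> has_real_derivative h x) (at x)" "\<Phi> 0 = 0" using ex_antiderivative by blast
  have "C1_bounded h h' K" using h assms by (intro C1_bounded.intro) (auto simp: abs_le_iff intro: order_trans[of _ 0])
  then show ?thesis using \<Phi> assms by (auto simp: C2_entropy_def C2_entropy_axioms_def)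
qed

section \<open>Gradient and entropy dissipation along the semigroup\<close>

context elliptic_coefficients
begin

text \<open>The gradient of \<open>T t F\<close>, because \<open>T t F = J (W t F)\<close> and
  \<open>R\<close> returns J together with the gradient.\<close>

definition grad :: "real \<Rightarrow> (real ^ 'n) l2 \<Rightarrow> ((real ^ 'n) l2 ^ 'n)" where
  "grad t F = snd (R (W t F))"

lemma R_W: "t > 0 \<Longrightarrow> R (W t F) = (T t F, grad t F)"
  using J_W[of t F] by (simp add: J_def grad_def prod_eq_iff)

lemma grad_sobolev: "t > 0 \<Longrightarrow> (T t F, grad t F) \<in> sobolev_graph \<Omega>"
  using R(1)[of "W t F"] by (simp add: R_W)

lemma grad_H0: "t > 0 \<Longrightarrow> grad t F $ i \<in> H0"
  using sobolev_graph_supp_in(2)[OF \<Omega>_sets grad_sobolev] by (simp add: H0_eq)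

lemma grad_Lipschitz:
  assumes "\<delta> > 0"
  shows "\<exists>C. \<forall>t r. \<delta> \<le> t \<longrightarrow> \<delta> \<le> r \<longrightarrow> norm (grad t F $ i - grad r F $ i) \<le> C * \<bar>t - r\<bar>"
proof -
  obtain K where K: "K \<ge> 0" "\<And>x. norm (R x) \<le> norm x * K" using bounded_linear.nonneg_bounded[OF R_bounded_linear] by blast
  have "norm (grad t F $ i - grad r F $ i) \<le> ((1 / \<delta> + 2 / \<delta>\<^sup>2) * norm F * K) * \<bar>t - r\<bar>" if "\<delta> \<le> t" "\<delta> \<le> r" for t r
  proof -
    have "grad t F $ i - grad r F $ i = snd (R (W t F - W r F)) $ i" by (simp add: grad_def R.diff)
    also have "norm \<dots> \<le> norm (snd (R (W t F - W r F)))" by (rule Finite_Cartesian_Product.norm_nth_le)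
    also have "\<dots> \<le> norm (R (W t F - W r F))"
      using norm_snd_le[of "snd (R (W t F - W r F))" "fst (R (W t F - W r F))"] by simp
    also have "\<dots> \<le> norm (W t F - W r F) * K" by (rule K(2))
    also have "\<dots> \<le> ((1 / \<delta> + 2 / \<delta>\<^sup>2) * \<bar>t - r\<bar> * norm F) * K" by (intro mult_right_mono W_Lipschitz assms that K(1))
    finally show ?thesis by (simp add: mult_ac)
  qed
  then show ?thesis by blast
qed

lemma vec_lambda_measurable:
  assumes "\<And>i. (\<lambda>p. g i p) \<in> borel_measurable N"
  shows "(\<lambda>p. (\<chi> i. g i p) :: real ^ 'n) \<in> borel_measurable N"
proof -
  have "(\<chi> i. g i p) = (\<Sum>i\<in>UNIV. g i p *\<^sub>R (axis i 1 :: real ^ 'n))" for p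
    by (simp add: vec_eq_iff axis_def if_distrib cong: if_cong)
  then show ?thesis using assms by simp
qed

text \<open>\<open>jointly_measurable_path\<close>, applied to each component of the gradient,
  supplies the witness for the choice in \<open>heat_gradient\<close>.\<close>

lemma heat_gradient_spec:
  assumes f: "f \<in> Lspace \<Omega> 2"
  shows "heat_gradient \<Omega> A f \<in> borel_measurable (lebesgue_on ({0<..} \<times> \<Omega>))"
    "t > 0 \<Longrightarrow> has_weak_gradient \<Omega> (heat \<Omega> A t f) (\<lambda>x. heat_gradient \<Omega> A f (t, x))"
proof -
  have "\<exists>g. g \<in> borel_measurable borel \<and> (\<forall>t>0. sqint (\<lambda>x. g (t, x)) \<and> cls (\<lambda>x. g (t, x)) = grad t (E f) $ i)" for i
    by (rule jointly_measurable_path) (rule grad_Lipschitz)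
  then obtain g where g: "\<And>i. g i \<in> borel_measurable borel"
    "\<And>i t. t > 0 \<Longrightarrow> sqint (\<lambda>x. g i (t, x)) \<and> cls (\<lambda>x. g i (t, x)) = grad t (E f) $ i" by metis
  define G where "G p = (\<chi> i. g i p)" for p
  have "G \<in> borel_measurable borel" unfolding G_def[abs_def] by (rule vec_lambda_measurable) (rule g(1))
  then have "G \<in> borel_measurable lebesgue" by (intro measurable_completion) simp
  then have Gm: "G \<in> borel_measurable (lebesgue_on ({0<..} \<times> \<Omega>))" by (rule measurable_restrict_space1)
  have "has_weak_gradient \<Omega> (heat \<Omega> A t f) (\<lambda>x. G (t, x))" if t: "t > 0" for t
  proof -
    have e: "E (\<lambda>x. g i (t, x)) = grad t (E f) $ i" "(\<lambda>x. g i (t, x)) \<in> Lspace \<Omega> 2" for i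
    proof -
      have s: "sqint (\<lambda>x. g i (t, x))" and c: "cls (\<lambda>x. g i (t, x)) = grad t (E f) $ i" using g(2)[OF t] by auto
      have ae: "AE x in lebesgue. rp (grad t (E f) $ i) x = g i (t, x)" using AE_rp_cls[OF s] by (simp add: c)
      have m: "ext \<Omega> (\<lambda>x. g i (t, x)) \<in> borel_measurable lebesgue"
        unfolding ext_indicator using \<Omega>_sets s by (intro borel_measurable_times borel_measurable_indicator sqint_measurable)
      have "sqint (ext \<Omega> (\<lambda>x. g i (t, x)))"
        by (rule sqint_bound[OF s m, of 1]) (simp add: ext_def)
      then show L: "(\<lambda>x. g i (t, x)) \<in> Lspace \<Omega> 2" by (simp add: Lspace_iff)
      have "E (\<lambda>x. g i (t, x)) = E (rp (grad t (E f) $ i))"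
        unfolding E_eq_iff[OF L rp_Lspace] AE_on_iff using ae by eventually_elim simp
      then show "E (\<lambda>x. g i (t, x)) = grad t (E f) $ i" by (simp add: E_rp grad_H0[OF t])
    qed
    have "GE (\<lambda>x. G (t, x)) = grad t (E f)" by (simp add: GE_def G_def e vec_eq_iff)
    then show ?thesis using t
      by (intro sobolev_has_weak_gradient) (simp_all add: heat_Lspace f heat_eq grad_sobolev G_def e)
  qed
  then have ex: "G \<in> borel_measurable (lebesgue_on ({0<..} \<times> \<Omega>)) \<and> (\<forall>t>0. has_weak_gradient \<Omega> (heat \<Omega> A t f) (\<lambda>x. G (t, x)))"
    using Gm by blast
  from someI[of "\<lambda>G. G \<in> borel_measurable (lebesgue_on ({0<..} \<times> \<Omega>)) \<and> (\<forall>t>0. has_weak_gradient \<Omega> (heat \<Omega> A t f) (\<lambda>x. G (t, x)))", OF ex]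
  show "heat_gradient \<Omega> A f \<in> borel_measurable (lebesgue_on ({0<..} \<times> \<Omega>))"
    "t > 0 \<Longrightarrow> has_weak_gradient \<Omega> (heat \<Omega> A t f) (\<lambda>x. heat_gradient \<Omega> A f (t, x))"
    unfolding heat_gradient_def by blast+
qed

lemma GE_heat_gradient:
  assumes f: "f \<in> Lspace \<Omega> 2" and t: "t > 0"
  shows "GE (\<lambda>x. heat_gradient \<Omega> A f (t, x)) = grad t (E f)"
proof -
  have H: "heat \<Omega> A t f \<in> Lspace \<Omega> 2" "(E (heat \<Omega> A t f), grad t (E f)) \<in> sobolev_graph \<Omega>"
    using t f by (simp_all add: heat_Lspace heat_eq grad_sobolev)
  from has_weak_gradient_unique[OF heat_gradient_spec(2)[OF f t] weak_gradient_eq(1)[OF H] refl] weak_gradient_eq(2)[OF H]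
  show ?thesis by simp
qed

definition quad :: "((real ^ 'n) l2 ^ 'n) \<Rightarrow> real ^ 'n \<Rightarrow> real" where
  "quad G x = (\<Sum>k\<in>UNIV. \<Sum>l\<in>UNIV. a k l x * rp (G $ k) x * rp (G $ l) x)"

lemma quad_bounds:
  "0 \<le> quad G x" "quad G x \<le> M * (real CARD('n))\<^sup>2 * (norm (\<chi> i. rp (G $ i) x))\<^sup>2"
proof -
  let ?\<xi> = "\<chi> i. rp (G $ i) x"
  have "0 \<le> \<nu> * (norm ?\<xi>)\<^sup>2" using nu_pos by simp
  also have "\<dots> \<le> quad G x" using a_elliptic[of ?\<xi> x] by (simp add: quad_def)
  finally show "0 \<le> quad G x" .
  have "quad G x \<le> (\<Sum>k\<in>(UNIV :: 'n set). \<Sum>l\<in>(UNIV :: 'n set). M * (norm ?\<xi>)\<^sup>2)"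
    unfolding quad_def
  proof (intro sum_mono)
    fix k l
    have c: "\<bar>rp (G $ k) x\<bar> \<le> norm ?\<xi>" for k using component_le_norm_cart[of ?\<xi> k] by simp
    have "a k l x * rp (G $ k) x * rp (G $ l) x \<le> \<bar>a k l x\<bar> * (\<bar>rp (G $ k) x\<bar> * \<bar>rp (G $ l) x\<bar>)"
      by (simp flip: abs_mult add: mult.assoc)
    also have "\<dots> \<le> M * (norm ?\<xi> * norm ?\<xi>)"
      by (intro mult_mono c a_bound) (auto intro: order_trans[OF abs_ge_zero a_bound])
    finally show "a k l x * rp (G $ k) x * rp (G $ l) x \<le> M * (norm ?\<xi>)\<^sup>2" by (simp add: power2_eq_square)
  qed
  then show "quad G x \<le> M * (real CARD('n))\<^sup>2 * (norm ?\<xi>)\<^sup>2" by (simp add: power2_eq_square mult_ac)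
qed

lemma M_nonneg: "M \<ge> 0" by (rule order_trans[OF abs_ge_zero a_bound])

text \<open>The \<open>L\<^sup>2\<close> inner product of \<open>\<Phi>'(u)\<close> with \<open>L u\<close> is the form of \<open>u\<close> and \<open>\<Phi>'(u)\<close>, which the chain rule makes local.\<close>

lemma entropy_dissipation:
  assumes "C2_entropy h h' K \<Phi>" and t: "t > 0"
  shows "((\<lambda>t. C2_entropy.entropy \<Phi> (T t F)) has_real_derivative
      - (\<integral>x. h' (rp (T t F) x) * quad (grad t F) x \<partial>lebesgue)) (at t)"
    and "integrable lebesgue (\<lambda>x. h' (rp (T t F) x) * quad (grad t F) x)"
proof -
  interpret C2: C2_entropy h h' K \<Phi> by fact
  let ?u = "T t F" and ?g = "grad t F"
  let ?m = "\<lambda>x. h' (rp ?u x)"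
  have mm: "?m \<in> borel_measurable lebesgue" by (rule C2.comp_measurable) (rule rp_measurable)
  have D: "((\<lambda>t. T t F) has_derivative (\<lambda>s. s *\<^sub>R (T t F - W t F))) (at t)"
    using T_has_vector_derivative[OF t] by (simp add: has_vector_derivative_def)
  have "((\<lambda>t. C2.entropy (T t F)) has_derivative (\<lambda>s. inner (C2.hop ?u) (s *\<^sub>R (?u - W t F)))) (at t)"
    by (rule has_derivative_compose[OF D C2.entropy_has_derivative])
  then have d: "((\<lambda>t. C2.entropy (T t F)) has_real_derivative inner (C2.hop ?u) (?u - W t F)) (at t)"
    by (simp add: has_field_derivative_def mult.commute[of "inner _ _"] mult_commute_abs)
  let ?v = "(C2.hop ?u, \<chi> i. mulop ?m (?g $ i))"
  have v: "?v \<in> sobolev_graph \<Omega>" by (rule C2.sobolev_chain_rule[OF grad_sobolev[OF t]])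
  \<comment> \<open>The resolvent equation for \<open>W t F\<close>, tested with \<open>h\<close> of
    the solution. Subtracting the zeroth-order term leaves exactly minus the form, so L never has to
    be applied.\<close>
  have "Q (?u, ?g) ?v = inner (W t F) (C2.hop ?u)" using R(2)[OF v, of "W t F"] by (simp add: R_W[OF t])
  then have e: "inner (C2.hop ?u) (?u - W t F) = - bform ?g (\<chi> i. mulop ?m (?g $ i))"
    by (simp add: Q_def inner_diff_right inner_commute)
  have s1: "sqint (\<lambda>x. a k l x * rp (?g $ k) x)" for k l by (rule sqint_mult_bounded(1)[OF sqint_rp a_measurable a_bound])
  have s2: "sqint (\<lambda>x. ?m x * rp (?g $ l) x)" for l by (rule sqint_mult_bounded(1)[OF sqint_rp mm C2.h'_bound])
  have i: "inner (mulop (a k l) (?g $ k)) (mulop ?m (?g $ l)) = (\<integral>x. (a k l x * rp (?g $ k) x) * (?m x * rp (?g $ l) x) \<partial>lebesgue)" for k l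
    unfolding mulop_def by (rule inner_cls[OF s1 s2])
  have int: "integrable lebesgue (\<lambda>x. (a k l x * rp (?g $ k) x) * (?m x * rp (?g $ l) x))" for k l
    by (rule sqint_mult_integrable[OF s1 s2])
  have q: "h' (rp ?u x) * quad ?g x = (\<Sum>k\<in>UNIV. \<Sum>l\<in>UNIV. (a k l x * rp (?g $ k) x) * (?m x * rp (?g $ l) x))" for x
    by (simp add: quad_def sum_distrib_left mult_ac)
  show "integrable lebesgue (\<lambda>x. h' (rp (T t F) x) * quad (grad t F) x)"
    unfolding q by (intro Bochner_Integration.integrable_sum int)
  have "bform ?g (\<chi> i. mulop ?m (?g $ i)) = (\<Sum>k\<in>UNIV. \<Sum>l\<in>UNIV. inner (mulop (a k l) (?g $ k)) ((\<chi> i. mulop ?m (?g $ i)) $ l))"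
    by (rule bform_def)
  also have "\<dots> = (\<Sum>k\<in>UNIV. \<Sum>l\<in>UNIV. \<integral>x. (a k l x * rp (?g $ k) x) * (?m x * rp (?g $ l) x) \<partial>lebesgue)"
    by (intro sum.cong refl) (simp only: vec_lambda_beta i)
  also have "\<dots> = (\<integral>x. (\<Sum>k\<in>UNIV. \<Sum>l\<in>UNIV. (a k l x * rp (?g $ k) x) * (?m x * rp (?g $ l) x)) \<partial>lebesgue)"
    by (subst Bochner_Integration.integral_sum; (intro sum.cong refl Bochner_Integration.integrable_sum int)?)
      (rule Bochner_Integration.integral_sum[symmetric], rule int)
  also have "\<dots> = (\<integral>x. h' (rp ?u x) * quad ?g x \<partial>lebesgue)" by (simp only: q)
  finally have "bform ?g (\<chi> i. mulop ?m (?g $ i)) = (\<integral>x. h' (rp ?u x) * quad ?g x \<partial>lebesgue)" .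
  then show "((\<lambda>t. C2_entropy.entropy \<Phi> (T t F)) has_real_derivative
      - (\<integral>x. h' (rp (T t F) x) * quad (grad t F) x \<partial>lebesgue)) (at t)" using d e by simp
qed

lemma entropy_continuous:
  assumes "C2_entropy h h' K \<Phi>" and F: "F \<in> H0"
  shows "continuous_on {0..\<tau>} (\<lambda>t. C2_entropy.entropy \<Phi> (T t F))"
proof -
  interpret C2: C2_entropy h h' K \<Phi> by fact
  have "continuous_on UNIV (C2.entropy :: (real ^ 'n) l2 \<Rightarrow> real)"
    using C2.entropy_isCont continuous_at_imp_continuous_on by blast
  then show ?thesis
    by (rule continuous_on_compose2[OF _ strongly_continuous_semigroup_on.S_continuous[OF T_semigroup_on F]]) simp
qed

text \<open>The path is differentiable for positive times only; continuity of the entropy up to time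
  0 closes the gap. The dissipation is nonnegative, so its time integral can be stated as an
  integral in [0, \<infinity>].\<close>

lemma entropy_identity:
  assumes C2: "C2_entropy h h' K \<Phi>" and F: "F \<in> H0" and \<tau>: "\<tau> \<ge> 0"
  shows "C2_entropy.entropy \<Phi> (T \<tau> F) \<le> C2_entropy.entropy \<Phi> F"
    and "(\<integral>\<^sup>+ t. indicator {0<..<\<tau>} t * ennreal (\<integral>x. h' (rp (T t F) x) * quad (grad t F) x \<partial>lebesgue) \<partial>lborel)
      = ennreal (C2_entropy.entropy \<Phi> F - C2_entropy.entropy \<Phi> (T \<tau> F))"
proof -
  interpret C2: C2_entropy h h' K \<Phi> by fact
  \<comment> \<open>Set to 0 at the end points: at time 0 there need not be any gradient.\<close>
  define d where "d t = (if t \<in> {0<..<\<tau>} then \<integral>x. h' (rp (T t F) x) * quad (grad t F) x \<partial>lebesgue else 0)" for t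
  have d0: "d t \<ge> 0" for t using C2.h'_nonneg quad_bounds(1) by (simp add: d_def)
  have "((\<lambda>t. - d t) has_integral (C2.entropy (T \<tau> F) - C2.entropy (T 0 F))) {0..\<tau>}"
  proof (rule fundamental_theorem_of_calculus_interior_strong[of "{}"])
    fix t assume "t \<in> {0<..<\<tau>} - {}"
    then show "((\<lambda>t. C2.entropy (T t F)) has_vector_derivative - d t) (at t)"
      using entropy_dissipation(1)[OF C2, of t F] by (simp add: d_def has_real_derivative_iff_has_vector_derivative)
  qed (use \<tau> entropy_continuous[OF C2 F] in auto)
  from has_integral_neg[OF this] have I: "(d has_integral (C2.entropy F - C2.entropy (T \<tau> F))) {0..\<tau>}" by simp
  have "0 \<le> C2.entropy F - C2.entropy (T \<tau> F)" by (rule has_integral_nonneg[OF I]) (rule d0)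
  then show "C2.entropy (T \<tau> F) \<le> C2.entropy F" by simp
  have "(\<integral>\<^sup>+ t. ennreal (d t) * indicator {0..\<tau>} t \<partial>lborel) = ennreal (C2.entropy F - C2.entropy (T \<tau> F))"
    by (rule nn_integral_has_integral_lebesgue'[OF d0 I])
  moreover have "ennreal (d t) * indicator {0..\<tau>} t
     = indicator {0<..<\<tau>} t * ennreal (\<integral>x. h' (rp (T t F) x) * quad (grad t F) x \<partial>lebesgue)" for t
    by (auto simp: d_def indicator_def)
  ultimately show "(\<integral>\<^sup>+ t. indicator {0<..<\<tau>} t * ennreal (\<integral>x. h' (rp (T t F) x) * quad (grad t F) x \<partial>lebesgue) \<partial>lborel)
      = ennreal (C2.entropy F - C2.entropy (T \<tau> F))" by simp
qed

text \<open>The entropy with \<open>\<Phi>'' = min (max (s - c) 0) 1\<close> vanishes exactly on \<open>s \<le> c\<close>.\<close>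

lemma T_submarkov:
  assumes F: "F \<in> H0" and c: "c \<ge> 0" and le: "AE x in lebesgue. rp F x \<le> c" and t: "t \<ge> 0"
  shows "AE x in lebesgue. rp (T t F) x \<le> c"
proof -
  define h' where "h' s = min (max (s - c) 0) 1" for s :: real
  have "continuous_on UNIV h'" unfolding h'_def by (intro continuous_intros)
  then obtain h \<Phi> where C2: "C2_entropy h h' 1 \<Phi>" using ex_C2_entropy[of h' 1] by (auto simp: h'_def)
  interpret C2: C2_entropy h h' 1 \<Phi> by fact
  \<comment> \<open>The assumption \<open>c \<ge> 0\<close> places 0, where \<open>h\<close> and
    \<open>\<Phi>\<close> are normalised, inside the region where \<open>h'\<close>
    vanishes.\<close>
  have h0: "h s = 0" if "s \<le> c" for s
  proof -
    have "norm (h s - h 0) \<le> 0 * norm (s - 0)"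
    proof (rule field_differentiable_bound[where S="{..c}" and f'=h'])
      show "(h has_real_derivative h' z) (at z within {..c})" for z by (rule has_field_derivative_at_within[OF C2.h_deriv])
      show "norm (h' z) \<le> 0" if "z \<in> {..c}" for z using that by (simp add: h'_def)
    qed (use that c in auto)
    then show ?thesis by (simp add: C2.h_0)
  qed
  have \<Phi>0: "\<Phi> s = 0" if "s \<le> c" for s
  proof -
    have "norm (\<Phi> s - \<Phi> 0) \<le> 0 * norm (s - 0)"
    proof (rule field_differentiable_bound[where S="{..c}" and f'=h])
      show "(\<Phi> has_real_derivative h z) (at z within {..c})" for z by (rule has_field_derivative_at_within[OF C2.\<Phi>_deriv])
      show "norm (h z) \<le> 0" if "z \<in> {..c}" for z using h0[of z] that by simp
    qed (use that c in auto)
    then show ?thesis by (simp add: C2.\<Phi>_0)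
  qed
  have hpos: "h s > 0" if "s > c" for s
  proof -
    have "h c < h s"
    proof (rule DERIV_pos_imp_increasing_open[OF that])
      show "\<exists>y. (h has_real_derivative y) (at x) \<and> 0 < y" if "c < x" "x < s" for x
        using C2.h_deriv[of x] that by (intro exI[of _ "h' x"]) (auto simp: h'_def)
      show "continuous_on {c..s} h" using C2.h_cont by (rule continuous_on_subset) simp
    qed
    then show ?thesis using h0[of c] by simp
  qed
  have \<Phi>pos: "\<Phi> s > 0" if "s > c" for s
  proof -
    have "\<Phi> c < \<Phi> s"
    proof (rule DERIV_pos_imp_increasing_open[OF that])
      show "\<exists>y. (\<Phi> has_real_derivative y) (at x) \<and> 0 < y" if "c < x" "x < s" for x
        using C2.\<Phi>_deriv[of x] hpos[of x] that by blast
      show "continuous_on {c..s} \<Phi>"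
        using C2.\<Phi>_deriv by (intro continuous_at_imp_continuous_on ballI) (rule DERIV_isCont)
    qed
    then show ?thesis using \<Phi>0[of c] by simp
  qed
  have nn: "\<Phi> s \<ge> 0" for s using \<Phi>0[of s] \<Phi>pos[of s] by (cases "s \<le> c") auto
  have "C2.entropy F = (\<integral>x. 0 \<partial>(lebesgue :: (real ^ 'n) measure))"
    unfolding C2.entropy_def
  proof (rule integral_cong_AE)
    show "(\<lambda>x. \<Phi> (rp F x)) \<in> borel_measurable lebesgue" by (rule measurable_compose[OF rp_measurable C2.\<Phi>_measurable])
    show "AE x in lebesgue. \<Phi> (rp F x) = 0" using le by eventually_elim (rule \<Phi>0)
  qed simp
  then have "C2.entropy (T t F) \<le> 0" using entropy_identity(1)[OF C2 F t] by simp
  then have "(\<integral>x. \<Phi> (rp (T t F) x) \<partial>lebesgue) = 0"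
    unfolding C2.entropy_def by (intro antisym integral_nonneg_AE) (auto simp: nn)
  then have "AE x in lebesgue. \<Phi> (rp (T t F) x) = 0"
    by (subst (asm) integral_nonneg_eq_0_iff_AE[OF C2.\<Phi>_integrable[OF sqint_rp]]) (auto simp: nn)
  then show ?thesis
  proof eventually_elim
    case (elim x) then show ?case using \<Phi>pos[of "rp (T t F) x"] by (cases "rp (T t F) x \<le> c") auto
  qed
qed

end

section \<open>The maximal theorem for positivity preserving contractions\<close>

definition nonneg :: "'a::euclidean_space l2 \<Rightarrow> bool" where
  "nonneg X \<longleftrightarrow> (AE x in lebesgue. 0 \<le> rp X x)"

lemma inner_nonneg: "nonneg X \<Longrightarrow> nonneg Y \<Longrightarrow> 0 \<le> inner X Y"
  unfolding nonneg_def inner_rp by (rule integral_nonneg_AE) (auto elim: AE_mp)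

lemma AE_rp_sum:
  assumes "finite S" shows "AE x in lebesgue. rp (\<Sum>i\<in>S. X i) x = (\<Sum>i\<in>S. rp (X i) x)"
  using assms
proof (induction S rule: finite_induct)
  case empty then show ?case using AE_rp_zero by simp
next
  case (insert i S)
  from insert.IH AE_rp_add[of "X i" "\<Sum>i\<in>S. X i"]
  have "AE x in lebesgue. rp (X i + (\<Sum>i\<in>S. X i)) x = rp (X i) x + (\<Sum>i\<in>S. rp (X i) x)"
    by eventually_elim simp
  then show ?case using insert.hyps by simp
qed

lemma sqint_sum: "finite S \<Longrightarrow> (\<And>i. i \<in> S \<Longrightarrow> sqint (f i)) \<Longrightarrow> sqint (\<lambda>x. \<Sum>i\<in>S. f i x)"
  by (induction S rule: finite_induct) (auto simp: sqint_zero sqint_add)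

lemma cls_sum: "finite S \<Longrightarrow> (\<And>i. i \<in> S \<Longrightarrow> sqint (f i)) \<Longrightarrow> cls (\<lambda>x. \<Sum>i\<in>S. f i x) = (\<Sum>i\<in>S. cls (f i))"
  by (induction S rule: finite_induct) (auto simp: cls_zero cls_add[symmetric] sqint_sum)

locale positivity_preserving = positive_contraction P for P :: "'a::euclidean_space l2 \<Rightarrow> 'a l2" +
  assumes P_nonneg: "nonneg X \<Longrightarrow> nonneg (P X)"
begin

lemma Pn_nonneg: "nonneg X \<Longrightarrow> nonneg ((P ^^ k) X)"
  by (induction k) (auto intro: P_nonneg)

lemma Pn_sym: "inner ((P ^^ k) X) Y = inner X ((P ^^ k) Y)"
proof (induction k arbitrary: X Y)
  case (Suc k)
  have "inner ((P ^^ Suc k) X) Y = inner ((P ^^ k) X) (P Y)" by (simp add: J_sym)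
  also have "\<dots> = inner X ((P ^^ k) (P Y))" by (rule Suc)
  finally show ?case by (simp add: funpow_swap1)
qed simp

lemma norm_Pn_le: "norm ((P ^^ k) X) \<le> norm X"
  by (induction k) (auto intro: order_trans[OF norm_J_le])

definition avg :: "nat \<Rightarrow> 'a l2 \<Rightarrow> 'a l2" where
  "avg n X = (1 / 2 ^ n) *\<^sub>R (\<Sum>k<2 ^ n. (P ^^ k) X)"

lemma norm_avg_le: "norm (avg n X) \<le> norm X"
proof -
  have "norm (\<Sum>k<2 ^ n. (P ^^ k) X) \<le> (\<Sum>k<(2::nat) ^ n. norm X)"
    by (rule order_trans[OF norm_sum], rule sum_mono, rule norm_Pn_le)
  then show ?thesis by (simp add: avg_def field_simps)
qed

lemma avg_sym: "inner (avg n X) Y = inner X (avg n Y)"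
  by (simp add: avg_def inner_sum_left inner_sum_right Pn_sym)

lemma inner_avg_nonneg: "nonneg X \<Longrightarrow> nonneg Y \<Longrightarrow> 0 \<le> inner (avg n X) Y"
  by (simp add: avg_def inner_sum_left sum_nonneg inner_nonneg Pn_nonneg)

text \<open>In the product of the two averages each shift \<open>b < 2 ^ j\<close> moves the block
  of \<open>2 ^ i\<close> powers inside the first \<open>2 ^ Suc i\<close> powers. All terms are
  nonnegative, so every shifted block is dominated by the long sum; the factor 2 is the change of
  normalisation.\<close>

lemma avg_compose_aux:
  assumes "nonneg X" "nonneg Y" "j \<le> i"
  shows "inner (avg i X) (avg j Y) \<le> 2 * inner (avg (Suc i) X) Y"
proof -
  define c where "c k = inner ((P ^^ k) X) Y" for k
  have c0: "c k \<ge> 0" for k unfolding c_def by (intro inner_nonneg Pn_nonneg assms)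
  have "inner (avg i X) (avg j Y) = (1 / 2 ^ i) * (1 / 2 ^ j) * (\<Sum>a<2 ^ i. \<Sum>b<2 ^ j. c (b + a))"
    by (simp add: avg_def inner_sum_left inner_sum_right c_def funpow_add Pn_sym sum_distrib_left mult_ac) (rule sum.swap)
  also have "(\<Sum>a<(2::nat) ^ i. \<Sum>b<2 ^ j. c (b + a)) = (\<Sum>b<2 ^ j. \<Sum>a<2 ^ i. c (b + a))" by (rule sum.swap)
  finally have eq: "inner (avg i X) (avg j Y) = (1 / 2 ^ i) * (1 / 2 ^ j) * (\<Sum>b<2 ^ j. \<Sum>a<2 ^ i. c (b + a))" .
  have le: "(\<Sum>b<(2::nat) ^ j. \<Sum>a<2 ^ i. c (b + a)) \<le> (\<Sum>b<(2::nat) ^ j. \<Sum>k<2 ^ Suc i. c k)"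
  proof (rule sum_mono)
    fix b :: nat assume b: "b \<in> {..<2 ^ j}"
    have p: "(2::nat) ^ j \<le> 2 ^ i" using assms(3) by (intro power_increasing) auto
    have "b < 2 ^ i" by (rule less_le_trans[OF _ p]) (use b in simp)
    then have "b + 2 ^ i \<le> 2 ^ Suc i" by simp
    then have sub: "{b..<b + 2 ^ i} \<subseteq> {..<2 ^ Suc i}" by auto
    have "(\<Sum>a<2 ^ i. c (b + a)) = sum c {b..<b + 2 ^ i}"
      by (rule sum.reindex_bij_witness[of _ "\<lambda>k. k - b" "\<lambda>a. b + a"]) auto
    also have "\<dots> \<le> (\<Sum>k<2 ^ Suc i. c k)" by (rule sum_mono2) (use sub c0 in auto)
    finally show "(\<Sum>a<2 ^ i. c (b + a)) \<le> (\<Sum>k<2 ^ Suc i. c k)" .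
  qed
  have "inner (avg i X) (avg j Y) \<le> (1 / 2 ^ i) * (1 / 2 ^ j) * (\<Sum>b<(2::nat) ^ j. \<Sum>k<2 ^ Suc i. c k)"
    unfolding eq by (rule mult_left_mono[OF le]) simp
  also have "\<dots> = (1 / 2 ^ i) * (1 / 2 ^ j) * (2 ^ j * (\<Sum>k<2 ^ Suc i. c k))" by simp
  also have "\<dots> = 2 * inner (avg (Suc i) X) Y" by (simp add: avg_def inner_sum_left c_def)
  finally show ?thesis .
qed

lemma avg_compose:
  assumes "nonneg X" "nonneg Y"
  shows "inner (avg i X) (avg j Y) \<le> 2 * (inner (avg (Suc i) X) Y + inner (avg (Suc j) Y) X)"
proof (cases "j \<le> i")
  case True
  then show ?thesis using avg_compose_aux[OF assms True] inner_avg_nonneg[OF assms(2,1), of "Suc j"] by simp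
next
  case False
  then have "inner (avg j Y) (avg i X) \<le> 2 * inner (avg (Suc j) Y) X" using assms by (intro avg_compose_aux) auto
  then show ?thesis using inner_avg_nonneg[OF assms, of "Suc i"] by (simp add: inner_commute)
qed

text \<open>A \<open>T T\<^sup>*\<close> argument: with \<open>N\<^sub>l = \<parallel>\<Sum>\<^sub>j avg (j + l) g\<^sub>j\<parallel>\<close> one has \<open>N\<^sub>l\<^sup>2 \<le> 4 N\<^sub>l\<^sub>+\<^sub>1 \<parallel>\<Sum>\<^sub>j g\<^sub>j\<parallel>\<close>, and \<open>N\<close> is bounded.\<close>

lemma norm_sum_avg_le:
  assumes g: "\<And>j. nonneg (g j)"
  shows "norm (\<Sum>j<m. avg j (g j)) \<le> 4 * norm (\<Sum>j<m. g j)"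
proof -
  define N where "N l = norm (\<Sum>j<m. avg (j + l) (g j))" for l
  define S where "S = norm (\<Sum>j<m. g j)"
  define B where "B = (\<Sum>j<m. norm (g j))"
  have NB: "N l \<le> B" for l unfolding N_def B_def by (rule order_trans[OF norm_sum], rule sum_mono, rule norm_avg_le)
  have rec: "(N l)\<^sup>2 \<le> 4 * N (Suc l) * S" for l
  proof -
    let ?s = "\<Sum>i<m. \<Sum>j<m. inner (avg (Suc (i + l)) (g i)) (g j)"
    have "(N l)\<^sup>2 = (\<Sum>i<m. \<Sum>j<m. inner (avg (i + l) (g i)) (avg (j + l) (g j)))"
      by (simp add: N_def power2_norm_eq_inner inner_sum_left inner_sum_right) (rule sum.swap)
    also have "\<dots> \<le> (\<Sum>i<m. \<Sum>j<m. 2 * (inner (avg (Suc (i + l)) (g i)) (g j) + inner (avg (Suc (j + l)) (g j)) (g i)))"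
      by (intro sum_mono avg_compose g)
    also have "\<dots> = 2 * ?s + 2 * (\<Sum>i<m. \<Sum>j<m. inner (avg (Suc (j + l)) (g j)) (g i))"
      by (simp add: sum.distrib sum_distrib_left distrib_left)
    also have "(\<Sum>i<m. \<Sum>j<m. inner (avg (Suc (j + l)) (g j)) (g i)) = ?s" by (rule sum.swap)
    also have "2 * ?s + 2 * ?s = 4 * inner (\<Sum>i<m. avg (i + Suc l) (g i)) (\<Sum>j<m. g j)"
      by (simp add: inner_sum_left inner_sum_right) (rule sum.swap)
    also have "\<dots> \<le> 4 * (N (Suc l) * S)"
      unfolding N_def S_def by (intro mult_left_mono norm_cauchy_schwarz) auto
    finally show ?thesis by simp
  qed
  have "N 0 \<le> 4 * S"
  proof (cases "S = 0")
    case True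
    then have "(N 0)\<^sup>2 \<le> 0" using rec[of 0] by simp
    then show ?thesis using True by simp
  next
    case False
    then have S: "S > 0" by (simp add: S_def)
    \<comment> \<open>In this scale the recursion reads
      \<open>(x l)\<^sup>2 \<le> x (Suc l)\<close>. If \<open>x 0\<close> exceeded 1, then
      \<open>x l\<close> would grow like \<open>(x 0) ^ (2 ^ l)\<close> and break the uniform
      bound.\<close>
    define x where "x l = N l / (4 * S)" for l
    have x0: "x l \<ge> 0" for l using S by (simp add: x_def N_def)
    have xr: "(x l)\<^sup>2 \<le> x (Suc l)" for l using rec[of l] S by (simp add: x_def field_simps power2_eq_square)
    have xb: "x l \<le> B / (4 * S)" for l unfolding x_def using S NB by (intro divide_right_mono) auto
    have "x 0 \<le> 1"
    proof (rule ccontr)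
      assume gt: "\<not> x 0 \<le> 1"
      have ge: "x l \<ge> (x 0) ^ (2 ^ l)" for l
      proof (induction l)
        case (Suc l)
        have "(x 0) ^ (2 ^ Suc l) = ((x 0) ^ (2 ^ l))\<^sup>2" by (simp only: power_Suc2 power_mult)
        also have "\<dots> \<le> (x l)\<^sup>2" using Suc x0 by (intro power_mono) auto
        also have "\<dots> \<le> x (Suc l)" by (rule xr)
        finally show ?case .
      qed simp
      obtain n where n: "B / (4 * S) < (x 0) ^ n" using real_arch_pow[of "x 0"] gt by auto
      have "(x 0) ^ n \<le> (x 0) ^ (2 ^ n)" using gt by (intro power_increasing) (auto intro: less_imp_le less_exp)
      then show False using ge[of n] xb[of n] n by linarith
    qed
    then show ?thesis using S by (simp add: x_def field_simps)
  qed
  then show ?thesis by (simp add: N_def S_def)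
qed

text \<open>Linearise the maximum: \<open>g\<close> is \<open>avg j f\<close> on the set
  \<open>S j\<close>, with pieces \<open>p j\<close>. Then the squared norm of \<open>g\<close> is
  the inner product of \<open>f\<close> with the sum of all \<open>avg j (p j)\<close>, and
  \<open>norm_sum_avg_le\<close> bounds that sum by 4 times the norm of \<open>g\<close>
  itself.\<close>

lemma maximal_avg:
  fixes f :: "'a l2"
  assumes f: "nonneg f"
  shows "\<exists>g. sqint g \<and> (\<forall>j<m. \<forall>x. rp (avg j f) x \<le> g x) \<and> norm (cls g) \<le> 4 * norm f"
proof (cases "m = 0")
  case True
  then show ?thesis by (intro exI[of _ "\<lambda>x::'a. 0"]) (simp add: sqint_zero cls_zero)
next
  case False
  define a where "a j = rp (avg j f)" for j
  have am: "a j \<in> borel_measurable lebesgue" for j unfolding a_def by (rule rp_measurable)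
  \<comment> \<open>The strict inequality for smaller indices selects the first index attaining the
    maximum, which makes these sets disjoint.\<close>
  define S where "S j = {x. (\<forall>i\<in>{..<m}. a i x \<le> a j x) \<and> (\<forall>i\<in>{..<j}. a i x < a j x)}" for j
  have Sm: "S j \<in> sets lebesgue" for j
  proof -
    have "Measurable.pred lebesgue (\<lambda>x. (\<forall>i\<in>{..<m}. a i x \<le> a j x) \<and> (\<forall>i\<in>{..<j}. a i x < a j x))"
      using am by measurable
    then show ?thesis unfolding S_def pred_def by simp
  qed
  have disj: "i = j" if "x \<in> S i" "x \<in> S j" "i < m" "j < m" for x i j
  proof (rule ccontr)
    assume "i \<noteq> j"
    then consider "i < j" | "j < i" by linarith
    then show False using that by cases (auto simp: S_def not_less dest!: bspec)
  qed
  have ex: "\<exists>j<m. x \<in> S j" for x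
  proof -
    define P where "P j \<longleftrightarrow> j < m \<and> (\<forall>i<m. a i x \<le> a j x)" for j
    have "Max ((\<lambda>j. a j x) ` {..<m}) \<in> (\<lambda>j. a j x) ` {..<m}" using False by (intro Max_in) auto
    then obtain j0 where "j0 < m" "Max ((\<lambda>j. a j x) ` {..<m}) = a j0 x" by auto
    then have "P j0" unfolding P_def by (metis Max_ge finite_imageI finite_lessThan imageI lessThan_iff)
    define j where "j = (LEAST j. P j)"
    have Pj: "P j" unfolding j_def by (rule LeastI[of P, OF \<open>P j0\<close>])
    have "a i x < a j x" if "i < j" for i
    proof (rule ccontr)
      assume "\<not> a i x < a j x"
      then have "P i" using Pj that unfolding P_def by (metis less_trans not_less order_trans)
      then show False using not_less_Least[of i P] that by (simp add: j_def)
    qed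
    then have "x \<in> S j" using Pj by (auto simp: S_def P_def)
    then show ?thesis using Pj by (auto simp: P_def)
  qed
  define p where "p j x = indicator (S j) x * a j x" for j x
  define g where "g x = (\<Sum>j<m. p j x)" for x
  have g_eq: "g x = a j x" if "j < m" "x \<in> S j" for x j
  proof -
    have "g x = (\<Sum>i<m. if i = j then a j x else 0)"
      unfolding g_def p_def by (intro sum.cong refl) (use disj that in \<open>auto simp: indicator_def\<close>)
    then show ?thesis using that by simp
  qed
  have gmax: "a j x \<le> g x" if "j < m" for j x
  proof -
    obtain i where "i < m" "x \<in> S i" using ex by blast
    then show ?thesis using g_eq that by (auto simp: S_def)
  qed
  have sp: "sqint (p j)" for j
    unfolding p_def[abs_def] a_def
    by (rule sqint_mult_bounded(1)[OF sqint_rp borel_measurable_indicator[OF Sm], of _ 1]) (simp add: indicator_def)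
  have sg: "sqint g" unfolding g_def[abs_def] by (intro sqint_sum sp) simp
  have a_nn: "AE x in lebesgue. \<forall>j. 0 \<le> a j x"
  proof -
    have "AE x in lebesgue. 0 \<le> a j x" for j
    proof -
      have "AE x in lebesgue. \<forall>k\<in>{..<(2::nat)^j}. 0 \<le> rp ((P ^^ k) f) x"
        using Pn_nonneg[OF f] by (intro AE_finite_allI) (auto simp: nonneg_def)
      with AE_rp_scale[of "1 / 2 ^ j" "\<Sum>k<2 ^ j. (P ^^ k) f"] AE_rp_sum[OF finite_lessThan[of "(2::nat) ^ j"], of "\<lambda>k. (P ^^ k) f"]
      show ?thesis unfolding a_def avg_def
      proof eventually_elim
        case (elim x)
        have "0 \<le> (\<Sum>k<2 ^ j. rp ((P ^^ k) f) x)" by (intro sum_nonneg) (use elim(3) in blast)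
        then show ?case by (simp only: elim(1,2)) simp
      qed
    qed
    then show ?thesis by (simp add: AE_all_countable)
  qed
  have p_nn: "nonneg (cls (p j))" for j
    unfolding nonneg_def using AE_rp_cls[OF sp[of j]] a_nn by eventually_elim (auto simp: p_def)
  have cg: "cls g = (\<Sum>j<m. cls (p j))" unfolding g_def[abs_def] by (intro cls_sum sp) simp
  have pt: "(g x)\<^sup>2 = (\<Sum>j<m. a j x * p j x)" for x
  proof -
    obtain i where i: "i < m" "x \<in> S i" using ex by blast
    have "(\<Sum>j<m. a j x * p j x) = (\<Sum>j<m. if j = i then (a i x)\<^sup>2 else 0)"
      by (intro sum.cong refl) (use disj i in \<open>auto simp: p_def indicator_def power2_eq_square\<close>)
    then show ?thesis using i g_eq by simp
  qed
  have "(norm (cls g))\<^sup>2 = (\<Sum>j<m. \<integral>x. a j x * p j x \<partial>lebesgue)"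
    unfolding norm_cls[OF sg] pt a_def by (intro Bochner_Integration.integral_sum sqint_mult_integrable sqint_rp sp)
  also have "\<dots> = (\<Sum>j<m. inner (avg j f) (cls (p j)))"
    using inner_cls[OF sqint_rp sp] by (simp add: a_def)
  also have "\<dots> = inner f (\<Sum>j<m. avg j (cls (p j)))" by (simp add: avg_sym inner_sum_right)
  also have "\<dots> \<le> norm f * norm (\<Sum>j<m. avg j (cls (p j)))" by (rule norm_cauchy_schwarz)
  also have "\<dots> \<le> norm f * (4 * norm (\<Sum>j<m. cls (p j)))" by (intro mult_left_mono norm_sum_avg_le p_nn) simp
  finally have "norm (cls g) * norm (cls g) \<le> norm (cls g) * (4 * norm f)" by (simp add: cg power2_eq_square mult_ac)
  then have "norm (cls g) \<le> 4 * norm f" by (cases "norm (cls g) = 0") (auto simp: mult_le_cancel_left)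
  then show ?thesis using sg gmax unfolding a_def by blast
qed

definition diffs :: "'a l2 \<Rightarrow> nat \<Rightarrow> 'a l2" where
  "diffs f k = (P ^^ Suc k) f - (P ^^ k) f"

text \<open>The sequence \<open>a k = inner ((P ^^ k) f) f\<close> is nonnegative, nonincreasing and
  convex: an even or odd index is split in halves and the weights 1, P, 1 - P and P - P^2 are
  nonnegative. Its second differences at even indices are the squared norms of
  \<open>diffs f k\<close>, so the weighted sum is controlled by Abel summation.\<close>

lemma square_function_discrete: "(\<Sum>k<K. real (Suc k) * (norm (diffs f k))\<^sup>2) \<le> (norm f)\<^sup>2"
proof -
  define a where "a k = inner ((P ^^ k) f) f" for k
  define \<delta> where "\<delta> k = a k - a (Suc k)" for k
  have aa: "inner ((P ^^ i) f) ((P ^^ j) f) = a (i + j)" for i j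
    by (simp add: a_def funpow_add Pn_sym[of i])
      (metis Pn_sym add.commute comp_apply funpow_add inner_commute)
  have parity: "\<exists>i. k = i + i \<or> k = Suc (i + i)" for k :: nat by presburger
  have a0: "a k \<ge> 0" for k
  proof -
    obtain i where "k = i + i \<or> k = Suc (i + i)" using parity by blast
    then show ?thesis
    proof
      assume "k = i + i" then show ?thesis using aa[of i i] by (metis inner_ge_zero)
    next
      assume "k = Suc (i + i)"
      then have "a k = inner (P ((P ^^ i) f)) ((P ^^ i) f)" using aa[of "Suc i" i] by simp
      then show ?thesis using pop_weight_nonneg(1) by simp
    qed
  qed
  have \<delta>0: "\<delta> k \<ge> 0" for k
  proof -
    obtain i where "k = i + i \<or> k = Suc (i + i)" using parity by blast
    then show ?thesis
    proof
      assume "k = i + i"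
      then have "\<delta> k = inner ((P ^^ i) f - P ((P ^^ i) f)) ((P ^^ i) f)"
        using aa[of i i] aa[of "Suc i" i] by (simp add: \<delta>_def inner_diff_left)
      then show ?thesis using pop_weight_nonneg(2) by simp
    next
      assume "k = Suc (i + i)"
      then have "\<delta> k = inner (P ((P ^^ i) f) - P (P ((P ^^ i) f))) ((P ^^ i) f)"
        using aa[of "Suc i" i] aa[of "Suc (Suc i)" i] by (simp add: \<delta>_def inner_diff_left)
      then show ?thesis using pop_weight_nonneg(3) by simp
    qed
  qed
  have \<delta>1: "\<delta> (Suc k) \<le> \<delta> k" for k
  proof -
    obtain i where "k = i + i \<or> k = Suc (i + i)" using parity by blast
    then show ?thesis
    proof
      assume k: "k = i + i"
      have "0 \<le> inner ((P ^^ i) f - (P ^^ Suc i) f) ((P ^^ i) f - (P ^^ Suc i) f)" by simp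
      also have "\<dots> = a (i + i) - a (i + Suc i) - (a (Suc i + i) - a (Suc i + Suc i))"
        unfolding inner_diff_left inner_diff_right aa by simp
      also have "\<dots> = \<delta> k - \<delta> (Suc k)" by (simp add: k \<delta>_def)
      finally show ?thesis by simp
    next
      assume k: "k = Suc (i + i)"
      have "0 \<le> inner (P ((P ^^ i) f - (P ^^ Suc i) f)) ((P ^^ i) f - (P ^^ Suc i) f)" by (rule pop_weight_nonneg(1))
      also have "\<dots> = inner ((P ^^ Suc i) f - (P ^^ Suc (Suc i)) f) ((P ^^ i) f - (P ^^ Suc i) f)" by (simp add: J.diff)
      also have "\<dots> = a (Suc i + i) - a (Suc i + Suc i) - (a (Suc (Suc i) + i) - a (Suc (Suc i) + Suc i))"
        unfolding inner_diff_left inner_diff_right aa by simp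
      also have "\<dots> = \<delta> k - \<delta> (Suc k)" by (simp add: k \<delta>_def)
      finally show ?thesis by simp
    qed
  qed
  have nd: "(norm (diffs f k))\<^sup>2 = \<delta> (2 * k) - \<delta> (Suc (2 * k))" for k
  proof -
    have "(norm (diffs f k))\<^sup>2 = a (Suc k + Suc k) - a (Suc k + k) - (a (k + Suc k) - a (k + k))"
      unfolding power2_norm_eq_inner diffs_def inner_diff_left inner_diff_right aa by simp
    then show ?thesis unfolding \<delta>_def mult_2 add_Suc add_Suc_right by linarith
  qed
  \<comment> \<open>The term \<open>real K * \<delta> (2 * K)\<close> is the boundary term of the
    Abel summation; with it the induction closes.\<close>
  have "(\<Sum>k<K. real (Suc k) * (norm (diffs f k))\<^sup>2) + real K * \<delta> (2 * K) \<le> a 0 - a (2 * K)" for K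
  proof (induction K)
    case (Suc K)
    have "real (Suc K) * \<delta> (Suc (Suc (2 * K))) \<le> real (Suc K) * \<delta> (Suc (2 * K))" by (intro mult_left_mono \<delta>1) simp
    moreover have "real (Suc K) * \<delta> (2 * K) = real K * \<delta> (2 * K) + \<delta> (2 * K)" by (simp only: of_nat_Suc distrib_right mult_1)
    moreover have "(\<Sum>k<Suc K. real (Suc k) * (norm (diffs f k))\<^sup>2)
      = (\<Sum>k<K. real (Suc k) * (norm (diffs f k))\<^sup>2) + (real (Suc K) * \<delta> (2 * K) - real (Suc K) * \<delta> (Suc (2 * K)))"
      by (simp only: sum.lessThan_Suc nd right_diff_distrib)
    moreover have "\<delta> (2 * K) = a (2 * K) - a (Suc (2 * K))" "a (Suc (Suc (2 * K))) \<le> a (Suc (2 * K))"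
      using \<delta>0[of "Suc (2 * K)"] by (simp_all add: \<delta>_def)
    moreover have "2 * Suc K = Suc (Suc (2 * K))" by simp
    ultimately show ?case using Suc by (simp only:)
  qed simp
  from this[of K] have "(\<Sum>k<K. real (Suc k) * (norm (diffs f k))\<^sup>2) \<le> a 0"
    using a0[of "2 * K"] mult_nonneg_nonneg[OF of_nat_0_le_iff[of K] \<delta>0[of "2 * K"]] by linarith
  then show ?thesis by (simp add: a_def dot_square_norm)
qed

text \<open>Stein's device: \<open>(P ^^ n) f\<close> differs from the average of the first
  \<open>n + 1\<close> powers by a weighted sum of differences, which Cauchy-Schwarz bounds by the
  square function \<open>q\<close>. The averages are handled by \<open>maximal_avg\<close>. The
  constant is 9 = 2 * 4 + 1.\<close>

lemma maximal_L2:
  assumes f: "nonneg f"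
  shows "\<exists>G. sqint G \<and> (AE x in lebesgue. \<forall>n\<le>K. \<bar>rp ((P ^^ n) f) x\<bar> \<le> G x) \<and> norm (cls G) \<le> 9 * norm f"
proof -
  \<comment> \<open>The dyadic exponent used for \<open>n \<le> K\<close> is at most
    \<open>Suc n\<close>, hence below \<open>Suc (Suc K)\<close>.\<close>
  obtain g where g: "sqint g" "\<And>j x. j < Suc (Suc K) \<Longrightarrow> rp (avg j f) x \<le> g x" "norm (cls g) \<le> 4 * norm f"
    using maximal_avg[OF f, of "Suc (Suc K)"] by blast
  define d where "d k = rp (diffs f k)" for k
  define q where "q x = sqrt (\<Sum>k<K. real (Suc k) * (d k x)\<^sup>2)" for x
  have q2: "(q x)\<^sup>2 = (\<Sum>k<K. real (Suc k) * (d k x)\<^sup>2)" for x unfolding q_def by (simp add: sum_nonneg)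
  have dm: "d k \<in> borel_measurable lebesgue" for k unfolding d_def by (rule rp_measurable)
  have qm: "q \<in> borel_measurable lebesgue" unfolding q_def[abs_def] using dm by measurable
  have int: "integrable lebesgue (\<lambda>x. real (Suc k) * (d k x)\<^sup>2)" for k
    unfolding d_def by (intro integrable_mult_right sqint_integrable sqint_rp)
  have sq: "sqint q" unfolding sqint_def q2 using qm int by (intro conjI Bochner_Integration.integrable_sum)
  have "(norm (cls q))\<^sup>2 = (\<Sum>k<K. real (Suc k) * (norm (diffs f k))\<^sup>2)"
  proof -
    have "(norm (cls q))\<^sup>2 = (\<Sum>k<K. \<integral>x. real (Suc k) * (d k x)\<^sup>2 \<partial>lebesgue)"
      unfolding norm_cls[OF sq] q2 by (rule Bochner_Integration.integral_sum) (rule int)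
    also have "\<dots> = (\<Sum>k<K. real (Suc k) * (norm (diffs f k))\<^sup>2)"
      by (intro sum.cong refl) (simp add: d_def norm_cls[OF sqint_rp, symmetric])
    finally show ?thesis .
  qed
  also have "\<dots> \<le> (norm f)\<^sup>2" by (rule square_function_discrete)
  finally have nq: "norm (cls q) \<le> norm f" by (rule power2_le_imp_le) simp
  have "AE x in lebesgue. \<forall>k. 0 \<le> rp ((P ^^ k) f) x" using Pn_nonneg[OF f] by (simp add: AE_all_countable nonneg_def)
  moreover have "AE x in lebesgue. \<forall>j. rp (avg j f) x = (1 / 2 ^ j) * (\<Sum>k<2 ^ j. rp ((P ^^ k) f) x)"
    unfolding AE_all_countable
  proof
    fix j
    from AE_rp_scale[of "1 / 2 ^ j" "\<Sum>k<2 ^ j. (P ^^ k) f"] AE_rp_sum[OF finite_lessThan[of "(2::nat) ^ j"], of "\<lambda>k. (P ^^ k) f"]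
    show "AE x in lebesgue. rp (avg j f) x = (1 / 2 ^ j) * (\<Sum>k<2 ^ j. rp ((P ^^ k) f) x)"
      unfolding avg_def by eventually_elim simp
  qed
  moreover have "AE x in lebesgue. \<forall>k. d k x = rp ((P ^^ Suc k) f) x - rp ((P ^^ k) f) x"
    unfolding AE_all_countable d_def diffs_def using AE_rp_diff by blast
  ultimately have "AE x in lebesgue. \<forall>n\<le>K. \<bar>rp ((P ^^ n) f) x\<bar> \<le> 2 * g x + q x"
  proof eventually_elim
    case (elim x)
    define c where "c k = rp ((P ^^ k) f) x" for k
    have c0: "c k \<ge> 0" for k using elim(1) by (simp add: c_def)
    have dk: "d k x = c (Suc k) - c k" for k using elim(3) by (simp add: c_def)
    show ?case
    proof (intro allI impI)
      fix n assume n: "n \<le> K"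
      have tel: "real (Suc n) * c n - (\<Sum>k\<le>n. c k) = (\<Sum>k<n. real (Suc k) * d k x)"
      proof (induction n)
        case (Suc n) then show ?case by (simp add: dk algebra_simps)
      qed simp
      define s where "s = (\<Sum>k<n. real (Suc k) * d k x)"
      \<comment> \<open>The weight is split into two square roots, so that one Cauchy-Schwarz factor
        is part of \<open>(q x)\<^sup>2\<close> and the other at most
        \<open>(Suc n)\<^sup>2\<close>.\<close>
      have "s\<^sup>2 = (\<Sum>k<n. sqrt (real (Suc k)) * (sqrt (real (Suc k)) * d k x))\<^sup>2"
        unfolding s_def by (simp flip: mult.assoc)
      also have "\<dots> \<le> (\<Sum>k<n. (sqrt (real (Suc k)))\<^sup>2) * (\<Sum>k<n. (sqrt (real (Suc k)) * d k x)\<^sup>2)"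
        by (rule Cauchy_Schwarz_ineq_sum)
      also have "\<dots> \<le> (real (Suc n))\<^sup>2 * (q x)\<^sup>2"
      proof (rule mult_mono)
        have "(\<Sum>k<n. (sqrt (real (Suc k)))\<^sup>2) \<le> (\<Sum>k<n. real (Suc n))" by (intro sum_mono) auto
        also have "\<dots> \<le> (real (Suc n))\<^sup>2" by (simp add: power2_eq_square)
        finally show "(\<Sum>k<n. (sqrt (real (Suc k)))\<^sup>2) \<le> (real (Suc n))\<^sup>2" .
        have "(\<Sum>k<n. (sqrt (real (Suc k)) * d k x)\<^sup>2) = (\<Sum>k<n. real (Suc k) * (d k x)\<^sup>2)"
          by (intro sum.cong refl) (simp add: power_mult_distrib)
        also have "\<dots> \<le> (q x)\<^sup>2" unfolding q2 by (rule sum_mono2) (use n in auto)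
        finally show "(\<Sum>k<n. (sqrt (real (Suc k)) * d k x)\<^sup>2) \<le> (q x)\<^sup>2" .
      qed (auto intro: sum_nonneg)
      finally have "s\<^sup>2 \<le> (real (Suc n) * q x)\<^sup>2" by (simp add: power_mult_distrib)
      then have s: "s \<le> real (Suc n) * q x"
        by (rule power2_le_imp_le) (auto simp: q_def intro!: mult_nonneg_nonneg real_sqrt_ge_zero sum_nonneg)
      \<comment> \<open>The smallest dyadic length covering \<open>n + 1\<close> terms is at most
        twice \<open>n + 1\<close>; this is the factor 2 in front of \<open>g\<close>.\<close>
      define j where "j = (LEAST j. Suc n \<le> 2 ^ j)"
      have exj: "Suc n \<le> 2 ^ Suc n" using less_exp[of "Suc n"] by simp
      have j1: "Suc n \<le> 2 ^ j" unfolding j_def by (rule LeastI[of "\<lambda>j. Suc n \<le> 2 ^ j", OF exj])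
      have "j \<le> Suc n" unfolding j_def by (rule Least_le[of "\<lambda>j. Suc n \<le> 2 ^ j", OF exj])
      then have jK: "j < Suc (Suc K)" using n by simp
      have j2: "(2::real) ^ j \<le> 2 * real (Suc n)"
      proof (cases j)
        case (Suc i)
        then have "\<not> Suc n \<le> 2 ^ i" using not_less_Least[of i "\<lambda>j. Suc n \<le> 2 ^ j"] by (simp add: j_def)
        then have "2 ^ i \<le> Suc n" by simp
        then have "real (2 ^ i) \<le> real (Suc n)" by (rule of_nat_mono)
        then show ?thesis using Suc by simp
      qed simp
      have "(\<Sum>k\<le>n. c k) \<le> (\<Sum>k<2 ^ j. c k)" by (rule sum_mono2) (use j1 c0 in auto)
      also have "\<dots> = 2 ^ j * rp (avg j f) x" using elim(2) by (simp add: c_def)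
      also have "\<dots> \<le> 2 ^ j * g x" by (intro mult_left_mono g jK) simp
      also have "\<dots> \<le> (2 * real (Suc n)) * g x"
      proof (rule mult_right_mono[OF j2])
        have "0 \<le> (1 / 2 ^ j) * (\<Sum>k<2 ^ j. c k)" by (intro mult_nonneg_nonneg sum_nonneg c0) auto
        then show "0 \<le> g x" using elim(2) g(2)[OF jK, of x] by (simp add: c_def)
      qed
      finally have "real (Suc n) * c n \<le> real (Suc n) * (2 * g x + q x)"
        using tel s unfolding s_def[symmetric] by (simp add: algebra_simps)
      then have "c n \<le> 2 * g x + q x" by (simp add: mult_le_cancel_left)
      then show "\<bar>rp ((P ^^ n) f) x\<bar> \<le> 2 * g x + q x" using c0[of n] by (simp add: c_def)
    qed
  qed
  moreover have "norm (cls (\<lambda>x. 2 * g x + q x)) \<le> 9 * norm f"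
  proof -
    have "cls (\<lambda>x. 2 * g x + q x) = 2 *\<^sub>R cls g + cls q" by (simp add: cls_scale cls_add sqint_scale g sq)
    then have "norm (cls (\<lambda>x. 2 * g x + q x)) \<le> 2 * norm (cls g) + norm (cls q)"
      using norm_triangle_ineq[of "2 *\<^sub>R cls g" "cls q"] by simp
    then show ?thesis using g(3) nq by linarith
  qed
  ultimately show ?thesis using sqint_add[OF sqint_scale[OF g(1), of 2] sq]
    by (intro exI[of _ "\<lambda>x. 2 * g x + q x"] conjI)
qed

end

section \<open>The maximal function of the semigroup\<close>

text \<open>\<open>K\<close> is measurable for the completed product measure only, so its individual
  sections need not be measurable. It is replaced by a Borel function off a null set, almost all of
  whose sections are null. The weight \<open>w\<close> is there to carry the power of the maximal
  function through the exchange.\<close>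

lemma lebesgue_Tonelli:
  fixes K :: "'b::euclidean_space \<times> 'a::euclidean_space \<Rightarrow> ennreal"
  assumes K: "K \<in> borel_measurable lebesgue"
  shows "\<exists>k\<in>borel_measurable borel. (AE x in lebesgue. (\<integral>\<^sup>+ t. K (t, x) \<partial>lebesgue) = k x) \<and>
    (\<forall>w\<in>borel_measurable borel. (\<integral>\<^sup>+ t. \<integral>\<^sup>+ x. w x * K (t, x) \<partial>lebesgue \<partial>lebesgue) = (\<integral>\<^sup>+ x. w x * k x \<partial>lebesgue))"
proof -
  from completion_ex_borel_measurable[OF K] obtain g where g: "g \<in> borel_measurable lborel" and ae: "AE p in lborel. K p = g p" by blast
  from ae obtain N where N: "N \<in> null_sets lborel" "{p \<in> space lborel. K p \<noteq> g p} \<subseteq> N" unfolding eventually_ae_filter by blast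
  have eq: "K p = g p" if "p \<notin> N" for p using N(2) that by auto
  have ae': "AE p in lborel \<Otimes>\<^sub>M lborel. p \<notin> N" unfolding lborel_prod by (rule AE_not_in[OF N(1)])
  have 1: "AE t in lborel. AE x in lborel. (t, x) \<notin> N" by (rule lborel_pair.AE_pair[OF ae'])
  have "{p \<in> space (lborel \<Otimes>\<^sub>M lborel). (fst p, snd p) \<notin> N} \<in> sets (lborel \<Otimes>\<^sub>M lborel)"
  proof -
    have "{p \<in> space (lborel \<Otimes>\<^sub>M lborel). (fst p, snd p) \<notin> N} = space (lborel \<Otimes>\<^sub>M lborel) - N" by auto
    also have "\<dots> \<in> sets (lborel \<Otimes>\<^sub>M lborel)" using null_setsD2[OF N(1)] unfolding lborel_prod by (intro sets.Diff sets.top)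
    finally show ?thesis .
  qed
  from lborel_pair.AE_commute[OF this] 1 have 2: "AE x in lborel. AE t in lborel. (t, x) \<notin> N" by simp
  have gm[measurable]: "g \<in> borel_measurable (lborel \<Otimes>\<^sub>M lborel)" using g by (simp add: lborel_prod)
  define k where "k x = (\<integral>\<^sup>+ t. g (t, x) \<partial>lborel)" for x
  have km: "k \<in> borel_measurable lborel" unfolding k_def[abs_def] by measurable
  show ?thesis
  proof (intro bexI[of _ k] conjI ballI)
    show "k \<in> borel_measurable borel" using km by simp
    show "AE x in lebesgue. (\<integral>\<^sup>+ t. K (t, x) \<partial>lebesgue) = k x"
    proof (rule AE_completion, rule AE_mp[OF 2], rule AE_I2, rule impI)
      fix x assume n: "AE t in lborel. (t, x) \<notin> N"
      show "(\<integral>\<^sup>+ t. K (t, x) \<partial>lebesgue) = k x"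
        unfolding k_def nn_integral_completion by (rule nn_integral_cong_AE, rule AE_mp[OF n], rule AE_I2) (simp add: eq)
    qed
    fix w :: "'a \<Rightarrow> ennreal" assume "w \<in> borel_measurable borel"
    then have w[measurable]: "w \<in> borel_measurable lborel" by simp
    have "(\<integral>\<^sup>+ t. \<integral>\<^sup>+ x. w x * K (t, x) \<partial>lebesgue \<partial>lebesgue) = (\<integral>\<^sup>+ t. \<integral>\<^sup>+ x. w x * g (t, x) \<partial>lborel \<partial>lborel)"
      unfolding nn_integral_completion
    proof (rule nn_integral_cong_AE, rule AE_mp[OF 1], rule AE_I2, rule impI)
      fix t assume n: "AE x in lborel. (t, x) \<notin> N"
      show "(\<integral>\<^sup>+ x. w x * K (t, x) \<partial>lborel) = (\<integral>\<^sup>+ x. w x * g (t, x) \<partial>lborel)"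
        by (rule nn_integral_cong_AE, rule AE_mp[OF n], rule AE_I2) (simp add: eq)
    qed
    also have "\<dots> = (\<integral>\<^sup>+ x. \<integral>\<^sup>+ t. w x * g (t, x) \<partial>lborel \<partial>lborel)"
      by (rule lborel_pair.Fubini'[symmetric]) measurable
    also have "\<dots> = (\<integral>\<^sup>+ x. w x * k x \<partial>lborel)"
      unfolding k_def by (intro nn_integral_cong nn_integral_cmult) measurable
    finally show "(\<integral>\<^sup>+ t. \<integral>\<^sup>+ x. w x * K (t, x) \<partial>lebesgue \<partial>lebesgue) = (\<integral>\<^sup>+ x. w x * k x \<partial>lebesgue)"
      by (simp add: nn_integral_completion)
  qed
qed

text \<open>The graph of \<open>s powr r\<close> lies above its tangent at \<open>a\<close>. In this
  form it is Young's inequality with exponents \<open>r\<close> and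
  \<open>r / (r - 1)\<close>.\<close>

lemma powr_tangent:
  fixes a s r :: real
  assumes "a > 0" "s \<ge> 0" "r \<ge> 1"
  shows "r * a powr (r - 1) * s \<le> s powr r + (r - 1) * a powr r"
proof (cases "r = 1")
  case False
  then have r: "r > 1" using assms by simp
  then have e: "(r - 1) * (r / (r - 1)) = r" by simp
  have "s * a powr (r - 1) \<le> s powr r / r + (a powr (r - 1)) powr (r / (r - 1)) / (r / (r - 1))"
    using r assms by (intro Youngs_inequality) (auto simp: field_simps)
  also have "\<dots> = (s powr r + (r - 1) * a powr r) / r"
    using r unfolding powr_powr e by (simp add: field_simps)
  finally show ?thesis using r by (simp add: field_simps)
qed (use assms in auto)

section \<open>Positivity, Jensen's inequality and the maximal inequality for the semigroup\<close>

context elliptic_coefficients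
begin

text \<open>The part of \<open>X\<close> outside \<open>\<Omega>\<close> is orthogonal to
  \<open>H0\<close>, which contains the range of \<open>T t\<close>; symmetry makes
  \<open>T t\<close> annihilate it. This extends statements on \<open>H0\<close> to the whole space,
  on which \<open>positivity_preserving\<close> is formulated.\<close>

lemma T_E_rp:
  assumes "t > 0" shows "T t X = T t (E (rp X))"
proof -
  define D where "D = X - E (rp X)"
  have D: "AE x in lebesgue. x \<in> \<Omega> \<longrightarrow> rp D x = 0"
    using AE_rp_diff[of X "E (rp X)"] AE_E[OF rp_Lspace[of X]] unfolding D_def
    by eventually_elim (simp add: ext_def)
  have "inner D Z = 0" if "Z \<in> H0" for Z
  proof -
    have "AE x in lebesgue. x \<notin> \<Omega> \<longrightarrow> rp Z x = 0" using that by (simp add: H0_eq supp_in_def)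
    with D have "AE x in lebesgue. rp D x * rp Z x = 0" by eventually_elim auto
    then have "(\<integral>x. rp D x * rp Z x \<partial>lebesgue) = 0" by (rule integral_eq_zero_AE)
    then show ?thesis by (simp add: inner_rp)
  qed
  from this[OF T_H0[OF assms, of "T t D"]] have "inner (T t D) (T t D) = 0" by (simp add: T_sym)
  then show ?thesis by (simp add: D_def T_diff)
qed

text \<open>The sub-Markov property with \<open>c = 0\<close>, applied to the negative of
  \<open>X\<close>.\<close>

lemma T_nonneg:
  assumes t: "t > 0" and X: "nonneg X" shows "nonneg (T t X)"
proof -
  interpret S: bounded_linear "T t" by (rule T_bounded_linear)
  let ?Y = "E (rp X)"
  have Y: "?Y \<in> H0" by (rule E_H0[OF rp_Lspace])
  have "AE x in lebesgue. rp (- ?Y) x \<le> 0"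
    using AE_rp_minus[of ?Y] AE_E[OF rp_Lspace[of X]] X unfolding nonneg_def by eventually_elim (simp add: ext_def)
  from T_submarkov[OF _ _ this] have "AE x in lebesgue. rp (T t (- ?Y)) x \<le> 0"
    using Y t by (simp add: subspace_neg H0_subspace)
  with AE_rp_minus[of "T t ?Y"] show ?thesis
    unfolding nonneg_def T_E_rp[OF t, of X] S.neg by eventually_elim simp
qed

text \<open>The inequality demanded of a positive contraction holds because \<open>T t\<close> is
  the square of the symmetric contraction \<open>T (t / 2)\<close>.\<close>

lemma T_positivity_preserving:
  assumes t: "t > 0" shows "positivity_preserving (T t)"
proof unfold_locales
  interpret S: bounded_linear "T t" by (rule T_bounded_linear)
  show "T t (x + y) = T t x + T t y" "T t (c *\<^sub>R x) = c *\<^sub>R T t x" "\<exists>K. \<forall>x. norm (T t x) \<le> norm x * K" for x y c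
    using S.bounded by (auto simp: S.add S.scaleR)
  show "inner (T t x) y = inner x (T t y)" for x y by (rule T_sym)
  show "(norm (T t x))\<^sup>2 \<le> inner (T t x) x" for x
  proof -
    have e: "T t x = T (t / 2) (T (t / 2) x)" using T_add[of "t / 2" "t / 2" x] t by simp
    have "inner (T t x) x = (norm (T (t / 2) x))\<^sup>2" unfolding e by (simp add: T_sym power2_norm_eq_inner)
    moreover have "norm (T t x) \<le> norm (T (t / 2) x)" unfolding e by (rule T_norm_le)
    ultimately show ?thesis by (simp add: power_mono)
  qed
  show "nonneg (T t X)" if "nonneg X" for X by (rule T_nonneg[OF t that])
qed

lemma T_funpow: "h \<ge> 0 \<Longrightarrow> (T h ^^ n) X = T (real n * h) X"
proof (induction n)
  case (Suc n)
  have "T (real (Suc n) * h) X = T (h + real n * h) X" by (simp add: algebra_simps)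
  then show ?case using Suc T_add[of h "real n * h" X] by simp
qed simp

text \<open>Tangents of \<open>s \<mapsto> |s|\<^sup>r\<close> at rational points suffice, so only countably many null sets occur.\<close>

lemma T_jensen:
  assumes F: "F \<in> H0" and X: "X \<in> H0" and r: "r \<ge> 1" and t: "t \<ge> 0"
    and FX: "AE x in lebesgue. rp X x = \<bar>rp F x\<bar> powr r"
  shows "AE x in lebesgue. \<bar>rp (T t F) x\<bar> powr r \<le> rp (T t X) x"
proof -
  interpret S: bounded_linear "T t" by (rule T_bounded_linear)
  have tang: "AE x in lebesgue. s * (r * b powr (r - 1)) * rp (T t F) x - (r - 1) * b powr r \<le> rp (T t X) x"
    if b: "b > 0" and s: "s = 1 \<or> s = - 1" for b s :: real
  proof -
    let ?c = "s * (r * b powr (r - 1))"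
    have "AE x in lebesgue. rp (?c *\<^sub>R F - X) x \<le> (r - 1) * b powr r"
      using AE_rp_diff[of "?c *\<^sub>R F" X] AE_rp_scale[of ?c F] FX
    proof eventually_elim
      case (elim x)
      have "s * rp F x \<le> \<bar>rp F x\<bar>" using s by auto
      then have "?c * rp F x \<le> r * b powr (r - 1) * \<bar>rp F x\<bar>"
        using r mult_left_mono[of "s * rp F x" "\<bar>rp F x\<bar>" "r * b powr (r - 1)"] by (simp add: mult_ac)
      then show ?case using powr_tangent[OF b abs_ge_zero r, of "rp F x"] elim by simp
    qed
    from T_submarkov[OF _ _ this t] have "AE x in lebesgue. rp (T t (?c *\<^sub>R F - X)) x \<le> (r - 1) * b powr r"
      using F X r by (simp add: subspace_diff subspace_scale H0_subspace)
    with AE_rp_diff[of "?c *\<^sub>R T t F" "T t X"] AE_rp_scale[of ?c "T t F"]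
    show ?thesis unfolding S.diff S.scaleR by eventually_elim simp
  qed
  have pos: "AE x in lebesgue. 0 \<le> rp (T t X) x"
  proof (cases "t = 0")
    case True
    from FX show ?thesis unfolding True T_0 by eventually_elim simp
  next
    case False
    have "nonneg X" unfolding nonneg_def using FX by eventually_elim simp
    with False t have "nonneg (T t X)" by (intro T_nonneg) auto
    then show ?thesis by (simp add: nonneg_def)
  qed
  define S where "S = \<rat> \<inter> {0::real<..}"
  have cS: "countable S" unfolding S_def by (intro countable_Int1 countable_rat)
  have "AE x in lebesgue. \<forall>b\<in>S. r * b powr (r - 1) * \<bar>rp (T t F) x\<bar> - (r - 1) * b powr r \<le> rp (T t X) x"
  proof (subst AE_ball_countable[OF cS], rule ballI)
    fix b assume "b \<in> S"
    then have b: "b > 0" by (simp add: S_def)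
    from tang[OF b, of 1] tang[OF b, of "-1"]
    have "AE x in lebesgue. (1 * (r * b powr (r - 1)) * rp (T t F) x - (r - 1) * b powr r \<le> rp (T t X) x)"
      "AE x in lebesgue. (- 1 * (r * b powr (r - 1)) * rp (T t F) x - (r - 1) * b powr r \<le> rp (T t X) x)" by blast+
    then show "AE x in lebesgue. r * b powr (r - 1) * \<bar>rp (T t F) x\<bar> - (r - 1) * b powr r \<le> rp (T t X) x"
      by eventually_elim (auto simp: abs_if)
  qed
  with pos show ?thesis
  proof eventually_elim
    case (elim x)
    \<comment> \<open>For \<open>u = 0\<close> only nonnegativity of \<open>rp (T t X) x\<close> is
      claimed, which is \<open>pos\<close>. For \<open>u > 0\<close> rational points of tangency
      tend to \<open>u\<close>, and the tangent at \<open>u\<close> has the value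
      \<open>u powr r\<close> there.\<close>
    define u where "u = \<bar>rp (T t F) x\<bar>"
    show ?case
    proof (cases "u = 0")
      case False
      then have u: "u > 0" by (simp add: u_def)
      have "u \<in> closure (\<rat> :: real set)" by (simp add: Rats_closure_real)
      then obtain b where b: "\<And>n. b n \<in> \<rat>" "b \<longlonglongrightarrow> u" unfolding closure_sequential by blast
      have "(\<lambda>n. r * b n powr (r - 1) * u - (r - 1) * b n powr r) \<longlonglongrightarrow> r * u powr (r - 1) * u - (r - 1) * u powr r"
        using u by (intro tendsto_intros b) auto
      moreover have "eventually (\<lambda>n. r * b n powr (r - 1) * u - (r - 1) * b n powr r \<le> rp (T t X) x) sequentially"
        using order_tendstoD(1)[OF b(2) u]
      proof eventually_elim
        case (elim n)
        then have "b n \<in> S" using b(1) by (simp add: S_def)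
        then show ?case using \<open>\<forall>b\<in>S. _\<close> by (simp add: u_def)
      qed
      ultimately have "r * u powr (r - 1) * u - (r - 1) * u powr r \<le> rp (T t X) x" by (rule tendsto_upperbound) simp
      moreover have "u powr (r - 1) * u = u powr r" using u by (simp add: powr_diff)
      ultimately show ?thesis by (simp add: u_def algebra_simps)
    qed (use elim u_def in simp)
  qed
qed

text \<open>Level \<open>m\<close> consists of the times up to \<open>2 ^ m\<close> with step
  \<open>2 ^ (- m)\<close>. The levels are nested and the discrete maximal theorem has the constant
  9 at every one of them, so monotone convergence applies; 81 is the square of 9.\<close>

lemma maximal_dyadic:
  assumes X: "nonneg X"
  shows "\<exists>V. V \<in> borel_measurable lebesgue \<and> (\<forall>m n x. n \<le> 4 ^ m \<longrightarrow> ennreal ((rp (T (real n / 2 ^ m) X) x)\<^sup>2) \<le> V x) \<and>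
    (\<integral>\<^sup>+ x. V x \<partial>lebesgue) \<le> ennreal (81 * (norm X)\<^sup>2)"
proof -
  define v where "v m x = (SUP n\<in>{..(4::nat) ^ m}. ennreal ((rp (T (real n / 2 ^ m) X) x)\<^sup>2))" for m :: nat and x
  have vm: "v m \<in> borel_measurable lebesgue" for m
    unfolding v_def[abs_def] using rp_measurable by (intro borel_measurable_SUP) auto
  have vle: "(\<integral>\<^sup>+ x. v m x \<partial>lebesgue) \<le> ennreal (81 * (norm X)\<^sup>2)" for m
  proof -

    obtain G where G: "sqint G" "AE x in lebesgue. \<forall>n\<le>4 ^ m. \<bar>rp ((T (1 / 2 ^ m) ^^ n) X) x\<bar> \<le> G x" "norm (cls G) \<le> 9 * norm X"
      using positivity_preserving.maximal_L2[OF T_positivity_preserving X, of "1 / 2 ^ m" "4 ^ m"] by auto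
    have e: "(T (1 / 2 ^ m) ^^ n) X = T (real n / 2 ^ m) X" for n using T_funpow[of "1 / 2 ^ m" n X] by simp
    have "(\<integral>\<^sup>+ x. v m x \<partial>lebesgue) \<le> (\<integral>\<^sup>+ x. ennreal ((G x)\<^sup>2) \<partial>lebesgue)"
    proof (rule nn_integral_mono_AE)
      show "AE x in lebesgue. v m x \<le> ennreal ((G x)\<^sup>2)"
        using G(2) unfolding e
      proof eventually_elim
        case (elim x)
        show ?case unfolding v_def
        proof (rule SUP_least)
          fix n :: nat assume "n \<in> {..4 ^ m}"
          then have "\<bar>rp (T (real n / 2 ^ m) X) x\<bar> \<le> G x" using elim by simp
          then have "\<bar>rp (T (real n / 2 ^ m) X) x\<bar>\<^sup>2 \<le> (G x)\<^sup>2" by (intro power_mono) auto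
          then show "ennreal ((rp (T (real n / 2 ^ m) X) x)\<^sup>2) \<le> ennreal ((G x)\<^sup>2)" by (intro ennreal_leI) simp
        qed
      qed
    qed
    also have "\<dots> = ennreal ((norm (cls G))\<^sup>2)" by (rule nn_norm_cls[OF G(1), symmetric])
    also have "\<dots> \<le> ennreal (81 * (norm X)\<^sup>2)"
      using power_mono[OF G(3), of 2] by (intro ennreal_leI) (simp add: power_mult_distrib)
    finally show ?thesis .
  qed
  have inc: "incseq v"
  proof (rule incseq_SucI, rule le_funI)
    fix m x
    show "v m x \<le> v (Suc m) x" unfolding v_def
    proof (rule SUP_least)
      fix n :: nat assume "n \<in> {..4 ^ m}"
      then have "2 * n \<in> {..(4::nat) ^ Suc m}" by simp
      then have "ennreal ((rp (T (real (2 * n) / 2 ^ Suc m) X) x)\<^sup>2) \<le> (SUP n\<in>{..(4::nat) ^ Suc m}. ennreal ((rp (T (real n / 2 ^ Suc m) X) x)\<^sup>2))"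
        by (rule SUP_upper)
      then show "ennreal ((rp (T (real n / 2 ^ m) X) x)\<^sup>2) \<le> (SUP n\<in>{..(4::nat) ^ Suc m}. ennreal ((rp (T (real n / 2 ^ Suc m) X) x)\<^sup>2))"
        by simp
    qed
  qed
  define V where "V x = (SUP m. v m x)" for x
  have "(\<integral>\<^sup>+ x. V x \<partial>lebesgue) = (SUP m. \<integral>\<^sup>+ x. v m x \<partial>lebesgue)"
    unfolding V_def by (rule nn_integral_monotone_convergence_SUP[OF inc vm])
  also have "\<dots> \<le> ennreal (81 * (norm X)\<^sup>2)" by (rule SUP_least) (rule vle)
  finally have "(\<integral>\<^sup>+ x. V x \<partial>lebesgue) \<le> ennreal (81 * (norm X)\<^sup>2)" .
  moreover have "V \<in> borel_measurable lebesgue" unfolding V_def[abs_def] using vm by (intro borel_measurable_SUP) auto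
  moreover have "ennreal ((rp (T (real n / 2 ^ m) X) x)\<^sup>2) \<le> V x" if "n \<le> 4 ^ m" for m n x
  proof -
    have "ennreal ((rp (T (real n / 2 ^ m) X) x)\<^sup>2) \<le> v m x" unfolding v_def using that by (intro SUP_upper) simp
    also have "\<dots> \<le> V x" unfolding V_def by (rule SUP_upper) simp
    finally show ?thesis .
  qed
  ultimately show ?thesis by blast
qed

text \<open>\<open>g\<close> is the \<open>q\<close>-th root of \<open>V\<close>, the bound
  belonging to \<open>X = \<bar>F\<bar> powr (q / 2)\<close>. The exceptional null set may depend on
  \<open>t\<close>, which avoids an uncountable supremum and is enough for integration in
  \<open>t\<close>. \<open>g\<close> is taken Borel so that it can enter the weight in
  \<open>lebesgue_Tonelli\<close>.\<close>

lemma maximal_function: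
  assumes F: "F \<in> H0" and q: "q \<ge> 2" and fin: "(\<integral>\<^sup>+ x. ennreal (\<bar>rp F x\<bar> powr q) \<partial>lebesgue) < top"
  shows "\<exists>g\<in>borel_measurable borel. (\<forall>x. 0 \<le> g x) \<and> (\<forall>t\<ge>0. AE x in lebesgue. \<bar>rp (T t F) x\<bar> \<le> g x) \<and>
    (\<integral>\<^sup>+ x. ennreal (g x powr q) \<partial>lebesgue) \<le> 81 * (\<integral>\<^sup>+ x. ennreal (\<bar>rp F x\<bar> powr q) \<partial>lebesgue)"
proof -
  define r where "r = q / 2"
  have r: "r \<ge> 1" using q by (simp add: r_def)
  have sq: "(\<bar>s\<bar> powr r)\<^sup>2 = \<bar>s\<bar> powr q" for s :: real by (simp add: r_def power2_eq_square flip: powr_add)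
  define y where "y x = \<bar>rp F x\<bar> powr r" for x
  have ym: "y \<in> borel_measurable lebesgue" unfolding y_def[abs_def] using rp_measurable[of F] by measurable
  have ys: "sqint y" unfolding sqint_nn_integral y_def sq using ym[unfolded y_def[abs_def]] fin by simp
  define X where "X = cls y"
  have FX: "AE x in lebesgue. rp X x = \<bar>rp F x\<bar> powr r" using AE_rp_cls[OF ys] by (simp add: X_def y_def)
  have nX: "ennreal ((norm X)\<^sup>2) = (\<integral>\<^sup>+ x. ennreal (\<bar>rp F x\<bar> powr q) \<partial>lebesgue)"
    unfolding X_def nn_norm_cls[OF ys] by (simp add: y_def sq)
  have "AE x in lebesgue. x \<notin> \<Omega> \<longrightarrow> rp F x = 0" using F by (simp add: H0_eq supp_in_def)
  with FX have X: "X \<in> H0" unfolding H0_eq supp_in_def mem_Collect_eq by eventually_elim simp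
  have "nonneg X" unfolding nonneg_def using FX by eventually_elim simp
  from maximal_dyadic[OF this] obtain V where V: "V \<in> borel_measurable lebesgue"
    "\<And>m n x. n \<le> 4 ^ m \<Longrightarrow> ennreal ((rp (T (real n / 2 ^ m) X) x)\<^sup>2) \<le> V x"
    "(\<integral>\<^sup>+ x. V x \<partial>lebesgue) \<le> ennreal (81 * (norm X)\<^sup>2)" by blast
  have "(\<integral>\<^sup>+ x. V x \<partial>lebesgue) \<noteq> \<infinity>" using V(3) by (auto simp: top_unique)
  from nn_integral_PInf_AE[OF V(1) this] have Vfin: "AE x in lebesgue. V x \<noteq> \<infinity>" .
  define g0 where "g0 x = enn2real (V x) powr (1 / q)" for x
  have g0m: "g0 \<in> borel_measurable lebesgue" unfolding g0_def[abs_def] using V(1) by measurable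
  from completion_ex_borel_measurable_real[OF g0m] obtain g1 where g1: "g1 \<in> borel_measurable borel" "AE x in lborel. g0 x = g1 x"
    by auto
  define g where "g x = \<bar>g1 x\<bar>" for x
  have g0g: "AE x in lebesgue. g0 x = g x"
    using AE_completion[OF g1(2)]
  proof eventually_elim
    case (elim x)
    have "0 \<le> g0 x" by (simp add: g0_def)
    then show ?case using elim by (simp add: g_def)
  qed
  have dy: "AE x in lebesgue. \<bar>rp (T (real n / 2 ^ m) F) x\<bar> \<le> g x" if n: "n \<le> 4 ^ m" for n m :: nat
  proof -
    have "AE x in lebesgue. \<bar>rp (T (real n / 2 ^ m) F) x\<bar> powr r \<le> rp (T (real n / 2 ^ m) X) x"
      by (rule T_jensen[OF F X r _ FX]) simp
    with Vfin g0g show ?thesis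
    proof eventually_elim
      case (elim x)
      define u where "u = \<bar>rp (T (real n / 2 ^ m) F) x\<bar>"
      have "u powr q = (u powr r)\<^sup>2" using sq[of u] by (simp add: u_def)
      also have "\<dots> \<le> (rp (T (real n / 2 ^ m) X) x)\<^sup>2" using elim(3) by (intro power_mono) (auto simp: u_def)
      also have "\<dots> \<le> enn2real (V x)"
        using V(2)[OF n, of x] elim(1) by (cases "V x") (auto simp: ennreal_le_iff2 top_unique)
      finally have "(u powr q) powr (1 / q) \<le> g0 x" unfolding g0_def using q by (intro powr_mono2) auto
      then show ?case using q elim(2) by (simp add: powr_powr u_def)
    qed
  qed
  have "AE x in lebesgue. \<bar>rp (T t F) x\<bar> \<le> g x" if t: "t \<ge> 0" for t
  proof -
    obtain j where j: "t < 2 ^ j" using real_arch_pow[of 2 t] by auto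
    \<comment> \<open>Rounding down at level \<open>m + j\<close>: since \<open>t < 2 ^ j\<close>,
      the index \<open>n m\<close> stays within the allowed range up to
      \<open>4 ^ (m + j)\<close>.\<close>
    define n where "n m = nat \<lfloor>t * 2 ^ (m + j)\<rfloor>" for m
    define d where "d m = real (n m) / 2 ^ (m + j)" for m
    have nr: "real (n m) = real_of_int \<lfloor>t * 2 ^ (m + j)\<rfloor>" for m using t by (simp add: n_def)
    have nle: "n m \<le> 4 ^ (m + j)" for m
    proof -
      have "real (n m) \<le> t * 2 ^ (m + j)" unfolding nr by simp
      also have "\<dots> \<le> 2 ^ (m + j) * 2 ^ (m + j)"
      proof (rule mult_right_mono)
        have "(2::real) ^ j \<le> 2 ^ (m + j)" by (rule power_increasing) auto
        then show "t \<le> 2 ^ (m + j)" using j by linarith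
      qed simp
      also have "\<dots> = real (4 ^ (m + j))" by (simp flip: power_mult_distrib)
      finally show ?thesis by (simp only: of_nat_le_iff)
    qed
    have dt: "\<bar>d m - t\<bar> \<le> (1 / 2) ^ m" "d m \<le> t" "0 \<le> d m" for m
    proof -
      have p: "(2::real) ^ (m + j) > 0" "(2::real) ^ m \<le> 2 ^ (m + j)" by (auto intro: power_increasing)
      have b: "real (n m) \<le> t * 2 ^ (m + j)" "t * 2 ^ (m + j) - 1 \<le> real (n m)" unfolding nr by linarith+
      show 1: "d m \<le> t" using b(1) p(1) by (simp add: d_def pos_divide_le_eq)
      show "0 \<le> d m" by (simp add: d_def)
      have "t - 1 / 2 ^ (m + j) \<le> d m" using b(2) p(1) by (simp add: d_def pos_le_divide_eq left_diff_distrib)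
      moreover have "1 / 2 ^ (m + j) \<le> (1 / 2 ^ m :: real)" using p(2) by (intro divide_left_mono) auto
      ultimately show "\<bar>d m - t\<bar> \<le> (1 / 2) ^ m" using 1 by (simp add: power_divide)
    qed
    have "(\<lambda>m. d m - t) \<longlonglongrightarrow> 0"
      by (rule LIMSEQ_norm_bound[of _ "\<lambda>m. (1 / 2) ^ m"]) (use dt(1) in \<open>auto intro: LIMSEQ_realpow_zero\<close>)
    then have "d \<longlonglongrightarrow> t" by (simp add: LIM_zero_iff)
    from continuous_on_tendsto_compose[OF strongly_continuous_semigroup_on.S_continuous[OF T_semigroup_on F, of t] this]
    have "(\<lambda>m. T (d m) F) \<longlonglongrightarrow> T t F" using t dt by simp
    from l2_tendsto_AE_subseq[OF this] obtain s where "AE x in lebesgue. (\<lambda>m. rp (T (d (s m)) F) x) \<longlonglongrightarrow> rp (T t F) x" by blast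
    moreover have "AE x in lebesgue. \<forall>m. \<bar>rp (T (d m) F) x\<bar> \<le> g x"
      unfolding AE_all_countable d_def using dy[OF nle] by blast
    ultimately show ?thesis
    proof eventually_elim
      case (elim x)
      show ?case by (rule tendsto_upperbound[OF tendsto_rabs[OF elim(1)]]) (use elim(2) in auto)
    qed
  qed
  moreover have "(\<integral>\<^sup>+ x. ennreal (g x powr q) \<partial>lebesgue) \<le> 81 * (\<integral>\<^sup>+ x. ennreal (\<bar>rp F x\<bar> powr q) \<partial>lebesgue)"
  proof -
    have "(\<integral>\<^sup>+ x. ennreal (g x powr q) \<partial>lebesgue) \<le> (\<integral>\<^sup>+ x. V x \<partial>lebesgue)"
    proof (rule nn_integral_mono_AE)
      show "AE x in lebesgue. ennreal (g x powr q) \<le> V x"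
        using g0g Vfin
      proof eventually_elim
        case (elim x)
        have "g x powr q = enn2real (V x)" using q unfolding elim(1)[symmetric] g0_def by (simp add: powr_powr)
        then show ?case using elim(2) by (simp add: top.not_eq_extremum)
      qed
    qed
    also have "\<dots> \<le> 81 * ennreal ((norm X)\<^sup>2)" using V(3) by (simp add: ennreal_mult)
    finally show ?thesis by (simp add: nX)
  qed
  moreover have "g \<in> borel_measurable borel" unfolding g_def[abs_def] using g1(1) by measurable
  ultimately show ?thesis by (intro bexI[of _ g]) (auto simp: g_def)
qed

end

section \<open>Entropy estimate of the square function\<close>

text \<open>The value \<open>1\<close> for \<open>q = 2\<close> is explicit because \<open>0 powr 0 = 0\<close>.\<close>

definition pw :: "real \<Rightarrow> real \<Rightarrow> real" where
  "pw q s = (if q = 2 then 1 else \<bar>s\<bar> powr (q - 2))"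

lemma pw_nonneg: "0 \<le> pw q s" by (simp add: pw_def)

lemma pw_mono: "q \<ge> 2 \<Longrightarrow> \<bar>s\<bar> \<le> \<bar>s'\<bar> \<Longrightarrow> pw q s \<le> pw q s'"
  by (auto simp: pw_def intro: powr_mono2)

lemma pw_continuous:
  assumes "q \<ge> 2" shows "continuous_on UNIV (pw q)"
proof (cases "q = 2")
  case False
  have "continuous_on UNIV (\<lambda>s::real. \<bar>s\<bar> powr (q - 2))"
    by (intro continuous_on_powr' continuous_on_rabs continuous_on_id continuous_on_const) (use assms False in auto)
  then show ?thesis using False by (simp add: pw_def[abs_def])
qed (simp add: pw_def[abs_def])

lemma sq_pw: "q \<ge> 2 \<Longrightarrow> s\<^sup>2 * pw q s = \<bar>s\<bar> powr q"
  by (cases "s = 0") (auto simp: pw_def powr_diff)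

lemma pw_half: "q \<ge> 2 \<Longrightarrow> pw q (s / 2) = pw q s / 2 powr (q - 2)"
  by (simp add: pw_def powr_divide)

text \<open>Distinguish \<open>s \<le> \<delta> b\<close> from \<open>b < s / \<delta>\<close>.\<close>

lemma pw_Young:
  assumes q: "q \<ge> 2" and \<delta>: "\<delta> > 0" and b: "b \<ge> 0" and s: "s \<ge> 0"
  shows "pw q b * s\<^sup>2 \<le> \<delta>\<^sup>2 * b powr q + \<delta> powr (2 - q) * s powr q"
proof (cases "s \<le> \<delta> * b")
  case True
  then have "s\<^sup>2 \<le> (\<delta> * b)\<^sup>2" using s by (intro power_mono) auto
  then have "pw q b * s\<^sup>2 \<le> pw q b * (\<delta> * b)\<^sup>2" by (intro mult_left_mono pw_nonneg)
  also have "\<dots> = \<delta>\<^sup>2 * b powr q" using sq_pw[OF q, of b] b by (simp add: power_mult_distrib mult_ac)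
  also have "\<dots> \<le> \<delta>\<^sup>2 * b powr q + \<delta> powr (2 - q) * s powr q" by simp
  finally show ?thesis .
next
  case False
  then have "b \<le> s / \<delta>" using \<delta> by (simp add: field_simps)
  then have "pw q b * s\<^sup>2 \<le> pw q (s / \<delta>) * s\<^sup>2" using b s \<delta> by (intro mult_right_mono pw_mono q) auto
  also have "pw q (s / \<delta>) = \<delta> powr (2 - q) * pw q s"
    using \<delta> s by (auto simp: pw_def powr_divide powr_diff field_simps)
  also have "\<dots> * s\<^sup>2 = \<delta> powr (2 - q) * s powr q" using sq_pw[OF q, of s] s by (simp add: mult_ac)
  also have "\<dots> \<le> \<delta>\<^sup>2 * b powr q + \<delta> powr (2 - q) * s powr q" by simp
  finally show ?thesis .
qed

section \<open>Pointwise bounds of an entropy density by its second derivative\<close>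

context C2_entropy
begin

lemma \<Phi>_upper:
  assumes m: "\<And>y. \<bar>y\<bar> \<le> \<bar>s\<bar> \<Longrightarrow> h' y \<le> m" shows "\<Phi> s \<le> m * s\<^sup>2"
proof -
  have m0: "m \<ge> 0" using m[of 0] h'_nonneg[of 0] by simp
  have hb: "\<bar>h y\<bar> \<le> m * \<bar>s\<bar>" if y: "\<bar>y\<bar> \<le> \<bar>s\<bar>" for y
  proof -
    have "norm (h y - h 0) \<le> m * norm (y - 0)"
    proof (rule field_differentiable_bound[where S="{-\<bar>s\<bar>..\<bar>s\<bar>}" and f'=h'])
      show "(h has_real_derivative h' z) (at z within {-\<bar>s\<bar>..\<bar>s\<bar>})" for z by (rule has_field_derivative_at_within[OF h_deriv])
      show "norm (h' z) \<le> m" if "z \<in> {-\<bar>s\<bar>..\<bar>s\<bar>}" for z using m[of z] h'_nonneg[of z] that by (simp add: abs_le_iff)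
    qed (use y in auto)
    also have "\<dots> \<le> m * \<bar>s\<bar>" using y m0 by (simp add: mult_left_mono)
    finally show ?thesis by (simp add: h_0)
  qed
  have "norm (\<Phi> s - \<Phi> 0) \<le> (m * \<bar>s\<bar>) * norm (s - 0)"
  proof (rule field_differentiable_bound[where S="{-\<bar>s\<bar>..\<bar>s\<bar>}" and f'=h])
    show "(\<Phi> has_real_derivative h z) (at z within {-\<bar>s\<bar>..\<bar>s\<bar>})" for z by (rule has_field_derivative_at_within[OF \<Phi>_deriv])
    show "norm (h z) \<le> m * \<bar>s\<bar>" if "z \<in> {-\<bar>s\<bar>..\<bar>s\<bar>}" for z using hb[of z] that by (simp add: abs_le_iff)
  qed auto
  then show ?thesis by (simp add: \<Phi>_0 power2_eq_square abs_le_iff mult.assoc)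
qed

lemma h_nonneg: "0 \<le> y \<Longrightarrow> 0 \<le> h y"
  using DERIV_nonneg_imp_nondecreasing[of 0 y h] h_deriv h'_nonneg by (metis h_0)

text \<open>Only the outer half of [0, s] is used, because the weight \<open>pw q\<close> vanishes
  at 0 when \<open>q > 2\<close>. Integrating \<open>m\<close> twice over a length
  \<open>s / 2\<close> gives (s / 2)^2 / 2, hence the 8.\<close>

lemma \<Phi>_lower_pos:
  assumes s: "s \<ge> 0" and m: "\<And>y. s / 2 \<le> y \<Longrightarrow> m \<le> h' y"
  shows "m * s\<^sup>2 / 8 \<le> \<Phi> s"
proof -
  have hm: "m * (y - s / 2) \<le> h y" if y: "s / 2 \<le> y" for y
  proof -
    have "h (s / 2) - m * (s / 2) \<le> h y - m * y"
    proof (rule DERIV_nonneg_imp_nondecreasing[OF y])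
      show "\<exists>d. ((\<lambda>y. h y - m * y) has_real_derivative d) (at x) \<and> 0 \<le> d" if "s / 2 \<le> x" for x
        using m[OF that] by (intro exI[of _ "h' x - m"]) (auto intro!: derivative_eq_intros h_deriv)
    qed
    moreover have "0 \<le> h (s / 2)" using s by (intro h_nonneg) simp
    ultimately show ?thesis by (simp add: algebra_simps)
  qed
  have "\<Phi> 0 \<le> \<Phi> (s / 2)"
    by (rule DERIV_nonneg_imp_nondecreasing) (use s \<Phi>_deriv h_nonneg in auto)
  moreover have "\<Phi> (s / 2) - m * (s / 2 - s / 2)\<^sup>2 / 2 \<le> \<Phi> s - m * (s - s / 2)\<^sup>2 / 2"
  proof (rule DERIV_nonneg_imp_nondecreasing[of "s / 2" s "\<lambda>y. \<Phi> y - m * (y - s / 2)\<^sup>2 / 2"])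
    show "\<exists>d. ((\<lambda>y. \<Phi> y - m * (y - s / 2)\<^sup>2 / 2) has_real_derivative d) (at x) \<and> 0 \<le> d" if "s / 2 \<le> x" for x
      using hm[OF that] by (intro exI[of _ "h x - m * (x - s / 2)"]) (auto intro!: derivative_eq_intros \<Phi>_deriv)
  qed (use s in simp)
  ultimately show ?thesis by (simp add: \<Phi>_0 power2_eq_square)
qed

lemma reflect: "C2_entropy (\<lambda>y. - h (- y)) (\<lambda>y. h' (- y)) M (\<lambda>y. \<Phi> (- y))"
proof unfold_locales
  show "((\<lambda>y. - h (- y)) has_real_derivative h' (- y)) (at y)" for y
    by (rule derivative_eq_intros DERIV_chain2[OF h_deriv] refl)+ simp
  show "((\<lambda>y. \<Phi> (- y)) has_real_derivative - h (- y)) (at y)" for y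
    using \<Phi>_deriv[of "- y"] by (simp only: DERIV_mirror)
  show "continuous_on UNIV (\<lambda>y. h' (- y))"
    by (rule continuous_on_compose2[OF h'_cont]) (auto intro: continuous_intros)
qed (auto simp: h'_nonneg h_0 \<Phi>_0 abs_le_D1[OF h'_bound])

lemma \<Phi>_lower:
  assumes m: "\<And>y. \<bar>s\<bar> / 2 \<le> \<bar>y\<bar> \<Longrightarrow> m \<le> h' y"
  shows "m * s\<^sup>2 / 8 \<le> \<Phi> s"
proof (cases "s \<ge> 0")
  case True
  then show ?thesis by (intro \<Phi>_lower_pos m) auto
next
  case False
  then show ?thesis using C2_entropy.\<Phi>_lower_pos[OF reflect, of "- s" m] m by simp
qed

lemma \<Phi>_nonneg: "0 \<le> \<Phi> s" using \<Phi>_lower[of s 0] h'_nonneg by simp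

lemma entropy_nonneg: "0 \<le> entropy X" unfolding entropy_def using \<Phi>_nonneg by simp

lemma nn_entropy: "ennreal (entropy X) = (\<integral>\<^sup>+ x. ennreal (\<Phi> (rp X x)) \<partial>lebesgue)"
  unfolding entropy_def by (rule nn_integral_eq_integral[symmetric]) (auto intro: \<Phi>_integrable sqint_rp \<Phi>_nonneg)

end

context elliptic_coefficients
begin

definition kernel :: "real set \<Rightarrow> (real ^ 'n \<Rightarrow> real) \<Rightarrow> real \<times> (real ^ 'n) \<Rightarrow> ennreal" where
  "kernel I f p = indicator (I \<times> \<Omega>) p * ennreal ((norm (heat_gradient \<Omega> A f p))\<^sup>2)"

lemma kernel_measurable:
  assumes I: "open I" "I \<subseteq> {0<..}" and f: "f \<in> Lspace \<Omega> 2"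
  shows "kernel I f \<in> borel_measurable lebesgue"
proof -
  let ?D = "{0::real<..} \<times> \<Omega>"
  have op: "U \<times> \<Omega> \<in> sets lebesgue" if "open U" for U :: "real set"
    by (rule sets_completionI_sets) (use borel_open[OF open_Times[OF that open_\<Omega>]] in simp)
  have D: "?D \<in> sets lebesgue" by (rule op) simp
  have "(\<lambda>p. (norm (heat_gradient \<Omega> A f p))\<^sup>2) \<in> borel_measurable (lebesgue_on ?D)"
    using heat_gradient_spec(1)[OF f] by measurable
  then have m: "ext ?D (\<lambda>p. (norm (heat_gradient \<Omega> A f p))\<^sup>2) \<in> borel_measurable lebesgue"
    by (simp only: measurable_ext[OF D])
  have "I \<times> \<Omega> \<in> sets lebesgue" by (rule op[OF I(1)])
  then have "(\<lambda>p. indicator (I \<times> \<Omega>) p * ennreal (ext ?D (\<lambda>p. (norm (heat_gradient \<Omega> A f p))\<^sup>2) p)) \<in> borel_measurable lebesgue"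
    using m by measurable
  moreover have "(\<lambda>p. indicator (I \<times> \<Omega>) p * ennreal (ext ?D (\<lambda>p. (norm (heat_gradient \<Omega> A f p))\<^sup>2) p)) = kernel I f"
  proof
    fix p show "indicator (I \<times> \<Omega>) p * ennreal (ext ?D (\<lambda>p. (norm (heat_gradient \<Omega> A f p))\<^sup>2) p) = kernel I f p"
      using I(2) by (auto simp: kernel_def ext_def indicator_def)
  qed
  ultimately show ?thesis by simp
qed

lemma kernel_grad:
  assumes f: "f \<in> Lspace \<Omega> 2" and t: "t > 0" "t \<in> I"
  shows "AE x in lebesgue. ennreal ((norm (\<chi> i. rp (grad t (E f) $ i) x))\<^sup>2) = kernel I f (t, x)"
proof -
  let ?H = "\<lambda>x. heat_gradient \<Omega> A f (t, x)"
  have L: "(\<lambda>x. ?H x $ i) \<in> Lspace \<Omega> 2" for i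
    using heat_gradient_spec(2)[OF f t(1)] by (simp add: has_weak_gradient_def)
  have e: "grad t (E f) $ i = E (\<lambda>x. ?H x $ i)" for i
    unfolding GE_heat_gradient[OF f t(1), symmetric] by (simp add: GE_def)
  have "AE x in lebesgue. \<forall>i. rp (grad t (E f) $ i) x = ext \<Omega> (\<lambda>x. ?H x $ i) x"
    unfolding AE_all_countable e using AE_E[OF L] by blast
  then show ?thesis
  proof eventually_elim
    case (elim x)
    have "(\<chi> i. rp (grad t (E f) $ i) x) = (if x \<in> \<Omega> then ?H x else 0)"
      using elim by (auto simp: vec_eq_iff ext_def)
    then show ?case using t(2) by (simp add: kernel_def indicator_def)
  qed
qed

lemma square_function_kernel:
  assumes I: "open I" and q: "q \<ge> 2" and k: "AE x in lebesgue. (\<integral>\<^sup>+ t. kernel I f (t, x) \<partial>lebesgue) = k x"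
  shows "(\<integral>\<^sup>+ x. epowr (square_function \<Omega> A I f x) q \<partial>lebesgue_on \<Omega>) = (\<integral>\<^sup>+ x. epowr (k x) (q / 2) \<partial>lebesgue)"
  unfolding nn_integral_lebesgue_on[OF \<Omega>_sets]
proof (rule nn_integral_cong_AE)
  have Is: "I \<in> sets lebesgue" using I by simp
  show "AE x in lebesgue. indicator \<Omega> x * epowr (square_function \<Omega> A I f x) q = epowr (k x) (q / 2)"
    using k
  proof eventually_elim
    case (elim x)
    have "epowr (epowr z (1 / 2)) q = epowr z (q / 2)" for z
      by (auto simp: epowr_def powr_powr)
    moreover have "square_function \<Omega> A I f x = epowr (k x) (1 / 2)" if "x \<in> \<Omega>"
      unfolding square_function_def nn_integral_lebesgue_on[OF Is] elim[symmetric] using that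
      by (intro arg_cong2[where f=epowr] nn_integral_cong refl) (simp add: kernel_def indicator_def)
    moreover have "k x = 0" if "x \<notin> \<Omega>"
      unfolding elim[symmetric] using that by (simp add: kernel_def)
    ultimately show ?case using q by (cases "x \<in> \<Omega>") (auto simp: epowr_def)
  qed
qed

text \<open>In the dissipation identity the weight \<open>h' (u(t))\<close> is at most
  \<open>pw q (g x)\<close>, which is free of \<open>t\<close>. After Tonelli the integral over
  \<open>t\<close> acts on the gradient alone and produces \<open>k\<close>, the square of the
  square function.\<close>

lemma entropy_square_function:
  assumes C2: "C2_entropy h h' K \<Phi>" and hq: "\<And>y. h' y \<le> pw q y" and q: "q \<ge> 2" and f: "f \<in> Lspace \<Omega> 2"
    and g: "g \<in> borel_measurable borel" "\<And>x. 0 \<le> g x" "\<And>t. t \<ge> 0 \<Longrightarrow> AE x in lebesgue. \<bar>rp (T t (E f)) x\<bar> \<le> g x"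
    and I: "{0<..<\<tau>} \<subseteq> I" and \<tau>: "\<tau> \<ge> 0"
    and k: "\<And>w. w \<in> borel_measurable borel \<Longrightarrow>
      (\<integral>\<^sup>+ t. \<integral>\<^sup>+ x. w x * kernel I f (t, x) \<partial>lebesgue \<partial>lebesgue) = (\<integral>\<^sup>+ x. w x * k x \<partial>lebesgue)"
  shows "ennreal (C2_entropy.entropy \<Phi> (E f) - C2_entropy.entropy \<Phi> (T \<tau> (E f)))
    \<le> (\<integral>\<^sup>+ x. ennreal (M * (real CARD('n))\<^sup>2 * pw q (g x)) * k x \<partial>lebesgue)"
proof -
  interpret C2: C2_entropy h h' K \<Phi> by fact
  define C where "C = M * (real CARD('n))\<^sup>2"
  have C0: "C \<ge> 0" using M_nonneg by (simp add: C_def)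
  define w where "w x = ennreal (C * pw q (g x))" for x
  have wm: "w \<in> borel_measurable borel"
    unfolding w_def[abs_def] using g(1) borel_measurable_continuous_onI[OF pw_continuous[OF q]] by measurable
  have "ennreal (C2.entropy (E f) - C2.entropy (T \<tau> (E f)))
    = (\<integral>\<^sup>+ t. indicator {0<..<\<tau>} t * ennreal (\<integral>x. h' (rp (T t (E f)) x) * quad (grad t (E f)) x \<partial>lebesgue) \<partial>lborel)"
    by (rule entropy_identity(2)[OF C2 E_H0[OF f] \<tau>, symmetric])
  also have "\<dots> \<le> (\<integral>\<^sup>+ t. \<integral>\<^sup>+ x. w x * kernel I f (t, x) \<partial>lebesgue \<partial>lborel)"
  proof (rule nn_integral_mono)
    fix t :: real
    show "indicator {0<..<\<tau>} t * ennreal (\<integral>x. h' (rp (T t (E f)) x) * quad (grad t (E f)) x \<partial>lebesgue)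
      \<le> (\<integral>\<^sup>+ x. w x * kernel I f (t, x) \<partial>lebesgue)"
    proof (cases "t \<in> {0<..<\<tau>}")
      case True
      then have t: "t > 0" "t \<in> I" using I by auto
      have "ennreal (\<integral>x. h' (rp (T t (E f)) x) * quad (grad t (E f)) x \<partial>lebesgue)
        = (\<integral>\<^sup>+ x. ennreal (h' (rp (T t (E f)) x) * quad (grad t (E f)) x) \<partial>lebesgue)"
        by (rule nn_integral_eq_integral[symmetric])
          (auto intro: entropy_dissipation(2)[OF C2 t(1)] mult_nonneg_nonneg C2.h'_nonneg quad_bounds(1))
      also have "\<dots> \<le> (\<integral>\<^sup>+ x. w x * kernel I f (t, x) \<partial>lebesgue)"
      proof (rule nn_integral_mono_AE)
        show "AE x in lebesgue. ennreal (h' (rp (T t (E f)) x) * quad (grad t (E f)) x) \<le> w x * kernel I f (t, x)"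
          using kernel_grad[OF f t] g(3)[OF less_imp_le[OF t(1)]]
        proof eventually_elim
          case (elim x)
          define G where "G = (norm (\<chi> i. rp (grad t (E f) $ i) x))\<^sup>2"
          have "h' (rp (T t (E f)) x) \<le> pw q (g x)"
            by (rule order_trans[OF hq pw_mono[OF q]]) (use elim(2) in simp)
          then have "h' (rp (T t (E f)) x) * quad (grad t (E f)) x \<le> pw q (g x) * (C * G)"
            using quad_bounds[of "grad t (E f)" x] by (intro mult_mono pw_nonneg) (auto simp: C_def G_def)
          then have "ennreal (h' (rp (T t (E f)) x) * quad (grad t (E f)) x) \<le> ennreal ((C * pw q (g x)) * G)"
            by (intro ennreal_leI) (simp add: mult_ac)
          also have "\<dots> = w x * ennreal G"
            unfolding w_def by (rule ennreal_mult) (use C0 in \<open>auto simp: G_def pw_nonneg\<close>)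
          also have "\<dots> = w x * kernel I f (t, x)" using elim(1) by (simp add: G_def)
          finally show ?case .
        qed
      qed
      finally show ?thesis using True by simp
    qed simp
  qed
  also have "\<dots> = (\<integral>\<^sup>+ x. w x * k x \<partial>lebesgue)" using k[OF wm] by (simp add: nn_integral_completion)
  finally show ?thesis by (simp add: w_def C_def)
qed

end

section \<open>Removal of the truncation, absorption and the two time intervals\<close>

lemma epowr_mono: "p > 0 \<Longrightarrow> x \<le> y \<Longrightarrow> epowr x p \<le> epowr y p"
  by (cases x; cases y) (auto simp: epowr_simps top_unique ennreal_le_iff2 intro!: powr_mono2 ennreal_leI)

lemma epowr_cmult: "c > 0 \<Longrightarrow> p > 0 \<Longrightarrow> epowr (ennreal c * x) p = ennreal (c powr p) * epowr x p"
  by (cases x) (auto simp: epowr_simps powr_mult ennreal_mult_top simp flip: ennreal_mult)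

lemma epowr_measurable:
  assumes k[measurable]: "k \<in> borel_measurable N" shows "(\<lambda>x. epowr (k x) p) \<in> borel_measurable N"
  unfolding epowr_def by measurable

lemma pw_Young_enn:
  assumes q: "q \<ge> 2" and \<delta>: "\<delta> > 0" and b: "b \<ge> 0"
  shows "ennreal (pw q b) * k \<le> ennreal (\<delta>\<^sup>2) * ennreal (b powr q) + ennreal (\<delta> powr (2 - q)) * epowr k (q / 2)"
proof (cases k)
  case (real r)
  have e: "(sqrt r) powr q = r powr (q / 2)" using real by (simp add: powr_half_sqrt[symmetric] powr_powr)
  have "ennreal (pw q b) * k = ennreal (pw q b * (sqrt r)\<^sup>2)" using real by (simp add: pw_nonneg flip: ennreal_mult)
  also have "\<dots> \<le> ennreal (\<delta>\<^sup>2 * b powr q + \<delta> powr (2 - q) * r powr (q / 2))"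
    using pw_Young[OF q \<delta> b, of "sqrt r"] real unfolding e by (intro ennreal_leI) simp
  also have "\<dots> = ennreal (\<delta>\<^sup>2) * ennreal (b powr q) + ennreal (\<delta> powr (2 - q)) * epowr k (q / 2)"
    using real by (simp add: epowr_simps ennreal_mult)
  finally show ?thesis .
next
  case top
  then show ?thesis using \<delta> by (simp add: epowr_simps ennreal_mult_top)
qed

text \<open>For each truncation \<open>\<Phi>_lower\<close> bounds the density below by the
  truncated weight at \<open>s / 2\<close> times \<open>s\<^sup>2 / 8\<close>, without computing
  antiderivatives. The truncation level tends to \<infinity> by monotone convergence, and
  \<open>pw_half\<close> accounts for \<open>2 powr (q - 2)\<close>.\<close>

lemma entropy_limit:
  assumes q: "q \<ge> 2"
    and B: "\<And>N h \<Phi>. C2_entropy h (\<lambda>s. min (pw q s) (real N)) (real N) \<Phi> \<Longrightarrow> ennreal (C2_entropy.entropy \<Phi> X) \<le> B"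
  shows "ennreal (1 / (8 * 2 powr (q - 2))) * (\<integral>\<^sup>+ x. ennreal (\<bar>rp X x\<bar> powr q) \<partial>lebesgue) \<le> B"
proof -
  define c where "c = 1 / (8 * 2 powr (q - 2))"
  define b where "b N x = ennreal (min (pw q (rp X x / 2)) (real N) * (rp X x)\<^sup>2 / 8)" for N :: nat and x
  have [measurable]: "rp X \<in> borel_measurable lebesgue" by (rule rp_measurable)
  have [measurable]: "pw q \<in> borel_measurable borel" by (rule borel_measurable_continuous_onI[OF pw_continuous[OF q]])
  have bm: "b N \<in> borel_measurable lebesgue" for N unfolding b_def[abs_def] by measurable
  have bB: "(\<integral>\<^sup>+ x. b N x \<partial>lebesgue) \<le> B" for N
  proof -
    have "continuous_on UNIV (\<lambda>s. min (pw q s) (real N))"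
      by (intro continuous_on_min pw_continuous q continuous_on_const)
    then obtain h \<Phi> where C2: "C2_entropy h (\<lambda>s. min (pw q s) (real N)) (real N) \<Phi>"
      using ex_C2_entropy[of "\<lambda>s. min (pw q s) (real N)" "real N"] pw_nonneg by auto
    interpret C2: C2_entropy h "\<lambda>s. min (pw q s) (real N)" "real N" \<Phi> by fact
    have "(\<integral>\<^sup>+ x. b N x \<partial>lebesgue) \<le> (\<integral>\<^sup>+ x. ennreal (\<Phi> (rp X x)) \<partial>lebesgue)"
    proof (rule nn_integral_mono)
      fix x
      have "min (pw q (rp X x / 2)) (real N) * (rp X x)\<^sup>2 / 8 \<le> \<Phi> (rp X x)"
      proof (rule C2.\<Phi>_lower)
        fix y assume "\<bar>rp X x\<bar> / 2 \<le> \<bar>y\<bar>"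
        then have "pw q (rp X x / 2) \<le> pw q y" by (intro pw_mono q) simp
        then show "min (pw q (rp X x / 2)) (real N) \<le> min (pw q y) (real N)" by simp
      qed
      then show "b N x \<le> ennreal (\<Phi> (rp X x))" unfolding b_def by (rule ennreal_leI)
    qed
    also have "\<dots> \<le> B" using B[OF C2] by (simp add: C2.nn_entropy)
    finally show ?thesis .
  qed
  have inc: "incseq b"
    by (intro incseq_SucI le_funI) (auto simp: b_def intro!: ennreal_leI divide_right_mono mult_right_mono)
  have "ennreal c * (\<integral>\<^sup>+ x. ennreal (\<bar>rp X x\<bar> powr q) \<partial>lebesgue) = (\<integral>\<^sup>+ x. ennreal c * ennreal (\<bar>rp X x\<bar> powr q) \<partial>lebesgue)"
    by (rule nn_integral_cmult[symmetric]) measurable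
  also have "\<dots> \<le> (\<integral>\<^sup>+ x. (SUP N. b N x) \<partial>lebesgue)"
  proof (rule nn_integral_mono)
    fix x
    obtain N where N: "pw q (rp X x / 2) \<le> real N" using real_arch_simple by blast
    have "ennreal c * ennreal (\<bar>rp X x\<bar> powr q) = ennreal (c * \<bar>rp X x\<bar> powr q)" by (rule ennreal_mult[symmetric]) (simp_all add: c_def)
    also have "c * \<bar>rp X x\<bar> powr q = pw q (rp X x / 2) * (rp X x)\<^sup>2 / 8"
      unfolding sq_pw[OF q, symmetric] pw_half[OF q] by (simp add: c_def mult_ac)
    also have "ennreal \<dots> = b N x" using N by (simp add: b_def)
    also have "\<dots> \<le> (SUP N. b N x)" by (rule SUP_upper) simp
    finally show "ennreal c * ennreal (\<bar>rp X x\<bar> powr q) \<le> (SUP N. b N x)" .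
  qed
  also have "\<dots> = (SUP N. \<integral>\<^sup>+ x. b N x \<partial>lebesgue)" by (rule nn_integral_monotone_convergence_SUP[OF inc bm])
  also have "\<dots> \<le> B" by (rule SUP_least) (rule bB)
  finally show ?thesis by (simp add: c_def)
qed

context elliptic_coefficients
begin

lemma nn_integral_E:
  assumes f: "f \<in> Lspace \<Omega> 2" and q: "q > 0"
  shows "(\<integral>\<^sup>+ x. ennreal (\<bar>rp (E f) x\<bar> powr q) \<partial>lebesgue) = (\<integral>\<^sup>+ x. epowr (ennreal \<bar>f x\<bar>) q \<partial>lebesgue_on \<Omega>)"
  unfolding nn_integral_lebesgue_on[OF \<Omega>_sets]
proof (rule nn_integral_cong_AE)
  show "AE x in lebesgue. ennreal (\<bar>rp (E f) x\<bar> powr q) = indicator \<Omega> x * epowr (ennreal \<bar>f x\<bar>) q"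
    using AE_E[OF f] by eventually_elim (use q in \<open>simp add: ext_def epowr_simps indicator_def\<close>)
qed

text \<open>The absorption argument, abstracted over the time interval: \<open>B\<close> bounds the
  entropy lost on \<open>I\<close>, and \<open>Z\<close> stands for what is left at the end of
  \<open>I\<close>. Both inequalities of the theorem are instances with different
  \<open>Z\<close>.\<close>

lemma entropy_square_function_bound:
  assumes q: "q \<ge> 2"
  shows "\<exists>c>0. \<forall>f\<in>Lspace \<Omega> q \<inter> Lspace \<Omega> 2. \<forall>I Z. open I \<longrightarrow> I \<subseteq> {0<..} \<longrightarrow>
    (\<forall>N h \<Phi> B. C2_entropy h (\<lambda>s. min (pw q s) (real N)) (real N) \<Phi> \<longrightarrow>
      (\<forall>\<tau>\<ge>0. {0<..<\<tau>} \<subseteq> I \<longrightarrow> ennreal (C2_entropy.entropy \<Phi> (E f) - C2_entropy.entropy \<Phi> (T \<tau> (E f))) \<le> B) \<longrightarrow>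
      ennreal (C2_entropy.entropy \<Phi> (E f)) \<le> B + Z) \<longrightarrow>
    (\<integral>\<^sup>+ x. epowr (ennreal \<bar>f x\<bar>) q \<partial>lebesgue_on \<Omega>)
      \<le> ennreal c * ((\<integral>\<^sup>+ x. epowr (square_function \<Omega> A I f x) q \<partial>lebesgue_on \<Omega>) + Z)"
proof -
  define C where "C = M * (real CARD('n))\<^sup>2"
  \<comment> \<open>\<open>C\<close> is only known to be nonnegative, and \<delta> is obtained by
    dividing.\<close>
  define D where "D = C + 1"
  have C0: "C \<ge> 0" using M_nonneg by (simp add: C_def)
  then have D0: "D > 0" "C \<le> D" by (simp_all add: D_def)
  define c0 where "c0 = 1 / (8 * 2 powr (q - 2))"
  have c0: "c0 > 0" by (simp add: c0_def)
  \<comment> \<open>Chosen so that, with 81 from the maximal inequality, the first Young term is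
    exactly half of \<open>c0 * Y\<close> and can be absorbed.\<close>
  define \<delta> where "\<delta> = sqrt (c0 / (162 * D))"
  have \<delta>: "\<delta> > 0" using c0 D0 by (simp add: \<delta>_def)
  have \<delta>2: "D * (\<delta>\<^sup>2 * 81) = c0 / 2" using c0 D0 by (simp add: \<delta>_def field_simps)
  define e where "e = \<delta> powr (2 - q)"
  have e: "e \<ge> 0" by (simp add: e_def)
  define c where "c = 2 / c0 * (D * e + 1)"
  have c: "c > 0" using c0 D0 e by (simp add: c_def add_nonneg_pos)
  have main: "(\<integral>\<^sup>+ x. epowr (ennreal \<bar>f x\<bar>) q \<partial>lebesgue_on \<Omega>)
      \<le> ennreal c * ((\<integral>\<^sup>+ x. epowr (square_function \<Omega> A I f x) q \<partial>lebesgue_on \<Omega>) + Z)"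
    if fq: "f \<in> Lspace \<Omega> q" and f: "f \<in> Lspace \<Omega> 2" and I: "open I" "I \<subseteq> {0<..}"
      and H: "\<forall>N h \<Phi> B. C2_entropy h (\<lambda>s. min (pw q s) (real N)) (real N) \<Phi> \<longrightarrow>
        (\<forall>\<tau>\<ge>0. {0<..<\<tau>} \<subseteq> I \<longrightarrow> ennreal (C2_entropy.entropy \<Phi> (E f) - C2_entropy.entropy \<Phi> (T \<tau> (E f))) \<le> B) \<longrightarrow>
        ennreal (C2_entropy.entropy \<Phi> (E f)) \<le> B + Z" for f I Z
  proof -
    define Y where "Y = (\<integral>\<^sup>+ x. epowr (ennreal \<bar>f x\<bar>) q \<partial>lebesgue_on \<Omega>)"
    define S where "S = (\<integral>\<^sup>+ x. epowr (square_function \<Omega> A I f x) q \<partial>lebesgue_on \<Omega>)"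
    have YE: "(\<integral>\<^sup>+ x. ennreal (\<bar>rp (E f) x\<bar> powr q) \<partial>lebesgue) = Y"
      unfolding Y_def using q by (intro nn_integral_E f) simp
    \<comment> \<open>Subtracting \<open>c0 / 2 * Y\<close> from both sides is allowed because
      \<open>f\<close> lies in \<open>L\<^sup>q(\<Omega>)\<close>.\<close>
    have Yfin: "Y < top"
      using fq unfolding Lspace_def Lnorm_def Lnorm_enn_def Y_def
      by (auto simp: epowr_def top.not_eq_extremum split: if_splits)
    obtain g where g: "g \<in> borel_measurable borel" "\<And>x. 0 \<le> g x" "\<And>t. t \<ge> 0 \<Longrightarrow> AE x in lebesgue. \<bar>rp (T t (E f)) x\<bar> \<le> g x"
      "(\<integral>\<^sup>+ x. ennreal (g x powr q) \<partial>lebesgue) \<le> 81 * Y"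
      using maximal_function[OF E_H0[OF f] q] Yfin unfolding YE by blast
    obtain k where k: "k \<in> borel_measurable borel" "AE x in lebesgue. (\<integral>\<^sup>+ t. kernel I f (t, x) \<partial>lebesgue) = k x"
      "\<And>w. w \<in> borel_measurable borel \<Longrightarrow>
        (\<integral>\<^sup>+ t. \<integral>\<^sup>+ x. w x * kernel I f (t, x) \<partial>lebesgue \<partial>lebesgue) = (\<integral>\<^sup>+ x. w x * k x \<partial>lebesgue)"
      using lebesgue_Tonelli[OF kernel_measurable[OF I f]] by blast
    have Sk: "S = (\<integral>\<^sup>+ x. epowr (k x) (q / 2) \<partial>lebesgue)"
      unfolding S_def by (rule square_function_kernel[OF I(1) q k(2)])
    have [measurable]: "g \<in> borel_measurable lebesgue" "k \<in> borel_measurable lebesgue"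
      using g(1) k(1) by (auto intro: measurable_completion)
    have [measurable]: "(\<lambda>x. epowr (k x) (q / 2)) \<in> borel_measurable lebesgue" by (rule epowr_measurable) measurable
    let ?B = "\<integral>\<^sup>+ x. ennreal (C * pw q (g x)) * k x \<partial>lebesgue"
    have lim: "ennreal c0 * Y \<le> ?B + Z"
      unfolding YE[symmetric] c0_def
    proof (rule entropy_limit[OF q])
      fix N :: nat and h \<Phi> assume C2: "C2_entropy h (\<lambda>s. min (pw q s) (real N)) (real N) \<Phi>"
      have "ennreal (C2_entropy.entropy \<Phi> (E f) - C2_entropy.entropy \<Phi> (T \<tau> (E f))) \<le> ?B" if "\<tau> \<ge> 0" "{0<..<\<tau>} \<subseteq> I" for \<tau>
        unfolding C_def by (rule entropy_square_function[OF C2 _ q f g(1-3) that(2,1) k(3)]) simp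
      then show "ennreal (C2_entropy.entropy \<Phi> (E f)) \<le> ?B + Z" using H[rule_format, OF C2] by blast
    qed
    have "?B \<le> (\<integral>\<^sup>+ x. ennreal D * (ennreal (\<delta>\<^sup>2) * ennreal (g x powr q) + ennreal e * epowr (k x) (q / 2)) \<partial>lebesgue)"
    proof (rule nn_integral_mono)
      fix x
      have "ennreal (C * pw q (g x)) * k x \<le> ennreal (D * pw q (g x)) * k x"
        by (intro mult_right_mono ennreal_leI D0 pw_nonneg) simp
      also have "\<dots> = ennreal D * (ennreal (pw q (g x)) * k x)"
        using D0 by (simp add: ennreal_mult pw_nonneg mult.assoc)
      also have "\<dots> \<le> ennreal D * (ennreal (\<delta>\<^sup>2) * ennreal (g x powr q) + ennreal e * epowr (k x) (q / 2))"
        unfolding e_def by (intro mult_left_mono pw_Young_enn q \<delta> g(2)) simp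
      finally show "ennreal (C * pw q (g x)) * k x \<le> ennreal D * (ennreal (\<delta>\<^sup>2) * ennreal (g x powr q) + ennreal e * epowr (k x) (q / 2))" .
    qed
    also have "\<dots> = ennreal D * (ennreal (\<delta>\<^sup>2) * (\<integral>\<^sup>+ x. ennreal (g x powr q) \<partial>lebesgue) + ennreal e * S)"
      unfolding Sk by (simp add: nn_integral_cmult nn_integral_add)
    also have "\<dots> \<le> ennreal D * (ennreal (\<delta>\<^sup>2) * (81 * Y) + ennreal e * S)"
      by (intro mult_left_mono add_right_mono g(4)) auto
    finally have est: "ennreal c0 * Y \<le> ennreal D * (ennreal (\<delta>\<^sup>2) * (81 * Y) + ennreal e * S) + Z"
      using lim add_right_mono order_trans by blast
    show ?thesis
    proof (cases "S = top \<or> Z = top")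
      case True
      then show ?thesis using c unfolding S_def[symmetric] by (auto simp: ennreal_mult_top)
    next
      case False
      obtain s where s: "S = ennreal s" "s \<ge> 0" using False by (cases S) auto
      obtain z where z: "Z = ennreal z" "z \<ge> 0" using False by (cases Z) auto
      obtain y where y: "Y = ennreal y" "y \<ge> 0" using Yfin by (cases Y) auto
      have "ennreal D * (ennreal (\<delta>\<^sup>2) * (81 * Y) + ennreal e * S) + Z = ennreal (D * (\<delta>\<^sup>2 * (81 * y) + e * s) + z)"
        using D0 e s z y by (simp add: ennreal_mult)
      moreover have "ennreal c0 * Y = ennreal (c0 * y)" using c0 y by (simp add: ennreal_mult)
      ultimately have "ennreal (c0 * y) \<le> ennreal (D * (\<delta>\<^sup>2 * (81 * y) + e * s) + z)" using est by simp
      then have "c0 * y \<le> D * (\<delta>\<^sup>2 * (81 * y) + e * s) + z"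
        using D0 e s z y by (subst (asm) ennreal_le_iff) auto
      also have "\<dots> = (D * (\<delta>\<^sup>2 * 81)) * y + (D * e) * s + z" by (simp add: algebra_simps)
      also have "\<dots> = c0 / 2 * y + (D * e) * s + z" by (simp only: \<delta>2)
      finally have "c0 * y \<le> 2 * ((D * e) * s + z)" by simp
      also have "\<dots> \<le> 2 * ((D * e + 1) * s + (D * e + 1) * z)"
        using D0 e s z by (intro mult_left_mono add_mono) (auto simp: algebra_simps)
      finally have "y \<le> c * (s + z)" using c0 by (simp add: c_def field_simps)
      then have "ennreal y \<le> ennreal (c * (s + z))" by (rule ennreal_leI)
      also have "\<dots> = ennreal c * (S + Z)" using c s z by (simp add: ennreal_mult)
      finally show ?thesis by (simp only: y(1)[symmetric] Y_def S_def)
    qed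
  qed
  show ?thesis by (intro exI[of _ c] conjI c ballI allI impI) (rule main, auto)
qed

text \<open>On (0, \<infinity>) nothing is left at the end, since \<open>T (real n) (E f)\<close>
  tends to 0 in L^2; on (0, 1) what is left is at most the integral of |e^(-L) f|^q.\<close>

lemma square_function_bounds:
  assumes q: "q \<ge> 2"
  shows "\<exists>c>0. \<forall>f\<in>Lspace \<Omega> q \<inter> Lspace \<Omega> 2.
    (\<integral>\<^sup>+ x. epowr (ennreal \<bar>f x\<bar>) q \<partial>lebesgue_on \<Omega>)
      \<le> ennreal c * (\<integral>\<^sup>+ x. epowr (square_function \<Omega> A {0<..} f x) q \<partial>lebesgue_on \<Omega>) \<and>
    (\<integral>\<^sup>+ x. epowr (ennreal \<bar>f x\<bar>) q \<partial>lebesgue_on \<Omega>)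
      \<le> ennreal c * ((\<integral>\<^sup>+ x. epowr (square_function \<Omega> A {0<..<1} f x) q \<partial>lebesgue_on \<Omega>)
        + (\<integral>\<^sup>+ x. epowr (ennreal \<bar>heat \<Omega> A 1 f x\<bar>) q \<partial>lebesgue_on \<Omega>))"
proof -
  obtain c where c: "c > 0" and b: "\<forall>f\<in>Lspace \<Omega> q \<inter> Lspace \<Omega> 2. \<forall>I Z. open I \<longrightarrow> I \<subseteq> {0<..} \<longrightarrow>
    (\<forall>N h \<Phi> B. C2_entropy h (\<lambda>s. min (pw q s) (real N)) (real N) \<Phi> \<longrightarrow>
      (\<forall>\<tau>\<ge>0. {0<..<\<tau>} \<subseteq> I \<longrightarrow> ennreal (C2_entropy.entropy \<Phi> (E f) - C2_entropy.entropy \<Phi> (T \<tau> (E f))) \<le> B) \<longrightarrow>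
      ennreal (C2_entropy.entropy \<Phi> (E f)) \<le> B + Z) \<longrightarrow>
    (\<integral>\<^sup>+ x. epowr (ennreal \<bar>f x\<bar>) q \<partial>lebesgue_on \<Omega>)
      \<le> ennreal c * ((\<integral>\<^sup>+ x. epowr (square_function \<Omega> A I f x) q \<partial>lebesgue_on \<Omega>) + Z)"
    using entropy_square_function_bound[OF q] by blast
  have split: "ennreal (C2_entropy.entropy \<Phi> (E f)) \<le> B + ennreal (C2_entropy.entropy \<Phi> (T \<tau> (E f)))"
    if C2: "C2_entropy h (\<lambda>s. min (pw q s) (real N)) (real N) \<Phi>" and f: "f \<in> Lspace \<Omega> 2" and \<tau>: "\<tau> \<ge> 0"
      and B: "ennreal (C2_entropy.entropy \<Phi> (E f) - C2_entropy.entropy \<Phi> (T \<tau> (E f))) \<le> B" for N h \<Phi> B f \<tau>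
  proof -
    let ?a = "C2_entropy.entropy \<Phi> (E f)" and ?b = "C2_entropy.entropy \<Phi> (T \<tau> (E f))"
    have "ennreal ?a = ennreal (?a - ?b) + ennreal ?b"
      using entropy_identity(1)[OF C2 E_H0[OF f] \<tau>] C2_entropy.entropy_nonneg[OF C2]
      by (subst ennreal_plus[symmetric]) auto
    also have "\<dots> \<le> B + ennreal ?b" by (intro add_right_mono B)
    finally show ?thesis .
  qed
  show ?thesis
  proof (intro exI[of _ c] conjI c ballI)
    fix f assume ff: "f \<in> Lspace \<Omega> q \<inter> Lspace \<Omega> 2"
    then have f: "f \<in> Lspace \<Omega> 2" by simp
    have "(\<integral>\<^sup>+ x. epowr (ennreal \<bar>f x\<bar>) q \<partial>lebesgue_on \<Omega>)
      \<le> ennreal c * ((\<integral>\<^sup>+ x. epowr (square_function \<Omega> A {0<..} f x) q \<partial>lebesgue_on \<Omega>) + 0)"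
    proof (rule b[rule_format, OF ff])
      fix N h \<Phi> and B :: ennreal
      assume C2: "C2_entropy h (\<lambda>s. min (pw q s) (real N)) (real N) \<Phi>"
        and B: "\<And>\<tau>. \<tau> \<ge> 0 \<Longrightarrow> {0<..<\<tau>} \<subseteq> {0<..} \<Longrightarrow> ennreal (C2_entropy.entropy \<Phi> (E f) - C2_entropy.entropy \<Phi> (T \<tau> (E f))) \<le> B"
      \<comment> \<open>The quadratic bound has the truncation level \<open>N\<close> as its
        constant, so the time tends to \<infinity> first, while \<open>N\<close> is fixed.\<close>
      have le: "ennreal (C2_entropy.entropy \<Phi> (E f)) \<le> B + ennreal (real N * (norm (T (real n) (E f)))\<^sup>2)" for n
      proof -
        have "ennreal (C2_entropy.entropy \<Phi> (E f)) \<le> B + ennreal (C2_entropy.entropy \<Phi> (T (real n) (E f)))"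
          by (rule split[OF C2 f]) (auto intro!: B)
        also have "\<dots> \<le> B + ennreal (real N * (norm (T (real n) (E f)))\<^sup>2)"
          using C2_entropy.entropy_le[OF C2, of "T (real n) (E f)"] by (intro add_left_mono ennreal_leI) auto
        finally show ?thesis .
      qed
      have "(\<lambda>n. T (real n) (E f)) \<longlonglongrightarrow> 0"
        by (rule T_tendsto_zero[OF _ E_H0[OF f]]) (rule sobolev_graph_kernel)
      then have "(\<lambda>n. real N * (norm (T (real n) (E f)))\<^sup>2) \<longlonglongrightarrow> real N * (norm (0 :: (real ^ 'n) l2))\<^sup>2"
        by (intro tendsto_intros)
      then have "(\<lambda>n. B + ennreal (real N * (norm (T (real n) (E f)))\<^sup>2)) \<longlonglongrightarrow> B + ennreal (real N * (norm (0 :: (real ^ 'n) l2))\<^sup>2)"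
        by (intro tendsto_add tendsto_const tendsto_ennrealI)
      then show "ennreal (C2_entropy.entropy \<Phi> (E f)) \<le> B + 0"
        using le by (intro LIMSEQ_le_const[of _ "B + 0"]) auto
    qed auto
    then show "(\<integral>\<^sup>+ x. epowr (ennreal \<bar>f x\<bar>) q \<partial>lebesgue_on \<Omega>)
      \<le> ennreal c * (\<integral>\<^sup>+ x. epowr (square_function \<Omega> A {0<..} f x) q \<partial>lebesgue_on \<Omega>)" by simp
    show "(\<integral>\<^sup>+ x. epowr (ennreal \<bar>f x\<bar>) q \<partial>lebesgue_on \<Omega>)
      \<le> ennreal c * ((\<integral>\<^sup>+ x. epowr (square_function \<Omega> A {0<..<1} f x) q \<partial>lebesgue_on \<Omega>)
        + (\<integral>\<^sup>+ x. epowr (ennreal \<bar>heat \<Omega> A 1 f x\<bar>) q \<partial>lebesgue_on \<Omega>))"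
    proof (rule b[rule_format, OF ff])
      fix N h \<Phi> and B :: ennreal
      assume C2: "C2_entropy h (\<lambda>s. min (pw q s) (real N)) (real N) \<Phi>"
        and B: "\<And>\<tau>. \<tau> \<ge> 0 \<Longrightarrow> {0<..<\<tau>} \<subseteq> {0<..<1} \<Longrightarrow> ennreal (C2_entropy.entropy \<Phi> (E f) - C2_entropy.entropy \<Phi> (T \<tau> (E f))) \<le> B"
      interpret C2: C2_entropy h "\<lambda>s. min (pw q s) (real N)" "real N" \<Phi> by fact
      \<comment> \<open>Independent of the truncation level, as is necessary for the term at time
        1.\<close>
      have up: "\<Phi> s \<le> \<bar>s\<bar> powr q" for s
      proof -
        have "\<Phi> s \<le> pw q s * s\<^sup>2" by (rule C2.\<Phi>_upper) (auto intro: min.coboundedI1 pw_mono q)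
        then show ?thesis using sq_pw[OF q, of s] by (simp add: mult.commute)
      qed
      have "ennreal (C2.entropy (E f)) \<le> B + ennreal (C2.entropy (T 1 (E f)))"
        by (rule split[OF C2 f]) (auto intro!: B)
      also have "ennreal (C2.entropy (T 1 (E f))) \<le> (\<integral>\<^sup>+ x. ennreal (\<bar>rp (T 1 (E f)) x\<bar> powr q) \<partial>lebesgue)"
        unfolding C2.nn_entropy by (intro nn_integral_mono ennreal_leI up)
      also have "\<dots> = (\<integral>\<^sup>+ x. epowr (ennreal \<bar>heat \<Omega> A 1 f x\<bar>) q \<partial>lebesgue_on \<Omega>)"
        using nn_integral_E[OF heat_Lspace[OF _ f, of 1], of q] heat_eq[OF _ f, of 1] q by simp
      finally show "ennreal (C2.entropy (E f)) \<le> B + (\<integral>\<^sup>+ x. epowr (ennreal \<bar>heat \<Omega> A 1 f x\<bar>) q \<partial>lebesgue_on \<Omega>)"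
        by (simp add: add_left_mono)
    qed auto
  qed
qed

end

theorem mainTheorem10:
  fixes \<Omega> :: "(real ^ 'n) set"
    and A :: "real ^ 'n \<Rightarrow> real ^ 'n ^ 'n"
    and \<nu> q :: real
  assumes "open \<Omega>"
    and "\<forall>k l. (\<lambda>x. A x $ k $ l) \<in> borel_measurable (lebesgue_on \<Omega>)"
    and "\<forall>k l. \<exists>M. \<forall>x\<in>\<Omega>. \<bar>A x $ k $ l\<bar> \<le> M"
    and "\<forall>k l. \<forall>x\<in>\<Omega>. A x $ k $ l = A x $ l $ k"
    and "\<nu> > 0"
    and "\<forall>x\<in>\<Omega>. \<forall>\<xi>. (\<Sum>k\<in>UNIV. \<Sum>l\<in>UNIV. A x $ k $ l * \<xi> $ k * \<xi> $ l) \<ge> \<nu> * (norm \<xi>)\<^sup>2"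
    and "q \<ge> 2"
  shows "\<exists>C::real. C > 0 \<and>
    (\<forall>f \<in> Lspace \<Omega> q \<inter> Lspace \<Omega> 2.
       ennreal C * Lnorm \<Omega> q f \<le> Lnorm_enn \<Omega> q (square_function \<Omega> A {0<..} f) \<and>
       ennreal C * Lnorm \<Omega> q f
         \<le> Lnorm \<Omega> q (heat \<Omega> A 1 f) + Lnorm_enn \<Omega> q (square_function \<Omega> A {0<..<1} f))"
proof -
  interpret elliptic_coefficients \<Omega> A \<nu> by (rule elliptic_coefficients.intro) (rule assms)+
  obtain c where c: "c > 0" and b: "\<And>f. f \<in> Lspace \<Omega> q \<inter> Lspace \<Omega> 2 \<Longrightarrow>
    (\<integral>\<^sup>+ x. epowr (ennreal \<bar>f x\<bar>) q \<partial>lebesgue_on \<Omega>)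
      \<le> ennreal c * (\<integral>\<^sup>+ x. epowr (square_function \<Omega> A {0<..} f x) q \<partial>lebesgue_on \<Omega>) \<and>
    (\<integral>\<^sup>+ x. epowr (ennreal \<bar>f x\<bar>) q \<partial>lebesgue_on \<Omega>)
      \<le> ennreal c * ((\<integral>\<^sup>+ x. epowr (square_function \<Omega> A {0<..<1} f x) q \<partial>lebesgue_on \<Omega>)
        + (\<integral>\<^sup>+ x. epowr (ennreal \<bar>heat \<Omega> A 1 f x\<bar>) q \<partial>lebesgue_on \<Omega>))"
    using square_function_bounds[OF \<open>q \<ge> 2\<close>] by blast
  have q: "1 / q > 0" using \<open>q \<ge> 2\<close> by simp
  \<comment> \<open>The factor 2 comes from \<open>u + v \<le> 2 * max u v\<close>: the
    \<open>q\<close>-th root of a sum is estimated through the maximum, whose root is below the sum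
    of the roots. With \<open>v = 0\<close> the same estimate covers the first inequality.\<close>
  define K where "K = (2 * c) powr (1 / q)"
  have K: "K > 0" using c by (simp add: K_def)
  have root: "ennreal (1 / K) * epowr y (1 / q) \<le> epowr u (1 / q) + epowr v (1 / q)"
    if "y \<le> ennreal c * (u + v)" for y u v
  proof -
    have "u + v \<le> 2 * max u v" unfolding mult_2 by (rule add_mono) auto
    then have "ennreal c * (u + v) \<le> ennreal c * (2 * max u v)" by (rule mult_left_mono) simp
    also have "\<dots> = ennreal (2 * c) * max u v" using c by (simp add: ennreal_mult mult_ac)
    finally have "y \<le> ennreal (2 * c) * max u v" using that by (rule order_trans[rotated])
    from epowr_mono[OF q this] have "epowr y (1 / q) \<le> ennreal K * epowr (max u v) (1 / q)"
      using epowr_cmult[of "2 * c" "1 / q" "max u v"] c q by (simp add: K_def)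
    then have "ennreal (1 / K) * epowr y (1 / q) \<le> ennreal (1 / K) * (ennreal K * epowr (max u v) (1 / q))"
      by (rule mult_left_mono) simp
    also have "\<dots> = epowr (max u v) (1 / q)"
      using K by (simp add: mult.assoc[symmetric] flip: ennreal_mult)
    also have "\<dots> \<le> epowr u (1 / q) + epowr v (1 / q)"
      by (cases "u \<le> v") (auto simp: max_def add_increasing add_increasing2)
    finally show ?thesis .
  qed
  show ?thesis
  proof (intro exI[of _ "1 / K"] conjI ballI)
    fix f assume f: "f \<in> Lspace \<Omega> q \<inter> Lspace \<Omega> 2"
    from b[OF f] root[of "\<integral>\<^sup>+ x. epowr (ennreal \<bar>f x\<bar>) q \<partial>lebesgue_on \<Omega>"
      "\<integral>\<^sup>+ x. epowr (square_function \<Omega> A {0<..} f x) q \<partial>lebesgue_on \<Omega>" 0]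
    show "ennreal (1 / K) * Lnorm \<Omega> q f \<le> Lnorm_enn \<Omega> q (square_function \<Omega> A {0<..} f)"
      by (simp add: Lnorm_def Lnorm_enn_def epowr_def[of 0])
    from b[OF f] root[of "\<integral>\<^sup>+ x. epowr (ennreal \<bar>f x\<bar>) q \<partial>lebesgue_on \<Omega>"
      "\<integral>\<^sup>+ x. epowr (square_function \<Omega> A {0<..<1} f x) q \<partial>lebesgue_on \<Omega>"
      "\<integral>\<^sup>+ x. epowr (ennreal \<bar>heat \<Omega> A 1 f x\<bar>) q \<partial>lebesgue_on \<Omega>"]
    show "ennreal (1 / K) * Lnorm \<Omega> q f \<le> Lnorm \<Omega> q (heat \<Omega> A 1 f) + Lnorm_enn \<Omega> q (square_function \<Omega> A {0<..<1} f)"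
      by (simp add: Lnorm_def Lnorm_enn_def add.commute)
  qed (use K in simp)
qed
end
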